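(* Let $\epsilon,\lambda>0$ be constants, let $\tau>0\mapsto\theta(\tau)$ be a smooth strictly convex function, and let $F:\mathbb{R}\to\mathbb{R}$ be smooth with bounded derivative and $F(0)=0$. Let $H=L^2(\mathbb{T})$, let $K$ be the closed convex cone of all nondecreasing functions in $I+H$, and let $\Theta:H\to(-\infty,+\infty]$ be the lower semicontinuous convex functional associated with $\theta$ (defined in the context). Let $\xi_0,Z_0$ be given in $H$, with $X_0=I+\xi_0\in K$. (1) There is a unique global solution $t\mapsto(\xi(t),Z(t))\in H\times H$ to $$-\frac{d\xi}{dt}+Z+\lambda\xi\in\epsilon\,\partial\Theta[\xi],\qquad \frac{dZ}{dt}+\lambda Z=-\lambda^2\xi+F(\xi),$$ depending continuously in $H$ on both $t$ and the initial condition $(\xi(0)=\xi_0,\ Z(0)=Z_0)$. (2) This solution can be viewed as a "generalized" solution to the Navier-Stokes system with forcing $F$, written in material coordinates with $X(t,a)=a+\xi(t,a)$, $$\partial^2_{tt}X=\lambda\epsilon\,\partial_a\big(\theta'(\partial_aX)\big)+\epsilon\,\partial_a\big(\theta''(\partial_aX)\,\partial^2_{ta}X\big)+F(X-a),$$ that is, with pressure and viscosity laws given by $$\mu(1/\tau)=\epsilon\,\tau\,\theta''(\tau),\qquad p(1/\tau)=-\lambda\epsilon\,\theta'(\tau),\qquad \tau>0,$$ and, in particular, for $\mu(\rho)=\epsilon\rho$, $p(\rho)=\lambda\epsilon\rho$ (the case $\theta(\tau)=-\log\tau$). (3) In addition, as $\epsilon\to0$, these solutions converge to those of $$-\frac{d\xi}{dt}+Z+\lambda\xi\in\partial1_K[I+\xi],\qquad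 \frac{dZ}{dt}+\lambda Z=-\lambda^2\xi+F(\xi),$$ where $1_K[X]$ is the indicator function of the cone $K$, with value $0$ whenever $X=I+\xi$ belongs to $K$ and $+\infty$ otherwise.
   Context: $I$ is the identity map of $\mathbb{R}$, $\mathbb{T}=\mathbb{R}/\mathbb{Z}$, and $L^2(\mathbb{T})$ is the Hilbert space of all locally square integrable $1$-periodic functions on $\mathbb{R}$. $I+H$ is the set of functions $I+\xi$ with $\xi\in H$. Functional $\Theta$: $\Theta[\xi]=+\infty$ if $I+\xi\notin K$; otherwise $\Theta[\xi]=\int_0^1\theta(1+\xi'(a))\,da\in(-\infty,+\infty]$, defined more precisely, since the derivative of $I+\xi\in K$ is a locally bounded nonnegative Borel measure, as a convex function of measures by $$\Theta[\xi]=\sup_f\int_{\mathbb{T}}\{f(a)\,d(a+\xi(a))-\theta^*(f(a))\,da\},$$ where $f$ ranges over the continuous functions on $\mathbb{T}$ and $\theta^*(s)=\sup_{\tau\in\mathbb{R}}(s\tau-\theta(\tau))$ is the Legendre-Fenchel transform of $\theta$ (with $\theta$ extended by $+\infty$ for $\tau\le0$). $\partial$ in front of $\Theta$ and $1_K$ denotes the subdifferential in the Hilbert space $H$ (for $1_K[I+\xi]$, as a convex function of $\xi$), and the evolution inclusions are those of the general theory of maximal monotone operators. $F(\xi)$ denotes the function $a\mapsto F(\xi(a))$. The Navier-Stokes system is, in the absence of forcing, $\partial_t(\rho v)+\partial_x(\rho v^2+p(\rho))=\partial_x(\mu(\rho)\partial_xv)$, $\partial_t\rho+\partial_x(\rho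 v)=0$, with $\rho,v$ $1$-periodic in $x$ and $\rho$ of unit mean; material coordinates are defined by $\partial_tX(t,a)=v(t,X(t,a))$, $\rho(t,X(t,a))\,\partial_aX(t,a)=1$, $X(t,a+1)=X(t,a)+1$. The variable $Z$ corresponds to $Z=V-\lambda(X-a)$, where $\partial_tX=V+\epsilon\,\partial_a(\theta'(\partial_aX))$. *)

theory Defs
  imports "HOL-Analysis.Analysis"
begin

section \<open>The Hilbert space \<open>L\<^sup>2(\<real>/\<int>)\<close>\<close>

definition L2_fun :: "(real \<Rightarrow> real) \<Rightarrow> bool" where
  "L2_fun f \<longleftrightarrow> f \<in> borel_measurable borel \<and> (\<forall>a. f (a + 1) = f a)
     \<and> set_integrable lborel {0..1} (\<lambda>a. (f a)\<^sup>2)"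

text \<open>By periodicity, equality almost everywhere on one period is equality almost everywhere.\<close>

definition L2_rel :: "(real \<Rightarrow> real) \<Rightarrow> (real \<Rightarrow> real) \<Rightarrow> bool" where
  "L2_rel f g \<longleftrightarrow> L2_fun f \<and> L2_fun g \<and> (AE a in lborel. a \<in> {0..1} \<longrightarrow> f a = g a)"

lemma L2_fun_zero: "L2_fun (\<lambda>_. 0)"
  by (simp add: L2_fun_def set_integrable_def)

lemma L2_rel_refl: "L2_fun f \<Longrightarrow> L2_rel f f"
  by (simp add: L2_rel_def)

lemma part_equivp_L2_rel: "part_equivp L2_rel"
proof (rule part_equivpI)
  show "\<exists>f. L2_rel f f"
    using L2_fun_zero L2_rel_refl by blast
  show "symp L2_rel"
    by (rule sympI) (auto simp: L2_rel_def elim: AE_mp)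
  show "transp L2_rel"
  proof (rule transpI)
    fix f g h assume "L2_rel f g" "L2_rel g h"
    then have "AE a in lborel. a \<in> {0..1} \<longrightarrow> f a = g a"
        "AE a in lborel. a \<in> {0..1} \<longrightarrow> g a = h a"
      by (auto simp: L2_rel_def)
    then have "AE a in lborel. a \<in> {0..1} \<longrightarrow> f a = h a"
      by eventually_elim simp
    with \<open>L2_rel f g\<close> \<open>L2_rel g h\<close> show "L2_rel f h" by (simp add: L2_rel_def)
  qed
qed

quotient_type L2T = "real \<Rightarrow> real" / partial: L2_rel
  by (rule part_equivp_L2_rel)

lemma L2_fun_mult:
  assumes "L2_fun f" "L2_fun g"
  shows "set_integrable lborel {0..1} (\<lambda>a. f a * g a)"
proof -
  have [measurable]: "f \<in> borel_measurable borel" "g \<in> borel_measurable borel"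
    using assms by (auto simp: L2_fun_def)
  have "set_integrable lborel {0..1} (\<lambda>a. (f a)\<^sup>2 + (g a)\<^sup>2)"
    using assms by (intro set_integral_add) (auto simp: L2_fun_def)
  then show ?thesis
    unfolding set_integrable_def
  proof (rule Bochner_Integration.integrable_bound)
    have "\<bar>x * y\<bar> \<le> x\<^sup>2 + y\<^sup>2" for x y :: real
      using sum_squares_bound[of "\<bar>x\<bar>" "\<bar>y\<bar>"] zero_le_power2[of x] zero_le_power2[of y]
      by (simp add: abs_mult) (metis abs_ge_zero mult_nonneg_nonneg order_trans
          add_increasing mult_2 le_add_same_cancel1 distrib_right)
    then show "AE a in lborel. norm (indicat_real {0..1} a *\<^sub>R (f a * g a))
        \<le> norm (indicat_real {0..1} a *\<^sub>R ((f a)\<^sup>2 + (g a)\<^sup>2))"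
      by (intro AE_I2) (auto simp: indicator_def)
  qed measurable
qed

lemma L2_fun_lincomb:
  assumes "L2_fun f" "L2_fun g"
  shows "L2_fun (\<lambda>a. r * f a + s * g a)"
proof -
  have [measurable]: "f \<in> borel_measurable borel" "g \<in> borel_measurable borel"
    using assms by (auto simp: L2_fun_def)
  have "set_integrable lborel {0..1}
      (\<lambda>a. r\<^sup>2 * (f a * f a) + (2 * r * s) * (f a * g a) + s\<^sup>2 * (g a * g a))"
    using L2_fun_mult assms by (intro set_integral_add set_integrable_mult_right) auto
  moreover have "r\<^sup>2 * (f a * f a) + (2 * r * s) * (f a * g a) + s\<^sup>2 * (g a * g a)
      = (r * f a + s * g a)\<^sup>2" for a
    by (simp add: power2_eq_square algebra_simps)
  ultimately show ?thesis
    using assms by (simp add: L2_fun_def)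
qed

lemma L2_fun_add: "L2_fun f \<Longrightarrow> L2_fun g \<Longrightarrow> L2_fun (\<lambda>a. f a + g a)"
  using L2_fun_lincomb[of f g 1 1] by simp

lemma L2_fun_diff: "L2_fun f \<Longrightarrow> L2_fun g \<Longrightarrow> L2_fun (\<lambda>a. f a - g a)"
  using L2_fun_lincomb[of f g 1 "-1"] by simp

lemma L2_fun_cmult: "L2_fun f \<Longrightarrow> L2_fun (\<lambda>a. r * f a)"
  using L2_fun_lincomb[of f f r 0] by simp

instantiation L2T :: real_inner
begin

lift_definition zero_L2T :: L2T is "\<lambda>_. 0"
  by (simp add: L2_rel_def L2_fun_zero)

lift_definition plus_L2T :: "L2T \<Rightarrow> L2T \<Rightarrow> L2T" is "\<lambda>f g a. f a + g a"
  unfolding L2_rel_def by (auto intro: L2_fun_add elim: AE_mp)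

lift_definition minus_L2T :: "L2T \<Rightarrow> L2T \<Rightarrow> L2T" is "\<lambda>f g a. f a - g a"
  unfolding L2_rel_def by (auto intro: L2_fun_diff elim: AE_mp)

lift_definition scaleR_L2T :: "real \<Rightarrow> L2T \<Rightarrow> L2T" is "\<lambda>r f a. r * f a"
  unfolding L2_rel_def by (auto intro: L2_fun_cmult elim: AE_mp)

lift_definition inner_L2T :: "L2T \<Rightarrow> L2T \<Rightarrow> real"
  is "\<lambda>f g. LINT a:{0..1}|lborel. f a * g a"
proof -
  fix f f' g g' :: "real \<Rightarrow> real"
  assume *: "L2_rel f f'" "L2_rel g g'"
  then have [measurable]: "f \<in> borel_measurable borel" "g \<in> borel_measurable borel"
      "f' \<in> borel_measurable borel" "g' \<in> borel_measurable borel"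
    by (auto simp: L2_fun_def L2_rel_def)
  have "AE a in lborel. a \<in> {0..1} \<longrightarrow> f a = f' a" "AE a in lborel. a \<in> {0..1} \<longrightarrow> g a = g' a"
    using * by (auto simp: L2_rel_def)
  then have "AE a in lborel. indicat_real {0..1} a *\<^sub>R (f a * g a)
      = indicat_real {0..1} a *\<^sub>R (f' a * g' a)"
    by eventually_elim (auto simp: indicator_def)
  then show "(LINT a:{0..1}|lborel. f a * g a) = (LINT a:{0..1}|lborel. f' a * g' a)"
    unfolding set_lebesgue_integral_def by (intro integral_cong_AE) auto
qed

definition uminus_L2T :: "L2T \<Rightarrow> L2T" where "uminus_L2T x = 0 - x"
definition norm_L2T :: "L2T \<Rightarrow> real" where "norm_L2T x = sqrt (inner x x)"
definition dist_L2T :: "L2T \<Rightarrow> L2T \<Rightarrow> real" where "dist_L2T x y = norm (x - y)"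
definition sgn_L2T :: "L2T \<Rightarrow> L2T" where "sgn_L2T x = inverse (norm x) *\<^sub>R x"
definition uniformity_L2T :: "(L2T \<times> L2T) filter" where
  "uniformity_L2T = (INF e\<in>{0<..}. principal {(x, y). dist x y < e})"
definition open_L2T :: "L2T set \<Rightarrow> bool" where
  "open_L2T U \<longleftrightarrow> (\<forall>x\<in>U. \<forall>\<^sub>F (x', y) in uniformity. x' = x \<longrightarrow> y \<in> U)"

instance
proof
  fix x y z :: L2T and r s :: real
  show "x + y + z = x + (y + z)"
    by transfer (auto intro: L2_rel_refl L2_fun_add simp: L2_rel_def algebra_simps)
  show "x + y = y + x"
    by transfer (auto intro: L2_rel_refl L2_fun_add simp: L2_rel_def algebra_simps)
  show "0 + x = x"
    by transfer (auto simp: L2_rel_def)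
  show "- x + x = 0"
    unfolding uminus_L2T_def
    by transfer (auto intro: L2_fun_add L2_fun_diff L2_fun_zero simp: L2_rel_def)
  show "x - y = x + - y"
    unfolding uminus_L2T_def
    by transfer (auto intro!: L2_fun_add L2_fun_diff L2_fun_zero simp: L2_rel_def)
  show "r *\<^sub>R (x + y) = r *\<^sub>R x + r *\<^sub>R y"
    by transfer (auto intro!: L2_fun_add L2_fun_cmult simp: L2_rel_def algebra_simps)
  show "(r + s) *\<^sub>R x = r *\<^sub>R x + s *\<^sub>R x"
    by transfer (auto intro!: L2_fun_add L2_fun_cmult simp: L2_rel_def algebra_simps)
  show "r *\<^sub>R s *\<^sub>R x = (r * s) *\<^sub>R x"
    by transfer (auto intro!: L2_fun_cmult simp: L2_rel_def algebra_simps)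
  show "1 *\<^sub>R x = x"
    by transfer (auto simp: L2_rel_def)
  show "inner x y = inner y x"
    by transfer (simp add: mult.commute)
  show "inner (x + y) z = inner x z + inner y z"
  proof transfer
    fix x y z :: "real \<Rightarrow> real"
    assume "L2_rel x x" "L2_rel y y" "L2_rel z z"
    then show "(LINT a:{0..1}|lborel. (x a + y a) * z a)
        = (LINT a:{0..1}|lborel. x a * z a) + (LINT a:{0..1}|lborel. y a * z a)"
      by (simp add: distrib_right set_integral_add L2_fun_mult L2_rel_def)
  qed
  show "inner (r *\<^sub>R x) y = r * inner x y"
    by transfer (simp add: mult.assoc)
  show "0 \<le> inner x x"
    by transfer (simp add: set_lebesgue_integral_def)
  show "inner x x = 0 \<longleftrightarrow> x = 0"
  proof transfer
    fix x :: "real \<Rightarrow> real"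
    assume *: "L2_rel x x"
    then have int: "set_integrable lborel {0..1} (\<lambda>a. x a * x a)"
      by (simp add: L2_fun_mult L2_rel_def)
    have "(LINT a:{0..1}|lborel. x a * x a) = 0
        \<longleftrightarrow> (AE a in lborel. indicat_real {0..1} a *\<^sub>R (x a * x a) = 0)"
      unfolding set_lebesgue_integral_def using int[unfolded set_integrable_def]
      by (intro integral_nonneg_eq_0_iff_AE) auto
    also have "\<dots> \<longleftrightarrow> (AE a in lborel. a \<in> {0..1} \<longrightarrow> x a = 0)"
      by (intro AE_cong) (auto simp: indicator_def)
    also have "\<dots> \<longleftrightarrow> L2_rel x (\<lambda>_. 0)"
      using * by (simp add: L2_rel_def L2_fun_zero)
    finally show "(LINT a:{0..1}|lborel. x a * x a) = 0 \<longleftrightarrow> L2_rel x (\<lambda>_. 0)" .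
  qed
qed (simp_all add: norm_L2T_def dist_L2T_def sgn_L2T_def uniformity_L2T_def open_L2T_def)

end

lemma norm_abs_L2T:
  "L2_fun f \<Longrightarrow> norm (abs_L2T f) = sqrt (LINT a:{0..1}|lborel. (f a)\<^sup>2)"
  by (simp add: norm_eq_sqrt_inner inner_L2T.abs_eq L2_rel_refl power2_eq_square)

lemma abs_L2T_diff:
  "L2_fun f \<Longrightarrow> L2_fun g \<Longrightarrow> abs_L2T f - abs_L2T g = abs_L2T (\<lambda>a. f a - g a)"
  by (simp add: minus_L2T.abs_eq L2_rel_refl)

lemma L2T_cases:
  obtains f where "L2_fun f" "x = abs_L2T f"
  using L2T.abs_induct[of "\<lambda>x. \<exists>f. L2_fun f \<and> x = abs_L2T f" x] L2_rel_def by blast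


instance L2T :: complete_space
proof
  fix u :: "nat \<Rightarrow> L2T"
  assume "Cauchy u"
  have "\<exists>r. strict_mono r \<and> (\<forall>n. \<forall>m\<ge>r n. norm (u m - u (r n)) < (1/2) ^ n)"
  proof -
    have "\<exists>N. \<forall>m\<ge>N. \<forall>k\<ge>N. norm (u m - u k) < (1/2) ^ n" for n
      using CauchyD[OF \<open>Cauchy u\<close>, of "(1/2) ^ n"] by simp
    then obtain N where N: "\<And>n m k. m \<ge> N n \<Longrightarrow> k \<ge> N n \<Longrightarrow> norm (u m - u k) < (1/2) ^ n"
      by metis
    define r where "r n = (\<Sum>i\<le>n. Suc (N i))" for n
    have "r n \<ge> N n" for n
      unfolding r_def by (cases n) auto
    moreover have "strict_mono r"
      unfolding strict_mono_Suc_iff r_def by simp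
    ultimately show ?thesis
      by (intro exI[of _ r]) (auto intro!: N intro: order_trans)
  qed
  then obtain r where r: "strict_mono r"
      and close: "\<And>n m. m \<ge> r n \<Longrightarrow> norm (u m - u (r n)) < (1/2) ^ n"
    by blast
  have "\<forall>n. \<exists>f. L2_fun f \<and> u (r n) = abs_L2T f"
    using L2T_cases by metis
  then obtain f where f: "\<And>n. L2_fun (f n)" and uf: "\<And>n. u (r n) = abs_L2T (f n)"
    by metis
  have meas [measurable]: "f n \<in> borel_measurable borel" for n
    using f by (simp add: L2_fun_def)
  define M where "M = restrict_space lborel {0..1::real}"
  have [measurable]: "f n \<in> borel_measurable M" for n
    unfolding M_def by (intro measurable_restrict_space1) simp
  have set_int: "(LINT a:{0..1}|lborel. h a) = integral\<^sup>L M h"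
      "set_integrable lborel {0..1} h \<longleftrightarrow> integrable M h" for h :: "real \<Rightarrow> real"
    unfolding M_def set_lebesgue_integral_def set_integrable_def
    by (simp_all add: integral_restrict_space integrable_restrict_space)
  interpret finite_measure M
    by (rule finite_measureI) (simp add: M_def emeasure_restrict_space space_restrict_space)
  have M1: "emeasure M (space M) = 1"
    by (simp add: M_def emeasure_restrict_space space_restrict_space)
  have sq: "(\<integral>\<^sup>+a. ennreal ((f m a - f n a)\<^sup>2) \<partial>M) = ennreal ((norm (u (r m) - u (r n)))\<^sup>2)" for m n
  proof -
    have *: "L2_fun (\<lambda>a. f m a - f n a)" using f L2_fun_diff by simp
    then have "integrable M (\<lambda>a. (f m a - f n a)\<^sup>2)" by (simp add: L2_fun_def set_int)
    then show ?thesis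
      by (simp add: nn_integral_eq_integral uf abs_L2T_diff f norm_abs_L2T[OF *] set_int)
  qed
  have L1: "(\<integral>\<^sup>+a. ennreal \<bar>f (Suc n) a - f n a\<bar> \<partial>M) \<le> ennreal ((1/2) ^ n)" for n
  proof -
    define c where "c = (1/2::real) ^ n"
    have c: "c > 0" by (simp add: c_def)
    have "(\<integral>\<^sup>+a. ennreal \<bar>f (Suc n) a - f n a\<bar> \<partial>M)
        \<le> (\<integral>\<^sup>+a. ennreal (inverse (2 * c)) * ennreal ((f (Suc n) a - f n a)\<^sup>2) + ennreal (c / 2) \<partial>M)"
    proof (intro nn_integral_mono)
      fix a
      define x where "x = \<bar>f (Suc n) a - f n a\<bar>"
      have "x \<le> inverse (2 * c) * x\<^sup>2 + c / 2"
        using zero_le_power2[of "x - c"] c by (simp add: field_simps power2_eq_square)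
      then show "ennreal \<bar>f (Suc n) a - f n a\<bar>
          \<le> ennreal (inverse (2 * c)) * ennreal ((f (Suc n) a - f n a)\<^sup>2) + ennreal (c / 2)"
        using c by (simp add: x_def flip: ennreal_mult ennreal_plus)
    qed
    also have "\<dots> = ennreal (inverse (2 * c)) * ennreal ((norm (u (r (Suc n)) - u (r n)))\<^sup>2) + ennreal (c / 2)"
      by (simp add: nn_integral_add nn_integral_cmult sq M1)
    also have "\<dots> \<le> ennreal (inverse (2 * c)) * ennreal (c\<^sup>2) + ennreal (c / 2)"
    proof -
      have "norm (u (r (Suc n)) - u (r n)) < c"
        unfolding c_def by (intro close strict_mono_leD[OF r]) simp
      then show ?thesis
        by (intro add_right_mono mult_left_mono ennreal_leI power_mono) auto
    qed
    also have "\<dots> = ennreal c"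
      using c by (simp add: power2_eq_square field_simps flip: ennreal_mult ennreal_plus)
    finally show ?thesis by (simp add: c_def)
  qed
  have "(\<integral>\<^sup>+a. (\<Sum>n. ennreal \<bar>f (Suc n) a - f n a\<bar>) \<partial>M)
      = (\<Sum>n. \<integral>\<^sup>+a. ennreal \<bar>f (Suc n) a - f n a\<bar> \<partial>M)"
    by (intro nn_integral_suminf) measurable
  also have "\<dots> \<le> (\<Sum>n. ennreal ((1/2) ^ n))"
    by (intro suminf_le L1) auto
  also have "\<dots> = ennreal (\<Sum>n. (1/2) ^ n)"
    by (intro suminf_ennreal2) (auto intro: summable_geometric)
  also have "\<dots> < \<infinity>" by simp
  finally have "AE a in M. (\<Sum>n. ennreal \<bar>f (Suc n) a - f n a\<bar>) \<noteq> \<infinity>"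
    by (intro nn_integral_PInf_AE) auto
  then have conv: "AE a in M. convergent (\<lambda>n. f n a)"
  proof eventually_elim
    case (elim a)
    then have "summable (\<lambda>n. \<bar>f (Suc n) a - f n a\<bar>)"
      by (intro summable_suminf_not_top) auto
    then have "summable (\<lambda>n. f (Suc n) a - f n a)"
      by (rule summable_rabs_cancel)
    then have "convergent (\<lambda>n. \<Sum>i<n. f (Suc i) a - f i a)"
      by (simp add: summable_iff_convergent)
    then have "convergent (\<lambda>n. f n a - f 0 a)"
      by (simp only: sum_lessThan_telescope[of "\<lambda>n. f n a" for a])
    then have "convergent (\<lambda>n. (f n a - f 0 a) + f 0 a)"
      by (intro convergent_add convergent_const)
    then show ?case by simp
  qed
  define g where "g a = lim (\<lambda>n. f n a)" for a
  have [measurable]: "g \<in> borel_measurable borel"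
    unfolding g_def by measurable
  have [measurable]: "g \<in> borel_measurable M"
    unfolding M_def by (intro measurable_restrict_space1) simp
  have Fatou: "(\<integral>\<^sup>+a. ennreal ((g a - f n a)\<^sup>2) \<partial>M) \<le> ennreal (((1/2) ^ n)\<^sup>2)" for n
  proof -
    have "(\<integral>\<^sup>+a. ennreal ((g a - f n a)\<^sup>2) \<partial>M)
        = (\<integral>\<^sup>+a. liminf (\<lambda>m. ennreal ((f m a - f n a)\<^sup>2)) \<partial>M)"
    proof (intro nn_integral_cong_AE, use conv in eventually_elim)
      fix a assume "convergent (\<lambda>m. f m a)"
      then have "(\<lambda>m. f m a) \<longlonglongrightarrow> g a"
        by (simp add: g_def convergent_LIMSEQ_iff)
      then have "(\<lambda>m. ennreal ((f m a - f n a)\<^sup>2)) \<longlonglongrightarrow> ennreal ((g a - f n a)\<^sup>2)"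
        by (intro tendsto_ennrealI tendsto_intros)
      then show "ennreal ((g a - f n a)\<^sup>2) = liminf (\<lambda>m. ennreal ((f m a - f n a)\<^sup>2))"
        by (intro lim_imp_Liminf[symmetric]) simp_all
    qed
    also have "\<dots> \<le> liminf (\<lambda>m. \<integral>\<^sup>+a. ennreal ((f m a - f n a)\<^sup>2) \<partial>M)"
      by (intro nn_integral_liminf) measurable
    also have "\<dots> \<le> liminf (\<lambda>m::nat. ennreal (((1/2) ^ n)\<^sup>2))"
    proof (intro Liminf_mono eventually_sequentiallyI[of n])
      fix m assume "n \<le> m"
      then have "norm (u (r m) - u (r n)) < (1/2) ^ n"
        by (intro close strict_mono_leD[OF r])
      then show "(\<integral>\<^sup>+a. ennreal ((f m a - f n a)\<^sup>2) \<partial>M) \<le> ennreal (((1/2) ^ n)\<^sup>2)"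
        unfolding sq by (intro ennreal_leI power_mono) auto
    qed
    also have "\<dots> = ennreal (((1/2) ^ n)\<^sup>2)"
      by (simp add: Liminf_const)
    finally show ?thesis .
  qed
  have int: "integrable M (\<lambda>a. (g a - f n a)\<^sup>2)" for n
    using Fatou[of n] by (intro integrableI_bounded) (auto intro: le_less_trans)
  have gf: "L2_fun (\<lambda>a. g a - f n a)" for n
    unfolding L2_fun_def using int f by (auto simp: set_int g_def L2_fun_def)
  have g: "L2_fun g"
    using L2_fun_add[OF gf f, of 0 0] by simp
  have dist: "norm (abs_L2T g - u (r n)) \<le> (1/2) ^ n" for n
  proof -
    have "ennreal (\<integral>a. (g a - f n a)\<^sup>2 \<partial>M) \<le> ennreal (((1/2) ^ n)\<^sup>2)"
      using Fatou[of n] int[of n] by (simp add: nn_integral_eq_integral)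
    then have "(\<integral>a. (g a - f n a)\<^sup>2 \<partial>M) \<le> ((1/2) ^ n)\<^sup>2"
      by simp
    then show ?thesis
      by (simp add: uf abs_L2T_diff g f norm_abs_L2T[OF gf] set_int real_le_lsqrt)
  qed
  have "(\<lambda>n. u (r n)) \<longlonglongrightarrow> abs_L2T g"
  proof (rule LIM_zero_cancel, rule Lim_null_comparison)
    show "\<forall>\<^sub>F n in sequentially. norm (u (r n) - abs_L2T g) \<le> (1/2) ^ n"
      using dist by (simp add: norm_minus_commute)
  qed (simp add: LIMSEQ_realpow_zero)
  then have "(u \<circ> r) \<longlonglongrightarrow> abs_L2T g"
    by (simp add: comp_def)
  then have "u \<longlonglongrightarrow> abs_L2T g"
    using \<open>Cauchy u\<close> r Cauchy_converges_subseq by blast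
  then show "convergent u"
    by (rule convergentI)
qed


section \<open>Smooth functions and periodic displacements\<close>

text \<open>All sets \<open>S\<close> below are open.\<close>

primrec diff_n_on :: "nat \<Rightarrow> 'a set \<Rightarrow> ('a::real_normed_vector \<Rightarrow> 'b::real_normed_vector) \<Rightarrow> bool" where
  "diff_n_on 0 S f \<longleftrightarrow> continuous_on S f"
| "diff_n_on (Suc n) S f \<longleftrightarrow>
     (\<forall>x\<in>S. f differentiable (at x)) \<and> (\<forall>v. diff_n_on n S (\<lambda>x. frechet_derivative f (at x) v))"

definition smooth_on :: "'a set \<Rightarrow> ('a::real_normed_vector \<Rightarrow> 'b::real_normed_vector) \<Rightarrow> bool" where
  "smooth_on S f \<longleftrightarrow> (\<forall>n. diff_n_on n S f)"

definition strictly_convex_on :: "real set \<Rightarrow> (real \<Rightarrow> real) \<Rightarrow> bool" where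
  "strictly_convex_on S f \<longleftrightarrow> convex S \<and>
     (\<forall>x\<in>S. \<forall>y\<in>S. \<forall>s. x \<noteq> y \<and> 0 < s \<and> s < 1 \<longrightarrow>
        f ((1 - s) * x + s * y) < (1 - s) * f x + s * f y)"

text \<open>The functions representing \<open>I + \<xi>\<close>, and the set of all \<open>\<xi>\<close> with \<open>I + \<xi> \<in> K\<close>.\<close>

definition I_plus :: "L2T \<Rightarrow> (real \<Rightarrow> real) set" where
  "I_plus \<xi> = {X. L2_fun (\<lambda>a. X a - a) \<and> abs_L2T (\<lambda>a. X a - a) = \<xi>}"

definition K_disp :: "L2T set" where
  "K_disp = {\<xi>. \<exists>X\<in>I_plus \<xi>. mono X}"

definition superpose :: "(real \<Rightarrow> real) \<Rightarrow> L2T \<Rightarrow> L2T" where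
  "superpose F \<xi> = abs_L2T (\<lambda>a. F (rep_L2T \<xi> a))"

lemma superpose_abs_L2T:
  assumes lip: "\<And>x y. \<bar>F x - F y\<bar> \<le> L * \<bar>x - y\<bar>" and f: "L2_fun f"
  shows "L2_fun (\<lambda>a. F (f a))" and "superpose F (abs_L2T f) = abs_L2T (\<lambda>a. F (f a))"
proof -
  have "L-lipschitz_on UNIV F"
  proof (rule lipschitz_onI)
    show "0 \<le> L" using lip[of 0 1] by simp
  qed (use lip in \<open>auto simp: dist_real_def\<close>)
  then have "continuous_on UNIV F" by (rule lipschitz_on_continuous_on)
  then have [measurable]: "F \<in> borel_measurable borel" by (rule borel_measurable_continuous_onI)
  have L2: "L2_fun (\<lambda>a. F (g a))" if g: "L2_fun g" for g
  proof -
    have [measurable]: "g \<in> borel_measurable borel" using g by (simp add: L2_fun_def)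
    have "set_integrable lborel {0..1} (\<lambda>a. 2 * L\<^sup>2 * (g a)\<^sup>2 + 2 * (F 0)\<^sup>2)"
      using g by (intro set_integral_add set_integrable_mult_right)
        (auto simp: L2_fun_def set_integrable_def)
    then have "set_integrable lborel {0..1} (\<lambda>a. (F (g a))\<^sup>2)"
      unfolding set_integrable_def
    proof (rule Bochner_Integration.integrable_bound)
      have "(F x)\<^sup>2 \<le> 2 * L\<^sup>2 * x\<^sup>2 + 2 * (F 0)\<^sup>2" for x
      proof -
        have "(F x - F 0)\<^sup>2 \<le> (L * \<bar>x\<bar>)\<^sup>2"
          using lip[of x 0] power_mono[of "\<bar>F x - F 0\<bar>" "L * \<bar>x\<bar>" 2] by simp
        moreover have "0 \<le> (F x - 2 * F 0)\<^sup>2" by simp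
        ultimately show ?thesis
          by (simp add: power_mult_distrib power2_diff)
      qed
      then show "AE a in lborel. norm (indicat_real {0..1} a *\<^sub>R (F (g a))\<^sup>2)
          \<le> norm (indicat_real {0..1} a *\<^sub>R (2 * L\<^sup>2 * (g a)\<^sup>2 + 2 * (F 0)\<^sup>2))"
        by (intro AE_I2) (auto simp: indicator_def)
    qed measurable
    then show ?thesis using g by (auto simp: L2_fun_def)
  qed
  then show "L2_fun (\<lambda>a. F (f a))" using f .
  have "L2_rel (rep_L2T (abs_L2T f)) f"
    using Quotient3_rep_abs[OF Quotient3_L2T, OF L2_rel_refl[OF f]] .
  then have "L2_rel (\<lambda>a. F (rep_L2T (abs_L2T f) a)) (\<lambda>a. F (f a))"
    unfolding L2_rel_def using L2 by (auto elim: AE_mp)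
  then show "superpose F (abs_L2T f) = abs_L2T (\<lambda>a. F (f a))"
    unfolding superpose_def by (rule Quotient3_rel_abs[OF Quotient3_L2T])
qed

section \<open>The functional \<open>\<Theta>\<close>\<close>

text \<open>The function \<open>\<theta>\<close> is only relevant on \<open>(0,\<infinity>)\<close>; it is extended by \<open>+\<infinity>\<close>.\<close>

definition theta_ext :: "(real \<Rightarrow> real) \<Rightarrow> real \<Rightarrow> ereal" where
  "theta_ext \<theta> \<tau> = (if \<tau> > 0 then ereal (\<theta> \<tau>) else \<infinity>)"

definition legendre :: "(real \<Rightarrow> real) \<Rightarrow> real \<Rightarrow> ereal" where
  "legendre \<theta> s = (SUP \<tau>. ereal (s * \<tau>) - theta_ext \<theta> \<tau>)"

text \<open>Integral of an extended real function whose negative part has finite integral.\<close>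

definition ereal_integral :: "'a measure \<Rightarrow> ('a \<Rightarrow> ereal) \<Rightarrow> ereal" where
  "ereal_integral M g =
     enn2ereal (\<integral>\<^sup>+x. e2ennreal (g x) \<partial>M) - enn2ereal (\<integral>\<^sup>+x. e2ennreal (- g x) \<partial>M)"

text \<open>The derivative of \<open>I + \<xi> \<in> K\<close>, as a Borel measure on \<open>\<real>\<close>, is the Stieltjes measure of the
  unique nondecreasing right-continuous representative of \<open>I + \<xi>\<close>.\<close>

definition deriv_measure :: "L2T \<Rightarrow> real measure" where
  "deriv_measure \<xi> = interval_measure
     (THE X. X \<in> I_plus \<xi> \<and> mono X \<and> (\<forall>a. continuous (at_right a) X))"

definition Theta :: "(real \<Rightarrow> real) \<Rightarrow> L2T \<Rightarrow> ereal" where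
  "Theta \<theta> \<xi> =
     (if \<xi> \<notin> K_disp then \<infinity>
      else SUP f \<in> {f. continuous_on UNIV f \<and> (\<forall>a. f (a + 1) = f a)}.
             ereal (LINT a:{0<..1}|deriv_measure \<xi>. f a)
             - ereal_integral (restrict_space lborel {0..1}) (\<lambda>a. legendre \<theta> (f a)))"

definition indicator_K :: "L2T \<Rightarrow> ereal" where
  "indicator_K \<xi> = (if \<xi> \<in> K_disp then 0 else \<infinity>)"

section \<open>Evolution inclusions\<close>

definition subdifferential :: "('a::real_inner \<Rightarrow> ereal) \<Rightarrow> 'a \<Rightarrow> 'a set" where
  "subdifferential \<Phi> x = {p. \<Phi> x \<noteq> \<infinity> \<and> (\<forall>y. \<Phi> x + ereal (inner p (y - x)) \<le> \<Phi> y)}"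

definition abs_cont_on :: "real \<Rightarrow> real \<Rightarrow> (real \<Rightarrow> 'a::real_normed_vector) \<Rightarrow> bool" where
  "abs_cont_on s t u \<longleftrightarrow>
     (\<forall>e>0. \<exists>d>0. \<forall>D. D division_of \<Union>D \<and> \<Union>D \<subseteq> {s..t} \<and> (\<Sum>J\<in>D. measure lborel J) < d \<longrightarrow>
        (\<Sum>J\<in>D. norm (u (Sup J) - u (Inf J))) < e)"

text \<open>Strong solutions, in the sense of the theory of maximal monotone operators, of
  \<open>-d\<xi>/dt + Z + \<lambda>\<xi> \<in> A \<xi>\<close>, \<open>dZ/dt + \<lambda>Z = -\<lambda>\<^sup>2\<xi> + F(\<xi>)\<close> on \<open>[0,\<infinity>)\<close>: continuous up to the initial time,
  locally absolutely continuous on \<open>(0,\<infinity>)\<close>, the relations holding almost everywhere. Absolute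
  continuity up to \<open>t = 0\<close> is not required, as initial data need only lie in the closure of the
  domain of \<open>A\<close>.\<close>

definition is_solution ::
  "(L2T \<Rightarrow> L2T set) \<Rightarrow> real \<Rightarrow> (real \<Rightarrow> real) \<Rightarrow> L2T \<times> L2T \<Rightarrow> (real \<Rightarrow> L2T \<times> L2T) \<Rightarrow> bool" where
  "is_solution A lam F w u \<longleftrightarrow>
     u 0 = w \<and> continuous_on {0..} u \<and> (\<forall>s t. 0 < s \<and> s < t \<longrightarrow> abs_cont_on s t u) \<and>
     (AE t in lborel. 0 < t \<longrightarrow>
        (\<exists>d\<xi> dZ. (u has_vector_derivative (d\<xi>, dZ)) (at t) \<and>
           - d\<xi> + snd (u t) + lam *\<^sub>R fst (u t) \<in> A (fst (u t)) \<and>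
           dZ + lam *\<^sub>R snd (u t) = - (lam\<^sup>2 *\<^sub>R fst (u t)) + superpose F (fst (u t))))"

definition viscous_op :: "real \<Rightarrow> (real \<Rightarrow> real) \<Rightarrow> L2T \<Rightarrow> L2T set" where
  "viscous_op eps \<theta> \<xi> = (\<lambda>p. eps *\<^sub>R p) ` subdifferential (Theta \<theta>) \<xi>"

definition solution_map ::
  "(L2T \<Rightarrow> L2T set) \<Rightarrow> real \<Rightarrow> (real \<Rightarrow> real) \<Rightarrow> (real \<Rightarrow> L2T \<times> L2T \<Rightarrow> L2T \<times> L2T) \<Rightarrow> bool" where
  "solution_map A lam F S \<longleftrightarrow>
     (\<forall>w \<in> K_disp \<times> UNIV. is_solution A lam F w (\<lambda>t. S t w) \<and>
        (\<forall>u. is_solution A lam F w u \<longrightarrow> (\<forall>t\<ge>0. u t = S t w)))"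

section \<open>The Navier-Stokes system\<close>

definition pd1 :: "(real \<Rightarrow> real \<Rightarrow> real) \<Rightarrow> real \<Rightarrow> real \<Rightarrow> real" where
  "pd1 f t a = deriv (\<lambda>s. f s a) t"

definition pd2 :: "(real \<Rightarrow> real \<Rightarrow> real) \<Rightarrow> real \<Rightarrow> real \<Rightarrow> real" where
  "pd2 f t a = deriv (f t) a"

definition smooth2 :: "(real \<Rightarrow> real \<Rightarrow> real) \<Rightarrow> bool" where
  "smooth2 f \<longleftrightarrow> smooth_on ({0<..} \<times> UNIV) (\<lambda>(t, a). f t a)"

definition smooth_flow :: "(real \<Rightarrow> real \<Rightarrow> real) \<Rightarrow> bool" where
  "smooth_flow X \<longleftrightarrow> smooth2 X \<and>
     (\<forall>t>0. \<forall>a. pd2 X t a > 0 \<and> X t (a + 1) = X t a + 1)"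

definition material_NS ::
  "real \<Rightarrow> real \<Rightarrow> (real \<Rightarrow> real) \<Rightarrow> (real \<Rightarrow> real) \<Rightarrow> (real \<Rightarrow> real \<Rightarrow> real) \<Rightarrow> bool" where
  "material_NS eps lam \<theta> F X \<longleftrightarrow>
     (\<forall>t>0. \<forall>a. pd1 (pd1 X) t a =
        lam * eps * pd2 (\<lambda>t a. deriv \<theta> (pd2 X t a)) t a
        + eps * pd2 (\<lambda>t a. deriv (deriv \<theta>) (pd2 X t a) * pd1 (pd2 X) t a) t a
        + F (X t a - a))"

text \<open>Smooth solutions of the compressible Navier-Stokes system with pressure law \<open>p\<close>, viscosity
  law \<open>\<mu>\<close> and acceleration field \<open>g\<close> (force per unit mass).\<close>

definition eulerian_NS ::
  "(real \<Rightarrow> real) \<Rightarrow> (real \<Rightarrow> real) \<Rightarrow> (real \<Rightarrow> real \<Rightarrow> real) \<Rightarrow>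
   (real \<Rightarrow> real \<Rightarrow> real) \<Rightarrow> (real \<Rightarrow> real \<Rightarrow> real) \<Rightarrow> bool" where
  "eulerian_NS p \<mu> g \<rho> v \<longleftrightarrow>
     smooth2 \<rho> \<and> smooth2 v \<and>
     (\<forall>t>0. (LINT x:{0..1}|lborel. \<rho> t x) = 1) \<and>
     (\<forall>t>0. \<forall>x. \<rho> t x > 0 \<and> \<rho> t (x + 1) = \<rho> t x \<and> v t (x + 1) = v t x \<and>
        pd1 (\<lambda>t x. \<rho> t x * v t x) t x + pd2 (\<lambda>t x. \<rho> t x * (v t x)\<^sup>2 + p (\<rho> t x)) t x
          = pd2 (\<lambda>t x. \<mu> (\<rho> t x) * pd2 v t x) t x + \<rho> t x * g t x \<and>
        pd1 \<rho> t x + pd2 (\<lambda>t x. \<rho> t x * v t x) t x = 0)"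

definition material_coordinates ::
  "(real \<Rightarrow> real \<Rightarrow> real) \<Rightarrow> (real \<Rightarrow> real \<Rightarrow> real) \<Rightarrow> (real \<Rightarrow> real \<Rightarrow> real) \<Rightarrow> bool" where
  "material_coordinates X \<rho> v \<longleftrightarrow>
     (\<forall>t>0. \<forall>a. pd1 X t a = v t (X t a) \<and> \<rho> t (X t a) * pd2 X t a = 1 \<and>
        X t (a + 1) = X t a + 1)"

text \<open>The forcing \<open>F\<close> acts on the displacement \<open>X - a\<close> of the material point \<open>a\<close> located at \<open>x\<close>.\<close>

definition eulerian_force :: "(real \<Rightarrow> real) \<Rightarrow> (real \<Rightarrow> real \<Rightarrow> real) \<Rightarrow> real \<Rightarrow> real \<Rightarrow> real" where
  "eulerian_force F X t x = F (x - inv (X t) x)"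

definition constitutive_laws ::
  "real \<Rightarrow> real \<Rightarrow> (real \<Rightarrow> real) \<Rightarrow> (real \<Rightarrow> real) \<Rightarrow> (real \<Rightarrow> real) \<Rightarrow> bool" where
  "constitutive_laws eps lam \<theta> p \<mu> \<longleftrightarrow>
     (\<forall>\<tau>>0. \<mu> (1 / \<tau>) = eps * \<tau> * deriv (deriv \<theta>) \<tau> \<and> p (1 / \<tau>) = - lam * eps * deriv \<theta> \<tau>)"

definition displacement :: "(real \<Rightarrow> real \<Rightarrow> real) \<Rightarrow> real \<Rightarrow> L2T" where
  "displacement X t = abs_L2T (\<lambda>a. X t a - a)"

text \<open>\<open>Z = V - \<lambda> (X - a)\<close>, where \<open>\<partial>\<^sub>tX = V + \<epsilon> \<partial>\<^sub>a(\<theta>'(\<partial>\<^sub>aX))\<close>\<close>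

definition Z_of_flow :: "real \<Rightarrow> real \<Rightarrow> (real \<Rightarrow> real) \<Rightarrow> (real \<Rightarrow> real \<Rightarrow> real) \<Rightarrow> real \<Rightarrow> L2T" where
  "Z_of_flow eps lam \<theta> X t = abs_L2T (\<lambda>a.
     pd1 X t a - eps * pd2 (\<lambda>t a. deriv \<theta> (pd2 X t a)) t a - lam * (X t a - a))"

text \<open>The material equation in the sense of distributions in time with values in \<open>L\<^sup>2(\<real>/\<int>)\<close>, with
  \<open>\<partial>\<^sub>a(\<theta>'(\<partial>\<^sub>aX))\<close> replaced by \<open>-q\<close> where \<open>q\<close> is a selection of \<open>\<partial>\<Theta>[\<xi>]\<close>, and
  \<open>\<partial>\<^sub>a(\<theta>''(\<partial>\<^sub>aX) \<partial>\<^sup>2\<^sub>t\<^sub>aX) = \<partial>\<^sub>t\<partial>\<^sub>a(\<theta>'(\<partial>\<^sub>aX))\<close> by \<open>-\<partial>\<^sub>tq\<close>.\<close>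

definition generalized_material_NS ::
  "real \<Rightarrow> real \<Rightarrow> (real \<Rightarrow> real) \<Rightarrow> (real \<Rightarrow> real) \<Rightarrow> (real \<Rightarrow> L2T) \<Rightarrow> bool" where
  "generalized_material_NS eps lam \<theta> F \<xi> \<longleftrightarrow>
     (\<exists>q. (AE t in lborel. 0 < t \<longrightarrow> q t \<in> subdifferential (Theta \<theta>) (\<xi> t)) \<and>
        (\<forall>h s t. 0 < s \<and> s < t \<longrightarrow> set_integrable lborel {s..t} (\<lambda>r. inner (q r) h)) \<and>
        (\<forall>h \<phi> s t. 0 < s \<and> s < t \<and> smooth_on UNIV \<phi> \<and> (\<forall>r. r \<notin> {s..t} \<longrightarrow> \<phi> r = 0) \<longrightarrow>
           (LINT r:{s..t}|lborel. deriv (deriv \<phi>) r * inner (\<xi> r) h)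
           = (LINT r:{s..t}|lborel. - lam * eps * \<phi> r * inner (q r) h
                + eps * deriv \<phi> r * inner (q r) h + \<phi> r * inner (superpose F (\<xi> r)) h)))"

end

theory Submission
  imports Defs
begin

text \<open>With \<open>u = (\<xi>, Z)\<close> the system reads \<open>u' \<in> B u - A u\<close>, where \<open>A\<close> acts on \<open>\<xi>\<close> alone as the
  subdifferential of \<open>\<epsilon> \<Theta>\<close> (or of the indicator of \<open>K\<close>) and \<open>B\<close> is globally Lipschitz. Replacing
  \<open>A\<close> by its Yosida approximations gives ordinary differential equations whose flows converge
  uniformly on bounded time intervals, at a rate depending only on the Lipschitz constant of \<open>B\<close>
  and on the norm of one element of \<open>A\<close> at the initial point. The same uniform rate permits to
  exchange the limits \<open>\<epsilon> \<rightarrow> 0\<close> and Yosida parameter \<open>\<rightarrow> 0\<close>, so that convergence of solutions reduces to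
  convergence of the resolvents of \<open>\<epsilon> \<partial>\<Theta>\<close> to the projection onto \<open>K\<close>. On a smooth flow the
  subdifferential of \<open>\<Theta>\<close> is the single element \<open>- \<partial>\<^sub>a(\<theta>'(\<partial>\<^sub>aX))\<close>, and eliminating \<open>Z\<close> gives the
  material equation.\<close>

section \<open>Gronwall's inequality and derivatives of squared distances\<close>

section \<open>Differential inequalities\<close>

text \<open>The initial point lies only in the closure of the domain, so speed bounds cannot reach
  time 0. Because A is a subdifferential, a time-weighted energy estimate bounds the speed of every
  Yosida flow by C / t, hence the limit is Lipschitz on each [t0, T] with t0 > 0. Its
  differentiability is obtained without a Radon-Nikodym argument: the right derivative exists at
  every t > 0 and is minus the element of least norm of A u - B u; that norm, damped by an
  exponential, is nonincreasing in time, so it is continuous off a countable set, and there the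
  two-sided derivative exists. Uniqueness has to cover all absolutely continuous competitors, which
  calls for a monotonicity criterion with an exceptional null set. For \<Theta> everything rests on
  one identity: against a C1 periodic test function, the Stieltjes measure of I + \<xi> integrates
  to a constant minus an inner product with \<xi>. Thus \<Theta> is, on the cone, a supremum of
  uniform limits of continuous affine functions of \<xi>, which yields convexity, closedness and the
  subgradients at smooth maps.\<close>

lemma gronwall_deriv:
  fixes g :: "real \<Rightarrow> real"
  assumes "s \<le> t" and cont: "continuous_on {s..t} g"
    and deriv: "\<And>r. s < r \<Longrightarrow> r < t \<Longrightarrow> \<exists>g'. (g has_real_derivative g') (at r) \<and> g' \<le> k * g r + c"
    and "k \<ge> 0" "c \<ge> 0"
  shows "g t \<le> exp (k * (t - s)) * (g s + c * (t - s))"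
proof -
  \<comment> \<open>Besides the usual damping, the linear term absorbs the source c, because the
    damping factor is at most 1 after time s.\<close>
  let ?h = "\<lambda>r. g r * exp (- k * (r - s)) - c * (r - s)"
  have "?h t \<le> ?h s"
  proof (rule DERIV_nonpos_imp_decreasing_open[OF \<open>s \<le> t\<close>])
    fix r assume r: "s < r" "r < t"
    obtain g' where g': "(g has_real_derivative g') (at r)" "g' \<le> k * g r + c"
      using deriv[OF r] by blast
    have e: "exp (- k * (r - s)) \<le> 1"
      using r \<open>k \<ge> 0\<close> by simp
    have "(?h has_real_derivative (g' - k * g r) * exp (- k * (r - s)) - c) (at r)"
      by (auto intro!: derivative_eq_intros g'(1) simp: algebra_simps)
    moreover have "(g' - k * g r) * exp (- k * (r - s)) \<le> c * exp (- k * (r - s))"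
      using g'(2) by (intro mult_right_mono) auto
    moreover have "c * exp (- k * (r - s)) \<le> c * 1"
      using e \<open>c \<ge> 0\<close> by (rule mult_left_mono)
    ultimately show "\<exists>y. (?h has_real_derivative y) (at r) \<and> y \<le> 0"
      by (intro exI conjI) (assumption, linarith)
  qed (intro continuous_intros cont)
  then have "g t * exp (- k * (t - s)) \<le> g s + c * (t - s)"
    by simp
  then have "exp (k * (t - s)) * (g t * exp (- k * (t - s))) \<le> exp (k * (t - s)) * (g s + c * (t - s))"
    by (intro mult_left_mono) auto
  also have "exp (k * (t - s)) * (g t * exp (- k * (t - s))) = g t"
    by (simp add: mult.left_commute flip: exp_add)
  finally show ?thesis .
qed

lemma has_derivative_norm_square_diff:
  fixes u v :: "real \<Rightarrow> 'a::real_inner"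
  assumes "(u has_vector_derivative u') (at t)" "(v has_vector_derivative v') (at t)"
  shows "((\<lambda>t. (norm (u t - v t))\<^sup>2) has_real_derivative 2 * inner (u' - v') (u t - v t)) (at t)"
proof -
  have "((\<lambda>t. inner (u t - v t) (u t - v t)) has_derivative
      (\<lambda>h. inner (u t - v t) (h *\<^sub>R u' - h *\<^sub>R v') + inner (h *\<^sub>R u' - h *\<^sub>R v') (u t - v t))) (at t)"
    using assms unfolding has_vector_derivative_def
    by (intro has_derivative_inner has_derivative_diff)
  then show ?thesis
    unfolding has_field_derivative_def power2_norm_eq_inner
    by (rule has_derivative_eq_rhs) (auto simp: inner_commute inner_simps algebra_simps)
qed

text \<open>Velocities are later identified by testing difference quotients against fixed vectors,
  which calls for differentiability in this form.\<close>

lemma has_vector_derivative_at_iff_quotient: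
  "(u has_vector_derivative d) (at t) \<longleftrightarrow> ((\<lambda>h. (u (t + h) - u t) /\<^sub>R h) \<longlongrightarrow> d) (at 0)"
proof -
  have "(u has_vector_derivative d) (at t)
      \<longleftrightarrow> ((\<lambda>h. norm (u (t + h) - u t - h *\<^sub>R d) / norm h) \<longlongrightarrow> 0) (at 0)"
    unfolding has_vector_derivative_def has_derivative_at
    by (simp add: bounded_linear_scaleR_left)
  also have "\<dots> \<longleftrightarrow> ((\<lambda>h. norm ((u (t + h) - u t) /\<^sub>R h - d)) \<longlongrightarrow> 0) (at 0)"
  proof (intro tendsto_cong eventually_at_ball'[THEN eventually_mono])
    fix h :: real assume "h \<in> ball 0 1 \<and> h \<noteq> 0 \<and> h \<in> UNIV"
    then have "(u (t + h) - u t) /\<^sub>R h - d = (u (t + h) - u t - h *\<^sub>R d) /\<^sub>R h"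
      by (simp add: algebra_simps)
    then show "norm (u (t + h) - u t - h *\<^sub>R d) / norm h = norm ((u (t + h) - u t) /\<^sub>R h - d)"
      by (simp add: divide_inverse_commute)
  qed (rule zero_less_one)
  also have "\<dots> \<longleftrightarrow> ((\<lambda>h. (u (t + h) - u t) /\<^sub>R h) \<longlongrightarrow> d) (at 0)"
    unfolding tendsto_norm_zero_iff by (rule LIM_zero_iff)
  finally show ?thesis .
qed

section \<open>Picard iteration, dependence on the initial point, growth of speeds\<close>

section \<open>Lipschitz ordinary differential equations\<close>

text \<open>Differentiability is asked at positive times and continuity covers time 0, so one-sided
  derivatives never occur.\<close>

definition is_flow :: "('a::real_normed_vector \<Rightarrow> 'a) \<Rightarrow> 'a \<Rightarrow> (real \<Rightarrow> 'a) \<Rightarrow> bool" where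
  "is_flow G w u \<longleftrightarrow> u 0 = w \<and> continuous_on {0..} u \<and> (\<forall>t>0. (u has_vector_derivative G (u t)) (at t))"

text \<open>Integrating a function of size exp(c s) gains a factor 1/c; this is what makes the
  Picard map contract in an exponentially weighted norm.\<close>

lemma norm_integral_exp_bound:
  fixes f :: "real \<Rightarrow> 'a::banach"
  assumes "0 \<le> t" "c > 0" and cont: "continuous_on {0..t} f"
    and bound: "\<And>s. 0 \<le> s \<Longrightarrow> s \<le> t \<Longrightarrow> norm (f s) \<le> M * exp (c * s)" and "0 \<le> M"
  shows "norm (integral {0..t} f) \<le> M / c * exp (c * t)"
proof -
  have "((\<lambda>s. M * exp (c * s)) has_integral (M / c * exp (c * t) - M / c * exp (c * 0))) {0..t}"
    using assms
    by (intro fundamental_theorem_of_calculus)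
       (auto intro!: derivative_eq_intros simp flip: has_real_derivative_iff_has_vector_derivative)
  then have "norm (integral {0..t} f) \<le> M / c * exp (c * t) - M / c * exp (c * 0)"
    using integral_norm_bound_integral[of f "{0..t}" "\<lambda>s. M * exp (c * s)"] bound cont
    by (auto simp: has_integral_iff intro: integrable_continuous_real)
  moreover have "M / c * exp (c * 0) \<ge> 0" using assms by simp
  ultimately show ?thesis by linarith
qed

lemma continuous_on_indefinite_integral_Ici:
  fixes f :: "real \<Rightarrow> 'a::banach"
  assumes "continuous_on {0..} f"
  shows "continuous_on {0..} (\<lambda>t. integral {0..t} f)"
    and "t > 0 \<Longrightarrow> ((\<lambda>t. integral {0..t} f) has_vector_derivative f t) (at t)"
proof -
  have *: "((\<lambda>t. integral {0..t} f) has_vector_derivative f t) (at t within {0..t+1})" if "t \<ge> 0" for t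
    using that by (intro integral_has_vector_derivative continuous_on_subset[OF assms]) auto
  show "continuous_on {0..} (\<lambda>t. integral {0..t} f)"
    unfolding continuous_on_eq_continuous_within
  proof
    fix t :: real assume t: "t \<in> {0..}"
    have "continuous (at t within {0..t+1}) (\<lambda>t. integral {0..t} f)"
      using *[of t] t by (auto intro: has_vector_derivative_continuous)
    moreover have "at t within {0..} = at t within {0..t+1}"
      by (rule at_within_nhd[of _ "{..<t+1}"]) auto
    ultimately show "continuous (at t within {0..}) (\<lambda>t. integral {0..t} f)" by simp
  qed
  show "((\<lambda>t. integral {0..t} f) has_vector_derivative f t) (at t)" if "t > 0"
    using *[of t] that at_within_interior[of t "{0..t+1}"] by auto
qed

text \<open>Picard iteration in the sup norm weighted by exp(- c t), which gives a global solution
  from a single contraction instead of gluing short time intervals.\<close>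

lemma is_flow_exists:
  fixes G :: "'a::banach \<Rightarrow> 'a"
  assumes lip: "\<And>x y. norm (G x - G y) \<le> K * norm (x - y)" and K: "K > 0"
  shows "\<exists>u. is_flow G w u"
proof -
  \<comment> \<open>Integration gains 1/c and G costs K, so the contraction factor is K / c =
    1/2.\<close>
  define c where "c = 2 * K"
  have c: "c > 0" using K by (simp add: c_def)
  have contG: "continuous_on UNIV G"
    by (rule lipschitz_on_continuous_on[of K]) (use lip K in \<open>auto intro!: lipschitz_onI simp: dist_norm\<close>)
  \<comment> \<open>The unknown is v = exp(- c t) u, which stays bounded while u itself may grow
    exponentially.\<close>
  define f where "f v s = G (exp (c * s) *\<^sub>R apply_bcontfun v s)" for v :: "real \<Rightarrow>\<^sub>C 'a" and s
  have contf: "continuous_on S (f v)" for v S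
    unfolding f_def
    by (rule continuous_on_compose2[OF contG]) (auto intro!: continuous_intros continuous_on_subset[OF continuous_on_apply_bcontfun])
  \<comment> \<open>Elements of the function space live on the whole line; \<open>max 0 t\<close>
    extends the Picard map constantly to negative times.\<close>
  define T where "T v t = exp (- c * max 0 t) *\<^sub>R (w + integral {0..max 0 t} (f v))" for v t
  have contT: "continuous_on UNIV (T v)" for v
    unfolding T_def
    by (intro continuous_intros continuous_on_compose2[OF continuous_on_indefinite_integral_Ici(1)[OF contf]]) auto
  have diffT: "norm (integral {0..t} (f v) - integral {0..t} (f v')) \<le> dist v v' / 2 * exp (c * t)" if "t \<ge> 0" for v v' t
  proof -
    have "norm (f v s - f v' s) \<le> (K * dist v v') * exp (c * s)" for s
    proof -
      have "norm (f v s - f v' s) \<le> K * norm (exp (c * s) *\<^sub>R (apply_bcontfun v s - apply_bcontfun v' s))"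
        unfolding f_def scaleR_diff_right by (rule lip)
      also have "\<dots> \<le> K * (exp (c * s) * dist v v')"
        using dist_bounded[of v s v'] K by (intro mult_left_mono) (auto simp: dist_norm)
      finally show ?thesis by (simp add: mult_ac)
    qed
    then have "norm (integral {0..t} (\<lambda>s. f v s - f v' s)) \<le> (K * dist v v') / c * exp (c * t)"
      using K c that by (intro norm_integral_exp_bound continuous_on_diff contf) auto
    moreover have "integral {0..t} (\<lambda>s. f v s - f v' s) = integral {0..t} (f v) - integral {0..t} (f v')"
      by (intro integral_diff integrable_continuous_real contf)
    ultimately show ?thesis using K by (simp add: c_def)
  qed
  have bT: "T v \<in> bcontfun" for v
  proof (rule bcontfun_normI[OF contT])
    fix t :: real
    define r where "r = max 0 t"
    have r: "r \<ge> 0" by (simp add: r_def)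
    have "norm (f v s) \<le> (norm (G 0) + K * norm v) * exp (c * s)" if "s \<ge> 0" for s
    proof -
      have "norm (f v s) \<le> norm (G 0) + norm (f v s - G 0)"
        by (metis add.commute norm_triangle_sub)
      also have "norm (f v s - G 0) \<le> K * (exp (c * s) * norm v)"
        unfolding f_def using norm_bounded[of v s] K
        by (intro order_trans[OF lip] mult_left_mono) auto
      also have "norm (G 0) \<le> norm (G 0) * exp (c * s)"
        using that c by (simp add: mult_le_cancel_left1)
      finally show ?thesis by (simp add: algebra_simps)
    qed
    then have "norm (integral {0..r} (f v)) \<le> (norm (G 0) + K * norm v) / c * exp (c * r)"
      using c K r by (intro norm_integral_exp_bound contf) auto
    then have "norm (w + integral {0..r} (f v)) \<le> norm w + (norm (G 0) + K * norm v) / c * exp (c * r)"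
      by (intro order_trans[OF norm_triangle_ineq] add_left_mono)
    also have "\<dots> \<le> (norm w + (norm (G 0) + K * norm v) / c) * exp (c * r)"
      using r c by (simp add: algebra_simps mult_le_cancel_left1)
    finally have "exp (- c * r) * norm (w + integral {0..r} (f v))
        \<le> exp (- c * r) * ((norm w + (norm (G 0) + K * norm v) / c) * exp (c * r))"
      by (intro mult_left_mono) auto
    also have "\<dots> = norm w + (norm (G 0) + K * norm v) / c"
      by (simp add: mult.left_commute flip: exp_add)
    finally show "norm (T v t) \<le> norm w + (norm (G 0) + K * norm v) / c"
      by (simp add: T_def r_def)
  qed
  have contr: "dist (Bcontfun (T v)) (Bcontfun (T v')) \<le> dist v v' / 2" for v v'
  proof (rule dist_bound)
    fix t :: real
    define r where "r = max 0 t"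
    have "norm (T v t - T v' t) = exp (- c * r) * norm (integral {0..r} (f v) - integral {0..r} (f v'))"
      by (simp add: T_def r_def flip: scaleR_diff_right)
    also have "\<dots> \<le> exp (- c * r) * (dist v v' / 2 * exp (c * r))"
      by (intro mult_left_mono diffT) (auto simp: r_def)
    also have "\<dots> = dist v v' / 2"
      by (simp add: mult.left_commute flip: exp_add)
    finally show "dist (apply_bcontfun (Bcontfun (T v)) t) (apply_bcontfun (Bcontfun (T v')) t) \<le> dist v v' / 2"
      by (simp add: Bcontfun_inverse[OF bT] dist_norm)
  qed
  have "\<exists>!v. Bcontfun (T v) = v"
    by (rule banach_fix_type[of "1/2"]) (use contr in auto)
  then obtain v where "Bcontfun (T v) = v" by blast
  then have v: "apply_bcontfun v = T v"
    by (metis Bcontfun_inverse bT)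
  define u where "u t = w + integral {0..t} (f v)" for t
  have u: "exp (c * t) *\<^sub>R apply_bcontfun v t = u t" if "t \<ge> 0" for t
    using that by (simp add: v T_def u_def max_def flip: exp_add)
  have "is_flow G w u"
    unfolding is_flow_def
  proof (intro conjI allI impI)
    show "u 0 = w" by (simp add: u_def)
    show "continuous_on {0..} u"
      unfolding u_def by (intro continuous_intros continuous_on_indefinite_integral_Ici contf)
    fix t :: real assume "t > 0"
    then show "(u has_vector_derivative G (u t)) (at t)"
      unfolding u_def[abs_def] using continuous_on_indefinite_integral_Ici(2)[OF contf, of t v] u[of t]
      by (auto intro!: derivative_eq_intros simp: f_def u_def)
  qed
  then show ?thesis by blast
qed

lemma is_flow_shift: "is_flow G w u \<Longrightarrow> h \<ge> 0 \<Longrightarrow> is_flow G (u h) (\<lambda>t. u (t + h))"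
  unfolding is_flow_def
proof (intro conjI allI impI)
  assume u: "u 0 = w \<and> continuous_on {0..} u \<and> (\<forall>t>0. (u has_vector_derivative G (u t)) (at t))" and h: "h \<ge> 0"
  show "continuous_on {0..} (\<lambda>t. u (t + h))"
    by (rule continuous_on_compose2[of "{0..}" u]) (use u h in \<open>auto intro!: continuous_intros\<close>)
  fix t :: real assume "t > 0"
  then show "((\<lambda>t. u (t + h)) has_vector_derivative G (u (t + h))) (at t)"
    using u h vector_diff_chain_at[of "\<lambda>t. t + h" 1 t u "G (u (t + h))"]
    by (auto simp: o_def has_vector_derivative_add_const)
qed simp

text \<open>Differentiating the squared distance involves G only through its one-sided constant L.
  For Yosida fields that constant stays fixed while the Lipschitz constant blows up.\<close>

lemma is_flow_dist:
  fixes G :: "'a::real_inner \<Rightarrow> 'a"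
  assumes osl: "\<And>x y. inner (G x - G y) (x - y) \<le> L * (norm (x - y))\<^sup>2" and "L \<ge> 0"
    and u: "is_flow G w u" and v: "is_flow G w' v" and st: "0 \<le> s" "s \<le> t"
  shows "norm (u t - v t) \<le> exp (L * (t - s)) * norm (u s - v s)"
proof -
  have "(norm (u t - v t))\<^sup>2 \<le> exp (2 * L * (t - s)) * ((norm (u s - v s))\<^sup>2 + 0 * (t - s))"
  proof (rule gronwall_deriv)
    show "continuous_on {s..t} (\<lambda>t. (norm (u t - v t))\<^sup>2)"
      using u v st unfolding is_flow_def by (intro continuous_intros) (auto intro: continuous_on_subset)
    fix r assume "s < r" "r < t"
    then show "\<exists>g'. ((\<lambda>t. (norm (u t - v t))\<^sup>2) has_real_derivative g') (at r) \<and> g' \<le> 2 * L * (norm (u r - v r))\<^sup>2 + 0"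
      using u v st osl[of "u r" "v r"] unfolding is_flow_def
      by (intro exI[of _ "2 * inner (G (u r) - G (v r)) (u r - v r)"] conjI has_derivative_norm_square_diff) auto
  qed (use assms in auto)
  also have "\<dots> = (exp (L * (t - s)) * norm (u s - v s))\<^sup>2"
    by (simp add: power_mult_distrib power2_eq_square algebra_simps flip: exp_add)
  finally show ?thesis
    by (rule power2_le_imp_le) simp
qed

text \<open>The equation is autonomous, so the flow shifted by h is again a flow; its distance to
  the original, divided by h, tends to the speed.\<close>

lemma is_flow_speed:
  fixes G :: "'a::real_inner \<Rightarrow> 'a"
  assumes osl: "\<And>x y. inner (G x - G y) (x - y) \<le> L * (norm (x - y))\<^sup>2" and "L \<ge> 0"
    and contG: "continuous_on UNIV G"
    and u: "is_flow G w u" and st: "0 \<le> s" "s \<le> t"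
  shows "norm (G (u t)) \<le> exp (L * (t - s)) * norm (G (u s))"
proof -
  have pos: "norm (G (u t)) \<le> exp (L * (t - s)) * norm (G (u s))" if st: "0 < s" "s \<le> t" for s t
  proof (rule tendsto_le[of "at_right 0"])
    have lim: "((\<lambda>h. norm ((u (r + h) - u r) /\<^sub>R h)) \<longlongrightarrow> norm (G (u r))) (at_right 0)" if "r > 0" for r
      using u that unfolding is_flow_def has_vector_derivative_at_iff_quotient
      by (intro tendsto_norm) (auto intro: tendsto_mono[OF at_le])
    show "((\<lambda>h. norm ((u (t + h) - u t) /\<^sub>R h)) \<longlongrightarrow> norm (G (u t))) (at_right 0)"
      using st by (intro lim) auto
    show "((\<lambda>h. exp (L * (t - s)) * norm ((u (s + h) - u s) /\<^sub>R h)) \<longlongrightarrow> exp (L * (t - s)) * norm (G (u s))) (at_right 0)"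
      using st by (intro tendsto_intros lim) auto
    show "\<forall>\<^sub>F h in at_right 0. norm ((u (t + h) - u t) /\<^sub>R h) \<le> exp (L * (t - s)) * norm ((u (s + h) - u s) /\<^sub>R h)"
    proof (rule eventually_at_right_less[THEN eventually_mono])
      fix h :: real assume "0 < h"
      then have "norm (u (t + h) - u t) \<le> exp (L * (t - s)) * norm (u (s + h) - u s)"
        using is_flow_dist[OF osl \<open>L \<ge> 0\<close> is_flow_shift[OF u, of h] u, of s t] st by simp
      then show "norm ((u (t + h) - u t) /\<^sub>R h) \<le> exp (L * (t - s)) * norm ((u (s + h) - u s) /\<^sub>R h)"
        using \<open>0 < h\<close> by (simp add: divide_right_mono mult.left_commute mult_left_mono)
    qed
  qed simp
  show ?thesis
  proof (cases "0 < s \<or> t = 0")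
    case True then show ?thesis using pos[of s t] st by auto
  next
    case False
    \<comment> \<open>No derivative is available at time 0, so this case is the limit of the
      inequality as s decreases to 0, by continuity of G along the flow.\<close>
    then have s: "s = 0" "t > 0" using st by auto
    have "continuous_on {0..} (\<lambda>s. exp (L * (t - s)) * norm (G (u s)))"
      using u unfolding is_flow_def
      by (intro continuous_intros continuous_on_compose2[OF contG]) auto
    then have "((\<lambda>s. exp (L * (t - s)) * norm (G (u s))) \<longlongrightarrow> exp (L * (t - 0)) * norm (G (u 0))) (at 0 within {0..})"
      unfolding continuous_on_def by (rule bspec) simp
    then have "((\<lambda>s. exp (L * (t - s)) * norm (G (u s))) \<longlongrightarrow> exp (L * (t - 0)) * norm (G (u 0))) (at_right 0)"
      by (rule tendsto_within_subset) auto
    moreover have "\<forall>\<^sub>F s in at_right 0. norm (G (u t)) \<le> exp (L * (t - s)) * norm (G (u s))"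
      using s by (intro eventually_at_rightI[of 0 t] pos) auto
    ultimately show ?thesis
      unfolding s by (rule tendsto_lowerbound) simp
  qed
qed

section \<open>Resolvents, Yosida approximations and the element of least norm\<close>

section \<open>Maximal monotone operators\<close>

text \<open>For a maximal monotone operator the decomposition of z exists, and monotonicity makes it
  unique (\<open>resolvent_eqI\<close>), so the choice is harmless.\<close>

definition resolvent :: "('a::real_vector \<Rightarrow> 'a set) \<Rightarrow> real \<Rightarrow> 'a \<Rightarrow> 'a" where
  "resolvent A \<mu> z = (SOME x. \<exists>y\<in>A x. z = x + \<mu> *\<^sub>R y)"

definition yosida :: "('a::real_vector \<Rightarrow> 'a set) \<Rightarrow> real \<Rightarrow> 'a \<Rightarrow> 'a" where
  "yosida A \<mu> z = (z - resolvent A \<mu> z) /\<^sub>R \<mu>"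

text \<open>Whenever A x is nonempty, this limit of Yosida approximations is the element of least
  norm of A x.\<close>

definition minimal_section :: "('a::real_normed_vector \<Rightarrow> 'a set) \<Rightarrow> 'a \<Rightarrow> 'a" where
  "minimal_section A x = lim (\<lambda>n. yosida A (inverse (Suc n)) x)"

definition shift_op :: "('a::real_vector \<Rightarrow> 'a set) \<Rightarrow> 'a \<Rightarrow> 'a \<Rightarrow> 'a set" where
  "shift_op A b x = (\<lambda>y. y - b) ` A x"

text \<open>By Minty's theorem, maximality among monotone operators amounts to surjectivity of the
  identity plus \<mu> A; taken as an axiom, it provides resolvents directly.\<close>

locale maximal_monotone =
  fixes A :: "'a::{real_inner,banach} \<Rightarrow> 'a set"
  assumes monotone: "y \<in> A x \<Longrightarrow> y' \<in> A x' \<Longrightarrow> 0 \<le> inner (y - y') (x - x')"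
    and range: "\<mu> > 0 \<Longrightarrow> \<exists>x. \<exists>y\<in>A x. z = x + \<mu> *\<^sub>R y"
begin

lemma yosida_in: "\<mu> > 0 \<Longrightarrow> yosida A \<mu> z \<in> A (resolvent A \<mu> z)"
proof -
  assume \<mu>: "\<mu> > 0"
  have "\<exists>y\<in>A (resolvent A \<mu> z). z = resolvent A \<mu> z + \<mu> *\<^sub>R y"
    unfolding resolvent_def by (rule someI_ex[OF range[OF \<mu>]])
  then obtain y where y: "y \<in> A (resolvent A \<mu> z)" and z: "z = resolvent A \<mu> z + \<mu> *\<^sub>R y" by blast
  from z have "z - resolvent A \<mu> z = \<mu> *\<^sub>R y" by (metis add_diff_cancel_left')
  with y \<mu> show ?thesis by (simp add: yosida_def)
qed

lemma resolvent_yosida: "\<mu> > 0 \<Longrightarrow> resolvent A \<mu> z = z - \<mu> *\<^sub>R yosida A \<mu> z"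
  by (simp add: yosida_def)

lemma resolvent_eqI:
  assumes \<mu>: "\<mu> > 0" and y: "y \<in> A x" and z: "z = x + \<mu> *\<^sub>R y"
  shows "resolvent A \<mu> z = x"
proof -
  have "0 \<le> inner (y - yosida A \<mu> z) (x - resolvent A \<mu> z)"
    by (rule monotone[OF y yosida_in[OF \<mu>]])
  also have "y - yosida A \<mu> z = - ((x - resolvent A \<mu> z) /\<^sub>R \<mu>)"
    using \<mu> by (simp add: yosida_def z algebra_simps)
  finally have "inner (x - resolvent A \<mu> z) (x - resolvent A \<mu> z) \<le> 0"
    using \<mu> by (simp add: mult_le_0_iff zero_le_mult_iff)
  then have "x - resolvent A \<mu> z = 0" using inner_ge_zero[of "x - resolvent A \<mu> z"] inner_eq_zero_iff by (metis antisym)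
  then show ?thesis by simp
qed

text \<open>Monotonicity of A holds between the resolvents; rewriting these as x minus \<mu> times
  the Yosida value leaves the square on the left. This cocoercivity contains both monotonicity and
  the Lipschitz constant 1/\<mu>.\<close>

lemma yosida_monotone:
  assumes \<mu>: "\<mu> > 0"
  shows "\<mu> * (norm (yosida A \<mu> x - yosida A \<mu> y))\<^sup>2 \<le> inner (yosida A \<mu> x - yosida A \<mu> y) (x - y)"
proof -
  have "0 \<le> inner (yosida A \<mu> x - yosida A \<mu> y) (resolvent A \<mu> x - resolvent A \<mu> y)"
    using \<mu> by (intro monotone yosida_in)
  also have "resolvent A \<mu> x - resolvent A \<mu> y = (x - y) - \<mu> *\<^sub>R (yosida A \<mu> x - yosida A \<mu> y)"
    using \<mu> by (simp add: resolvent_yosida algebra_simps)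
  finally show ?thesis by (simp add: inner_diff_right power2_norm_eq_inner)
qed

lemma yosida_lipschitz:
  assumes \<mu>: "\<mu> > 0"
  shows "norm (yosida A \<mu> x - yosida A \<mu> y) \<le> norm (x - y) / \<mu>"
proof -
  have "\<mu> * (norm (yosida A \<mu> x - yosida A \<mu> y))\<^sup>2 \<le> norm (yosida A \<mu> x - yosida A \<mu> y) * norm (x - y)"
    using yosida_monotone[OF \<mu>] norm_cauchy_schwarz order_trans by blast
  then show ?thesis
    using \<mu> by (cases "norm (yosida A \<mu> x - yosida A \<mu> y) = 0") (auto simp: power2_eq_square field_simps)
qed

lemma yosida_le_inner:
  assumes \<mu>: "\<mu> > 0" and y: "y \<in> A x"
  shows "(norm (yosida A \<mu> x))\<^sup>2 \<le> inner y (yosida A \<mu> x)"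
proof -
  have "0 \<le> inner (y - yosida A \<mu> x) (x - resolvent A \<mu> x)"
    by (rule monotone[OF y yosida_in[OF \<mu>]])
  then show ?thesis
    using \<mu> by (simp add: resolvent_yosida power2_norm_eq_inner inner_diff_left zero_le_mult_iff)
qed

lemma norm_yosida_le:
  assumes \<mu>: "\<mu> > 0" and y: "y \<in> A x"
  shows "norm (yosida A \<mu> x) \<le> norm y"
proof -
  have "(norm (yosida A \<mu> x))\<^sup>2 \<le> norm y * norm (yosida A \<mu> x)"
    using yosida_le_inner[OF assms] norm_cauchy_schwarz order_trans by blast
  then show ?thesis
    by (cases "norm (yosida A \<mu> x) = 0") (auto simp: power2_eq_square)
qed

text \<open>Monotonicity between the resolvents for the two parameters bounds the inner product of
  the two values from below. Hence norms grow as the parameter shrinks, and bounded norms force a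
  Cauchy sequence.\<close>

lemma yosida_yosida:
  assumes \<mu>: "\<mu> > 0" "\<mu> \<le> \<nu>"
  shows "(norm (yosida A \<mu> x - yosida A \<nu> x))\<^sup>2 \<le> (norm (yosida A \<mu> x))\<^sup>2 - (norm (yosida A \<nu> x))\<^sup>2"
proof -
  have \<nu>: "\<nu> > 0" using assms by simp
  define a b where "a = yosida A \<mu> x" and "b = yosida A \<nu> x"
  have "0 \<le> inner (a - b) (resolvent A \<mu> x - resolvent A \<nu> x)"
    unfolding a_def b_def using \<mu> \<nu> by (intro monotone yosida_in)
  also have "resolvent A \<mu> x - resolvent A \<nu> x = \<nu> *\<^sub>R b - \<mu> *\<^sub>R a"
    using \<mu> \<nu> by (simp add: a_def b_def resolvent_yosida)
  finally have *: "\<mu> * (norm a)\<^sup>2 + \<nu> * (norm b)\<^sup>2 \<le> (\<mu> + \<nu>) * inner a b"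
    by (simp add: power2_norm_eq_inner inner_simps inner_commute algebra_simps)
  have ab: "(norm (a - b))\<^sup>2 = (norm a)\<^sup>2 + (norm b)\<^sup>2 - 2 * inner a b"
    by (simp add: power2_norm_eq_inner inner_simps inner_commute)
  have "2 * (\<mu> * (norm a)\<^sup>2 + \<nu> * (norm b)\<^sup>2) \<le> (\<mu> + \<nu>) * ((norm a)\<^sup>2 + (norm b)\<^sup>2 - (norm (a - b))\<^sup>2)"
  proof -
    have "2 * (\<mu> * (norm a)\<^sup>2 + \<nu> * (norm b)\<^sup>2) \<le> 2 * ((\<mu> + \<nu>) * inner a b)"
      using * by (rule mult_left_mono) simp
    also have "\<dots> = (\<mu> + \<nu>) * (2 * inner a b)" by simp
    also have "2 * inner a b = (norm a)\<^sup>2 + (norm b)\<^sup>2 - (norm (a - b))\<^sup>2" using ab by simp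
    finally show ?thesis .
  qed
  then have eq: "(\<mu> + \<nu>) * (norm (a - b))\<^sup>2 \<le> (\<nu> - \<mu>) * ((norm a)\<^sup>2 - (norm b)\<^sup>2)"
    by (simp add: algebra_simps)
  have "0 \<le> (\<nu> - \<mu>) * ((norm a)\<^sup>2 - (norm b)\<^sup>2)"
    by (rule order_trans[OF _ eq]) (use \<mu> \<nu> in auto)
  show ?thesis
  proof (cases "\<mu> = \<nu>")
    case True then show ?thesis by simp
  next
    case False
    then have "0 \<le> (norm a)\<^sup>2 - (norm b)\<^sup>2"
      using \<open>0 \<le> (\<nu> - \<mu>) * _\<close> \<mu> by (simp add: zero_le_mult_iff)
    then have "(\<nu> - \<mu>) * ((norm a)\<^sup>2 - (norm b)\<^sup>2) \<le> (\<mu> + \<nu>) * ((norm a)\<^sup>2 - (norm b)\<^sup>2)"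
      using \<mu> by (intro mult_right_mono) auto
    with eq have "(\<mu> + \<nu>) * (norm (a - b))\<^sup>2 \<le> (\<mu> + \<nu>) * ((norm a)\<^sup>2 - (norm b)\<^sup>2)" by linarith
    then show ?thesis
      using \<mu> \<nu> unfolding a_def[symmetric] b_def[symmetric]
      by (metis add_pos_pos mult_le_cancel_left_pos)
  qed
qed

text \<open>The limit pair is tested against the decomposition l + m = p + q with q in A p; in the
  limit, monotonicity reads - |l - p|^2 \<ge> 0.\<close>

lemma graph_closed:
  assumes "x \<longlonglongrightarrow> l" "y \<longlonglongrightarrow> m" "\<And>n. y n \<in> A (x n)"
  shows "m \<in> A l"
proof -
  define p where "p = resolvent A 1 (l + m)"
  define q where "q = yosida A 1 (l + m)"
  have q: "q \<in> A p" by (simp add: p_def q_def yosida_in)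
  have pq: "q = l + m - p" by (simp add: p_def q_def yosida_def)
  have "(\<lambda>n. inner (y n - q) (x n - p)) \<longlonglongrightarrow> inner (m - q) (l - p)"
    by (intro tendsto_intros assms)
  then have "0 \<le> inner (m - q) (l - p)"
    by (rule LIMSEQ_le_const) (use monotone[OF assms(3) q] in auto)
  also have "m - q = - (l - p)" by (simp add: pq)
  finally have "inner (l - p) (l - p) \<le> 0" by (simp only: inner_minus_left)
  then have "l - p = 0" using inner_ge_zero[of "l - p"] inner_eq_zero_iff by (metis antisym)
  then have "l = p" by simp
  then show ?thesis using q pq by simp
qed

text \<open>A bound on the Yosida values alone places x in the domain, since their squared norms
  increase and so converge; this is how the evolution is later shown to enter the domain.\<close>

lemma yosida_limit:
  assumes bound: "\<And>n. norm (yosida A (inverse (Suc n)) x) \<le> C"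
  shows "(\<lambda>n. yosida A (inverse (Suc n)) x) \<longlonglongrightarrow> minimal_section A x" "minimal_section A x \<in> A x"
proof -
  let ?y = "\<lambda>n. yosida A (inverse (Suc n)) x"
  have step: "(norm (?y m - ?y n))\<^sup>2 \<le> (norm (?y m))\<^sup>2 - (norm (?y n))\<^sup>2" if "n \<le> m" for m n
    using that by (intro yosida_yosida le_imp_inverse_le) auto
  have "incseq (\<lambda>n. (norm (?y n))\<^sup>2)"
    unfolding incseq_def
  proof (intro allI impI)
    fix m n :: nat assume "m \<le> n"
    from step[OF this] have "0 \<le> (norm (?y n))\<^sup>2 - (norm (?y m))\<^sup>2"
      by (rule order_trans[OF zero_le_power2])
    then show "(norm (?y m))\<^sup>2 \<le> (norm (?y n))\<^sup>2" by simp
  qed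
  moreover have "(norm (?y n))\<^sup>2 \<le> C\<^sup>2" for n
    using bound by (intro power_mono) auto
  ultimately obtain l where "(\<lambda>n. (norm (?y n))\<^sup>2) \<longlonglongrightarrow> l"
    using incseq_convergent[of "\<lambda>n. (norm (?y n))\<^sup>2" "C\<^sup>2"] by blast
  then have C: "Cauchy (\<lambda>n. (norm (?y n))\<^sup>2)" by (rule LIMSEQ_imp_Cauchy)
  have "Cauchy ?y"
  proof (rule CauchyI)
    fix e :: real assume e: "e > 0"
    obtain N where N: "\<And>m n. m \<ge> N \<Longrightarrow> n \<ge> N \<Longrightarrow> norm ((norm (?y m))\<^sup>2 - (norm (?y n))\<^sup>2) < e\<^sup>2"
      using CauchyD[OF C, of "e\<^sup>2"] e by auto
    have "norm (?y m - ?y n) < e" if "m \<ge> N" "n \<ge> N" for m n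
    proof -
      have "(norm (?y m - ?y n))\<^sup>2 \<le> \<bar>(norm (?y m))\<^sup>2 - (norm (?y n))\<^sup>2\<bar>"
        using step[of n m] step[of m n] by (cases "n \<le> m") (auto simp: norm_minus_commute)
      also have "\<dots> < e\<^sup>2" using N[OF that] by simp
      finally show ?thesis by (rule power2_less_imp_less) (use e in auto)
    qed
    then show "\<exists>M. \<forall>m\<ge>M. \<forall>n\<ge>M. norm (?y m - ?y n) < e" by blast
  qed
  then show lim: "?y \<longlonglongrightarrow> minimal_section A x"
    unfolding minimal_section_def by (simp add: Cauchy_convergent_iff convergent_LIMSEQ_iff)
  have "(\<lambda>n. x - inverse (Suc n) *\<^sub>R ?y n) \<longlonglongrightarrow> x - 0 *\<^sub>R minimal_section A x"
    by (intro tendsto_intros lim LIMSEQ_inverse_real_of_nat)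
  then have "(\<lambda>n. x - inverse (Suc n) *\<^sub>R ?y n) \<longlonglongrightarrow> x" by simp
  then show "minimal_section A x \<in> A x"
    by (rule graph_closed[OF _ lim]) (use yosida_in[of "inverse (Suc _)" x] resolvent_yosida[of "inverse (Suc _)" x] in simp)
qed

lemma minimal_section:
  assumes "y \<in> A x"
  shows "minimal_section A x \<in> A x" "norm (minimal_section A x) \<le> norm y"
    "(\<lambda>n. yosida A (inverse (Suc n)) x) \<longlonglongrightarrow> minimal_section A x"
proof -
  have b: "norm (yosida A (inverse (Suc n)) x) \<le> norm y" for n
    using assms by (intro norm_yosida_le) auto
  show "minimal_section A x \<in> A x" "(\<lambda>n. yosida A (inverse (Suc n)) x) \<longlonglongrightarrow> minimal_section A x"
    using yosida_limit[OF b] by auto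
  then show "norm (minimal_section A x) \<le> norm y"
    using b by (intro tendsto_upperbound[OF tendsto_norm]) auto
qed

lemma maximal_monotone_shift: "maximal_monotone (shift_op A b)"
proof
  fix y x y' x' assume "y \<in> shift_op A b x" "y' \<in> shift_op A b x'"
  then show "0 \<le> inner (y - y') (x - x')"
    using monotone by (auto simp: shift_op_def)
next
  fix \<mu> :: real and z assume "\<mu> > 0"
  then obtain x y where "y \<in> A x" "z + \<mu> *\<^sub>R b = x + \<mu> *\<^sub>R y" using range by blast
  then show "\<exists>x. \<exists>y\<in>shift_op A b x. z = x + \<mu> *\<^sub>R y"
    by (intro exI[of _ x] bexI[of _ "y - b"]) (auto simp: shift_op_def algebra_simps)
qed

end

section \<open>Yosida flows: bounds independent of the regularisation, and their limit\<close>

section \<open>The evolution generated by a subdifferential with a Lipschitz perturbation\<close>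

definition yosida_field :: "('a::real_vector \<Rightarrow> 'a set) \<Rightarrow> ('a \<Rightarrow> 'a) \<Rightarrow> nat \<Rightarrow> 'a \<Rightarrow> 'a" where
  "yosida_field A B n x = B x - yosida A (inverse (Suc n)) x"

definition yosida_flow :: "('a::real_normed_vector \<Rightarrow> 'a set) \<Rightarrow> ('a \<Rightarrow> 'a) \<Rightarrow> nat \<Rightarrow> 'a \<Rightarrow> real \<Rightarrow> 'a" where
  "yosida_flow A B n w = (SOME u. is_flow (yosida_field A B n) w u)"

definition evol :: "('a::real_normed_vector \<Rightarrow> 'a set) \<Rightarrow> ('a \<Rightarrow> 'a) \<Rightarrow> real \<Rightarrow> 'a \<Rightarrow> 'a" where
  "evol A B t w = lim (\<lambda>n. yosida_flow A B n w t)"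

text \<open>Here c bounds |y| + |B w| for some y in A w. Up to time T, speeds are at most exp(L T) c
  and displacements at most T exp(L T) c; a Yosida value is B minus the velocity.\<close>

definition yosida_bound :: "real \<Rightarrow> real \<Rightarrow> real \<Rightarrow> real" where
  "yosida_bound L T c = c + (L * T + 1) * (exp (L * T) * c)"

text \<open>Square root of the Gronwall bound with source 4 \<mu> C^2, where C is
  \<open>yosida_bound\<close>. The operator enters only through c, which allows one rate for a whole
  family of operators.\<close>

definition yosida_rate :: "real \<Rightarrow> real \<Rightarrow> real \<Rightarrow> nat \<Rightarrow> real" where
  "yosida_rate L T c n = exp (L * T) * (yosida_bound L T c * sqrt (4 * T * inverse (Suc n)))"

lemma yosida_rate_tendsto: "(\<lambda>n. yosida_rate L T c n) \<longlonglongrightarrow> 0"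
proof -
  have "(\<lambda>n. exp (L * T) * (yosida_bound L T c * sqrt (4 * T * inverse (real (Suc n)))))
      \<longlonglongrightarrow> exp (L * T) * (yosida_bound L T c * sqrt (4 * T * 0))"
    by (intro tendsto_intros LIMSEQ_inverse_real_of_nat)
  then show ?thesis by (simp add: yosida_rate_def)
qed

lemma deriv_bound_imp_lipschitz:
  fixes u :: "real \<Rightarrow> 'a::real_normed_vector"
  assumes "s \<le> t" "continuous_on {s..t} u"
    and "\<And>r. s < r \<Longrightarrow> r < t \<Longrightarrow> (u has_vector_derivative u' r) (at r)"
    and "\<And>r. s < r \<Longrightarrow> r < t \<Longrightarrow> norm (u' r) \<le> D"
  shows "norm (u t - u s) \<le> D * (t - s)"
proof (cases "s = t")
  case False
  then have "norm (u t - u s) \<le> D * t - D * s"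
    using assms
    by (intro differentiable_bound_general[of s t u "\<lambda>t. D * t" u' "\<lambda>_. D"])
       (auto intro!: continuous_intros derivative_eq_intros simp flip: has_real_derivative_iff_has_vector_derivative)
  then show ?thesis by (simp add: algebra_simps)
qed simp

text \<open>The potential is a real function whose values matter on the domain of A only; it is
  normalised to be nonnegative there so that its Moreau envelopes are nonnegative.\<close>

locale evolution = maximal_monotone A
  for A :: "'a::{real_inner,banach} \<Rightarrow> 'a set" +
  fixes \<phi> :: "'a \<Rightarrow> real" and B :: "'a \<Rightarrow> 'a" and L :: real
  assumes subgradient: "y \<in> A x \<Longrightarrow> y' \<in> A x' \<Longrightarrow> \<phi> x + inner y (x' - x) \<le> \<phi> x'"
    and nonneg: "y \<in> A x \<Longrightarrow> 0 \<le> \<phi> x"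
    and lip: "norm (B x - B y) \<le> L * norm (x - y)"
    and L: "L > 0"
begin

abbreviation "mu n \<equiv> inverse (real (Suc n))"
abbreviation "V \<equiv> yosida_field A B"
abbreviation "U \<equiv> yosida_flow A B"
abbreviation "a n \<equiv> yosida A (mu n)"
abbreviation "D \<equiv> {x. A x \<noteq> {}}"

lemma continuous_on_B: "continuous_on S B"
  by (rule lipschitz_on_continuous_on[of L]) (use lip L in \<open>auto intro!: lipschitz_onI simp: dist_norm\<close>)

lemma continuous_on_yosida: "\<mu> > 0 \<Longrightarrow> continuous_on S (yosida A \<mu>)"
  by (rule lipschitz_on_continuous_on[of "inverse \<mu>"])
     (use yosida_lipschitz[of \<mu>] in \<open>auto intro!: lipschitz_onI simp: dist_norm divide_inverse_commute\<close>)

lemma continuous_on_V: "continuous_on S (V n)"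
  unfolding yosida_field_def[abs_def] by (intro continuous_intros continuous_on_B continuous_on_yosida) simp

lemma V_lipschitz: "norm (V n x - V n y) \<le> (L + Suc n) * norm (x - y)"
proof -
  have "V n x - V n y = (B x - B y) - (a n x - a n y)"
    by (simp add: yosida_field_def)
  then have "norm (V n x - V n y) \<le> norm (B x - B y) + norm (a n x - a n y)"
    by (simp only: norm_triangle_ineq4)
  also have "\<dots> \<le> L * norm (x - y) + Suc n * norm (x - y)"
    using lip yosida_lipschitz[of "mu n" x y] by (intro add_mono) (auto simp: field_simps)
  finally show ?thesis by (simp add: algebra_simps)
qed

lemma B_osl: "inner (B x - B y) (x - y) \<le> L * (norm (x - y))\<^sup>2"
proof -
  have "inner (B x - B y) (x - y) \<le> norm (B x - B y) * norm (x - y)" by (rule norm_cauchy_schwarz)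
  also have "\<dots> \<le> (L * norm (x - y)) * norm (x - y)" by (intro mult_right_mono lip) simp
  finally show ?thesis by (simp add: power2_eq_square)
qed

text \<open>The Yosida term is monotone and drops out, so the constant does not depend on n.
  \<open>V_lipschitz\<close>, which does, serves only for the existence of the flows.\<close>

lemma V_osl: "inner (V n x - V n y) (x - y) \<le> L * (norm (x - y))\<^sup>2"
proof -
  have "0 \<le> mu n * (norm (a n x - a n y))\<^sup>2" by simp
  also have "\<dots> \<le> inner (a n x - a n y) (x - y)" by (rule yosida_monotone) simp
  finally show ?thesis
    using B_osl[of x y] by (simp add: yosida_field_def inner_diff_left)
qed

lemma flow: "is_flow (V n) w (U n w)"
proof -
  have "\<exists>u. is_flow (V n) w u"
    by (rule is_flow_exists[of _ "L + Suc n"]) (use V_lipschitz L in auto)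
  then show ?thesis unfolding yosida_flow_def by (rule someI_ex)
qed

lemma U0 [simp]: "U n w 0 = w"
  using flow[of n w] by (simp add: is_flow_def)

lemma continuous_on_U: "S \<subseteq> {0..} \<Longrightarrow> continuous_on S (U n w)"
  using flow[of n w] continuous_on_subset by (auto simp: is_flow_def)

lemma U_deriv: "t > 0 \<Longrightarrow> (U n w has_vector_derivative V n (U n w t)) (at t)"
  using flow[of n w] by (simp add: is_flow_def)

lemma U_dist: "0 \<le> s \<Longrightarrow> s \<le> t \<Longrightarrow> norm (U n w t - U n w' t) \<le> exp (L * (t - s)) * norm (U n w s - U n w' s)"
  using L by (intro is_flow_dist[OF V_osl _ flow flow]) auto

lemma U_dist_shift:
  "0 \<le> s \<Longrightarrow> s \<le> t \<Longrightarrow> 0 \<le> h \<Longrightarrow> norm (U n w (t + h) - U n w t) \<le> exp (L * (t - s)) * norm (U n w (s + h) - U n w s)"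
  using is_flow_dist[OF V_osl[of n] _ is_flow_shift[OF flow[of n w], of h] flow[of n w], of s t] L by auto

lemma V_speed: "0 \<le> s \<Longrightarrow> s \<le> t \<Longrightarrow> norm (V n (U n w t)) \<le> exp (L * (t - s)) * norm (V n (U n w s))"
  using L by (intro is_flow_speed[OF V_osl _ continuous_on_V flow]) auto

lemma U_lipschitz:
  assumes "0 \<le> s" "s \<le> t" "\<And>r. s < r \<Longrightarrow> r < t \<Longrightarrow> norm (V n (U n w r)) \<le> M"
  shows "norm (U n w t - U n w s) \<le> M * (t - s)"
  using assms by (intro deriv_bound_imp_lipschitz[where u' = "\<lambda>r. V n (U n w r)"] continuous_on_U U_deriv) auto

lemma yosida_eq: "a n x = B x - V n x"
  by (simp add: yosida_field_def)

lemma V_initial: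
  assumes "y \<in> A w" shows "norm (V n w) \<le> norm y + norm (B w)"
proof -
  have "norm (V n w) \<le> norm (B w) + norm (a n w)"
    unfolding yosida_field_def by (rule norm_triangle_ineq4)
  then show ?thesis using norm_yosida_le[OF _ assms, of "mu n"] by simp
qed

lemma V_bound:
  assumes y: "y \<in> A w" and c: "norm y + norm (B w) \<le> c" and t: "0 \<le> t" "t \<le> T"
  shows "norm (V n (U n w t)) \<le> exp (L * T) * c"
proof -
  have "norm (V n (U n w t)) \<le> exp (L * (t - 0)) * norm (V n (U n w 0))"
    using t by (intro V_speed) auto
  also have "\<dots> \<le> exp (L * T) * c"
    using V_initial[OF y, of n] c t L by (intro mult_mono) auto
  finally show ?thesis .
qed

lemma U_minus_initial:
  assumes y: "y \<in> A w" and c: "norm y + norm (B w) \<le> c" and t: "0 \<le> t" "t \<le> T"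
  shows "norm (U n w t - w) \<le> T * (exp (L * T) * c)"
proof -
  have c0: "c \<ge> 0" using c by (rule order_trans[rotated]) simp
  have "norm (U n w t - U n w 0) \<le> exp (L * T) * c * (t - 0)"
    using t by (intro U_lipschitz V_bound[OF y c]) auto
  also have "\<dots> \<le> exp (L * T) * c * T"
    using t c0 by (intro mult_left_mono) auto
  finally show ?thesis by (simp add: mult_ac)
qed

lemma a_bound:
  assumes y: "y \<in> A w" and c: "norm y + norm (B w) \<le> c" and t: "0 \<le> t" "t \<le> T"
  shows "norm (a n (U n w t)) \<le> yosida_bound L T c"
proof -
  have "norm (a n (U n w t)) \<le> norm (B (U n w t)) + norm (V n (U n w t))"
    unfolding yosida_eq by (rule norm_triangle_ineq4)
  also have "norm (B (U n w t)) \<le> norm (B w) + norm (B (U n w t) - B w)"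
    by (rule norm_triangle_sub)
  also have "norm (B (U n w t) - B w) \<le> L * (T * (exp (L * T) * c))"
    using U_minus_initial[OF assms, of n] L by (intro order_trans[OF lip] mult_left_mono) auto
  also have "norm (V n (U n w t)) \<le> exp (L * T) * c" by (rule V_bound[OF assms])
  also have "norm (B w) \<le> c" using c by (rule order_trans[rotated]) simp
  finally show ?thesis by (simp add: yosida_bound_def algebra_simps)
qed

text \<open>A is monotone at the resolvents, and a point differs from its resolvent by the parameter
  times the Yosida value; for bounded Yosida values the defect is of first order in the
  parameters.\<close>

lemma yosida_cross_monotone:
  assumes "norm (a n x) \<le> C" "norm (a m y) \<le> C"
  shows "- ((mu n + mu m) * C\<^sup>2) \<le> inner (a n x - a m y) (x - y)"
proof -
  have C: "C \<ge> 0" using assms(1) by (rule order_trans[rotated]) simp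
  have "0 \<le> inner (a n x - a m y) (resolvent A (mu n) x - resolvent A (mu m) y)"
    by (intro monotone yosida_in) auto
  also have "\<dots> = inner (a n x - a m y) (x - y) - inner (a n x - a m y) (mu n *\<^sub>R a n x - mu m *\<^sub>R a m y)"
    by (simp add: resolvent_yosida inner_diff_right)
  finally have 1: "inner (a n x - a m y) (mu n *\<^sub>R a n x - mu m *\<^sub>R a m y) \<le> inner (a n x - a m y) (x - y)" by simp
  have "inner (a n x - a m y) (mu n *\<^sub>R a n x - mu m *\<^sub>R a m y)
      = mu n * (norm (a n x))\<^sup>2 + mu m * (norm (a m y))\<^sup>2 - (mu n + mu m) * inner (a n x) (a m y)"
    unfolding power2_norm_eq_inner
    by (simp add: inner_diff_left inner_diff_right inner_commute algebra_simps del: of_nat_Suc)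
  moreover have "(mu n + mu m) * inner (a n x) (a m y) \<le> (mu n + mu m) * C\<^sup>2"
  proof (rule mult_left_mono)
    have "inner (a n x) (a m y) \<le> norm (a n x) * norm (a m y)" by (rule norm_cauchy_schwarz)
    also have "\<dots> \<le> C * C" using assms C by (intro mult_mono) auto
    finally show "inner (a n x) (a m y) \<le> C\<^sup>2" by (simp add: power2_eq_square)
  qed simp
  moreover have "0 \<le> mu n * (norm (a n x))\<^sup>2" "0 \<le> mu m * (norm (a m y))\<^sup>2" by simp_all
  ultimately show ?thesis using 1 by linarith
qed

text \<open>For m \<ge> n both parameters are at most \<open>mu n\<close>, so Gronwall's inequality
  for the squared distance has source 4 \<open>mu n\<close> C^2 and the rate depends on n
  alone.\<close>

lemma U_cauchy:
  assumes y: "y \<in> A w" and c: "norm y + norm (B w) \<le> c" and t: "0 \<le> t" "t \<le> T" and nm: "n \<le> m"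
  shows "norm (U n w t - U m w t) \<le> yosida_rate L T c n"
proof -
  define C where "C = yosida_bound L T c"
  have C: "C \<ge> 0" using a_bound[OF assms(1-4), of 0] unfolding C_def by (rule order_trans[rotated]) simp
  have T: "T \<ge> 0" using t by simp
  let ?g = "\<lambda>t. (norm (U n w t - U m w t))\<^sup>2"
  have mu: "mu m \<le> mu n" using nm by (intro le_imp_inverse_le) auto
  have "?g t \<le> exp (2 * L * (t - 0)) * (?g 0 + 4 * mu n * C\<^sup>2 * (t - 0))"
  proof (rule gronwall_deriv)
    show "continuous_on {0..t} ?g" by (intro continuous_intros continuous_on_U) auto
    fix r assume r: "0 < r" "r < t"
    have "- ((mu n + mu m) * C\<^sup>2) \<le> inner (a n (U n w r) - a m (U m w r)) (U n w r - U m w r)"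
      using r t unfolding C_def by (intro yosida_cross_monotone a_bound[OF y c]) auto
    moreover have "(mu n + mu m) * C\<^sup>2 \<le> (2 * mu n) * C\<^sup>2"
      using mu by (intro mult_right_mono) auto
    moreover have "inner (V n (U n w r) - V m (U m w r)) (U n w r - U m w r)
       = inner (B (U n w r) - B (U m w r)) (U n w r - U m w r) - inner (a n (U n w r) - a m (U m w r)) (U n w r - U m w r)"
      by (simp add: yosida_field_def inner_diff_left)
    ultimately have "2 * inner (V n (U n w r) - V m (U m w r)) (U n w r - U m w r) \<le> 2 * L * ?g r + 4 * mu n * C\<^sup>2"
      using B_osl[of "U n w r" "U m w r"] by (simp del: of_nat_Suc)
    then show "\<exists>g'. (?g has_real_derivative g') (at r) \<and> g' \<le> 2 * L * ?g r + 4 * mu n * C\<^sup>2"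
      using has_derivative_norm_square_diff[OF U_deriv U_deriv, OF r(1) r(1)] by blast
  qed (use t L in auto)
  also have "\<dots> = exp (2 * L * t) * (4 * mu n * C\<^sup>2 * t)" by simp
  also have "\<dots> \<le> exp (2 * L * T) * (4 * mu n * C\<^sup>2 * T)"
    using t L by (intro mult_mono) auto
  also have "\<dots> = (exp (L * T))\<^sup>2 * (C\<^sup>2 * (4 * T * mu n))"
    by (simp add: power2_eq_square algebra_simps flip: exp_add)
  also have "\<dots> = (exp (L * T) * (C * sqrt (4 * T * mu n)))\<^sup>2"
    using T by (simp add: power_mult_distrib)
  finally show ?thesis
    unfolding yosida_rate_def C_def[symmetric] by (rule power2_le_imp_le) (use C T in simp)
qed

lemma dist_mono_time: "0 \<le> t \<Longrightarrow> t \<le> T \<Longrightarrow> norm (U n w t - U n w' t) \<le> exp (L * T) * norm (w - w')"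
proof -
  assume t: "0 \<le> t" "t \<le> T"
  have "norm (U n w t - U n w' t) \<le> exp (L * (t - 0)) * norm (U n w 0 - U n w' 0)"
    using t by (intro U_dist) auto
  also have "\<dots> \<le> exp (L * T) * norm (w - w')"
    using t L by (intro mult_mono) auto
  finally show ?thesis .
qed

text \<open>The rate is available only from points of the domain. A point of the closure is
  approximated by such a point, since all flows depend on the initial point with the same constant
  exp(L T).\<close>

lemma evol_uniform_limit:
  assumes w: "w \<in> closure D"
  shows "uniform_limit {0..T} (\<lambda>n. U n w) (\<lambda>t. evol A B t w) sequentially"
proof -
  have "uniformly_Cauchy_on {0..T} (\<lambda>n. U n w)"
  proof (rule uniformly_Cauchy_onI')
    fix e :: real assume e: "e > 0"
    obtain w' where w': "w' \<in> D" "dist w' w < e / 4 / exp (L * T)"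
      using w e unfolding closure_approachable by (meson divide_pos_pos exp_gt_zero zero_less_numeral)
    then obtain y where y: "y \<in> A w'" by blast
    obtain N where N: "\<And>n. n \<ge> N \<Longrightarrow> yosida_rate L T (norm y + norm (B w')) n < e / 2"
      using order_tendstoD(2)[OF yosida_rate_tendsto, of "e/2"] e unfolding eventually_sequentially by force
    have "dist (U m w t) (U n w t) < e" if t: "t \<in> {0..T}" and mn: "m \<ge> N" "n > m" for t m n
    proof -
      have "dist (U m w t) (U n w t) \<le> dist (U m w t) (U m w' t) + dist (U m w' t) (U n w' t) + dist (U n w' t) (U n w t)"
        by (intro order_trans[OF dist_triangle add_right_mono[OF dist_triangle]])
      also have "\<dots> \<le> exp (L * T) * norm (w - w') + yosida_rate L T (norm y + norm (B w')) m + exp (L * T) * norm (w' - w)"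
        unfolding dist_norm using t mn y by (intro add_mono dist_mono_time U_cauchy) auto
      also have "\<dots> < e / 4 + e / 2 + e / 4"
        using w'(2) N[of m] mn by (intro add_strict_mono) (auto simp: dist_norm norm_minus_commute field_simps)
      finally show ?thesis by simp
    qed
    then show "\<exists>M. \<forall>x\<in>{0..T}. \<forall>m\<ge>M. \<forall>n>m. dist (U m w x) (U n w x) < e" by blast
  qed
  then show ?thesis
    unfolding evol_def uniformly_convergent_uniform_limit_iff[symmetric] by (rule Cauchy_uniformly_convergent)
qed

lemma evol_tendsto:
  assumes w: "w \<in> closure D" and t: "t \<ge> 0"
  shows "(\<lambda>n. U n w t) \<longlonglongrightarrow> evol A B t w"
  using tendsto_uniform_limitI[OF evol_uniform_limit[OF w, of t]] t by simp

lemma evol_0: "w \<in> closure D \<Longrightarrow> evol A B 0 w = w"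
  using LIMSEQ_unique[OF evol_tendsto[of w 0]] by simp

lemma evol_continuous:
  assumes w: "w \<in> closure D"
  shows "continuous_on {0..} (\<lambda>t. evol A B t w)"
  unfolding continuous_on_eq_continuous_within
proof
  fix t :: real assume t: "t \<in> {0..}"
  have "continuous_on {0..t+1} (\<lambda>t. evol A B t w)"
    by (rule uniform_limit_theorem[OF _ evol_uniform_limit[OF w]]) (auto intro!: always_eventually continuous_on_U)
  then have "continuous (at t within {0..t+1}) (\<lambda>t. evol A B t w)"
    using t by (simp add: continuous_on_eq_continuous_within)
  moreover have "at t within {0..} = at t within {0..t+1}"
    by (rule at_within_nhd[of _ "{..<t+1}"]) auto
  ultimately show "continuous (at t within {0..}) (\<lambda>t. evol A B t w)" by simp
qed

lemma evol_dist:
  assumes "w \<in> closure D" "w' \<in> closure D" "0 \<le> t" "t \<le> T"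
  shows "norm (evol A B t w - evol A B t w') \<le> exp (L * T) * norm (w - w')"
  using assms by (intro tendsto_upperbound[OF tendsto_norm[OF tendsto_diff[OF evol_tendsto evol_tendsto]]])
    (auto intro!: always_eventually dist_mono_time)

text \<open>The limit m \<rightarrow> \<infinity> in \<open>U_cauchy\<close>. Through this rate the
  Yosida index can be chosen once for all viscosities.\<close>

lemma evol_rate:
  assumes y: "y \<in> A w" and c: "norm y + norm (B w) \<le> c" and t: "0 \<le> t" "t \<le> T"
  shows "norm (U n w t - evol A B t w) \<le> yosida_rate L T c n"
proof (rule tendsto_upperbound)
  have "w \<in> closure D" by (rule subsetD[OF closure_subset]) (use y in blast)
  then show "(\<lambda>m. norm (U n w t - U m w t)) \<longlonglongrightarrow> norm (U n w t - evol A B t w)"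
    using t by (intro tendsto_intros evol_tendsto) auto
  show "\<forall>\<^sub>F m in sequentially. norm (U n w t - U m w t) \<le> yosida_rate L T c n"
    using eventually_ge_at_top[of n] by eventually_elim (rule U_cauchy[OF assms])
qed simp

lemma evol_dist_shift:
  assumes w: "w \<in> closure D" and "0 \<le> s" "s \<le> t" "0 \<le> h"
  shows "norm (evol A B (t + h) w - evol A B t w) \<le> exp (L * (t - s)) * norm (evol A B (s + h) w - evol A B s w)"
proof (rule tendsto_le)
  show "(\<lambda>n. norm (U n w (t + h) - U n w t)) \<longlonglongrightarrow> norm (evol A B (t + h) w - evol A B t w)"
    "(\<lambda>n. exp (L * (t - s)) * norm (U n w (s + h) - U n w s)) \<longlonglongrightarrow> exp (L * (t - s)) * norm (evol A B (s + h) w - evol A B s w)"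
    using assms by (intro tendsto_intros evol_tendsto; simp)+
  show "\<forall>\<^sub>F n in sequentially. norm (U n w (t + h) - U n w t) \<le> exp (L * (t - s)) * norm (U n w (s + h) - U n w s)"
    using assms by (intro always_eventually allI U_dist_shift)
qed simp

section \<open>Moreau envelopes and the smoothing effect of a subdifferential\<close>

subsection \<open>Regularisation\<close>

text \<open>The Moreau envelope, the infimum over y of \<phi> y + |x - y|^2 / (2 \<mu>), written at
  its minimiser, the resolvent: x minus the resolvent is \<mu> times the Yosida value.\<close>

definition moreau :: "nat \<Rightarrow> 'a \<Rightarrow> real" where
  "moreau n x = \<phi> (resolvent A (mu n) x) + mu n / 2 * (norm (a n x))\<^sup>2"

lemma moreau_nonneg: "0 \<le> moreau n x"
  unfolding moreau_def using nonneg[OF yosida_in[of "mu n" x]] by simp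

text \<open>The subgradient inequality of \<phi> between the two resolvents, completed by the square
  of the difference of the Yosida values.\<close>

lemma moreau_subgradient: "moreau n x + inner (a n x) (z - x) \<le> moreau n z"
proof -
  have "\<phi> (resolvent A (mu n) x) + inner (a n x) (resolvent A (mu n) z - resolvent A (mu n) x) \<le> \<phi> (resolvent A (mu n) z)"
    by (rule subgradient[OF yosida_in yosida_in]) auto
  moreover have "inner (a n x) (resolvent A (mu n) z - resolvent A (mu n) x)
      = inner (a n x) (z - x) - mu n * inner (a n x) (a n z) + mu n * (norm (a n x))\<^sup>2"
    unfolding power2_norm_eq_inner
    by (simp add: resolvent_yosida inner_diff_right algebra_simps del: of_nat_Suc)
  moreover have "0 \<le> mu n / 2 * (norm (a n z - a n x))\<^sup>2" by simp
  then have "0 \<le> mu n / 2 * (norm (a n z))\<^sup>2 + mu n / 2 * (norm (a n x))\<^sup>2 - mu n * inner (a n x) (a n z)"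
    unfolding power2_norm_eq_inner
    by (simp add: inner_diff_right inner_diff_left inner_commute algebra_simps del: of_nat_Suc)
  ultimately show ?thesis unfolding moreau_def by linarith
qed

lemma moreau_le:
  assumes "y \<in> A v"
  shows "moreau n x - \<phi> v \<le> inner (a n x) (x - v)"
proof -
  have "\<phi> (resolvent A (mu n) x) + inner (a n x) (v - resolvent A (mu n) x) \<le> \<phi> v"
    by (rule subgradient[OF yosida_in assms]) auto
  moreover have "inner (a n x) (v - resolvent A (mu n) x) = mu n * (norm (a n x))\<^sup>2 - inner (a n x) (x - v)"
    unfolding power2_norm_eq_inner
    by (simp add: resolvent_yosida inner_diff_right algebra_simps del: of_nat_Suc)
  moreover have "0 \<le> mu n / 2 * (norm (a n x))\<^sup>2" by simp
  ultimately show ?thesis unfolding moreau_def by linarith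
qed

text \<open>The subgradient inequalities at x and at y trap the remainder below <a(y) - a(x), y -
  x>, which the Lipschitz bound on the gradient makes quadratic in |y - x|.\<close>

lemma moreau_has_derivative: "(moreau n has_derivative inner (a n x)) (at x)"
  unfolding has_derivative_at_alt
proof (intro conjI allI impI)
  show "bounded_linear (inner (a n x))" by (rule bounded_linear_inner_right)
  fix e :: real assume e: "e > 0"
  have "norm (moreau n y - moreau n x - inner (a n x) (y - x)) \<le> e * norm (y - x)" if "norm (y - x) < e * mu n" for y
  proof -
    have "inner (a n y) (x - y) = - inner (a n y) (y - x)" by (simp add: inner_diff_right)
    then have "\<bar>moreau n y - moreau n x - inner (a n x) (y - x)\<bar> \<le> inner (a n y - a n x) (y - x)"
      using moreau_subgradient[of n x y] moreau_subgradient[of n y x] by (simp add: inner_diff_left)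
    also have "\<dots> \<le> norm (a n y - a n x) * norm (y - x)" by (rule norm_cauchy_schwarz)
    also have "\<dots> \<le> e * norm (y - x)"
    proof (rule mult_right_mono)
      have "norm (a n y - a n x) \<le> norm (y - x) / mu n" by (rule yosida_lipschitz) simp
      also have "\<dots> \<le> e" using that by (simp add: field_simps)
      finally show "norm (a n y - a n x) \<le> e" .
    qed simp
    finally show ?thesis by simp
  qed
  then show "\<exists>d>0. \<forall>y. norm (y - x) < d \<longrightarrow> norm (moreau n y - moreau n x - inner (a n x) (y - x)) \<le> e * norm (y - x)"
    using e by (intro exI[of _ "e * mu n"]) auto
qed

lemma continuous_on_moreau: "continuous_on UNIV (moreau n)"
  by (rule has_derivative_continuous_on) (rule has_derivative_at_withinI[OF moreau_has_derivative])

lemma weighted_energy_deriv: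
  assumes "(f has_real_derivative f') (at r)" "(g has_real_derivative g') (at r)"
  shows "((\<lambda>r. f r / 2 + r * g r - k * r + r\<^sup>2 * p\<^sup>2 / 4) has_real_derivative
    f' / 2 + (g r + r * g') - k + r * p\<^sup>2 / 2) (at r)"
  by (auto intro!: derivative_eq_intros assms)

lemma moreau_flow_deriv:
  assumes "t > 0"
  shows "((\<lambda>t. moreau n (U n w t)) has_real_derivative inner (a n (U n w t)) (V n (U n w t))) (at t)"
  using has_derivative_compose[OF U_deriv[OF assms, unfolded has_vector_derivative_def] moreau_has_derivative]
  unfolding has_field_derivative_def
  by (rule has_derivative_eq_rhs) (auto simp: mult.commute)

text \<open>A flow started in the domain moves a bounded distance, uniformly in n, and any other
  flow stays near it by dependence on the initial point.\<close>

lemma U_bounded: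
  "\<exists>R\<ge>0. \<forall>n t. 0 \<le> t \<longrightarrow> t \<le> T \<longrightarrow> norm (U n w t) \<le> R \<and> norm (B (U n w t)) \<le> R"
proof -
  obtain v y where y: "y \<in> A v" using range[OF zero_less_one, of 0] by blast
  define c where "c = norm y + norm (B v)"
  define R1 where "R1 = norm v + T * (exp (L * T) * c) + exp (L * T) * norm (w - v)"
  have R1: "norm (U n w t) \<le> R1" if "0 \<le> t" "t \<le> T" for n t
  proof -
    have "norm (U n w t) \<le> norm v + norm (U n v t - v) + norm (U n w t - U n v t)"
      using norm_triangle_sub[of "U n w t" "U n v t"] norm_triangle_sub[of "U n v t" v] by linarith
    also have "norm (U n v t - v) \<le> T * (exp (L * T) * c)"
      using that by (intro U_minus_initial[OF y]) (auto simp: c_def)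
    also have "norm (U n w t - U n v t) \<le> exp (L * T) * norm (w - v)"
      using that by (rule dist_mono_time)
    finally show ?thesis by (simp add: R1_def)
  qed
  have "norm (B (U n w t)) \<le> norm (B 0) + L * R1" if "0 \<le> t" "t \<le> T" for n t
  proof -
    have "norm (B (U n w t)) \<le> norm (B 0) + norm (B (U n w t) - B 0)"
      by (rule norm_triangle_sub)
    also have "norm (B (U n w t) - B 0) \<le> L * norm (U n w t - 0)" by (rule lip)
    also have "\<dots> \<le> L * R1" using R1[OF that] L by simp
    finally show ?thesis by simp
  qed
  with R1 show ?thesis
    by (intro exI[of _ "max 0 (max R1 (norm (B 0) + L * R1))"]) (auto simp: le_max_iff_disj)
qed

text \<open>The decay of |u - v|^2 / 2 produces minus the envelope, which cancels the envelope
  arising when t times the envelope is differentiated; what remains is - t |u'|^2 / 2 plus bounded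
  terms. Since speeds grow at most by the factor exp(L T), the final speed is controlled by the
  earlier ones, which gives C / t with C independent of n.\<close>

lemma V_regularised:
  obtains C where "C \<ge> 0" "\<And>n t. 0 < t \<Longrightarrow> t \<le> T \<Longrightarrow> norm (V n (U n w t)) \<le> C / t"
proof (cases "T \<ge> 0")
  case False then show ?thesis by (intro that[of 0]) auto
next
  case T: True
  obtain R where R: "R \<ge> 0" "\<And>n t. 0 \<le> t \<Longrightarrow> t \<le> T \<Longrightarrow> norm (U n w t) \<le> R"
    "\<And>n t. 0 \<le> t \<Longrightarrow> t \<le> T \<Longrightarrow> norm (B (U n w t)) \<le> R" using U_bounded[of T w] by metis
  obtain v y where y: "y \<in> A v" using range[OF zero_less_one, of 0] by blast
  \<comment> \<open>K collects what survives the cancellation: the pairing of B with u - v, the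
    value of \<phi> at v, and half of T times the bound on |B|^2.\<close>
  define K where "K = R * (R + norm v) + \<phi> v + T * R\<^sup>2 / 2"
  have K: "K \<ge> 0" unfolding K_def using R T nonneg[OF y] by auto
  define C where "C = 2 * exp (L * T) * sqrt ((norm (w - v))\<^sup>2 / 2 + K * T)"
  have "norm (V n (U n w t)) \<le> C / t" if t: "0 < t" "t \<le> T" for n t
  proof -
    define u where "u = U n w"
    \<comment> \<open>A lower bound for all speeds on [0, t], constant in time: with it the
      dissipation r |u'|^2 / 2 pays for the derivative of r^2 p^2 / 4.\<close>
    define p where "p = exp (- L * T) * norm (V n (u t))"
    let ?\<psi> = "\<lambda>r. (norm (u r - v))\<^sup>2 / 2 + r * moreau n (u r) - K * r + r\<^sup>2 * p\<^sup>2 / 4"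
    have "?\<psi> t \<le> ?\<psi> 0"
    proof (rule DERIV_nonpos_imp_decreasing_open[where a = 0 and b = t and f = ?\<psi>])
      show "continuous_on {0..t} ?\<psi>"
        unfolding u_def
        by (intro continuous_intros continuous_on_compose2[OF continuous_on_moreau] continuous_on_U) auto
      fix r assume r: "0 < r" "r < t"
      let ?u' = "V n (u r)"
      have du: "(u has_vector_derivative ?u') (at r)" unfolding u_def by (rule U_deriv[OF r(1)])
      have "((\<lambda>r. (norm (u r - v))\<^sup>2) has_real_derivative 2 * inner (?u' - 0) (u r - v)) (at r)"
        by (rule has_derivative_norm_square_diff[OF du]) simp
      moreover have "((\<lambda>r. moreau n (u r)) has_real_derivative inner (a n (u r)) ?u') (at r)"
        unfolding u_def by (rule moreau_flow_deriv[OF r(1)])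
      ultimately have der: "(?\<psi> has_real_derivative 2 * inner (?u' - 0) (u r - v) / 2 + (moreau n (u r) + r * inner (a n (u r)) ?u') - K + r * p\<^sup>2 / 2) (at r)"
        by (rule weighted_energy_deriv)
      have nB: "norm (B (u r)) \<le> R" and nu: "norm (u r - v) \<le> R + norm v"
        using R(2,3)[of r n] r t unfolding u_def by (auto intro: order_trans[OF norm_triangle_ineq4])
      have 1: "inner ?u' (u r - v) \<le> R * (R + norm v) + \<phi> v - moreau n (u r)"
      proof -
        have "inner ?u' (u r - v) = inner (B (u r)) (u r - v) - inner (a n (u r)) (u r - v)"
          by (simp add: yosida_field_def inner_diff_left)
        also have "inner (B (u r)) (u r - v) \<le> R * (R + norm v)"
          using nB nu R(1) by (intro order_trans[OF norm_cauchy_schwarz] mult_mono) auto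
        finally show ?thesis using moreau_le[OF y, of n "u r"] by simp
      qed
      have 2: "inner (a n (u r)) ?u' \<le> R\<^sup>2 / 2 - (norm ?u')\<^sup>2 / 2"
      proof -
        have "inner (a n (u r)) ?u' = inner (B (u r)) ?u' - (norm ?u')\<^sup>2"
          by (simp only: yosida_eq inner_diff_left power2_norm_eq_inner)
        also have "inner (B (u r)) ?u' \<le> R * norm ?u'"
          using nB by (intro order_trans[OF norm_cauchy_schwarz] mult_right_mono) auto
        also have "R * norm ?u' \<le> R\<^sup>2 / 2 + (norm ?u')\<^sup>2 / 2"
          using sum_squares_bound[of R "norm ?u'"] by simp
        finally show ?thesis by simp
      qed
      have 3: "p \<le> norm ?u'"
      proof -
        have "norm (V n (u t)) \<le> exp (L * (t - r)) * norm ?u'"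
          unfolding u_def using r by (intro V_speed) auto
        also have "\<dots> \<le> exp (L * T) * norm ?u'"
          using r t L by (intro mult_right_mono) auto
        finally have "p \<le> exp (- L * T) * (exp (L * T) * norm ?u')"
          unfolding p_def by (intro mult_left_mono) auto
        then show ?thesis by (simp add: mult.assoc[symmetric] flip: exp_add)
      qed
      have p0: "0 \<le> p" by (simp add: p_def)
      have "r * inner (a n (u r)) ?u' + r * p\<^sup>2 / 2 \<le> r * (R\<^sup>2 / 2 - (norm ?u')\<^sup>2 / 2) + r * (norm ?u')\<^sup>2 / 2"
        using 2 3 r p0 by (intro add_mono mult_left_mono divide_right_mono power_mono) auto
      also have "\<dots> = r * R\<^sup>2 / 2" by (simp add: algebra_simps)
      also have "\<dots> \<le> T * R\<^sup>2 / 2" using r t by (intro divide_right_mono mult_right_mono) auto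
      finally have "2 * inner (?u' - 0) (u r - v) / 2 + (moreau n (u r) + r * inner (a n (u r)) ?u') - K + r * p\<^sup>2 / 2 \<le> 0"
        using 1 unfolding K_def by simp
      with der show "\<exists>y. (?\<psi> has_real_derivative y) (at r) \<and> y \<le> 0" by blast
    qed (use t in simp)
    then have "(norm (u t - v))\<^sup>2 / 2 + t * moreau n (u t) + t\<^sup>2 * p\<^sup>2 / 4 \<le> (norm (w - v))\<^sup>2 / 2 + K * t"
      by (simp add: u_def mult.commute)
    moreover have "0 \<le> (norm (u t - v))\<^sup>2 / 2" "0 \<le> t * moreau n (u t)" "K * t \<le> K * T"
      using t K moreau_nonneg by (auto intro: mult_left_mono)
    moreover have "(t * p / 2)\<^sup>2 = t\<^sup>2 * p\<^sup>2 / 4" by (simp add: power_divide power_mult_distrib)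
    ultimately have "(t * p / 2)\<^sup>2 \<le> (norm (w - v))\<^sup>2 / 2 + K * T" by linarith
    then have "t * p / 2 \<le> sqrt ((norm (w - v))\<^sup>2 / 2 + K * T)"
      by (rule real_le_rsqrt)
    then have "exp (L * T) * (t * p) \<le> exp (L * T) * (2 * sqrt ((norm (w - v))\<^sup>2 / 2 + K * T))"
      by (intro mult_left_mono) auto
    also have "exp (L * T) * (t * p) = t * norm (V n (u t))"
      unfolding p_def by (simp add: mult.left_commute flip: exp_add)
    finally show ?thesis using t by (simp add: C_def u_def field_simps)
  qed
  moreover have "C \<ge> 0" unfolding C_def using K T by auto
  ultimately show ?thesis using that by blast
qed

end

section \<open>Differentiability of the limit evolution at positive times\<close>

section \<open>Regularity of the evolution\<close>

lemma norm_quotient_le: "norm x \<le> \<bar>h\<bar> * c \<Longrightarrow> h \<noteq> 0 \<Longrightarrow> norm (x /\<^sub>R h) \<le> c" for h :: real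
  by (simp add: field_simps)

context evolution
begin

text \<open>With B frozen at z the shifted operator is maximal monotone, and the element of least
  norm of A z - B z is the candidate for minus the velocity at z.\<close>

definition accel :: "'a \<Rightarrow> 'a" where
  "accel z = minimal_section (shift_op A (B z)) z"

lemma accel:
  assumes "y \<in> A z"
  shows "B z + accel z \<in> A z" "norm (accel z) \<le> norm (y - B z)"
    "(\<lambda>n. yosida (shift_op A (B z)) (mu n) z) \<longlonglongrightarrow> accel z"
proof -
  interpret S: maximal_monotone "shift_op A (B z)" by (rule maximal_monotone_shift)
  have y: "y - B z \<in> shift_op A (B z) z" using assms by (auto simp: shift_op_def)
  have "accel z \<in> shift_op A (B z) z" unfolding accel_def by (rule S.minimal_section[OF y])
  then show "B z + accel z \<in> A z" by (auto simp: shift_op_def)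
  show "norm (accel z) \<le> norm (y - B z)"
    "(\<lambda>n. yosida (shift_op A (B z)) (mu n) z) \<longlonglongrightarrow> accel z"
    using S.minimal_section[OF y] by (simp_all add: accel_def)
qed

text \<open>Take for x a resolvent point of the shifted operator, so that z - x is the parameter
  times its Yosida value e. The test becomes <q, e> \<le> - |e|^2 + O(h), and with |q| \<le>
  \<alpha> this yields |q + e|^2 \<le> \<alpha>^2 - |e|^2 + O(h). As |e| is close to |accel z|, q is
  trapped near - e without weak compactness.\<close>

lemma difference_quotient_tendsto:
  assumes y: "y \<in> A z" and F: "F \<le> at 0"
    and test: "\<And>x y. y \<in> A x \<Longrightarrow> \<exists>K. \<forall>\<^sub>F h in F. inner (q h) (z - x) \<le> inner (B z - y) (z - x) + K * \<bar>h\<bar>"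
    and bound: "\<forall>\<^sub>F h in F. norm (q h) \<le> \<alpha> h" and \<alpha>: "(\<alpha> \<longlongrightarrow> norm (accel z)) F"
  shows "(q \<longlongrightarrow> - accel z) F"
proof (rule tendstoI)
  fix e :: real assume e: "e > 0"
  interpret S: maximal_monotone "shift_op A (B z)" by (rule maximal_monotone_shift)
  let ?e = "\<lambda>n. yosida (shift_op A (B z)) (mu n) z"
  have lim: "?e \<longlonglongrightarrow> accel z" by (rule accel(3)[OF y])
  have "(\<lambda>n. (norm (accel z))\<^sup>2 - (norm (?e n))\<^sup>2) \<longlonglongrightarrow> (norm (accel z))\<^sup>2 - (norm (accel z))\<^sup>2"
    by (intro tendsto_intros lim)
  then have "\<forall>\<^sub>F n in sequentially. (norm (accel z))\<^sup>2 - (norm (?e n))\<^sup>2 < (e / 2)\<^sup>2 / 2"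
    by (rule order_tendstoD) (use e in simp)
  moreover have "\<forall>\<^sub>F n in sequentially. dist (?e n) (accel z) < e / 2"
    using e by (intro tendstoD[OF lim]) simp
  ultimately have "\<forall>\<^sub>F n in sequentially. (norm (accel z))\<^sup>2 - (norm (?e n))\<^sup>2 < (e / 2)\<^sup>2 / 2 \<and> dist (?e n) (accel z) < e / 2"
    by (rule eventually_conj)
  \<comment> \<open>The index is fixed before h tends to 0, because the constant K of the test
    depends on the resolvent point x.\<close>
  then obtain n where n: "(norm (accel z))\<^sup>2 - (norm (?e n))\<^sup>2 < (e / 2)\<^sup>2 / 2" "dist (?e n) (accel z) < e / 2"
    by (auto simp: eventually_sequentially)
  define x where "x = z - mu n *\<^sub>R ?e n"
  have "?e n \<in> shift_op A (B z) (resolvent (shift_op A (B z)) (mu n) z)"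
    by (rule S.yosida_in) simp
  then have "B z + ?e n \<in> A x"
    unfolding x_def by (auto simp: S.resolvent_yosida shift_op_def)
  then obtain K where "\<forall>\<^sub>F h in F. inner (q h) (z - x) \<le> inner (B z - (B z + ?e n)) (z - x) + K * \<bar>h\<bar>"
    using test by blast
  then have K: "\<forall>\<^sub>F h in F. inner (q h) (?e n) \<le> - (norm (?e n))\<^sup>2 + real (Suc n) * K * \<bar>h\<bar>"
  proof eventually_elim
    case (elim h)
    have "real (Suc n) * inner (q h) (z - x) \<le> real (Suc n) * (inner (B z - (B z + ?e n)) (z - x) + K * \<bar>h\<bar>)"
      using elim by (rule mult_left_mono) simp
    moreover have "real (Suc n) * inner v (z - x) = inner v (?e n)" for v
      by (simp add: x_def del: of_nat_Suc)
    ultimately have "inner (q h) (?e n) \<le> inner (B z - (B z + ?e n)) (?e n) + real (Suc n) * (K * \<bar>h\<bar>)"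
      by (simp only: distrib_left)
    then show ?case by (simp add: power2_norm_eq_inner mult.assoc algebra_simps del: of_nat_Suc)
  qed
  have "((\<lambda>h. (\<alpha> h)\<^sup>2 + 2 * (real (Suc n) * K) * \<bar>h\<bar>) \<longlongrightarrow> (norm (accel z))\<^sup>2 + 2 * (real (Suc n) * K) * \<bar>0\<bar>) F"
    by (intro tendsto_intros \<alpha> tendsto_mono[OF F])
  moreover have "(norm (accel z))\<^sup>2 + 2 * (real (Suc n) * K) * \<bar>0\<bar> < (norm (accel z))\<^sup>2 + (e / 2)\<^sup>2 / 2"
    using e by simp
  ultimately have "\<forall>\<^sub>F h in F. (\<alpha> h)\<^sup>2 + 2 * (real (Suc n) * K) * \<bar>h\<bar> < (norm (accel z))\<^sup>2 + (e / 2)\<^sup>2 / 2"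
    by (rule order_tendstoD)
  with bound K show "\<forall>\<^sub>F h in F. dist (q h) (- accel z) < e"
  proof eventually_elim
    case (elim h)
    have "(norm (q h + ?e n))\<^sup>2 = (norm (q h))\<^sup>2 + 2 * inner (q h) (?e n) + (norm (?e n))\<^sup>2"
      by (simp add: power2_norm_eq_inner inner_add_left inner_add_right inner_commute)
    also have "(norm (q h))\<^sup>2 \<le> (\<alpha> h)\<^sup>2" using elim(1) by (intro power_mono) auto
    finally have "(norm (q h + ?e n))\<^sup>2 < (e / 2)\<^sup>2"
      using elim(2,3) n(1) by linarith
    then have "norm (q h + ?e n) < e / 2" by (rule power2_less_imp_less) (use e in simp)
    moreover have "dist (q h) (- accel z) \<le> norm (q h + ?e n) + dist (?e n) (accel z)"
      unfolding dist_norm using norm_triangle_ineq4[of "q h + ?e n" "?e n - accel z"] by (simp add: algebra_simps)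
    ultimately show ?case using n(2) by linarith
  qed
qed

lemma yosida_flow_bounds:
  assumes "0 < t0"
  shows "\<exists>M>0. \<forall>n t. t0 \<le> t \<longrightarrow> t \<le> T \<longrightarrow> norm (V n (U n w t)) \<le> M \<and> norm (U n w t) \<le> M
     \<and> norm (B (U n w t)) \<le> M \<and> norm (a n (U n w t)) \<le> M"
proof -
  obtain R where R: "R \<ge> 0" "\<And>n t. 0 \<le> t \<Longrightarrow> t \<le> T \<Longrightarrow> norm (U n w t) \<le> R"
    "\<And>n t. 0 \<le> t \<Longrightarrow> t \<le> T \<Longrightarrow> norm (B (U n w t)) \<le> R" using U_bounded[of T w] by metis
  obtain C where C: "C \<ge> 0" "\<And>n t. 0 < t \<Longrightarrow> t \<le> T \<Longrightarrow> norm (V n (U n w t)) \<le> C / t"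
    using V_regularised[of T w] by metis
  have V: "norm (V n (U n w t)) \<le> C / t0" if "t0 \<le> t" "t \<le> T" for n t
    using C(2)[of t n] that assms C(1) by (intro order_trans[OF C(2)] divide_left_mono) auto
  have "norm (a n (U n w t)) \<le> R + C / t0" if "t0 \<le> t" "t \<le> T" for n t
    unfolding yosida_eq using that assms by (intro order_trans[OF norm_triangle_ineq4] add_mono R V) auto
  moreover have "C / t0 \<ge> 0" using C assms by simp
  moreover have "norm (U n w t) \<le> R \<and> norm (B (U n w t)) \<le> R" if "t0 \<le> t" "t \<le> T" for n t
    using R(2,3)[of t n] that assms by simp
  ultimately have "norm (V n (U n w t)) \<le> R + C / t0 + 1 \<and> norm (U n w t) \<le> R + C / t0 + 1
     \<and> norm (B (U n w t)) \<le> R + C / t0 + 1 \<and> norm (a n (U n w t)) \<le> R + C / t0 + 1" if "t0 \<le> t" "t \<le> T" for n t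
    using V[OF that, of n] that R(1) by (smt (verit))
  moreover have "R + C / t0 + 1 > 0" using \<open>C / t0 \<ge> 0\<close> R(1) by linarith
  ultimately show ?thesis by blast
qed

context
  fixes w assumes w: "w \<in> closure D"
begin

abbreviation "u t \<equiv> evol A B t w"

lemma evol_lipschitz:
  assumes "0 < t0"
  shows "\<exists>M>0. \<forall>s t. t0 \<le> s \<longrightarrow> s \<le> t \<longrightarrow> t \<le> T \<longrightarrow> norm (u t - u s) \<le> M * (t - s)"
proof -
  obtain M where M: "M > 0" "\<And>n t. t0 \<le> t \<Longrightarrow> t \<le> T \<Longrightarrow> norm (V n (U n w t)) \<le> M"
    using yosida_flow_bounds[OF assms, of T w] by blast
  have "norm (u t - u s) \<le> M * (t - s)" if "t0 \<le> s" "s \<le> t" "t \<le> T" for s t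
  proof (rule tendsto_upperbound)
    show "(\<lambda>n. norm (U n w t - U n w s)) \<longlonglongrightarrow> norm (u t - u s)"
      using that assms by (intro tendsto_intros evol_tendsto w) auto
    show "\<forall>\<^sub>F n in sequentially. norm (U n w t - U n w s) \<le> M * (t - s)"
      using that assms by (intro always_eventually allI U_lipschitz M) auto
  qed simp
  then show ?thesis using M(1) by blast
qed

text \<open>For fixed m the value \<open>a m (u t)\<close> is bounded by M: the approximating state
  is within O(\<open>mu n\<close>) of its resolvent, where an element of A of norm at most M is
  known. \<open>yosida_limit\<close> then provides an element of A (u t).\<close>

lemma evol_in_domain:
  assumes t: "0 < t"
  shows "A (u t) \<noteq> {}"
proof -
  obtain M where M: "M > 0" "\<And>n. norm (a n (U n w t)) \<le> M"
    using yosida_flow_bounds[OF t, of t w] by auto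
  have "norm (a m (u t)) \<le> M" for m
  proof (rule tendsto_le)
    show "(\<lambda>n. norm (a m (U n w t))) \<longlonglongrightarrow> norm (a m (u t))"
      using t by (intro tendsto_norm continuous_on_tendsto_compose[OF continuous_on_yosida[of _ UNIV]] evol_tendsto w) auto
    have "(\<lambda>n. M + mu n * M * real (Suc m)) \<longlonglongrightarrow> M + 0 * M * real (Suc m)"
      by (intro tendsto_intros LIMSEQ_inverse_real_of_nat)
    then show "(\<lambda>n. M + mu n * M * real (Suc m)) \<longlonglongrightarrow> M" by simp
    have "norm (a m (U n w t)) \<le> M + mu n * M * real (Suc m)" for n
    proof -
      let ?J = "resolvent A (mu n) (U n w t)"
      have "a n (U n w t) \<in> A ?J" by (rule yosida_in) simp
      then have "norm (a m ?J) \<le> norm (a n (U n w t))" by (intro norm_yosida_le) auto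
      then have "norm (a m ?J) \<le> M" using M(2) by (rule order_trans)
      moreover have "norm (a m (U n w t) - a m ?J) \<le> norm (U n w t - ?J) / mu m"
        by (rule yosida_lipschitz) simp
      moreover have "norm (U n w t - ?J) / mu m \<le> mu n * M * real (Suc m)"
      proof -
        have "norm (U n w t - ?J) / mu m = mu n * norm (a n (U n w t)) * real (Suc m)"
          by (simp add: resolvent_yosida divide_inverse del: of_nat_Suc)
        then show ?thesis using M(2)[of n] by (simp add: mult_right_mono mult_left_mono del: of_nat_Suc)
      qed
      ultimately show ?thesis using norm_triangle_sub[of "a m (U n w t)" "a m ?J"] by linarith
    qed
    then show "\<forall>\<^sub>F n in sequentially. norm (a m (U n w t)) \<le> M + mu n * M * real (Suc m)" by simp
  qed simp
  then show ?thesis using yosida_limit(2)[of "u t" M] by blast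
qed

text \<open>An integral inequality that survives the limit in n, with an error quadratic in the
  length of the interval. The state and B may be frozen at any r in it, so that forward quotients (r
  at the left end) and backward ones (r at the right end) can both be tested.\<close>

lemma evol_test_inequality:
  assumes t0: "0 < t0" and y: "y \<in> A x"
  shows "\<exists>K. \<forall>t1 t2 r. t0 \<le> t1 \<longrightarrow> t1 < t2 \<longrightarrow> t2 \<le> T \<longrightarrow> r \<in> {t1..t2} \<longrightarrow>
    inner (u t2 - u t1) (u r - x) \<le> (t2 - t1) * (inner (B (u r) - y) (u r - x) + K * (t2 - t1))"
proof -
  obtain M where M: "M > 0" "\<And>n t. t0 \<le> t \<Longrightarrow> t \<le> T \<Longrightarrow> norm (V n (U n w t)) \<le> M"
    "\<And>n t. t0 \<le> t \<Longrightarrow> t \<le> T \<Longrightarrow> norm (U n w t) \<le> M" "\<And>n t. t0 \<le> t \<Longrightarrow> t \<le> T \<Longrightarrow> norm (B (U n w t)) \<le> M"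
    "\<And>n t. t0 \<le> t \<Longrightarrow> t \<le> T \<Longrightarrow> norm (a n (U n w t)) \<le> M"
    using yosida_flow_bounds[OF t0, of T w] by blast
  \<comment> \<open>The summands bound, per unit of length, the changes of the test direction, of B
    and of the state between the mean value time and r.\<close>
  define K where "K = M * M + L * M * (M + norm x) + (M + norm y) * M"
  have "inner (u t2 - u t1) (u r - x) \<le> (t2 - t1) * (inner (B (u r) - y) (u r - x) + K * (t2 - t1))"
    if t: "t0 \<le> t1" "t1 < t2" "t2 \<le> T" "r \<in> {t1..t2}" for t1 t2 r
  proof (rule tendsto_le)
    let ?R = "\<lambda>n. (t2 - t1) * (inner (B (U n w r) - y) (U n w r - x) + K * (t2 - t1) + mu n * (M * norm y))"
    have lim: "(\<lambda>n. U n w s) \<longlonglongrightarrow> u s" if "s \<ge> t1" for s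
      using that t t0 by (intro evol_tendsto w) auto
    show "(\<lambda>n. inner (U n w t2 - U n w t1) (U n w r - x)) \<longlonglongrightarrow> inner (u t2 - u t1) (u r - x)"
      using t by (intro tendsto_intros lim) auto
    have "?R \<longlonglongrightarrow> (t2 - t1) * (inner (B (u r) - y) (u r - x) + K * (t2 - t1) + 0 * (M * norm y))"
      using t by (intro tendsto_intros lim continuous_on_tendsto_compose[OF continuous_on_B[of UNIV]] LIMSEQ_inverse_real_of_nat) auto
    then show "?R \<longlonglongrightarrow> (t2 - t1) * (inner (B (u r) - y) (u r - x) + K * (t2 - t1))" by simp
    have "inner (U n w t2 - U n w t1) (U n w r - x) \<le> ?R n" for n
    proof -
      let ?f = "\<lambda>s. inner (U n w s) (U n w r - x)"
      \<comment> \<open>With the direction frozen at r the increment is that of a real function, so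
        the mean value theorem applies and no vector-valued integral enters.\<close>
      have "\<exists>q. t1 < q \<and> q < t2 \<and> ?f t2 - ?f t1 = (t2 - t1) * inner (V n (U n w q)) (U n w r - x)"
      proof (rule MVT2)
        fix s assume "t1 \<le> s" "s \<le> t2"
        then have "(U n w has_vector_derivative V n (U n w s)) (at s)"
          using t t0 by (intro U_deriv) auto
        from bounded_linear.has_vector_derivative[OF bounded_linear_inner_left this]
        show "(?f has_real_derivative inner (V n (U n w s)) (U n w r - x)) (at s)"
          by (simp add: has_real_derivative_iff_has_vector_derivative)
      qed (use t in simp)
      then obtain q where q: "t1 < q" "q < t2"
        and eq: "?f t2 - ?f t1 = (t2 - t1) * inner (V n (U n w q)) (U n w r - x)" by blast
      have tq: "t0 \<le> q" "q \<le> T" "t0 \<le> r" "r \<le> T" using t q by auto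
      define h where "h = t2 - t1"
      have h: "h > 0" using t by (simp add: h_def)
      have qr: "norm (U n w q - U n w r) \<le> M * h"
      proof -
        have "norm (U n w q - U n w r) \<le> M * \<bar>q - r\<bar>"
        proof (cases "r \<le> q")
          case True
          then show ?thesis
            using U_lipschitz[of r q n w M] t0 tq M(2) by auto
        next
          case False
          then show ?thesis
            using U_lipschitz[of q r n w M] t0 tq M(2) by (auto simp: norm_minus_commute)
        qed
        also have "\<dots> \<le> M * h" using M(1) t q by (intro mult_left_mono) (auto simp: h_def)
        finally show ?thesis .
      qed
      let ?P = "B (U n w q) - y" and ?Q = "U n w q - x"
      let ?P' = "B (U n w r) - y" and ?Q' = "U n w r - x"
      have 1: "inner (V n (U n w q)) ?Q' \<le> inner (V n (U n w q)) ?Q + M * M * h"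
      proof -
        have "inner (V n (U n w q)) ?Q' - inner (V n (U n w q)) ?Q = inner (V n (U n w q)) (U n w r - U n w q)"
          by (simp add: inner_diff_right)
        also have "\<dots> \<le> M * (M * h)"
          using qr M(1) M(2)[OF tq(1,2)]
          by (intro order_trans[OF norm_cauchy_schwarz] mult_mono) (auto simp: norm_minus_commute)
        finally show ?thesis by simp
      qed
      have 2: "inner (V n (U n w q)) ?Q \<le> inner ?P ?Q + mu n * (M * norm y)"
      proof -
        have "0 \<le> inner (a n (U n w q) - y) (resolvent A (mu n) (U n w q) - x)"
          by (intro monotone yosida_in y) simp
        also have "\<dots> = inner (a n (U n w q) - y) ?Q - mu n * (norm (a n (U n w q)))\<^sup>2 + mu n * inner y (a n (U n w q))"
          unfolding power2_norm_eq_inner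
          by (simp add: resolvent_yosida inner_diff_left inner_diff_right algebra_simps del: of_nat_Suc)
        also have "\<dots> \<le> inner (a n (U n w q) - y) ?Q + mu n * inner y (a n (U n w q))"
          by simp
        also have "mu n * inner y (a n (U n w q)) \<le> mu n * (M * norm y)"
        proof (rule mult_left_mono)
          have "inner y (a n (U n w q)) \<le> norm y * norm (a n (U n w q))" by (rule norm_cauchy_schwarz)
          also have "\<dots> \<le> norm y * M" using M(5)[OF tq(1,2)] by (intro mult_left_mono) auto
          finally show "inner y (a n (U n w q)) \<le> M * norm y" by (simp add: mult.commute)
        qed simp
        finally have "- inner (a n (U n w q) - y) ?Q \<le> mu n * (M * norm y)" by simp
        moreover have "inner (V n (U n w q)) ?Q = inner ?P ?Q - inner (a n (U n w q) - y) ?Q"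
          by (simp add: yosida_field_def inner_diff_left)
        ultimately show ?thesis by simp
      qed
      have 3: "inner ?P ?Q \<le> inner ?P' ?Q' + L * (M * h) * (M + norm x) + (M + norm y) * (M * h)"
      proof -
        have "inner ?P ?Q = inner ?P' ?Q' + inner (B (U n w q) - B (U n w r)) ?Q + inner ?P' (U n w q - U n w r)"
          by (simp add: inner_diff_left inner_diff_right)
        moreover have "inner (B (U n w q) - B (U n w r)) ?Q \<le> L * (M * h) * (M + norm x)"
        proof (rule order_trans[OF norm_cauchy_schwarz], rule mult_mono)
          show "norm (B (U n w q) - B (U n w r)) \<le> L * (M * h)"
            using qr L by (intro order_trans[OF lip] mult_left_mono) auto
          show "norm ?Q \<le> M + norm x"
            using M(3)[OF tq(1,2)] by (intro order_trans[OF norm_triangle_ineq4] add_mono) auto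
        qed (use L M h in auto)
        moreover have "inner ?P' (U n w q - U n w r) \<le> (M + norm y) * (M * h)"
        proof (rule order_trans[OF norm_cauchy_schwarz], rule mult_mono)
          show "norm ?P' \<le> M + norm y"
            using M(4)[OF tq(3,4)] by (intro order_trans[OF norm_triangle_ineq4] add_mono) auto
        qed (use qr M(1) in auto)
        ultimately show ?thesis by linarith
      qed
      have "inner (V n (U n w q)) ?Q' \<le> inner ?P' ?Q' + K * h + mu n * (M * norm y)"
        using 1 2 3 by (simp add: K_def algebra_simps del: of_nat_Suc)
      then have "h * inner (V n (U n w q)) ?Q' \<le> h * (inner ?P' ?Q' + K * h + mu n * (M * norm y))"
        using h by (intro mult_left_mono) auto
      then show ?thesis using eq by (simp add: h_def inner_diff_left)
    qed
    then show "\<forall>\<^sub>F n in sequentially. inner (U n w t2 - U n w t1) (U n w r - x) \<le> ?R n" by simp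
  qed simp
  then show ?thesis by blast
qed

text \<open>Measured from z = u t1, the distance grows at most at the rate |B - y| with y = B z +
  accel z in A z. At z itself this is |accel z|, and the motion of B costs a further multiple of the
  elapsed time.\<close>

lemma evol_speed_bound:
  assumes t0: "0 < t0"
  shows "\<exists>K. \<forall>t1 t2. t0 \<le> t1 \<longrightarrow> t1 \<le> t2 \<longrightarrow> t2 \<le> T \<longrightarrow>
    norm (u t2 - u t1) \<le> (t2 - t1) * (norm (accel (u t1)) + K * (t2 - t1))"
proof -
  obtain M where M: "M > 0" "\<And>n t. t0 \<le> t \<Longrightarrow> t \<le> T \<Longrightarrow> norm (V n (U n w t)) \<le> M"
    "\<And>n t. t0 \<le> t \<Longrightarrow> t \<le> T \<Longrightarrow> norm (a n (U n w t)) \<le> M"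
    using yosida_flow_bounds[OF t0, of T w] by blast
  have "norm (u t2 - u t1) \<le> (t2 - t1) * (norm (accel (u t1)) + L * M * (t2 - t1))"
    if t: "t0 \<le> t1" "t1 \<le> t2" "t2 \<le> T" for t1 t2
  proof -
    define z where "z = u t1"
    define h where "h = t2 - t1"
    have h: "h \<ge> 0" using t by (simp add: h_def)
    define y where "y = B z + accel z"
    obtain y0 where "y0 \<in> A z" using evol_in_domain[of t1] t t0 unfolding z_def by fastforce
    then have y: "y \<in> A z" unfolding y_def by (rule accel(1))
    have half_sqrt: "inverse s / 2 * (2 * i) = i / s" for s i :: real by (simp add: field_simps)
    have shift: "x - C * t2 \<le> y - C * t1 \<Longrightarrow> x \<le> y + (t2 - t1) * C" for x y C :: real
      by (simp add: algebra_simps)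
    \<comment> \<open>A bound for B minus y along the approximate flow: the least norm, the error at
      time t1, and the motion of B. The middle term vanishes as n grows.\<close>
    define c where "c n = norm (accel z) + L * norm (U n w t1 - z) + L * M * h" for n
    have approx: "sqrt ((norm (U n w t2 - z))\<^sup>2 + \<delta>) \<le> sqrt ((norm (U n w t1 - z))\<^sup>2 + \<delta>) + h * (c n + mu n * (M * norm y) / sqrt \<delta>)"
      if \<delta>: "\<delta> > 0" for n \<delta>
    proof -
      \<comment> \<open>The shift by \<delta> keeps the square root differentiable when the flow
        meets z; it is removed after the limit in n, by taking \<delta> = e^2.\<close>
      let ?g = "\<lambda>t. (norm (U n w t - z))\<^sup>2 + \<delta>"
      have gpos: "?g t > 0" for t using \<delta> by (simp add: add_nonneg_pos)
      have "sqrt (?g t2) - (c n + mu n * (M * norm y) / sqrt \<delta>) * t2 \<le> sqrt (?g t1) - (c n + mu n * (M * norm y) / sqrt \<delta>) * t1"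
      proof (rule DERIV_nonpos_imp_decreasing_open[where f = "\<lambda>t. sqrt (?g t) - (c n + mu n * (M * norm y) / sqrt \<delta>) * t", OF t(2)])
        show "continuous_on {t1..t2} (\<lambda>t. sqrt (?g t) - (c n + mu n * (M * norm y) / sqrt \<delta>) * t)"
          using t t0 by (intro continuous_intros continuous_on_U) auto
        fix r assume r: "t1 < r" "r < t2"
        then have r0: "r > 0" "t0 \<le> r" "r \<le> T" using t t0 by auto
        let ?V = "V n (U n w r)"
        have "((\<lambda>t. (norm (U n w t - z))\<^sup>2) has_real_derivative 2 * inner (?V - 0) (U n w r - z)) (at r)"
          by (rule has_derivative_norm_square_diff[OF U_deriv[OF r0(1)]]) simp
        from DERIV_add[OF this DERIV_const[of \<delta>]]
        have "(?g has_real_derivative 2 * inner ?V (U n w r - z)) (at r)" by simp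
        then have "((\<lambda>t. sqrt (?g t)) has_real_derivative (inverse (sqrt (?g r)) / 2) * (2 * inner ?V (U n w r - z))) (at r)"
          by (rule DERIV_chain2[where f = sqrt and g = ?g, OF DERIV_real_sqrt[OF gpos]])
        then have "((\<lambda>t. sqrt (?g t)) has_real_derivative (inner ?V (U n w r - z)) / sqrt (?g r)) (at r)"
          by (simp only: half_sqrt)
        then have "((\<lambda>t. sqrt (?g t) - (c n + mu n * (M * norm y) / sqrt \<delta>) * t) has_real_derivative
           (inner ?V (U n w r - z)) / sqrt (?g r) - (c n + mu n * (M * norm y) / sqrt \<delta>) * 1) (at r)"
          by (intro DERIV_diff DERIV_cmult DERIV_ident)
        moreover have "(inner ?V (U n w r - z)) / sqrt (?g r) \<le> c n + mu n * (M * norm y) / sqrt \<delta>"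
        proof -
          have cn: "c n \<ge> 0" unfolding c_def using L M h by auto
          have "0 \<le> inner (a n (U n w r) - y) (resolvent A (mu n) (U n w r) - z)"
            by (intro monotone yosida_in y) simp
          also have "\<dots> = inner (a n (U n w r) - y) (U n w r - z) - mu n * (norm (a n (U n w r)))\<^sup>2 + mu n * inner y (a n (U n w r))"
            unfolding power2_norm_eq_inner
            by (simp add: resolvent_yosida inner_diff_left inner_diff_right algebra_simps del: of_nat_Suc)
          also have "\<dots> \<le> inner (a n (U n w r) - y) (U n w r - z) + mu n * inner y (a n (U n w r))"
            by simp
          also have "mu n * inner y (a n (U n w r)) \<le> mu n * (M * norm y)"
          proof (rule mult_left_mono)
            have "inner y (a n (U n w r)) \<le> norm y * norm (a n (U n w r))" by (rule norm_cauchy_schwarz)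
            also have "\<dots> \<le> norm y * M" using M(3)[OF r0(2,3)] by (intro mult_left_mono) auto
            finally show "inner y (a n (U n w r)) \<le> M * norm y" by (simp add: mult.commute)
          qed simp
          finally have "- inner (a n (U n w r) - y) (U n w r - z) \<le> mu n * (M * norm y)" by simp
          moreover have "inner ?V (U n w r - z) = inner (B (U n w r) - y) (U n w r - z) - inner (a n (U n w r) - y) (U n w r - z)"
            by (simp add: yosida_field_def inner_diff_left)
          moreover have "inner (B (U n w r) - y) (U n w r - z) \<le> c n * norm (U n w r - z)"
          proof (rule order_trans[OF norm_cauchy_schwarz], rule mult_right_mono)
            have "B (U n w r) - y = (B (U n w r) - B (U n w t1)) + (B (U n w t1) - B z) - accel z"
              by (simp add: y_def)
            then have "norm (B (U n w r) - y) \<le> norm (B (U n w r) - B (U n w t1)) + norm (B (U n w t1) - B z) + norm (accel z)"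
              by (simp only:) (intro order_trans[OF norm_triangle_ineq4] add_right_mono norm_triangle_ineq)
            moreover have "norm (B (U n w r) - B (U n w t1)) \<le> L * (M * h)"
            proof (rule order_trans[OF lip], rule mult_left_mono)
              have "norm (U n w r - U n w t1) \<le> M * (r - t1)"
                using r t t0 M(2) by (intro U_lipschitz) auto
              also have "\<dots> \<le> M * h" using r M(1) by (simp add: h_def)
              finally show "norm (U n w r - U n w t1) \<le> M * h" .
            qed (use L in simp)
            moreover have "norm (B (U n w t1) - B z) \<le> L * norm (U n w t1 - z)" by (rule lip)
            ultimately show "norm (B (U n w r) - y) \<le> c n" by (simp add: c_def mult.assoc)
          qed simp
          moreover have "c n * norm (U n w r - z) \<le> c n * sqrt (?g r)"
            using cn \<delta> by (intro mult_left_mono real_le_rsqrt) auto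
          moreover have "mu n * (M * norm y) \<le> (mu n * (M * norm y) / sqrt \<delta>) * sqrt (?g r)"
          proof -
            have "mu n * (M * norm y) = (mu n * (M * norm y) / sqrt \<delta>) * sqrt \<delta>" using \<delta> by simp
            also have "\<dots> \<le> (mu n * (M * norm y) / sqrt \<delta>) * sqrt (?g r)"
              using \<delta> M(1) by (intro mult_left_mono) auto
            finally show ?thesis .
          qed
          ultimately have "inner ?V (U n w r - z) \<le> (c n + mu n * (M * norm y) / sqrt \<delta>) * sqrt (?g r)"
            by (simp only: distrib_right)
          then show ?thesis using gpos[of r] by (simp add: pos_divide_le_eq)
        qed
        ultimately show "\<exists>y'. ((\<lambda>t. sqrt (?g t) - (c n + mu n * (M * norm y) / sqrt \<delta>) * t) has_real_derivative y') (at r) \<and> y' \<le> 0"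
          by (intro exI conjI) (assumption, simp)
      qed
      then show ?thesis unfolding h_def by (rule shift)
    qed
    have lim: "(\<lambda>n. U n w s) \<longlonglongrightarrow> u s" if "s \<ge> t1" for s
      using that t t0 by (intro evol_tendsto w) auto
    have lim': "norm (u t2 - z) \<le> sqrt \<delta> + h * (norm (accel z) + L * M * h)" if \<delta>: "\<delta> > 0" for \<delta>
    proof -
      have "sqrt ((norm (u t2 - z))\<^sup>2 + \<delta>) \<le> sqrt ((norm (u t1 - z))\<^sup>2 + \<delta>) + h * ((norm (accel z) + L * norm (u t1 - z) + L * M * h) + 0 * (M * norm y) / sqrt \<delta>)"
      proof (rule tendsto_le[OF _ _ _ always_eventually[OF allI[OF approx[OF \<delta>]]]])
        show "(\<lambda>n. sqrt ((norm (U n w t1 - z))\<^sup>2 + \<delta>) + h * (c n + mu n * (M * norm y) / sqrt \<delta>)) \<longlonglongrightarrow>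
           sqrt ((norm (u t1 - z))\<^sup>2 + \<delta>) + h * ((norm (accel z) + L * norm (u t1 - z) + L * M * h) + 0 * (M * norm y) / sqrt \<delta>)"
          unfolding c_def using \<delta> by (intro tendsto_intros lim LIMSEQ_inverse_real_of_nat) auto
        show "(\<lambda>n. sqrt ((norm (U n w t2 - z))\<^sup>2 + \<delta>)) \<longlonglongrightarrow> sqrt ((norm (u t2 - z))\<^sup>2 + \<delta>)"
          using t by (intro tendsto_intros lim) auto
      qed simp
      moreover have "norm (u t2 - z) \<le> sqrt ((norm (u t2 - z))\<^sup>2 + \<delta>)"
        using \<delta> by (intro real_le_rsqrt) auto
      ultimately show ?thesis by (simp add: z_def)
    qed
    have "norm (u t2 - z) \<le> h * (norm (accel z) + L * M * h)"
    proof (rule field_le_epsilon)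
      fix e :: real assume "e > 0"
      then show "norm (u t2 - z) \<le> h * (norm (accel z) + L * M * h) + e"
        using lim'[of "e\<^sup>2"] by simp
    qed
    then show ?thesis by (simp add: z_def h_def)
  qed
  then show ?thesis by blast
qed

lemma evol_test_eventually:
  assumes t: "0 < t" and y: "y \<in> A x" and F: "F \<le> at 0"
  shows "\<exists>K. \<forall>\<^sub>F h in F. inner ((u (t + h) - u t) /\<^sub>R h) (u t - x) \<le> inner (B (u t) - y) (u t - x) + K * \<bar>h\<bar>"
proof -
  obtain K where K: "\<And>t1 t2 r. t / 2 \<le> t1 \<Longrightarrow> t1 < t2 \<Longrightarrow> t2 \<le> 2 * t \<Longrightarrow> r \<in> {t1..t2} \<Longrightarrow>
    inner (u t2 - u t1) (u r - x) \<le> (t2 - t1) * (inner (B (u r) - y) (u r - x) + K * (t2 - t1))"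
    using evol_test_inequality[OF half_gt_zero[OF t] y, of "2 * t"] by blast
  have "inner ((u (t + h) - u t) /\<^sub>R h) (u t - x) \<le> inner (B (u t) - y) (u t - x) + K * \<bar>h\<bar>"
    if h: "h \<noteq> 0" "\<bar>h\<bar> < t / 2" for h
  proof (cases "h > 0")
    case True
    then have "inner (u (t + h) - u t) (u t - x) \<le> h * (inner (B (u t) - y) (u t - x) + K * h)"
      using K[of t "t + h" t] h by auto
    then have "inverse h * inner (u (t + h) - u t) (u t - x) \<le> inverse h * (h * (inner (B (u t) - y) (u t - x) + K * h))"
      using True by (intro mult_left_mono) auto
    then show ?thesis using True by (simp add: mult.assoc[symmetric])
  next
    case False
    then have "inner (u t - u (t + h)) (u t - x) \<le> (- h) * (inner (B (u t) - y) (u t - x) + K * (- h))"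
      using K[of "t + h" t t] h by auto
    then have "inverse (- h) * inner (u t - u (t + h)) (u t - x) \<le> inverse (- h) * ((- h) * (inner (B (u t) - y) (u t - x) + K * (- h)))"
      using False h by (intro mult_left_mono) auto
    moreover have "inverse (- h) * inner (u t - u (t + h)) (u t - x) = inner ((u (t + h) - u t) /\<^sub>R h) (u t - x)"
      by (simp add: inner_diff_left algebra_simps)
    ultimately show ?thesis using False h by (simp only: mult.assoc[symmetric]) simp
  qed
  moreover have "\<forall>\<^sub>F h in F. h \<noteq> 0 \<and> \<bar>h\<bar> < t / 2"
    using eventually_at_ball[of "t / 2" 0 UNIV] t
    by (intro filter_leD[OF F] eventually_at[THEN iffD2] exI[of _ "t / 2"]) auto
  ultimately show ?thesis by (intro exI[of _ K]) (auto elim: eventually_mono)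
qed

text \<open>For h > 0 the speed bound starts at t itself and involves only the norm of
  \<open>accel (u t)\<close>, exactly the limit norm that \<open>difference_quotient_tendsto\<close>
  demands.\<close>

lemma evol_right_derivative:
  assumes t: "0 < t"
  shows "((\<lambda>h. (u (t + h) - u t) /\<^sub>R h) \<longlongrightarrow> - accel (u t)) (at_right 0)"
proof -
  obtain y where y: "y \<in> A (u t)" using evol_in_domain[OF t] by blast
  obtain K where K: "\<And>t1 t2. t \<le> t1 \<Longrightarrow> t1 \<le> t2 \<Longrightarrow> t2 \<le> 2 * t \<Longrightarrow>
    norm (u t2 - u t1) \<le> (t2 - t1) * (norm (accel (u t1)) + K * (t2 - t1))"
    using evol_speed_bound[OF t, of "2 * t"] by blast
  have "\<forall>\<^sub>F h in at_right 0. norm ((u (t + h) - u t) /\<^sub>R h) \<le> norm (accel (u t)) + K * h"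
  proof (rule eventually_at_rightI[of 0 t])
    fix h assume "h \<in> {0<..<t}"
    then show "norm ((u (t + h) - u t) /\<^sub>R h) \<le> norm (accel (u t)) + K * h"
      using K[of t "t + h"] by (intro norm_quotient_le) auto
  qed (use t in simp)
  moreover have "((\<lambda>h. norm (accel (u t)) + K * h) \<longlongrightarrow> norm (accel (u t)) + K * 0) (at_right 0)"
    by (intro tendsto_intros)
  ultimately show ?thesis
    by (intro difference_quotient_tendsto[OF y] evol_test_eventually[OF t] at_le) simp_all
qed

text \<open>The evolution and its shift by h separate at most exponentially; division by h gives the
  claim, since right derivatives exist at all positive times.\<close>

lemma accel_decreasing:
  assumes "0 < s" "s \<le> t"
  shows "norm (accel (u t)) \<le> exp (L * (t - s)) * norm (accel (u s))"
proof (rule tendsto_le)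
  show "((\<lambda>h. norm ((u (t + h) - u t) /\<^sub>R h)) \<longlongrightarrow> norm (accel (u t))) (at_right 0)"
    using tendsto_norm[OF evol_right_derivative[of t]] assms by (simp only: norm_minus_cancel)
  show "((\<lambda>h. exp (L * (t - s)) * norm ((u (s + h) - u s) /\<^sub>R h)) \<longlongrightarrow> exp (L * (t - s)) * norm (accel (u s))) (at_right 0)"
    using tendsto_mult_left[OF tendsto_norm[OF evol_right_derivative[of s]]] assms by (simp only: norm_minus_cancel)
  show "\<forall>\<^sub>F h in at_right 0. norm ((u (t + h) - u t) /\<^sub>R h) \<le> exp (L * (t - s)) * norm ((u (s + h) - u s) /\<^sub>R h)"
  proof (rule eventually_at_right_less[THEN eventually_mono])
    fix h :: real assume h: "0 < h"
    have "norm (u (t + h) - u t) \<le> exp (L * (t - s)) * norm (u (s + h) - u s)"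
      using evol_dist_shift[OF w, of s t h] assms h by simp
    then show "norm ((u (t + h) - u t) /\<^sub>R h) \<le> exp (L * (t - s)) * norm ((u (s + h) - u s) /\<^sub>R h)"
      using h by (simp add: divide_right_mono mult.left_commute mult_left_mono)
  qed
qed simp

text \<open>For h < 0 the speed bound starts at t + h, so the norm of \<open>accel\<close> at
  earlier times enters; its continuity at t restores the bound needed.\<close>

lemma evol_derivative:
  assumes t: "0 < t" and cont: "isCont (\<lambda>t. norm (accel (u t))) t"
  shows "(u has_vector_derivative - accel (u t)) (at t)"
proof -
  obtain y where y: "y \<in> A (u t)" using evol_in_domain[OF t] by blast
  obtain K where K: "\<And>t1 t2. t / 2 \<le> t1 \<Longrightarrow> t1 \<le> t2 \<Longrightarrow> t2 \<le> 2 * t \<Longrightarrow>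
    norm (u t2 - u t1) \<le> (t2 - t1) * (norm (accel (u t1)) + K * (t2 - t1))"
    using evol_speed_bound[OF half_gt_zero[OF t], of "2 * t"] by blast
  \<comment> \<open>\<open>min h 0\<close> starts the bound at t for h > 0 and at t + h for h <
    0.\<close>
  define \<alpha> where "\<alpha> h = norm (accel (u (t + min h 0))) + K * \<bar>h\<bar>" for h
  have "norm ((u (t + h) - u t) /\<^sub>R h) \<le> \<alpha> h" if h: "h \<noteq> 0" "\<bar>h\<bar> < t / 2" for h
  proof (cases "h > 0")
    case True
    then have "\<alpha> h = norm (accel (u t)) + K * h" "\<bar>h\<bar> = t + h - t" "t / 2 \<le> t" "t \<le> t + h" "t + h \<le> 2 * t"
      using h unfolding \<alpha>_def by (auto simp: min_def)
    with K[of t "t + h"] have "norm (u (t + h) - u t) \<le> \<bar>h\<bar> * \<alpha> h" by (metis add_diff_cancel_left')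
    then show ?thesis using h by (intro norm_quotient_le)
  next
    case False
    then have "\<alpha> h = norm (accel (u (t + h))) + K * \<bar>h\<bar>" "\<bar>h\<bar> = t - (t + h)" "t / 2 \<le> t + h" "t + h \<le> t" "t \<le> 2 * t"
      using h t unfolding \<alpha>_def by (auto simp: min_def)
    with K[of "t + h" t] have "norm (u (t + h) - u t) \<le> \<bar>h\<bar> * \<alpha> h" by (metis norm_minus_commute)
    then show ?thesis using h by (intro norm_quotient_le)
  qed
  moreover have "\<forall>\<^sub>F h in at 0. h \<noteq> 0 \<and> \<bar>h\<bar> < t / 2"
    using t by (intro eventually_at[THEN iffD2] exI[of _ "t / 2"]) auto
  ultimately have "\<forall>\<^sub>F h in at 0. norm ((u (t + h) - u t) /\<^sub>R h) \<le> \<alpha> h"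
    by (auto elim: eventually_mono)
  moreover have "(\<alpha> \<longlongrightarrow> norm (accel (u t))) (at 0)"
  proof -
    have "isCont (\<lambda>h. t + min h 0) (0::real)" by (intro continuous_intros)
    moreover have "isCont (\<lambda>t. norm (accel (u t))) (t + min 0 0)" using cont by simp
    ultimately have "isCont (\<lambda>h. norm (accel (u (t + min h 0)))) (0::real)"
      by (rule isCont_o2)
    then have "isCont \<alpha> 0" unfolding \<alpha>_def by (rule isCont_add) (intro continuous_intros)
    then show ?thesis by (simp add: isCont_def \<alpha>_def)
  qed
  ultimately show ?thesis
    unfolding has_vector_derivative_at_iff_quotient
    by (intro difference_quotient_tendsto[OF y] evol_test_eventually[OF t] order_refl)
qed

text \<open>The damped norm of \<open>accel\<close> is monotone in time, hence continuous off a
  countable set. Countability of the exceptional set, stronger than measure zero, is used again for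
  the weak form of the material equation.\<close>

theorem evol_solution:
  shows "\<exists>N. countable N \<and> (\<forall>t>0. t \<notin> N \<longrightarrow> (\<exists>d. (u has_vector_derivative d) (at t) \<and> B (u t) - d \<in> A (u t)))"
proof -
  let ?f = "\<lambda>t. - (exp (- L * t) * norm (accel (u t)))"
  have "mono_on {0<..} ?f"
  proof (rule mono_onI)
    fix s t :: real assume st: "s \<in> {0<..}" "t \<in> {0<..}" "s \<le> t"
    have "exp (- L * t) * norm (accel (u t)) \<le> exp (- L * t) * (exp (L * (t - s)) * norm (accel (u s)))"
      using accel_decreasing[of s t] st by (intro mult_left_mono) auto
    also have "\<dots> = exp (- L * s) * norm (accel (u s))"
      by (simp add: mult.assoc[symmetric] algebra_simps flip: exp_add)
    finally show "?f s \<le> ?f t" by simp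
  qed
  then have "countable {t\<in>{0<..}. \<not> isCont ?f t}"
    by (rule mono_on_ctble_discont_open[OF open_greaterThan])
  moreover have "\<exists>d. (u has_vector_derivative d) (at t) \<and> B (u t) - d \<in> A (u t)"
    if t: "t > 0" "isCont ?f t" for t
  proof -
    have "isCont (\<lambda>t. - (exp (L * t) * ?f t)) t"
      by (rule isCont_minus[OF isCont_mult[OF _ t(2)]]) (intro continuous_intros)
    moreover have "(\<lambda>t. - (exp (L * t) * ?f t)) = (\<lambda>t. norm (accel (u t)))"
      by (simp add: mult.assoc[symmetric] flip: exp_add)
    ultimately have "(u has_vector_derivative - accel (u t)) (at t)"
      using evol_derivative[OF t(1)] by simp
    moreover have "B (u t) + accel (u t) \<in> A (u t)"
      using accel(1) evol_in_domain[OF t(1)] by blast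
    ultimately show ?thesis by (intro exI[of _ "- accel (u t)"]) simp
  qed
  ultimately show ?thesis by (intro exI[of _ "{t\<in>{0<..}. \<not> isCont ?f t}"]) auto
qed

end

end

section \<open>Stability of the evolution under convergence of resolvents\<close>

section \<open>Convergence of evolutions\<close>

text \<open>The two operators are compared only along the orbit of the second flow. Young's
  inequality 2 \<eta> d \<le> \<eta>^2 + d^2 turns the Gronwall constant 2 L into 2 L + 1.\<close>

lemma yosida_flow_compare:
  assumes "evolution A \<phi> B L" "evolution A' \<phi>' B L" and t: "0 \<le> t" "t \<le> T"
    and \<eta>: "\<And>s. 0 \<le> s \<Longrightarrow> s \<le> T \<Longrightarrow> norm (yosida A (inverse (Suc n)) (yosida_flow A' B n w s)
       - yosida A' (inverse (Suc n)) (yosida_flow A' B n w s)) \<le> \<eta>"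
  shows "norm (yosida_flow A B n w t - yosida_flow A' B n w t) \<le> exp ((L + 1) * T) * (\<eta> * sqrt T)"
proof -
  interpret P: evolution A \<phi> B L by fact
  interpret Q: evolution A' \<phi>' B L by fact
  have \<eta>0: "\<eta> \<ge> 0" using \<eta>[of 0] t by (intro order_trans[OF norm_ge_zero]) auto
  let ?u = "yosida_flow A B n w" and ?v = "yosida_flow A' B n w"
  let ?g = "\<lambda>t. (norm (?u t - ?v t))\<^sup>2"
  have "?g t \<le> exp ((2 * L + 1) * (t - 0)) * (?g 0 + \<eta>\<^sup>2 * (t - 0))"
  proof (rule gronwall_deriv)
    show "continuous_on {0..t} ?g" by (intro continuous_intros P.continuous_on_U Q.continuous_on_U) auto
    fix r assume r: "0 < r" "r < t"
    let ?d = "?u r - ?v r"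
    have "inner (P.V n (?u r) - Q.V n (?v r)) ?d = inner (P.V n (?u r) - P.V n (?v r)) ?d
       + inner (yosida A' (inverse (Suc n)) (?v r) - yosida A (inverse (Suc n)) (?v r)) ?d"
      by (simp add: yosida_field_def inner_diff_left)
    moreover have "inner (P.V n (?u r) - P.V n (?v r)) ?d \<le> L * ?g r"
      by (rule P.V_osl)
    moreover have "inner (yosida A' (inverse (Suc n)) (?v r) - yosida A (inverse (Suc n)) (?v r)) ?d \<le> \<eta> * norm ?d"
      using \<eta>[of r] r t by (intro order_trans[OF norm_cauchy_schwarz] mult_right_mono) (auto simp: norm_minus_commute)
    moreover have "2 * (\<eta> * norm ?d) \<le> \<eta>\<^sup>2 + ?g r"
      using sum_squares_bound[of \<eta> "norm ?d"] by simp
    ultimately have "2 * inner (P.V n (?u r) - Q.V n (?v r)) ?d \<le> (2 * L + 1) * ?g r + \<eta>\<^sup>2"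
      by (simp add: distrib_right)
    then show "\<exists>g'. (?g has_real_derivative g') (at r) \<and> g' \<le> (2 * L + 1) * ?g r + \<eta>\<^sup>2"
      using has_derivative_norm_square_diff[OF P.U_deriv Q.U_deriv, OF r(1) r(1)] by blast
  qed (use t P.L in auto)
  also have "\<dots> = exp ((2 * L + 1) * t) * (\<eta>\<^sup>2 * t)" by simp
  also have "\<dots> \<le> exp (2 * ((L + 1) * T)) * (\<eta>\<^sup>2 * T)"
  proof -
    have "(2 * L + 1) * t \<le> (2 * L + 2) * T" using t P.L by (intro mult_mono) auto
    then show ?thesis using t by (intro mult_mono) (auto simp: algebra_simps)
  qed
  also have "\<dots> = (exp ((L + 1) * T) * (\<eta> * sqrt T))\<^sup>2"
    using t by (simp add: power_mult_distrib exp_double)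
  finally show ?thesis by (rule power2_le_imp_le) (use \<eta>0 t in simp)
qed

text \<open>For fixed \<mu> all Yosida approximations share the Lipschitz constant 1/\<mu>, so
  convergence on a finite net is uniform convergence on the compact set.\<close>

lemma yosida_converges_on_compact:
  fixes A :: "real \<Rightarrow> 'a::{real_inner,banach} \<Rightarrow> 'a set"
  assumes M: "\<And>e. 0 < e \<Longrightarrow> e \<le> 1 \<Longrightarrow> maximal_monotone (A e)" and M0: "maximal_monotone A0"
    and res: "\<And>x. ((\<lambda>e. resolvent (A e) \<mu> x) \<longlongrightarrow> resolvent A0 \<mu> x) (at_right 0)"
    and C: "compact C" and \<mu>: "\<mu> > 0" and \<eta>: "\<eta> > 0"
  shows "\<forall>\<^sub>F e in at_right 0. \<forall>x\<in>C. norm (yosida (A e) \<mu> x - yosida A0 \<mu> x) \<le> \<eta>"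
proof -
  \<comment> \<open>Moving to a net point then costs at most \<eta>/3 for each of the two
    operators.\<close>
  define r where "r = \<eta> * \<mu> / 3"
  have r: "r > 0" using \<eta> \<mu> by (simp add: r_def)
  obtain F where F: "finite F" "F \<subseteq> C" "C \<subseteq> (\<Union>x\<in>F. ball x r)"
    using compactE_image[OF C, of C "\<lambda>x. ball x r"] r by (metis UN_I centre_in_ball open_ball subsetI)
  have "((\<lambda>e. norm (yosida (A e) \<mu> x - yosida A0 \<mu> x)) \<longlongrightarrow> norm (yosida A0 \<mu> x - yosida A0 \<mu> x)) (at_right 0)" for x
    unfolding yosida_def by (intro tendsto_intros res)
  then have "\<forall>\<^sub>F e in at_right 0. norm (yosida (A e) \<mu> x - yosida A0 \<mu> x) < \<eta> / 3" for x
    by (rule order_tendstoD) (use \<eta> in simp)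
  then have "\<forall>\<^sub>F e in at_right 0. \<forall>x\<in>F. norm (yosida (A e) \<mu> x - yosida A0 \<mu> x) < \<eta> / 3"
    using F(1) by (intro eventually_ball_finite) auto
  moreover have "\<forall>\<^sub>F e in at_right (0::real). 0 < e \<and> e \<le> 1"
    by (rule eventually_at_rightI[of 0 1]) auto
  ultimately show ?thesis
  proof eventually_elim
    case (elim e)
    interpret P: maximal_monotone "A e" using M elim(2) by simp
    interpret Q: maximal_monotone A0 by fact
    show ?case
    proof
      fix x assume "x \<in> C"
      then obtain x0 where x0: "x0 \<in> F" "dist x0 x < r" using F by auto
      have b: "norm (x - x0) / \<mu> \<le> \<eta> / 3" "norm (x0 - x) / \<mu> \<le> \<eta> / 3"
        using x0(2) \<mu> by (auto simp: dist_norm norm_minus_commute r_def field_simps)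
      have "yosida (A e) \<mu> x - yosida A0 \<mu> x = (yosida (A e) \<mu> x - yosida (A e) \<mu> x0)
          + (yosida (A e) \<mu> x0 - yosida A0 \<mu> x0) + (yosida A0 \<mu> x0 - yosida A0 \<mu> x)" by simp
      then have "norm (yosida (A e) \<mu> x - yosida A0 \<mu> x) \<le> norm (yosida (A e) \<mu> x - yosida (A e) \<mu> x0)
          + norm (yosida (A e) \<mu> x0 - yosida A0 \<mu> x0) + norm (yosida A0 \<mu> x0 - yosida A0 \<mu> x)"
        by (simp only:) (intro order_trans[OF norm_triangle_ineq] add_right_mono norm_triangle_ineq)
      also have "\<dots> \<le> \<eta> / 3 + \<eta> / 3 + \<eta> / 3"
        using elim(1) x0(1) by (intro add_mono order_trans[OF P.yosida_lipschitz[OF \<mu>]] order_trans[OF Q.yosida_lipschitz[OF \<mu>]] b) auto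
      finally show "norm (yosida (A e) \<mu> x - yosida A0 \<mu> x) \<le> \<eta>" by simp
    qed
  qed
qed

text \<open>Five errors of size \<delta>/8: initial point and Yosida index for each operator, and
  the distance of the two Yosida flows. The index n is fixed first, by a rate valid for all e at
  once; afterwards e tends to 0 along one fixed flow, whose orbit is compact. W consists of points
  where the operators have uniformly bounded elements.\<close>

theorem evol_converges:
  fixes A :: "real \<Rightarrow> 'a::{real_inner,banach} \<Rightarrow> 'a set"
  assumes E: "\<And>e. 0 < e \<Longrightarrow> e \<le> 1 \<Longrightarrow> evolution (A e) (\<phi> e) B L" and E0: "evolution A0 \<phi>0 B L"
    and res: "\<And>\<mu> x. \<mu> > 0 \<Longrightarrow> ((\<lambda>e. resolvent (A e) \<mu> x) \<longlongrightarrow> resolvent A0 \<mu> x) (at_right 0)"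
    and w: "w \<in> closure W" and T: "T \<ge> 0"
    and W: "\<And>w. w \<in> W \<Longrightarrow> \<exists>c. (\<exists>y\<in>A0 w. norm y \<le> c) \<and> (\<forall>e. 0 < e \<longrightarrow> e \<le> 1 \<longrightarrow> (\<exists>y\<in>A e w. norm y \<le> c))"
  shows "uniform_limit {0..T} (\<lambda>e t. evol (A e) B t w) (\<lambda>t. evol A0 B t w) (at_right 0)"
  unfolding uniform_limit_iff
proof (intro allI impI)
  fix \<delta> :: real assume \<delta>: "\<delta> > 0"
  interpret Q: evolution A0 \<phi>0 B L by fact
  obtain w' where w': "w' \<in> W" "dist w' w < \<delta> / 8 / exp (L * T)"
    using w \<delta> unfolding closure_approachable by (meson divide_pos_pos exp_gt_zero zero_less_numeral)
  then obtain c0 where c0: "\<exists>y\<in>A0 w'. norm y \<le> c0" "\<And>e. 0 < e \<Longrightarrow> e \<le> 1 \<Longrightarrow> \<exists>y\<in>A e w'. norm y \<le> c0"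
    using W by metis
  define c where "c = c0 + norm (B w')"
  have "\<forall>\<^sub>F n in sequentially. yosida_rate L T c n < \<delta> / 8"
    using \<delta> by (intro order_tendstoD(2)[OF yosida_rate_tendsto]) simp
  then obtain n where n: "yosida_rate L T c n < \<delta> / 8" by (auto simp: eventually_sequentially)
  \<comment> \<open>Solves the bound of \<open>yosida_flow_compare\<close> for \<delta>/8; the added
    1 keeps the denominator positive when T = 0.\<close>
  define \<eta> where "\<eta> = \<delta> / 8 / (exp ((L + 1) * T) * (sqrt T + 1))"
  have \<eta>: "\<eta> > 0" using \<delta> T by (simp add: \<eta>_def add_nonneg_pos)
  have small: "exp ((L + 1) * T) * (\<eta> * sqrt T) \<le> \<delta> / 8"
  proof -
    have "exp ((L + 1) * T) * (\<eta> * sqrt T) \<le> exp ((L + 1) * T) * (\<eta> * (sqrt T + 1))"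
      using \<eta> T by (intro mult_left_mono) auto
    also have "\<dots> = \<delta> / 8"
      using real_sqrt_ge_zero[OF T] by (simp add: \<eta>_def field_simps add_nonneg_eq_0_iff)
    finally show ?thesis .
  qed
  have clW: "W \<subseteq> {x. A0 x \<noteq> {}}" "\<And>e. 0 < e \<Longrightarrow> e \<le> 1 \<Longrightarrow> W \<subseteq> {x. A e x \<noteq> {}}"
    using W by blast+
  have "\<forall>\<^sub>F e in at_right 0. \<forall>x\<in>(yosida_flow A0 B n w') ` {0..T}.
      norm (yosida (A e) (inverse (Suc n)) x - yosida A0 (inverse (Suc n)) x) \<le> \<eta>"
  proof (rule yosida_converges_on_compact)
    show "compact (yosida_flow A0 B n w' ` {0..T})"
      by (intro compact_continuous_image Q.continuous_on_U) auto
    show "maximal_monotone (A e)" if "0 < e" "e \<le> 1" for e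
      using E[OF that] by (simp add: evolution_def)
    show "maximal_monotone A0" using E0 by (simp add: evolution_def)
  qed (use \<eta> res in auto)
  moreover have "\<forall>\<^sub>F e in at_right (0::real). 0 < e \<and> e \<le> 1"
    by (rule eventually_at_rightI[of 0 1]) auto
  ultimately show "\<forall>\<^sub>F e in at_right 0. \<forall>t\<in>{0..T}. dist (evol (A e) B t w) (evol A0 B t w) < \<delta>"
  proof eventually_elim
    case (elim e)
    interpret P: evolution "A e" "\<phi> e" B L using E elim(2) by simp
    show ?case
    proof
      fix t assume t: "t \<in> {0..T}"
      obtain y where y: "y \<in> A e w'" "norm y + norm (B w') \<le> c" using c0(2)[of e] elim(2) unfolding c_def by auto
      obtain y' where y': "y' \<in> A0 w'" "norm y' + norm (B w') \<le> c" using c0(1) unfolding c_def by auto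
      have cl: "w \<in> closure {x. A0 x \<noteq> {}}" "w \<in> closure {x. A e x \<noteq> {}}"
        "w' \<in> closure {x. A0 x \<noteq> {}}" "w' \<in> closure {x. A e x \<noteq> {}}"
        using w clW(1) clW(2)[of e] elim(2) w'(1) closure_mono closure_subset by (meson subsetD)+
      have ww: "exp (L * T) * norm (w - w') < \<delta> / 8" "exp (L * T) * norm (w' - w) < \<delta> / 8"
        using w'(2) by (auto simp: dist_norm norm_minus_commute field_simps)
      have 1: "dist (evol (A e) B t w) (evol (A e) B t w') < \<delta> / 8"
        unfolding dist_norm using t by (intro le_less_trans[OF P.evol_dist[of _ _ t T] ww(1)] cl) auto
      have 2: "dist (evol (A e) B t w') (yosida_flow (A e) B n w' t) < \<delta> / 8"
        unfolding dist_norm using t P.evol_rate[OF y, of t T n] n by (simp add: norm_minus_commute)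
      have 3: "dist (yosida_flow (A e) B n w' t) (yosida_flow A0 B n w' t) \<le> \<delta> / 8"
        unfolding dist_norm
        by (rule order_trans[OF yosida_flow_compare[OF P.evolution_axioms E0, where \<eta> = \<eta> and T = T] small])
           (use t elim(1) in auto)
      have 4: "dist (yosida_flow A0 B n w' t) (evol A0 B t w') < \<delta> / 8"
        unfolding dist_norm using t Q.evol_rate[OF y', of t T n] n by simp
      have 5: "dist (evol A0 B t w') (evol A0 B t w) < \<delta> / 8"
        unfolding dist_norm using t by (intro le_less_trans[OF Q.evol_dist[of _ _ t T] ww(2)] cl) auto
      show "dist (evol (A e) B t w) (evol A0 B t w) < \<delta>"
        using 1 2 3 4 5 dist_triangle[of "evol (A e) B t w" "evol A0 B t w" "evol (A e) B t w'"]
          dist_triangle[of "evol (A e) B t w'" "evol A0 B t w" "yosida_flow (A e) B n w' t"]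
          dist_triangle[of "yosida_flow (A e) B n w' t" "evol A0 B t w" "yosida_flow A0 B n w' t"]
          dist_triangle[of "yosida_flow A0 B n w' t" "evol A0 B t w" "evol A0 B t w'"] \<delta>
        by linarith
    qed
  qed
qed

section \<open>Absolutely continuous functions and uniqueness of strong solutions\<close>

section \<open>Absolute continuity and uniqueness\<close>

lemma division_interval:
  fixes J :: "real set"
  assumes "D division_of \<Union>D" "\<Union>D \<subseteq> {s..t}" "J \<in> D"
  obtains a b where "J = {a..b}" "s \<le> a" "a \<le> b" "b \<le> t" "Inf J = a" "Sup J = b"
proof -
  obtain a b where ab: "J = cbox a b" using division_ofD(4)[OF assms(1,3)] by blast
  moreover have "J \<noteq> {}" by (rule division_ofD(3)[OF assms(1,3)])
  ultimately have "a \<le> b" "J = {a..b}" by auto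
  moreover have "J \<subseteq> {s..t}" using assms(2,3) by blast
  ultimately show ?thesis by (intro that[of a b]) auto
qed

text \<open>Meant for squares and products of bounded functions, whose increments are dominated by
  those of the factors.\<close>

lemma abs_cont_on_dominated:
  assumes u: "abs_cont_on s t u" and v: "abs_cont_on s t v" and C: "C > 0"
    and dom: "\<And>a b. s \<le> a \<Longrightarrow> a \<le> b \<Longrightarrow> b \<le> t \<Longrightarrow> norm (f b - f a) \<le> C * (norm (u b - u a) + norm (v b - v a))"
  shows "abs_cont_on s t f"
  unfolding abs_cont_on_def
proof (intro allI impI)
  fix e :: real assume e: "e > 0"
  let ?ok = "\<lambda>D d. D division_of \<Union>D \<and> \<Union>D \<subseteq> {s..t} \<and> (\<Sum>J\<in>D. measure lborel J) < d"
  have e2: "e / (2 * C) > 0" using e C by simp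
  obtain d1 where d1: "d1 > 0" "\<And>D. ?ok D d1 \<Longrightarrow> (\<Sum>J\<in>D. norm (u (Sup J) - u (Inf J))) < e / (2 * C)"
    using u e2 unfolding abs_cont_on_def by meson
  obtain d2 where d2: "d2 > 0" "\<And>D. ?ok D d2 \<Longrightarrow> (\<Sum>J\<in>D. norm (v (Sup J) - v (Inf J))) < e / (2 * C)"
    using v e2 unfolding abs_cont_on_def by meson
  have "(\<Sum>J\<in>D. norm (f (Sup J) - f (Inf J))) < e" if D: "?ok D (min d1 d2)" for D
  proof -
    have "(\<Sum>J\<in>D. norm (f (Sup J) - f (Inf J)))
        \<le> (\<Sum>J\<in>D. C * (norm (u (Sup J) - u (Inf J)) + norm (v (Sup J) - v (Inf J))))"
    proof (rule sum_mono)
      fix J assume "J \<in> D"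
      then obtain a b where "J = {a..b}" "s \<le> a" "a \<le> b" "b \<le> t" "Inf J = a" "Sup J = b"
        using division_interval D by metis
      then show "norm (f (Sup J) - f (Inf J)) \<le> C * (norm (u (Sup J) - u (Inf J)) + norm (v (Sup J) - v (Inf J)))"
        using dom by auto
    qed
    also have "\<dots> = C * ((\<Sum>J\<in>D. norm (u (Sup J) - u (Inf J))) + (\<Sum>J\<in>D. norm (v (Sup J) - v (Inf J))))"
      by (simp only: sum_distrib_left[symmetric] sum.distrib)
    also have "\<dots> < C * (e / (2 * C) + e / (2 * C))"
      using d1(2)[of D] d2(2)[of D] D C by (intro mult_strict_left_mono add_strict_mono) auto
    also have "\<dots> = e" using C by (simp add: field_simps)
    finally show ?thesis .
  qed
  then show "\<exists>d>0. \<forall>D. ?ok D d \<longrightarrow> (\<Sum>J\<in>D. norm (f (Sup J) - f (Inf J))) < e"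
    using d1(1) d2(1) by (intro exI[of _ "min d1 d2"]) auto
qed

lemma abs_cont_on_lipschitz:
  assumes lip: "\<And>a b. s \<le> a \<Longrightarrow> a \<le> b \<Longrightarrow> b \<le> t \<Longrightarrow> norm (f b - f a) \<le> C * (b - a)" and C: "C > 0"
  shows "abs_cont_on s t f"
  unfolding abs_cont_on_def
proof (intro allI impI)
  fix e :: real assume e: "e > 0"
  have "(\<Sum>J\<in>D. norm (f (Sup J) - f (Inf J))) < e"
    if D: "D division_of \<Union>D" "\<Union>D \<subseteq> {s..t}" "(\<Sum>J\<in>D. measure lborel J) < e / C" for D
  proof -
    have "(\<Sum>J\<in>D. norm (f (Sup J) - f (Inf J))) \<le> (\<Sum>J\<in>D. C * measure lborel J)"
    proof (rule sum_mono)
      fix J assume "J \<in> D"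
      then obtain a b where "J = {a..b}" "s \<le> a" "a \<le> b" "b \<le> t" "Inf J = a" "Sup J = b"
        using division_interval D(1,2) by metis
      then show "norm (f (Sup J) - f (Inf J)) \<le> C * measure lborel J"
        using lip by auto
    qed
    also have "\<dots> < e" using D(3) C by (simp add: sum_distrib_left[symmetric] field_simps)
    finally show ?thesis .
  qed
  then show "\<exists>d>0. \<forall>D. D division_of \<Union>D \<and> \<Union>D \<subseteq> {s..t} \<and> (\<Sum>J\<in>D. measure lborel J) < d
      \<longrightarrow> (\<Sum>J\<in>D. norm (f (Sup J) - f (Inf J))) < e"
    using e C by (intro exI[of _ "e / C"]) auto
qed

text \<open>Members of a division may share endpoints, but their interiors are disjoint and have the
  same measure, so additivity applies to those.\<close>

lemma division_content_le_measure:
  fixes W :: "real set"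
  assumes D: "D division_of \<Union>D" "\<Union>D \<subseteq> W" and W: "W \<in> sets lborel" "emeasure lborel W < \<infinity>"
  shows "(\<Sum>J\<in>D. measure lborel J) \<le> measure lborel W"
proof -
  have fin: "finite D" by (rule division_of_finite[OF D(1)])
  have J: "\<exists>a b. J = {a..b} \<and> a \<le> b" if "J \<in> D" for J
    using division_ofD(3,4)[OF D(1) that] by auto
  have m: "measure lborel (interior J) = measure lborel J" "emeasure lborel (interior J) \<noteq> \<infinity>" if "J \<in> D" for J
    using J[OF that] by (auto simp: interior_atLeastAtMost_real)
  have "(\<Sum>J\<in>D. measure lborel J) = (\<Sum>J\<in>D. measure lborel (interior J))"
    using m by simp
  also have "\<dots> = measure lborel (\<Union>J\<in>D. interior J)"
    using fin m division_ofD(5)[OF D(1)]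
    by (intro measure_finite_Union[symmetric]) (auto simp: disjoint_family_on_def)
  also have "\<dots> \<le> measure lborel W"
  proof (rule measure_mono_fmeasurable)
    show "(\<Union>J\<in>D. interior J) \<subseteq> W" using D(2) interior_subset by blast
    show "W \<in> fmeasurable lborel" using W by (simp add: fmeasurable_def)
  qed (auto intro!: borel_open)
  finally show ?thesis .
qed

text \<open>Cousin's lemma with a gauge that confines the tags in the exceptional null set to an open set
  so small that absolute continuity controls the corresponding increments.\<close>

lemma abs_cont_nonincreasing:
  fixes g :: "real \<Rightarrow> real"
  assumes ac: "abs_cont_on s t g" and st: "s < t"
    and deriv: "AE r in lborel. s < r \<longrightarrow> r < t \<longrightarrow> (\<exists>g'. (g has_real_derivative g') (at r) \<and> g' \<le> 0)"
  shows "g t \<le> g s"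
proof (rule field_le_epsilon)
  fix e' :: real assume e': "e' > 0"
  define e where "e = e' / (1 + (t - s))"
  have e: "e > 0" "e * (1 + (t - s)) = e'" using e' st by (auto simp: e_def)
  obtain d where d: "d > 0" "\<And>D. D division_of \<Union>D \<and> \<Union>D \<subseteq> {s..t} \<and> (\<Sum>J\<in>D. measure lborel J) < d
     \<Longrightarrow> (\<Sum>J\<in>D. norm (g (Sup J) - g (Inf J))) < e"
    using ac e(1) unfolding abs_cont_on_def by meson
  obtain N0 where N0: "N0 \<in> null_sets lborel"
    "\<And>r. r \<notin> N0 \<Longrightarrow> s < r \<Longrightarrow> r < t \<Longrightarrow> \<exists>g'. (g has_real_derivative g') (at r) \<and> g' \<le> 0"
  proof -
    obtain N where "{r \<in> space lborel. \<not> (s < r \<longrightarrow> r < t \<longrightarrow> (\<exists>g'. (g has_real_derivative g') (at r) \<and> g' \<le> 0))} \<subseteq> N"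
      "N \<in> null_sets lborel"
      using deriv unfolding eventually_ae_filter by blast
    then show ?thesis by (intro that[of N]) auto
  qed
  \<comment> \<open>The endpoints join the exceptional set, because the derivative is known only
    strictly inside the interval.\<close>
  define N where "N = N0 \<union> {s, t}"
  have N: "N \<in> null_sets lborel" unfolding N_def
    using null_sets.Un[OF N0(1) finite_imp_null_set_lborel[of "{s, t}"]] by simp
  then have Nb: "N \<in> sets borel" by auto
  obtain W where W: "open W" "N \<subseteq> W" "emeasure lborel (W - N) < ennreal d"
    by (rule outer_regular_lborel[OF Nb d(1)])
  have Wm: "emeasure lborel W < ennreal d"
  proof -
    have "emeasure lborel ((W - N) \<union> N) = emeasure lborel (W - N)"
      using W(1) N by (intro emeasure_Un_null_set) auto
    moreover have "(W - N) \<union> N = W" using W(2) by blast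
    ultimately show ?thesis using W(3) by (simp only:)
  qed
  have "\<exists>\<delta>>0. \<forall>y. \<bar>y - r\<bar> < \<delta> \<longrightarrow> (y \<ge> r \<longrightarrow> g y - g r \<le> e * (y - r)) \<and> (y \<le> r \<longrightarrow> g r - g y \<le> e * (r - y))"
    if r: "r \<notin> N" "s \<le> r" "r \<le> t" for r
  proof -
    have "s < r" "r < t" using r unfolding N_def by force+
    then obtain g' where g': "(g has_real_derivative g') (at r)" "g' \<le> 0" using N0(2)[of r] r unfolding N_def by auto
    have "\<exists>\<delta>>0. \<forall>y. norm (y - r) < \<delta> \<longrightarrow> norm (g y - g r - g' * (y - r)) \<le> e * norm (y - r)"
      using g'(1) e(1) unfolding has_field_derivative_def has_derivative_at_alt by blast
    then obtain \<delta> where \<delta>: "\<delta> > 0" "\<And>y. \<bar>y - r\<bar> < \<delta> \<Longrightarrow> \<bar>g y - g r - g' * (y - r)\<bar> \<le> e * \<bar>y - r\<bar>" by auto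
    have "(y \<ge> r \<longrightarrow> g y - g r \<le> e * (y - r)) \<and> (y \<le> r \<longrightarrow> g r - g y \<le> e * (r - y))" if "\<bar>y - r\<bar> < \<delta>" for y
    proof -
      have "y \<ge> r \<Longrightarrow> g' * (y - r) \<le> 0" "y \<le> r \<Longrightarrow> g' * (y - r) \<ge> 0"
        using g'(2) by (auto simp: mult_nonpos_nonneg mult_nonpos_nonpos)
      then show ?thesis using \<delta>(2)[OF that] by (auto simp: abs_if split: if_splits)
    qed
    then show ?thesis using \<delta>(1) by blast
  qed
  then obtain \<delta> where \<delta>: "\<And>r. r \<notin> N \<Longrightarrow> s \<le> r \<Longrightarrow> r \<le> t \<Longrightarrow> \<delta> r > 0"
     "\<And>r y. r \<notin> N \<Longrightarrow> s \<le> r \<Longrightarrow> r \<le> t \<Longrightarrow> \<bar>y - r\<bar> < \<delta> r \<Longrightarrow> (y \<ge> r \<longrightarrow> g y - g r \<le> e * (y - r)) \<and> (y \<le> r \<longrightarrow> g r - g y \<le> e * (r - y))"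
    by metis
  define \<gamma> where "\<gamma> r = (if r \<in> N then W else if s \<le> r \<and> r \<le> t then ball r (\<delta> r) else UNIV)" for r
  have "gauge \<gamma>" unfolding gauge_def \<gamma>_def using W(1,2) \<delta>(1) by auto
  then obtain p where p: "p tagged_division_of {s..t}" "\<gamma> fine p"
    using fine_division_exists_real by blast
  note pD = tagged_division_ofD[OF p(1)]
  let ?p1 = "{xk\<in>p. fst xk \<in> N}" and ?p2 = "{xk\<in>p. fst xk \<notin> N}"
  let ?G = "\<lambda>K. g (Sup K) - g (Inf K)"
  have int: "\<exists>a b. k = {a..b} \<and> a \<le> b \<and> x \<in> k \<and> s \<le> a \<and> b \<le> t \<and> Sup k = b \<and> Inf k = a" if xk: "(x, k) \<in> p" for x k
  proof -
    obtain a b where ab: "k = cbox a b" using pD(4)[OF xk] by blast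
    moreover have "x \<in> k" "k \<subseteq> {s..t}" using pD(2,3)[OF xk] by auto
    ultimately show ?thesis by (intro exI[of _ a] exI[of _ b]) auto
  qed
  have "g t - g s = (\<Sum>(x,k)\<in>p. ?G k)"
    using additive_tagged_division_1[of s t p g] st p(1) by simp
  also have "p = ?p1 \<union> ?p2" by auto
  also have "(\<Sum>(x,k)\<in>?p1 \<union> ?p2. ?G k) = (\<Sum>(x,k)\<in>?p1. ?G k) + (\<Sum>(x,k)\<in>?p2. ?G k)"
    by (rule sum.union_disjoint) (use pD(1) in auto)
  also have "(\<Sum>(x,k)\<in>?p2. ?G k) \<le> (\<Sum>(x,k)\<in>?p2. e * measure lborel k)"
  proof (rule sum_mono, clarify)
    fix x k assume xk: "(x, k) \<in> p" "fst (x, k) \<notin> N"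
    obtain a b where ab: "k = {a..b}" "a \<le> b" "x \<in> k" "s \<le> a" "b \<le> t" "Sup k = b" "Inf k = a" using int[OF xk(1)] by blast
    have "k \<subseteq> \<gamma> x" using p(2) xk(1) unfolding fine_def by blast
    then have "k \<subseteq> ball x (\<delta> x)" using xk(2) ab unfolding \<gamma>_def by auto
    moreover have "a \<in> k" "b \<in> k" using ab(1,2) by auto
    ultimately have "a \<in> ball x (\<delta> x)" "b \<in> ball x (\<delta> x)" by auto
    then have "\<bar>a - x\<bar> < \<delta> x" "\<bar>b - x\<bar> < \<delta> x" by (auto simp: dist_real_def abs_minus_commute)
    then have "g x - g a \<le> e * (x - a)" "g b - g x \<le> e * (b - x)"
      using \<delta>(2)[of x] xk(2) ab by auto
    then have "g b - g a \<le> e * (b - a)" by (simp add: algebra_simps)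
    then show "?G k \<le> e * measure lborel k" using ab by simp
  qed
  also have "\<dots> \<le> (\<Sum>(x,k)\<in>p. e * measure lborel k)"
    using e(1) pD(1) by (intro sum_mono2) (auto intro: mult_nonneg_nonneg)
  also have "\<dots> = e * (\<Sum>(x,k)\<in>p. measure lborel k)"
    by (simp add: sum_distrib_left case_prod_unfold)
  also have "(\<Sum>(x,k)\<in>p. measure lborel k) = t - s"
    using additive_content_tagged_division[of p s t] p(1) st by simp
  also have "(\<Sum>(x,k)\<in>?p1. ?G k) \<le> (\<Sum>(x,k)\<in>?p1. norm (?G k))"
    by (intro sum_mono) auto
  also have "\<dots> < e"
  proof -
    have "p tagged_partial_division_of {s..t}" using p(1) by (simp add: tagged_division_of_def)
    then have part: "?p1 tagged_partial_division_of {s..t}" by (rule tagged_partial_division_subset) auto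
    define D where "D = snd ` ?p1"
    have D: "D division_of \<Union>D" unfolding D_def by (rule partial_division_of_tagged_division[OF part])
    \<comment> \<open>The summation rule over divisions asks for the value 0 on degenerate boxes,
      including the empty one, whose supremum and infimum mean nothing.\<close>
    define G where "G k = (if k = {} then 0 else norm (?G k))" for k
    have "(\<Sum>(x,k)\<in>?p1. norm (?G k)) = (\<Sum>(x,k)\<in>?p1. G k)"
      by (intro sum.cong) (auto simp: G_def dest: pD(2))
    also have "\<dots> = (\<Sum>k\<in>D. G k)"
      unfolding D_def
    proof (rule sum.over_tagged_division_lemma[OF tagged_partial_division_of_Union_self[OF part]])
      fix u v :: real assume "box u v = {}"
      then have "v \<le> u" by auto
      then show "G (cbox u v) = 0" by (cases "u = v") (auto simp: G_def)
    qed
    also have "\<dots> = (\<Sum>k\<in>D. norm (?G k))"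
      using division_ofD(3)[OF D] by (intro sum.cong) (auto simp: G_def)
    also have "\<dots> < e"
    proof (rule d(2), intro conjI D)
      show "\<Union>D \<subseteq> {s..t}" unfolding D_def using pD(3) by force
      have "(\<Sum>J\<in>D. measure lborel J) \<le> measure lborel W"
      proof (rule division_content_le_measure[OF D])
        show "\<Union>D \<subseteq> W"
        proof
          fix y assume "y \<in> \<Union>D"
          then obtain x k where "(x, k) \<in> p" "x \<in> N" "y \<in> k" unfolding D_def by auto
          then show "y \<in> W" using p(2) unfolding fine_def \<gamma>_def by fastforce
        qed
        show "emeasure lborel W < \<infinity>" using Wm by (rule less_trans) simp
      qed (use W(1) in simp)
      also have "measure lborel W < d"
        using Wm d(1) by (metis ennreal_less_iff emeasure_eq_ennreal_measure ennreal_less_top less_trans less_top measure_nonneg order_less_irrefl)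
      finally show "(\<Sum>J\<in>D. measure lborel J) < d" .
    qed
    finally show ?thesis .
  qed
  finally have "g t - g s < e + e * (t - s)" by simp
  then show "g t \<le> g s + e'" using e(2) by (simp add: distrib_left)
qed

text \<open>The abstract counterpart of \<open>is_solution\<close>: both equations are merged into
  the single inclusion B u - u' in A u for the pair.\<close>

definition strong_solution :: "('a::real_inner \<Rightarrow> 'a set) \<Rightarrow> ('a \<Rightarrow> 'a) \<Rightarrow> (real \<Rightarrow> 'a) \<Rightarrow> bool" where
  "strong_solution A B u \<longleftrightarrow> continuous_on {0..} u \<and> (\<forall>s t. 0 < s \<and> s < t \<longrightarrow> abs_cont_on s t u) \<and>
    (AE t in lborel. 0 < t \<longrightarrow> (\<exists>d. (u has_vector_derivative d) (at t) \<and> B (u t) - d \<in> A (u t)))"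

text \<open>The squared distance damped by exp(- 2 L t) is absolutely continuous with nonpositive
  derivative almost everywhere: monotonicity disposes of A and the one-sided constant of B.\<close>

lemma strong_solution_dist:
  fixes A :: "'a::real_inner \<Rightarrow> 'a set"
  assumes mono: "\<And>x x' y y'. y \<in> A x \<Longrightarrow> y' \<in> A x' \<Longrightarrow> 0 \<le> inner (y - y') (x - x')"
    and osl: "\<And>x y. inner (B x - B y) (x - y) \<le> L * (norm (x - y))\<^sup>2"
    and u: "strong_solution A B u" and v: "strong_solution A B v" and st: "0 < s" "s < t"
  shows "(norm (u t - v t))\<^sup>2 * exp (- (2 * L) * t) \<le> (norm (u s - v s))\<^sup>2 * exp (- (2 * L) * s)"
proof -
  have cont: "continuous_on {s..t} u" "continuous_on {s..t} v"
    using u v st unfolding strong_solution_def by (auto intro: continuous_on_subset)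
  have ac: "abs_cont_on s t u" "abs_cont_on s t v"
    using u v st unfolding strong_solution_def by auto
  let ?g = "\<lambda>t. (norm (u t - v t))\<^sup>2" and ?e = "\<lambda>t. exp (- (2 * L) * t)"
  have "bounded ((\<lambda>t. u t - v t) ` {s..t})"
    by (intro compact_imp_bounded compact_continuous_image continuous_intros cont) auto
  then obtain M where M: "M > 0" "\<And>r. r \<in> {s..t} \<Longrightarrow> norm (u r - v r) \<le> M"
    unfolding bounded_pos by auto
  have acg: "abs_cont_on s t ?g"
  proof (rule abs_cont_on_dominated[OF ac, of "2 * M"])
    fix a b assume ab: "s \<le> a" "a \<le> b" "b \<le> t"
    have "norm (?g b - ?g a) = \<bar>norm (u b - v b) - norm (u a - v a)\<bar> * \<bar>norm (u b - v b) + norm (u a - v a)\<bar>"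
      unfolding abs_mult[symmetric] by (simp add: power2_eq_square algebra_simps)
    also have "\<dots> \<le> (norm (u b - u a) + norm (v b - v a)) * (2 * M)"
    proof (rule mult_mono)
      have "\<bar>norm (u b - v b) - norm (u a - v a)\<bar> \<le> norm ((u b - v b) - (u a - v a))"
        by (rule norm_triangle_ineq3)
      also have "(u b - v b) - (u a - v a) = (u b - u a) - (v b - v a)" by simp
      also have "norm \<dots> \<le> norm (u b - u a) + norm (v b - v a)" by (rule norm_triangle_ineq4)
      finally show "\<bar>norm (u b - v b) - norm (u a - v a)\<bar> \<le> norm (u b - u a) + norm (v b - v a)" .
    qed (use M(2)[of a] M(2)[of b] ab in auto)
    finally show "norm (?g b - ?g a) \<le> 2 * M * (norm (u b - u a) + norm (v b - v a))" by (simp add: mult.commute)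
  qed (use M in simp)
  have conte: "continuous_on {s..t} ?e" by (intro continuous_intros)
  have "bounded (?e ` {s..t})"
    by (intro compact_imp_bounded compact_continuous_image conte) auto
  then obtain E where E: "E > 0" "\<And>r. r \<in> {s..t} \<Longrightarrow> ?e r \<le> E"
    unfolding bounded_pos by auto
  have ace: "abs_cont_on s t ?e"
  proof (rule abs_cont_on_lipschitz)
    fix a b assume ab: "s \<le> a" "a \<le> b" "b \<le> t"
    show "norm (?e b - ?e a) \<le> ((2 * \<bar>L\<bar> + 1) * E) * (b - a)"
    proof (rule deriv_bound_imp_lipschitz[OF ab(2)])
      show "continuous_on {a..b} ?e" by (intro continuous_intros)
      show "(?e has_vector_derivative (- (2 * L) * ?e r)) (at r)" for r
        by (auto intro!: derivative_eq_intros simp flip: has_real_derivative_iff_has_vector_derivative)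
      fix r assume "a < r" "r < b"
      then have "?e r \<le> E" using ab by (intro E(2)) auto
      then show "norm (- (2 * L) * ?e r) \<le> (2 * \<bar>L\<bar> + 1) * E"
        unfolding norm_mult using E(1) by (intro mult_mono) auto
    qed
  qed (use E in simp)
  have "abs_cont_on s t (\<lambda>t. ?g t * ?e t)"
  proof (rule abs_cont_on_dominated[OF acg ace, of "E + M\<^sup>2"])
    fix a b assume ab: "s \<le> a" "a \<le> b" "b \<le> t"
    have "?g b * ?e b - ?g a * ?e a = (?g b - ?g a) * ?e b + ?g a * (?e b - ?e a)" by (simp add: algebra_simps)
    then have "norm (?g b * ?e b - ?g a * ?e a) \<le> norm (?g b - ?g a) * ?e b + ?g a * norm (?e b - ?e a)"
      using norm_triangle_ineq[of "(?g b - ?g a) * ?e b" "?g a * (?e b - ?e a)"] by (simp only: norm_mult) simp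
    also have "\<dots> \<le> norm (?g b - ?g a) * (E + M\<^sup>2) + (E + M\<^sup>2) * norm (?e b - ?e a)"
    proof (intro add_mono mult_left_mono mult_right_mono)
      show "?e b \<le> E + M\<^sup>2" using E(2)[of b] ab by (simp add: add_increasing2)
      have "?g a \<le> M\<^sup>2" using M(2)[of a] ab by (intro power_mono) auto
      then show "?g a \<le> E + M\<^sup>2" using E(1) by simp
    qed auto
    finally show "norm (?g b * ?e b - ?g a * ?e a) \<le> (E + M\<^sup>2) * (norm (?g b - ?g a) + norm (?e b - ?e a))"
      by (simp add: algebra_simps)
  qed (use E in \<open>simp add: add_pos_nonneg\<close>)
  moreover have "AE r in lborel. s < r \<longrightarrow> r < t \<longrightarrow>
      (\<exists>h'. ((\<lambda>t. ?g t * ?e t) has_real_derivative h') (at r) \<and> h' \<le> 0)"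
  proof -
    have "AE t in lborel. 0 < t \<longrightarrow> (\<exists>d. (u has_vector_derivative d) (at t) \<and> B (u t) - d \<in> A (u t))"
      "AE t in lborel. 0 < t \<longrightarrow> (\<exists>d. (v has_vector_derivative d) (at t) \<and> B (v t) - d \<in> A (v t))"
      using u v by (simp_all add: strong_solution_def)
    then show ?thesis
    proof eventually_elim
      case (elim r)
      show ?case
      proof (intro impI)
        assume r: "s < r" "r < t"
        then obtain d d' where d: "(u has_vector_derivative d) (at r)" "B (u r) - d \<in> A (u r)"
          and d': "(v has_vector_derivative d') (at r)" "B (v r) - d' \<in> A (v r)" using elim st by force
        have "0 \<le> inner ((B (u r) - d) - (B (v r) - d')) (u r - v r)" by (rule mono[OF d(2) d'(2)])
        then have "2 * inner (d - d') (u r - v r) \<le> 2 * inner (B (u r) - B (v r)) (u r - v r)"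
          by (simp add: inner_diff_left)
        also have "\<dots> \<le> 2 * L * ?g r" using osl[of "u r" "v r"] by simp
        finally have le: "2 * inner (d - d') (u r - v r) \<le> 2 * L * ?g r" .
        have "(?e has_real_derivative (- (2 * L) * ?e r)) (at r)"
          by (auto intro!: derivative_eq_intros)
        from DERIV_mult[OF has_derivative_norm_square_diff[OF d(1) d'(1)] this]
        have "((\<lambda>t. ?g t * ?e t) has_real_derivative (2 * inner (d - d') (u r - v r) - 2 * L * ?g r) * ?e r) (at r)"
          by (rule DERIV_cong) (simp add: algebra_simps)
        moreover have "(2 * inner (d - d') (u r - v r) - 2 * L * ?g r) * ?e r \<le> 0"
          using le by (intro mult_nonpos_nonneg) auto
        ultimately show "\<exists>h'. ((\<lambda>t. ?g t * ?e t) has_real_derivative h') (at r) \<and> h' \<le> 0" by blast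
      qed
    qed
  qed
  ultimately show ?thesis using abs_cont_nonincreasing[of s t "\<lambda>t. ?g t * ?e t"] st(2) by simp
qed

text \<open>Absolute continuity holds only away from time 0, so the comparison starts at s > 0 and s
  then decreases to 0 by continuity.\<close>

lemma strong_solution_unique:
  fixes A :: "'a::real_inner \<Rightarrow> 'a set"
  assumes mono: "\<And>x x' y y'. y \<in> A x \<Longrightarrow> y' \<in> A x' \<Longrightarrow> 0 \<le> inner (y - y') (x - x')"
    and osl: "\<And>x y. inner (B x - B y) (x - y) \<le> L * (norm (x - y))\<^sup>2"
    and u: "strong_solution A B u" and v: "strong_solution A B v" and 0: "u 0 = v 0" and t: "t \<ge> 0"
  shows "u t = v t"
proof (cases "t = 0")
  case False
  let ?h = "\<lambda>t. (norm (u t - v t))\<^sup>2 * exp (- (2 * L) * t)"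
  have "continuous_on {0..} ?h"
    using u v unfolding strong_solution_def by (intro continuous_intros) auto
  then have "(?h \<longlongrightarrow> ?h 0) (at 0 within {0..})"
    unfolding continuous_on_def by (rule bspec) simp
  then have "(?h \<longlongrightarrow> ?h 0) (at_right 0)"
    by (rule tendsto_within_subset) auto
  moreover have "\<forall>\<^sub>F s in at_right 0. ?h t \<le> ?h s"
    using t False by (intro eventually_at_rightI[of 0 t] strong_solution_dist[OF mono osl u v]) auto
  ultimately have "?h t \<le> ?h 0" by (rule tendsto_lowerbound) simp
  also have "?h 0 = 0" using 0 by simp
  finally have "(norm (u t - v t))\<^sup>2 \<le> 0" by (simp add: mult_le_0_iff)
  then show ?thesis by simp
qed (simp add: 0)

theorem (in evolution) evol_strong_solution:
  assumes w: "w \<in> closure D"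
  shows "strong_solution A B (\<lambda>t. evol A B t w)"
  unfolding strong_solution_def
proof (intro conjI allI impI)
  show "continuous_on {0..} (\<lambda>t. evol A B t w)" by (rule evol_continuous[OF w])
  show "abs_cont_on s t (\<lambda>t. evol A B t w)" if st: "0 < s \<and> s < t" for s t
  proof -
    obtain M where M: "M > 0" "\<And>a b. s \<le> a \<Longrightarrow> a \<le> b \<Longrightarrow> b \<le> t \<Longrightarrow> norm (evol A B b w - evol A B a w) \<le> M * (b - a)"
      using evol_lipschitz[OF w, of s t] st by blast
    then show ?thesis by (intro abs_cont_on_lipschitz[of s t _ M])
  qed
  obtain N where N: "countable N" "\<And>t. t > 0 \<Longrightarrow> t \<notin> N \<Longrightarrow>
    (\<exists>d. ((\<lambda>t. evol A B t w) has_vector_derivative d) (at t) \<and> B (evol A B t w) - d \<in> A (evol A B t w))"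
    using evol_solution[OF w] by blast
  have "N \<in> null_sets lborel" by (rule countable_imp_null_set_lborel[OF N(1)])
  then have "AE t in lborel. t \<notin> N" by (rule AE_not_in)
  then show "AE t in lborel. 0 < t \<longrightarrow> (\<exists>d. ((\<lambda>t. evol A B t w) has_vector_derivative d) (at t)
      \<and> B (evol A B t w) - d \<in> A (evol A B t w))"
    by eventually_elim (use N(2) in blast)
qed

text \<open>Continuity in time at the fixed point w is combined with the Lipschitz dependence on the
  initial point, uniform up to time t + 1.\<close>

lemma (in evolution) evol_jointly_continuous:
  assumes "W \<subseteq> closure D"
  shows "continuous_on ({0..} \<times> W) (\<lambda>(t, w). evol A B t w)"
  unfolding continuous_on_iff
proof (intro ballI allI impI)
  fix p :: "real \<times> 'a" and e :: real
  assume p: "p \<in> {0..} \<times> W" and e: "e > 0"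
  obtain t w where tw: "p = (t, w)" "t \<ge> 0" "w \<in> W" using p by auto
  have w: "w \<in> closure D" using tw assms by blast
  obtain d1 where d1: "d1 > 0" "\<And>t'. t' \<ge> 0 \<Longrightarrow> dist t' t < d1 \<Longrightarrow> dist (evol A B t' w) (evol A B t w) < e / 2"
    using evol_continuous[OF w] tw(2) half_gt_zero[OF e] unfolding continuous_on_iff by (metis atLeast_iff)
  define d2 where "d2 = e / 2 / exp (L * (t + 1))"
  have d2: "d2 > 0" using e by (simp add: d2_def)
  have "dist (evol A B t' w') (evol A B t w) < e"
    if q: "t' \<ge> 0" "w' \<in> W" "dist (t', w') (t, w) < min 1 (min d1 d2)" for t' w'
  proof -
    have dt: "dist t' t < min 1 d1" and dw: "dist w' w < d2"
      using q(3) dist_fst_le[of "(t', w')" "(t, w)"] dist_snd_le[of "(t', w')" "(t, w)"] by auto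
    have w': "w' \<in> closure D" using q assms by blast
    have "norm (evol A B t' w' - evol A B t' w) \<le> exp (L * (t + 1)) * norm (w' - w)"
      using dt q by (intro evol_dist w w') (auto simp: dist_real_def)
    also have "\<dots> < e / 2" using dw by (simp add: d2_def dist_norm field_simps)
    finally show ?thesis
      using d1(2)[of t'] q(1) dt dist_triangle[of "evol A B t' w'" "evol A B t w" "evol A B t' w"]
      by (simp add: dist_norm)
  qed
  then show "\<exists>d>0. \<forall>q\<in>{0..} \<times> W. dist q p < d \<longrightarrow>
      dist (case q of (t, w) \<Rightarrow> evol A B t w) (case p of (t, w) \<Rightarrow> evol A B t w) < e"
    using d1(1) d2 by (intro exI[of _ "min 1 (min d1 d2)"]) (auto simp: tw)
qed

section \<open>Integration over one period and elementary L2 estimates\<close>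

section \<open>The circle\<close>

instance L2T :: banach ..

abbreviation circ :: "(real \<Rightarrow> real) \<Rightarrow> real" where
  "circ f \<equiv> (LINT a:{0..1}|lborel. f a)"

lemma inner_abs_L2T: "L2_fun f \<Longrightarrow> L2_fun g \<Longrightarrow> inner (abs_L2T f) (abs_L2T g) = circ (\<lambda>a. f a * g a)"
  by (simp add: inner_L2T.abs_eq L2_rel_refl)

lemma abs_L2T_add: "L2_fun f \<Longrightarrow> L2_fun g \<Longrightarrow> abs_L2T f + abs_L2T g = abs_L2T (\<lambda>a. f a + g a)"
  by (simp add: plus_L2T.abs_eq L2_rel_refl)

lemma abs_L2T_scaleR: "L2_fun f \<Longrightarrow> r *\<^sub>R abs_L2T f = abs_L2T (\<lambda>a. r * f a)"
  by (simp add: scaleR_L2T.abs_eq L2_rel_refl)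

lemma abs_L2T_eq_iff: "L2_fun f \<Longrightarrow> L2_fun g \<Longrightarrow> abs_L2T f = abs_L2T g \<longleftrightarrow> (AE a in lborel. a \<in> {0..1} \<longrightarrow> f a = g a)"
  using Quotient3_rel[OF Quotient3_L2T, of f g] by (auto simp: L2_rel_def L2_rel_refl)

lemma L2_fun_cong_AE:
  assumes f: "L2_fun f" and g: "g \<in> borel_measurable borel" "\<And>a. g (a + 1) = g a"
    and ae: "AE a in lborel. a \<in> {0..1} \<longrightarrow> f a = g a"
  shows "L2_fun g" "abs_L2T g = abs_L2T f"
proof -
  have [measurable]: "f \<in> borel_measurable borel" using f by (simp add: L2_fun_def)
  note [measurable] = g(1)
  have "set_integrable lborel {0..1} (\<lambda>a. (f a)\<^sup>2) = set_integrable lborel {0..1} (\<lambda>a. (g a)\<^sup>2)"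
    using ae by (intro set_integrable_cong_AE) auto
  then show "L2_fun g" using f g by (simp add: L2_fun_def)
  then show "abs_L2T g = abs_L2T f"
    using f ae by (subst abs_L2T_eq_iff) (auto elim: AE_mp)
qed

lemma L2_fun_continuous:
  assumes "continuous_on UNIV f" "\<And>a. f (a + 1) = f a"
  shows "L2_fun f"
  unfolding L2_fun_def
  using assms by (auto intro!: borel_measurable_continuous_onI borel_integrable_atLeastAtMost' continuous_intros
      intro: continuous_on_subset)

lemma circ_integrable: "continuous_on UNIV f \<Longrightarrow> set_integrable lborel {0..1} (f :: real \<Rightarrow> real)"
  by (rule borel_integrable_atLeastAtMost') (auto intro: continuous_on_subset)

lemma L2_fun_integrable:
  assumes "L2_fun f" shows "set_integrable lborel {0..1} f"
  using L2_fun_mult[OF assms L2_fun_continuous[of "\<lambda>_. 1"]] by simp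

lemma circ_FTC:
  assumes "\<And>a. (F has_real_derivative f a) (at a)" "continuous_on UNIV f"
  shows "circ f = F 1 - F 0"
proof -
  have "(\<integral>x. f x * indicator {0..1} x \<partial>lborel) = F 1 - F 0"
    using assms by (intro integral_FTC_Icc_real) (auto simp: continuous_on_eq_continuous_at)
  then show ?thesis by (simp add: set_lebesgue_integral_def mult.commute)
qed

lemma bounded_on_unit:
  assumes "continuous_on UNIV (f :: real \<Rightarrow> real)"
  shows "\<exists>C. \<forall>a\<in>{0..1}. \<bar>f a\<bar> \<le> C"
proof -
  have "compact (f ` {0..1})" by (intro compact_continuous_image continuous_on_subset[OF assms]) auto
  then show ?thesis by (auto dest!: compact_imp_bounded simp: bounded_iff)
qed

lemma circ_const: "circ (\<lambda>_. c) = c"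
  by (simp add: set_integral_const)

lemma circ_abs_le_norm:
  assumes "L2_fun f" shows "circ (\<lambda>a. \<bar>f a\<bar>) \<le> norm (abs_L2T f)"
proof -
  have m: "f \<in> borel_measurable borel" using assms by (simp add: L2_fun_def)
  have L: "L2_fun (\<lambda>a. \<bar>f a\<bar>)" using assms m by (simp add: L2_fun_def)
  have one: "L2_fun (\<lambda>_. 1)" by (rule L2_fun_continuous) auto
  have "circ (\<lambda>a. \<bar>f a\<bar>) = inner (abs_L2T (\<lambda>a. \<bar>f a\<bar>)) (abs_L2T (\<lambda>_. 1))"
    by (simp add: inner_abs_L2T[OF L one])
  also have "\<dots> \<le> norm (abs_L2T (\<lambda>a. \<bar>f a\<bar>)) * norm (abs_L2T (\<lambda>_. 1))" by (rule norm_cauchy_schwarz)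
  also have "\<dots> = norm (abs_L2T f)"
    using circ_const[of 1] by (simp add: norm_abs_L2T L one assms)
  finally show ?thesis .
qed

lemma norm_abs_L2T_le:
  assumes f: "L2_fun f" and c: "\<And>a. a \<in> {0..1} \<Longrightarrow> \<bar>f a\<bar> \<le> c"
  shows "norm (abs_L2T f) \<le> c"
proof -
  have c0: "c \<ge> 0" using c[of 0] by simp
  have "circ (\<lambda>a. (f a)\<^sup>2) \<le> circ (\<lambda>_. c\<^sup>2)"
  proof (rule set_integral_mono)
    show "set_integrable lborel {0..1} (\<lambda>a. (f a)\<^sup>2)" using f by (simp add: L2_fun_def)
    show "(f a)\<^sup>2 \<le> c\<^sup>2" if "a \<in> {0..1}" for a
      using power_mono[OF c[OF that], of 2] by simp
  qed (rule circ_integrable, simp)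
  then show ?thesis
    using c0 by (simp add: norm_abs_L2T[OF f] circ_const real_le_lsqrt)
qed

text \<open>Serves with c = 0 for periodic functions and with c = 1 for lifts of circle
  maps.\<close>

lemma periodic_int_shift:
  fixes X :: "real \<Rightarrow> real"
  assumes "\<And>a. X (a + 1) = X a + c"
  shows "X (a + of_int n) = X a + of_int n * c"
proof -
  have nat: "X (a + real k) = X a + real k * c" for a k
  proof (induction k)
    case (Suc k)
    then show ?case using assms[of "a + real k"] by (simp add: algebra_simps)
  qed simp
  show ?thesis
  proof (cases "n \<ge> 0")
    case True
    then show ?thesis using nat[of a "nat n"] by simp
  next
    case False
    then show ?thesis using nat[of "a + of_int n" "nat (- n)"] by simp
  qed
qed

section \<open>Convexity and closedness of the cone of monotone maps\<close>

section \<open>The cone of nondecreasing maps\<close>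

lemma I_plusD:
  assumes "X \<in> I_plus \<xi>"
  shows "L2_fun (\<lambda>a. X a - a)" "abs_L2T (\<lambda>a. X a - a) = \<xi>" "X (a + 1) = X a + 1"
proof -
  show L: "L2_fun (\<lambda>a. X a - a)" "abs_L2T (\<lambda>a. X a - a) = \<xi>" using assms by (auto simp: I_plus_def)
  have "X (a + 1) - (a + 1) = X a - a" using L(1) by (auto simp: L2_fun_def)
  then show "X (a + 1) = X a + 1" by simp
qed

lemma I_plusI: "L2_fun (\<lambda>a. X a - a) \<Longrightarrow> abs_L2T (\<lambda>a. X a - a) = \<xi> \<Longrightarrow> X \<in> I_plus \<xi>"
  by (simp add: I_plus_def)

lemma mono_L2_fun:
  assumes X: "mono X" "\<And>a. X (a + 1) = X a + 1"
  shows "L2_fun (\<lambda>a. X a - a)"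
proof -
  have m: "X \<in> borel_measurable borel" by (rule borel_measurable_mono[OF X(1)])
  have "set_integrable lborel {0..1} (\<lambda>a. (X a - a)\<^sup>2)"
  proof (rule set_integrable_bound[where f = "\<lambda>_::real. (\<bar>X 0\<bar> + \<bar>X 1\<bar> + 1)\<^sup>2"])
    show "set_integrable lborel {0..1} (\<lambda>_::real. (\<bar>X 0\<bar> + \<bar>X 1\<bar> + 1)\<^sup>2)" by (rule circ_integrable) simp
    show "set_borel_measurable lborel {0..1} (\<lambda>a. (X a - a)\<^sup>2)"
      using m unfolding set_borel_measurable_def by measurable
    show "AE a in lborel. a \<in> {0..1} \<longrightarrow> norm ((X a - a)\<^sup>2) \<le> norm ((\<bar>X 0\<bar> + \<bar>X 1\<bar> + 1)\<^sup>2)"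
    proof (intro AE_I2 impI)
      fix a :: real assume a: "a \<in> {0..1}"
      have "X 0 \<le> X a" "X a \<le> X 1" using X(1) a by (auto simp: mono_def)
      then have "\<bar>X a - a\<bar> \<le> \<bar>X 0\<bar> + \<bar>X 1\<bar> + 1" using a by auto
      then show "norm ((X a - a)\<^sup>2) \<le> norm ((\<bar>X 0\<bar> + \<bar>X 1\<bar> + 1)\<^sup>2)"
        using power_mono[of "\<bar>X a - a\<bar>" "\<bar>X 0\<bar> + \<bar>X 1\<bar> + 1" 2] by simp
    qed
  qed
  then show ?thesis using m X(2) by (simp add: L2_fun_def)
qed

lemma mono_in_K_disp:
  "mono X \<Longrightarrow> (\<And>a. X (a + 1) = X a + 1) \<Longrightarrow> abs_L2T (\<lambda>a. X a - a) \<in> K_disp"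
  unfolding K_disp_def I_plus_def using mono_L2_fun by blast

lemma K_disp_convex:
  assumes "\<xi> \<in> K_disp" "\<eta> \<in> K_disp" "0 \<le> s" "s \<le> 1"
  shows "(1 - s) *\<^sub>R \<xi> + s *\<^sub>R \<eta> \<in> K_disp"
proof -
  obtain X Y where X: "X \<in> I_plus \<xi>" "mono X" and Y: "Y \<in> I_plus \<eta>" "mono Y"
    using assms by (auto simp: K_disp_def)
  have "mono (\<lambda>a. (1 - s) * X a + s * Y a)"
    using X(2) Y(2) assms(3,4) by (intro monoI add_mono mult_left_mono) (auto dest: monoD)
  moreover have "(1 - s) *\<^sub>R \<xi> + s *\<^sub>R \<eta> = abs_L2T (\<lambda>a. ((1 - s) * X a + s * Y a) - a)"
  proof -
    have "(1 - s) *\<^sub>R \<xi> + s *\<^sub>R \<eta> = abs_L2T (\<lambda>a. (1 - s) * (X a - a) + s * (Y a - a))"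
      using I_plusD[OF X(1)] I_plusD[OF Y(1)]
      by (simp add: abs_L2T_scaleR abs_L2T_add L2_fun_cmult flip: I_plusD(2)[OF X(1)] I_plusD(2)[OF Y(1)])
    then show ?thesis by (simp add: algebra_simps)
  qed
  moreover have "(1 - s) * X (a + 1) + s * Y (a + 1) = (1 - s) * X a + s * Y a + 1" for a
    by (subst I_plusD(3)[OF X(1)], subst I_plusD(3)[OF Y(1)]) (simp add: algebra_simps)
  ultimately show ?thesis using mono_in_K_disp by simp
qed

lemma K_disp_0: "0 \<in> K_disp"
proof -
  have "abs_L2T (\<lambda>a::real. a - a) \<in> K_disp" by (rule mono_in_K_disp) (auto simp: mono_def)
  then show ?thesis by (simp add: zero_L2T_def)
qed

text \<open>The upper limit inherits monotonicity and the shift relation. It is finite because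
  convergence at the single point b bounds the sequence at all integer translates of b, hence by
  monotonicity in between.\<close>

lemma mono_limsup_shift:
  fixes x :: "nat \<Rightarrow> real \<Rightarrow> real"
  assumes "\<And>n. mono (x n)" "\<And>n a. x n (a + 1) = x n a + 1" and lim: "(\<lambda>n. x n b) \<longlonglongrightarrow> l"
  shows "\<exists>X. mono X \<and> (\<forall>a. X (a + 1) = X a + 1) \<and> (\<forall>a l. (\<lambda>n. x n a) \<longlonglongrightarrow> l \<longrightarrow> X a = l)"
proof -
  have fin: "\<bar>limsup (\<lambda>n. ereal (x n a))\<bar> \<noteq> \<infinity>" for a
  proof -
    obtain k :: nat where k: "real k \<ge> \<bar>a - b\<bar>" using real_arch_simple by blast
    have sh: "x n (b + real k) = x n b + real k" "x n (b - real k) = x n b - real k" for n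
      using periodic_int_shift[of "x n" 1 b "int k", OF assms(2)]
        periodic_int_shift[of "x n" 1 b "- int k", OF assms(2)] by simp_all
    have ab: "b - real k \<le> a" "a \<le> b + real k" using k by auto
    have "x n a \<le> x n b + real k" "x n b - real k \<le> x n a" for n
      using monoD[OF assms(1) ab(1), of n] monoD[OF assms(1) ab(2), of n] by (simp_all add: sh)
    moreover have L: "limsup (\<lambda>n. ereal (x n b + real k)) = ereal (l + real k)"
      "limsup (\<lambda>n. ereal (x n b - real k)) = ereal (l - real k)"
      by (intro lim_imp_Limsup tendsto_ereal tendsto_intros lim; simp)+
    ultimately have "limsup (\<lambda>n. ereal (x n a)) \<le> ereal (l + real k)" "ereal (l - real k) \<le> limsup (\<lambda>n. ereal (x n a))"
      unfolding L[symmetric] by (intro Limsup_mono always_eventually allI; simp)+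
    then show ?thesis by auto
  qed
  define X where "X a = real_of_ereal (limsup (\<lambda>n. ereal (x n a)))" for a
  have X: "ereal (X a) = limsup (\<lambda>n. ereal (x n a))" for a
    unfolding X_def using fin by (simp add: ereal_real')
  have "mono X"
  proof (rule monoI)
    fix a b :: real assume "a \<le> b"
    have "limsup (\<lambda>n. ereal (x n a)) \<le> limsup (\<lambda>n. ereal (x n b))"
      by (intro Limsup_mono always_eventually allI) (simp add: monoD[OF assms(1) \<open>a \<le> b\<close>])
    then show "X a \<le> X b" unfolding X[symmetric] by simp
  qed
  moreover have "X (a + 1) = X a + 1" for a
  proof -
    have "limsup (\<lambda>n. ereal (x n a) + 1) = limsup (\<lambda>n. ereal (x n a)) + 1"
      by (rule Limsup_add_ereal_right) auto
    then have "ereal (X (a + 1)) = ereal (X a) + 1"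
      unfolding X assms(2) by (simp add: one_ereal_def)
    then show ?thesis by (simp add: one_ereal_def)
  qed
  moreover have "X a = l" if "(\<lambda>n. x n a) \<longlonglongrightarrow> l" for a l
    using lim_imp_Limsup[OF _ tendsto_ereal[OF that]] X[of a] by simp
  ultimately show ?thesis by blast
qed

text \<open>Convergence in L2 gives a subsequence converging almost everywhere on the period; the
  upper limit of the monotone representatives is then a monotone representative of the limit,
  defined at every point.\<close>

lemma K_disp_closed:
  assumes \<xi>: "\<And>n. \<xi> n \<in> K_disp" and lim: "\<xi> \<longlonglongrightarrow> \<eta>"
  shows "\<eta> \<in> K_disp"
proof -
  have "\<forall>n. \<exists>X. X \<in> I_plus (\<xi> n) \<and> mono X" using \<xi> by (auto simp: K_disp_def)
  then obtain x where x: "\<And>n. x n \<in> I_plus (\<xi> n)" "\<And>n. mono (x n)" by metis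
  obtain f where f: "L2_fun f" "\<eta> = abs_L2T f" by (rule L2T_cases)
  let ?d = "\<lambda>n a. (x n a - a) - f a"
  have d: "L2_fun (?d n)" for n by (intro L2_fun_diff I_plusD(1)[OF x(1)] f)
  have nd: "norm (abs_L2T (?d n)) = norm (\<xi> n - \<eta>)" for n
    using abs_L2T_diff[OF I_plusD(1)[OF x(1)[of n]] f(1)] I_plusD(2)[OF x(1)[of n]] f(2) by simp
  have "(\<lambda>n. norm (\<xi> n - \<eta>)) \<longlonglongrightarrow> 0" using lim by (simp add: tendsto_norm_zero LIM_zero)
  then have "(\<lambda>n. circ (\<lambda>a. \<bar>?d n a\<bar>)) \<longlonglongrightarrow> 0"
    by (rule Lim_null_comparison[rotated])
      (use circ_abs_le_norm[OF d] nd in \<open>auto intro!: always_eventually simp: abs_of_nonneg set_lebesgue_integral_def\<close>)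
  then have "(\<lambda>n. \<integral>a. norm (indicat_real {0..1} a *\<^sub>R ?d n a) \<partial>lborel) \<longlonglongrightarrow> 0"
    by (simp add: set_lebesgue_integral_def abs_mult)
  then obtain r where r: "strict_mono r" "AE a in lborel. (\<lambda>n. indicat_real {0..1} a *\<^sub>R ?d (r n) a) \<longlonglongrightarrow> 0"
    using tendsto_L1_AE_subseq[of lborel "\<lambda>n a. indicat_real {0..1} a *\<^sub>R ?d n a"] L2_fun_integrable[OF d]
    unfolding set_integrable_def by blast
  have conv: "AE a in lborel. a \<in> {0..1} \<longrightarrow> (\<lambda>n. x (r n) a) \<longlonglongrightarrow> f a + a"
    using r(2)
  proof eventually_elim
    case (elim a)
    show ?case
    proof
      assume "a \<in> {0..1}"
      then have "(\<lambda>n. ?d (r n) a) \<longlonglongrightarrow> 0" using elim by simp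
      then have "(\<lambda>n. ?d (r n) a + (f a + a)) \<longlonglongrightarrow> 0 + (f a + a)" by (intro tendsto_intros)
      then show "(\<lambda>n. x (r n) a) \<longlonglongrightarrow> f a + a" by simp
    qed
  qed
  \<comment> \<open>One point of convergence anchors \<open>mono_limsup_shift\<close>; it exists
    because the period has positive measure.\<close>
  have "\<exists>b\<in>{0..1}. (\<lambda>n. x (r n) b) \<longlonglongrightarrow> f b + b"
  proof (rule ccontr)
    assume "\<not> ?thesis"
    then have "AE a in lborel. a \<notin> {0..1::real}" using conv by (auto elim: AE_mp)
    then have "emeasure lborel {0..1::real} = 0"
      by (subst (asm) AE_iff_measurable[of "{0..1}"]) auto
    then show False by simp
  qed
  then obtain b where b: "(\<lambda>n. x (r n) b) \<longlonglongrightarrow> f b + b" by blast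
  obtain X where X: "mono X" "\<And>a. X (a + 1) = X a + 1" "\<And>a l. (\<lambda>n. x (r n) a) \<longlonglongrightarrow> l \<Longrightarrow> X a = l"
    using mono_limsup_shift[of "\<lambda>n. x (r n)", OF x(2) I_plusD(3)[OF x(1)] b] by blast
  have "AE a in lborel. a \<in> {0..1} \<longrightarrow> f a = X a - a"
    using conv by eventually_elim (use X(3) in fastforce)
  then have "abs_L2T (\<lambda>a. X a - a) = \<eta>"
    unfolding f(2) using f(1) X(1,2) borel_measurable_mono[OF X(1)]
    by (intro L2_fun_cong_AE(2)) auto
  then show ?thesis using mono_in_K_disp[OF X(1,2)] by simp
qed

section \<open>The Stieltjes measure of a monotone map and integration by parts\<close>

subsection \<open>Right-continuous representatives\<close>

text \<open>The right limits of Y differ from Y only at its discontinuities, of which a monotone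
  function has countably many.\<close>

lemma right_continuous_representative:
  assumes "mono Y"
  defines "X \<equiv> \<lambda>a::real. (INF b\<in>{a<..}. Y b :: real)"
  shows "mono X" "\<And>a. continuous (at_right a) X" "AE a in lborel. X a = Y a"
    "(\<And>a. Y (a + 1) = Y a + 1) \<Longrightarrow> X (a + 1) = X a + 1"
proof -
  have X_eq: "X a = (INF b\<in>{a<..}. Y b)" for a by (simp add: X_def)
  have bdd: "bdd_below (Y ` {a<..})" for a
    by (rule bdd_belowI2[of _ "Y a"]) (simp add: monoD[OF assms(1)])
  have le: "Y a \<le> X a" for a
    unfolding X_def by (rule cINF_greatest) (simp_all add: monoD[OF assms(1)])
  have ge: "a < b \<Longrightarrow> X a \<le> Y b" for a b
    unfolding X_def by (intro cINF_lower bdd) auto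
  show mono: "mono X"
    unfolding X_def by (intro monoI cINF_superset_mono bdd) auto
  show "continuous (at_right a) X" for a
    unfolding continuous_within
  proof (rule order_tendstoI)
    fix c assume "c < X a"
    then show "\<forall>\<^sub>F x in at_right a. c < X x"
      using monoD[OF mono] by (intro eventually_at_right_less[THEN eventually_mono]) (meson less_le less_le_trans)
  next
    fix c assume "X a < c"
    then obtain b where b: "a < b" "Y b < c"
      unfolding X_def by (subst (asm) cINF_less_iff) (auto intro: bdd)
    show "\<forall>\<^sub>F x in at_right a. X x < c"
      using b by (intro eventually_at_rightI[of a b] le_less_trans[OF ge]) auto
  qed
  have "{a. \<not> isCont Y a} \<in> null_sets lborel"
    by (intro countable_imp_null_set_lborel mono_ctble_discont assms(1))
  then have "AE a in lborel. isCont Y a" using AE_not_in by force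
  then show "AE a in lborel. X a = Y a"
  proof eventually_elim
    case (elim a)
    have "(Y \<longlongrightarrow> Y a) (at_right a)" using elim by (auto simp: isCont_def intro: tendsto_mono[OF at_le])
    then have "X a \<le> Y a"
      by (rule tendsto_lowerbound) (auto intro!: eventually_at_right_less[THEN eventually_mono] ge)
    then show ?case using le[of a] by simp
  qed
  show "X (a + 1) = X a + 1" if Y: "\<And>a. Y (a + 1) = Y a + 1"
  proof (rule antisym)
    show "X (a + 1) \<le> X a + 1"
    proof -
      have "X (a + 1) - 1 \<le> X a"
        unfolding X_eq[of a]
      proof (rule cINF_greatest)
        fix b assume "b \<in> {a<..}"
        then show "X (a + 1) - 1 \<le> Y b" using ge[of "a + 1" "b + 1"] Y[of b] by simp
      qed auto
      then show ?thesis by simp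
    qed
    show "X a + 1 \<le> X (a + 1)"
      unfolding X_eq[of "a + 1"]
    proof (rule cINF_greatest)
      fix b assume "b \<in> {a + 1<..}"
      then show "X a + 1 \<le> Y b" using ge[of a "b - 1"] Y[of "b - 1"] by simp
    qed auto
  qed
qed

text \<open>Between a and any larger b lies a point where the two functions agree, so X a \<le> X'
  b, and right continuity lets b tend to a. Applied both ways this makes the representative
  unique.\<close>

lemma right_continuous_unique:
  fixes X X' :: "real \<Rightarrow> real"
  assumes m: "mono X" "mono X'" and rc: "\<And>a. continuous (at_right a) X'"
    and per: "\<And>a. X (a + 1) = X a + 1" "\<And>a. X' (a + 1) = X' a + 1"
    and ae: "AE a in lborel. a \<in> {0..1} \<longrightarrow> X a = X' a"
  shows "X a \<le> X' a"
proof -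
  have base: "X a \<le> X' a" if a: "0 \<le> a" "a < 1" for a
  proof -
    have le: "X a \<le> X' b" if b: "a < b" for b
    proof -
      \<comment> \<open>Agreement is known only on [0, 1], hence the cut at 1; all other points are
        reached by integer translation.\<close>
      have "\<exists>c. a < c \<and> c < min b 1 \<and> X c = X' c"
      proof (rule ccontr)
        assume no: "\<not> ?thesis"
        have "AE c in lborel. c \<notin> {a<..<min b 1}"
          using ae by eventually_elim (use no a in auto)
        then have "emeasure lborel {a<..<min b 1} = 0"
          by (subst (asm) AE_iff_measurable[of "{a<..<min b 1}"]) auto
        then show False using a b by simp
      qed
      then obtain c where "a < c" "c < min b 1" "X c = X' c" by blast
      then show ?thesis using monoD[OF m(1), of a c] monoD[OF m(2), of c b] by simp
    qed
    have "(X' \<longlongrightarrow> X' a) (at_right a)" using rc by (simp add: continuous_within)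
    then show ?thesis
      by (rule tendsto_lowerbound) (auto intro!: eventually_at_right_less[THEN eventually_mono] le)
  qed
  have "X (frac a + of_int \<lfloor>a\<rfloor>) = X (frac a) + of_int \<lfloor>a\<rfloor>" "X' (frac a + of_int \<lfloor>a\<rfloor>) = X' (frac a) + of_int \<lfloor>a\<rfloor>"
    using periodic_int_shift[of X 1, OF per(1)] periodic_int_shift[of X' 1, OF per(2)] by simp_all
  then show ?thesis using base[of "frac a"] by (simp add: frac_ge_0 frac_lt_1) (simp add: frac_def)
qed

text \<open>The function hidden in the definite description of \<open>deriv_measure\<close>, named
  so that its properties can be stated.\<close>

definition rc_rep :: "L2T \<Rightarrow> real \<Rightarrow> real" where
  "rc_rep \<xi> = (THE X. X \<in> I_plus \<xi> \<and> mono X \<and> (\<forall>a. continuous (at_right a) X))"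

lemma rc_rep_eqI:
  assumes X: "X \<in> I_plus \<xi>" "mono X" "\<And>a. continuous (at_right a) X"
  shows "rc_rep \<xi> = X"
  unfolding rc_rep_def
proof (rule the_equality)
  fix Y assume Y: "Y \<in> I_plus \<xi> \<and> mono Y \<and> (\<forall>a. continuous (at_right a) Y)"
  have "abs_L2T (\<lambda>a. X a - a) = abs_L2T (\<lambda>a. Y a - a)"
    by (simp only: I_plusD(2)[OF X(1)] I_plusD(2)[OF conjunct1[OF Y]])
  then have "AE a in lborel. a \<in> {0..1} \<longrightarrow> X a - a = Y a - a"
    by (simp only: abs_L2T_eq_iff[OF I_plusD(1)[OF X(1)] I_plusD(1)[OF conjunct1[OF Y]]])
  then have ae: "AE a in lborel. a \<in> {0..1} \<longrightarrow> X a = Y a" "AE a in lborel. a \<in> {0..1} \<longrightarrow> Y a = X a"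
    by (eventually_elim, simp)+
  show "Y = X"
  proof (rule ext, rule antisym)
    show "Y a \<le> X a" for a
      by (rule right_continuous_unique[OF _ X(2,3) I_plusD(3)[OF conjunct1[OF Y]] I_plusD(3)[OF X(1)] ae(2)]) (use Y in simp)
    show "X a \<le> Y a" for a
      by (rule right_continuous_unique[OF X(2) _ _ I_plusD(3)[OF X(1)] I_plusD(3)[OF conjunct1[OF Y]] ae(1)]) (use Y in simp_all)
  qed
qed (use X in simp)

lemma rc_rep:
  assumes "\<xi> \<in> K_disp"
  shows "rc_rep \<xi> \<in> I_plus \<xi>" "mono (rc_rep \<xi>)" "continuous (at_right a) (rc_rep \<xi>)" "rc_rep \<xi> (a + 1) = rc_rep \<xi> a + 1"
proof -
  obtain Y where Y: "Y \<in> I_plus \<xi>" "mono Y" using assms by (auto simp: K_disp_def)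
  define X where "X a = (INF b\<in>{a<..}. Y b)" for a
  note X = right_continuous_representative[OF Y(2), folded X_def]
  have per: "X (a + 1) = X a + 1" for a by (rule X(4)) (rule I_plusD(3)[OF Y(1)])
  have "AE a in lborel. a \<in> {0..1} \<longrightarrow> Y a - a = X a - a" using X(3) by eventually_elim simp
  then have "abs_L2T (\<lambda>a. X a - a) = abs_L2T (\<lambda>a. Y a - a)"
    using I_plusD(1)[OF Y(1)] borel_measurable_mono[OF X(1)] per by (intro L2_fun_cong_AE(2)) auto
  then have IX: "X \<in> I_plus \<xi>"
    using mono_L2_fun[OF X(1) per] I_plusD(2)[OF Y(1)] by (intro I_plusI) auto
  have eq: "rc_rep \<xi> = X" by (rule rc_rep_eqI[OF IX X(1,2)])
  show "rc_rep \<xi> \<in> I_plus \<xi>" "mono (rc_rep \<xi>)" "continuous (at_right a) (rc_rep \<xi>)" "rc_rep \<xi> (a + 1) = rc_rep \<xi> a + 1"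
    using IX X per unfolding eq by auto
qed

lemma deriv_measure_eq: "deriv_measure \<xi> = interval_measure (rc_rep \<xi>)"
  by (simp add: deriv_measure_def rc_rep_def)

text \<open>The half-open period counts an atom at an integer exactly once, so for \<xi> in the cone
  this integrates against a probability measure.\<close>

definition deriv_int :: "(real \<Rightarrow> real) \<Rightarrow> L2T \<Rightarrow> real" where
  "deriv_int f \<xi> = (LINT a:{0<..1}|deriv_measure \<xi>. f a)"

lemma deriv_measure_period:
  assumes "\<xi> \<in> K_disp"
  shows "measure (deriv_measure \<xi>) {0<..1} = 1" "emeasure (deriv_measure \<xi>) {0<..1} = 1"
    "sets (deriv_measure \<xi>) = sets borel"
proof -
  note X = rc_rep[OF assms]
  have "emeasure (interval_measure (rc_rep \<xi>)) {0<..1} = ennreal (rc_rep \<xi> 1 - rc_rep \<xi> 0)"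
    by (intro emeasure_interval_measure_Ioc monoD[OF X(2)] X(3)) simp_all
  then show "emeasure (deriv_measure \<xi>) {0<..1} = 1"
    using X(4)[of 0] by (simp add: deriv_measure_eq)
  then show "measure (deriv_measure \<xi>) {0<..1} = 1" by (simp add: measure_def)
  show "sets (deriv_measure \<xi>) = sets borel" by (simp add: deriv_measure_eq)
qed

lemma deriv_int_integrable:
  assumes \<xi>: "\<xi> \<in> K_disp" and f: "continuous_on UNIV f"
  shows "set_integrable (deriv_measure \<xi>) {0<..1} (f :: real \<Rightarrow> real)"
proof -
  obtain C where C: "\<And>a. a \<in> {0..1} \<Longrightarrow> \<bar>f a\<bar> \<le> C" using bounded_on_unit[OF f] by blast
  have [measurable]: "f \<in> borel_measurable borel" using f by (rule borel_measurable_continuous_onI)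
  note [measurable_cong] = deriv_measure_period(3)[OF \<xi>]
  have C': "\<bar>f a\<bar> \<le> \<bar>C\<bar>" if "a \<in> {0<..1}" for a using C[of a] that by force
  show ?thesis
    unfolding set_integrable_def
  proof (rule Bochner_Integration.integrable_bound)
    show "integrable (deriv_measure \<xi>) (\<lambda>a. C * indicat_real {0<..1} a)"
      using deriv_measure_period[OF \<xi>] by (intro integrable_mult_right integrable_real_indicator) simp_all
    show "(\<lambda>a. indicat_real {0<..1} a *\<^sub>R f a) \<in> borel_measurable (deriv_measure \<xi>)"
      by measurable
    show "AE a in deriv_measure \<xi>. norm (indicat_real {0<..1} a *\<^sub>R f a) \<le> norm (C * indicat_real {0<..1} a)"
      using C' by (intro AE_I2) (simp add: indicator_def)
  qed
qed

lemma deriv_int_const: "\<xi> \<in> K_disp \<Longrightarrow> deriv_int (\<lambda>_. c) \<xi> = c"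
  unfolding deriv_int_def using deriv_measure_period[of \<xi>] by (subst set_integral_const) auto

text \<open>The total mass 1 makes the error independent of \<xi>; this uniformity over the cone
  carries all later approximation arguments.\<close>

lemma deriv_int_diff_le:
  assumes \<xi>: "\<xi> \<in> K_disp" and f: "continuous_on UNIV f" and g: "continuous_on UNIV g"
    and e: "\<And>a. \<bar>f a - g a\<bar> \<le> e"
  shows "\<bar>deriv_int f \<xi> - deriv_int g \<xi>\<bar> \<le> e"
proof -
  have int: "set_integrable (deriv_measure \<xi>) {0<..1} (\<lambda>a. f a - g a)" "set_integrable (deriv_measure \<xi>) {0<..1} (\<lambda>_. e)"
    "set_integrable (deriv_measure \<xi>) {0<..1} (\<lambda>_. - e)"
    by (intro deriv_int_integrable[OF \<xi>] continuous_intros f g)+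
  have eq: "deriv_int f \<xi> - deriv_int g \<xi> = (LINT a:{0<..1}|deriv_measure \<xi>. f a - g a)"
    unfolding deriv_int_def using deriv_int_integrable[OF \<xi> f] deriv_int_integrable[OF \<xi> g] by simp
  have "(LINT a:{0<..1}|deriv_measure \<xi>. f a - g a) \<le> (LINT a:{0<..1}|deriv_measure \<xi>. e)"
    using e by (intro set_integral_mono int) (simp add: abs_le_iff)
  moreover have "(LINT a:{0<..1}|deriv_measure \<xi>. - e) \<le> (LINT a:{0<..1}|deriv_measure \<xi>. f a - g a)"
  proof (intro set_integral_mono int)
    show "- e \<le> f a - g a" for a using e[of a] by linarith
  qed
  ultimately show ?thesis
    unfolding eq using deriv_int_const[OF \<xi>, of e] deriv_int_const[OF \<xi>, of "- e"]
    by (simp add: deriv_int_def abs_le_iff)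
qed

text \<open>Integration by parts, by Fubini's theorem applied to \<open>f'(b)\<close> on the triangle \<open>a \<le> b\<close>.\<close>

lemma deriv_int_C1:
  assumes \<xi>: "\<xi> \<in> K_disp" and f: "\<And>a. (f has_real_derivative f' a) (at a)" "continuous_on UNIV f'"
    and per: "\<And>a. f (a + 1) = f a"
  shows "deriv_int f \<xi> = circ f - inner (abs_L2T f') \<xi>"
proof -
  define X where "X = rc_rep \<xi>"
  note X = rc_rep[OF \<xi>, folded X_def]
  have meas_eq: "deriv_measure \<xi> = interval_measure X" by (simp add: deriv_measure_eq X_def)
  have mono: "x \<le> y \<Longrightarrow> X x \<le> X y" for x y using X(2) by (rule monoD)
  interpret M: sigma_finite_measure "interval_measure X"
    by (intro sigma_finite_interval_measure mono X(3))
  interpret P: pair_sigma_finite "interval_measure X" lborel ..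
  have contf: "continuous_on UNIV f" using f(1) by (intro continuous_at_imp_continuous_on) (auto intro: DERIV_isCont)
  have [measurable]: "f' \<in> borel_measurable borel" using f(2) by (rule borel_measurable_continuous_onI)
  have X1: "X 1 = X 0 + 1" using X(4)[of 0] by simp
  have perf': "f' (a + 1) = f' a" for a
  proof (rule DERIV_unique)
    show "(f has_real_derivative f' (a + 1)) (at (a + 1))" by (rule f)
    have "((\<lambda>x. f (x + (- 1))) has_real_derivative f' a) (at (a + 1))"
      using f(1)[of a] DERIV_shift[of f "f' a" "a + 1" "- 1"] by simp
    moreover have "f (x + (- 1)) = f x" for x using per[of "x - 1"] by simp
    ultimately show "(f has_real_derivative f' a) (at (a + 1))" by simp
  qed
  obtain C where C: "\<And>a. a \<in> {0..1} \<Longrightarrow> \<bar>f' a\<bar> \<le> C" using bounded_on_unit[OF f(2)] by blast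
  define g where "g a b = indicat_real {0<..1} a * (indicat_real {0..1} b * (indicat_real {a..} b * f' b))" for a b
  have g_eq: "g a b = (if 0 < a \<and> a \<le> 1 \<and> 0 \<le> b \<and> b \<le> 1 \<and> a \<le> b then f' b else 0)" for a b
    by (auto simp: g_def indicator_def)
  have gm: "(\<lambda>(a, b). g a b) \<in> borel_measurable (interval_measure X \<Otimes>\<^sub>M lborel)"
    unfolding g_eq by measurable
  have gint: "integrable (interval_measure X \<Otimes>\<^sub>M lborel) (\<lambda>(a, b). g a b)"
  proof (rule Bochner_Integration.integrable_bound)
    have "emeasure (interval_measure X \<Otimes>\<^sub>M lborel) ({0<..1} \<times> {0..1::real})
       = emeasure (interval_measure X) {0<..1} * emeasure lborel {0..1::real}"
      by (rule lborel.emeasure_pair_measure_Times) auto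
    also have "\<dots> < \<infinity>"
      using deriv_measure_period(2)[OF \<xi>] by (simp add: meas_eq)
    finally show "integrable (interval_measure X \<Otimes>\<^sub>M lborel) (\<lambda>p. C * indicat_real ({0<..1} \<times> {0..1::real}) p)"
      by (intro integrable_mult_right integrable_real_indicator pair_measureI) auto
    show "AE p in interval_measure X \<Otimes>\<^sub>M lborel. norm (case p of (a, b) \<Rightarrow> g a b) \<le> norm (C * indicat_real ({0<..1} \<times> {0..1}) p)"
    proof (intro AE_I2, clarify)
      fix a b
      have "b \<in> {0..1} \<Longrightarrow> \<bar>f' b\<bar> \<le> \<bar>C\<bar>" using C[of b] by simp
      then show "norm (g a b) \<le> norm (C * indicat_real ({0<..1} \<times> {0..1}) (a, b))"
        by (simp add: g_eq indicator_def)
    qed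
  qed (rule gm)
  have Fub: "(\<integral>b. (\<integral>a. g a b \<partial>interval_measure X) \<partial>lborel) = (\<integral>a. (\<integral>b. g a b \<partial>lborel) \<partial>interval_measure X)"
    by (rule P.Fubini_integral[OF gint])
  have in_b: "(\<integral>b. g a b \<partial>lborel) = indicat_real {0<..1} a * (f 1 - f a)" for a
  proof (cases "a \<in> {0<..1}")
    case True
    then have "(\<integral>b. g a b \<partial>lborel) = (\<integral>b. f' b * indicator {a..1} b \<partial>lborel)"
      by (intro Bochner_Integration.integral_cong) (auto simp: g_eq indicator_def)
    also have "\<dots> = f 1 - f a"
      using True f by (intro integral_FTC_Icc_real) (auto simp: continuous_on_eq_continuous_at)
    finally show ?thesis using True by simp
  qed (simp add: g_def)
  have in_a: "(\<integral>a. g a b \<partial>interval_measure X) = indicat_real {0..1} b * (f' b * (X b - X 0))" for b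
  proof (cases "b \<in> {0..1}")
    case True
    then have "(\<integral>a. g a b \<partial>interval_measure X) = (\<integral>a. f' b * indicat_real {0<..b} a \<partial>interval_measure X)"
      by (intro Bochner_Integration.integral_cong) (auto simp: g_eq indicator_def)
    also have "\<dots> = f' b * measure (interval_measure X) {0<..b}" by simp
    also have "measure (interval_measure X) {0<..b} = X b - X 0"
      by (intro measure_interval_measure_Ioc mono X(3)) (use True in simp_all)
    finally show ?thesis using True by simp
  qed (simp add: g_def)
  have one: "set_integrable (deriv_measure \<xi>) {0<..1} f" "set_integrable (deriv_measure \<xi>) {0<..1} (\<lambda>_. f 1)"
    by (intro deriv_int_integrable[OF \<xi>] contf continuous_intros)+
  have "circ (\<lambda>b. f' b * (X b - X 0)) = (LINT a:{0<..1}|deriv_measure \<xi>. f 1 - f a)"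
    using Fub by (simp add: in_a in_b set_lebesgue_integral_def meas_eq)
  also have "\<dots> = f 1 - deriv_int f \<xi>"
    using set_integral_diff(2)[OF one(2,1)] deriv_int_const[OF \<xi>, of "f 1"] by (simp add: deriv_int_def)
  finally have 1: "deriv_int f \<xi> = f 1 - circ (\<lambda>b. f' b * (X b - X 0))" by simp
  have Lf': "L2_fun f'" by (rule L2_fun_continuous[OF f(2) perf'])
  have inn: "inner (abs_L2T f') \<xi> = circ (\<lambda>b. f' b * (X b - b))"
    using inner_abs_L2T[OF Lf' I_plusD(1)[OF X(1)]] I_plusD(2)[OF X(1)] by simp
  have ints: "set_integrable lborel {0..1} (\<lambda>b. f' b * (X b - b))" "set_integrable lborel {0..1} (\<lambda>b. f' b * (b - X 0))"
    "set_integrable lborel {0..1} f"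
    by (rule L2_fun_mult[OF Lf' I_plusD(1)[OF X(1)]]) (intro circ_integrable continuous_intros f contf)+
  have "circ (\<lambda>b. f' b * (X b - X 0)) = circ (\<lambda>b. f' b * (X b - b) + f' b * (b - X 0))"
    by (simp add: algebra_simps)
  also have "\<dots> = circ (\<lambda>b. f' b * (X b - b)) + circ (\<lambda>b. f' b * (b - X 0))"
    by (rule set_integral_add(2)[OF ints(1,2)])
  also have "circ (\<lambda>b. f' b * (b - X 0)) = f 1 - circ f"
  proof -
    have "circ (\<lambda>b. f' b * (b - X 0) + f b) = f 1 * (1 - X 0) - f 0 * (0 - X 0)"
      by (rule circ_FTC[of "\<lambda>b. f b * (b - X 0)"]) (auto intro!: derivative_eq_intros f continuous_intros contf)
    moreover have "circ (\<lambda>b. f' b * (b - X 0) + f b) = circ (\<lambda>b. f' b * (b - X 0)) + circ f"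
      by (rule set_integral_add(2)[OF ints(2,3)])
    ultimately show ?thesis using per[of 0] by (simp add: algebra_simps)
  qed
  finally show ?thesis using 1 inn by simp
qed

section \<open>C1 approximation of test functions; affinity and continuity of the integral\<close>

subsection \<open>Averaging\<close>

lemma antiderivative_exists:
  fixes f :: "real \<Rightarrow> real"
  assumes "continuous_on UNIV f"
  obtains F where "\<And>a. (F has_real_derivative f a) (at a)"
proof -
  have "\<exists>F. \<forall>x::real. -\<infinity> < ereal x \<longrightarrow> ereal x < \<infinity> \<longrightarrow> (F has_vector_derivative f x) (at x)"
    using assms by (intro einterval_antiderivative) (auto simp: continuous_on_eq_continuous_at)
  then show ?thesis using that by (auto simp: has_real_derivative_iff_has_vector_derivative)
qed

lemma DERIV_shift_diff:
  assumes F: "\<And>a. (F has_real_derivative f a) (at a)"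
  shows "((\<lambda>a. (F (a + h) - F a) / h) has_real_derivative (f (a + h) - f a) / h) (at a)"
proof -
  have "((\<lambda>a. F (a + h)) has_real_derivative f (a + h)) (at a)"
    using F[of "a + h"] DERIV_shift by blast
  from DERIV_cdivide[OF DERIV_diff[OF this F[of a]]] show ?thesis .
qed

lemma antiderivative_shift:
  fixes F f :: "real \<Rightarrow> real"
  assumes F: "\<And>a. (F has_real_derivative f a) (at a)" and per: "\<And>a. f (a + 1) = f a + c"
  shows "F (a + 1) - F a - c * a = F 1 - F 0"
proof -
  have "\<exists>k. \<forall>a. F (a + 1) - F a - c * a = k"
  proof (rule has_field_derivative_zero_constant[of UNIV "\<lambda>a. F (a + 1) - F a - c * a", simplified])
    fix a
    have "((\<lambda>a. F (a + 1)) has_real_derivative f (a + 1)) (at a)"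
      using F[of "a + 1"] DERIV_shift by blast
    then have "((\<lambda>a. F (a + 1) - F a - c * a) has_real_derivative f (a + 1) - f a - c * 1) (at a)"
      by (intro DERIV_diff DERIV_cmult DERIV_ident F)
    then show "((\<lambda>a. F (a + 1) - F a - c * a) has_real_derivative 0) (at a)" by (simp add: per)
  qed
  then show ?thesis by (metis add_0 diff_zero mult_zero_right)
qed

lemma average_between:
  fixes F f :: "real \<Rightarrow> real"
  assumes F: "\<And>a. (F has_real_derivative f a) (at a)" and h: "h > 0"
  obtains c where "a < c" "c < a + h" "(F (a + h) - F a) / h = f c"
  using MVT2[of a "a + h" F f] F h by (auto simp: field_simps)

lemma periodic_uniform_continuity:
  fixes f :: "real \<Rightarrow> real"
  assumes f: "continuous_on UNIV f" and per: "\<And>a. f (a + 1) = f a" and e: "e > 0"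
  obtains d where "d > 0" "\<And>a b. \<bar>a - b\<bar> < d \<Longrightarrow> \<bar>f a - f b\<bar> < e"
proof -
  have "uniformly_continuous_on {-1..2} f"
    by (intro compact_uniformly_continuous continuous_on_subset[OF f]) auto
  then obtain d where d: "d > 0" "\<And>a b. a \<in> {-1..2} \<Longrightarrow> b \<in> {-1..2} \<Longrightarrow> dist b a < d \<Longrightarrow> dist (f b) (f a) < e"
    using e unfolding uniformly_continuous_on_def by metis
  have "\<bar>f a - f b\<bar> < e" if ab: "\<bar>a - b\<bar> < min d 1" for a b
  proof -
    define n where "n = - \<lfloor>a\<rfloor>"
    have eq: "f (a + of_int n) = f a" "f (b + of_int n) = f b"
      using periodic_int_shift[of f 0] per by auto
    have "0 \<le> a + of_int n" "a + of_int n < 1" unfolding n_def by linarith+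
    moreover have "- 1 \<le> b + of_int n" "b + of_int n \<le> 2" using ab calculation by linarith+
    ultimately show ?thesis
      using d(2)[of "b + of_int n" "a + of_int n"] ab unfolding eq by (auto simp: dist_real_def)
  qed
  then show ?thesis using d(1) by (intro that[of "min d 1"]) auto
qed

text \<open>The average of f over [a, a + d] is a difference quotient of an antiderivative, hence C1
  and periodic, and it is close to f by uniform continuity.\<close>

lemma C1_approximation:
  fixes f :: "real \<Rightarrow> real"
  assumes f: "continuous_on UNIV f" and per: "\<And>a. f (a + 1) = f a" and e: "e > 0"
  obtains g g' where "\<And>a. (g has_real_derivative g' a) (at a)" "continuous_on UNIV g'"
    "\<And>a. g (a + 1) = g a" "\<And>a. \<bar>f a - g a\<bar> \<le> e"
proof -
  obtain F where F: "\<And>a. (F has_real_derivative f a) (at a)" using antiderivative_exists[OF f] by blast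
  obtain d where d: "d > 0" "\<And>a b. \<bar>a - b\<bar> < d \<Longrightarrow> \<bar>f a - f b\<bar> < e"
    using periodic_uniform_continuity[OF f per e] by blast
  show ?thesis
  proof (rule that[of "\<lambda>a. (F (a + d) - F a) / d" "\<lambda>a. (f (a + d) - f a) / d"])
    show "continuous_on UNIV (\<lambda>a. (f (a + d) - f a) / d)"
      by (intro continuous_intros continuous_on_compose2[OF f] f) (use d(1) in auto)
    show "(F (a + 1 + d) - F (a + 1)) / d = (F (a + d) - F a) / d" for a
      using antiderivative_shift[of F f 0 a] antiderivative_shift[of F f 0 "a + d"] F per by (simp add: algebra_simps)
    show "\<bar>f a - (F (a + d) - F a) / d\<bar> \<le> e" for a
    proof -
      obtain c where "a < c" "c < a + d" "(F (a + d) - F a) / d = f c" by (rule average_between[of F f, OF F d(1)])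
      then show ?thesis using d(2)[of a c] by simp
    qed
  qed (rule DERIV_shift_diff[OF F])
qed

text \<open>On the whole cone the integral is uniformly close to a continuous affine function of
  \<xi>. Its affinity and continuity for merely continuous f follow by letting e tend to 0.\<close>

lemma deriv_int_approx:
  assumes f: "continuous_on UNIV f" "\<And>a. f (a + 1) = f a" and e: "e > 0"
  obtains c p where "\<And>\<xi>. \<xi> \<in> K_disp \<Longrightarrow> \<bar>deriv_int f \<xi> - (c - inner p \<xi>)\<bar> \<le> e"
proof -
  obtain g g' where g: "\<And>a. (g has_real_derivative g' a) (at a)" "continuous_on UNIV g'"
    "\<And>a. g (a + 1) = g a" "\<And>a. \<bar>f a - g a\<bar> \<le> e" using C1_approximation[OF f e] by blast
  have cg: "continuous_on UNIV g" using g(1) by (intro continuous_at_imp_continuous_on) (auto intro: DERIV_isCont)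
  show ?thesis
  proof (rule that[of "circ g" "abs_L2T g'"])
    fix \<xi> assume \<xi>: "\<xi> \<in> K_disp"
    show "\<bar>deriv_int f \<xi> - (circ g - inner (abs_L2T g') \<xi>)\<bar> \<le> e"
      using deriv_int_diff_le[OF \<xi> f(1) cg g(4)] deriv_int_C1[OF \<xi> g(1-3)] by simp
  qed
qed

lemma deriv_int_affine:
  assumes f: "continuous_on UNIV f" "\<And>a. f (a + 1) = f a"
    and \<xi>: "\<xi> \<in> K_disp" "\<eta> \<in> K_disp" "0 \<le> s" "s \<le> 1"
  shows "deriv_int f ((1 - s) *\<^sub>R \<xi> + s *\<^sub>R \<eta>) = (1 - s) * deriv_int f \<xi> + s * deriv_int f \<eta>"
proof -
  have "\<bar>deriv_int f ((1 - s) *\<^sub>R \<xi> + s *\<^sub>R \<eta>) - ((1 - s) * deriv_int f \<xi> + s * deriv_int f \<eta>)\<bar> \<le> 0 + e" if e: "e > 0" for e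
  proof -
    obtain c p where cp: "\<And>\<xi>. \<xi> \<in> K_disp \<Longrightarrow> \<bar>deriv_int f \<xi> - (c - inner p \<xi>)\<bar> \<le> e / 2"
      using deriv_int_approx[OF f, of "e / 2"] e by auto
    let ?E = "\<lambda>\<xi>. deriv_int f \<xi> - (c - inner p \<xi>)"
    have "deriv_int f ((1 - s) *\<^sub>R \<xi> + s *\<^sub>R \<eta>) - ((1 - s) * deriv_int f \<xi> + s * deriv_int f \<eta>)
       = ?E ((1 - s) *\<^sub>R \<xi> + s *\<^sub>R \<eta>) - ((1 - s) * ?E \<xi> + s * ?E \<eta>)"
      by (simp add: inner_add_right algebra_simps)
    moreover have "\<bar>(1 - s) * ?E \<xi> + s * ?E \<eta>\<bar> \<le> (1 - s) * (e / 2) + s * (e / 2)"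
    proof (rule order_trans[OF abs_triangle_ineq], rule add_mono)
      show "\<bar>(1 - s) * ?E \<xi>\<bar> \<le> (1 - s) * (e / 2)" "\<bar>s * ?E \<eta>\<bar> \<le> s * (e / 2)"
        unfolding abs_mult using \<xi> by (intro mult_mono cp; simp)+
    qed
    moreover have "(1 - s) * (e / 2) + s * (e / 2) = e / 2" by (simp flip: distrib_right)
    ultimately show ?thesis using cp[OF K_disp_convex[OF \<xi>]] by linarith
  qed
  then have "\<bar>deriv_int f ((1 - s) *\<^sub>R \<xi> + s *\<^sub>R \<eta>) - ((1 - s) * deriv_int f \<xi> + s * deriv_int f \<eta>)\<bar> \<le> 0"
    by (rule field_le_epsilon)
  then show ?thesis by simp
qed

lemma deriv_int_tendsto:
  assumes f: "continuous_on UNIV f" "\<And>a. f (a + 1) = f a"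
    and \<xi>: "\<And>n. \<xi> n \<in> K_disp" "\<xi> \<longlonglongrightarrow> \<eta>"
  shows "(\<lambda>n. deriv_int f (\<xi> n)) \<longlonglongrightarrow> deriv_int f \<eta>"
proof (rule tendstoI)
  fix e :: real assume e: "e > 0"
  obtain c p where cp: "\<And>\<xi>. \<xi> \<in> K_disp \<Longrightarrow> \<bar>deriv_int f \<xi> - (c - inner p \<xi>)\<bar> \<le> e / 4"
    using deriv_int_approx[OF f, of "e / 4"] e by auto
  have \<eta>: "\<eta> \<in> K_disp" by (rule K_disp_closed[OF \<xi>])
  have "(\<lambda>n. inner p (\<xi> n)) \<longlonglongrightarrow> inner p \<eta>" by (intro tendsto_intros \<xi>(2))
  then have "\<forall>\<^sub>F n in sequentially. dist (inner p (\<xi> n)) (inner p \<eta>) < e / 2"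
    by (rule tendstoD) (use e in simp)
  then show "\<forall>\<^sub>F n in sequentially. dist (deriv_int f (\<xi> n)) (deriv_int f \<eta>) < e"
  proof eventually_elim
    case (elim n)
    then have "\<bar>inner p (\<xi> n) - inner p \<eta>\<bar> < e / 2" by (simp add: dist_real_def)
    then show ?case using cp[OF \<xi>(1)[of n]] cp[OF \<eta>] unfolding dist_real_def by linarith
  qed
qed

section \<open>Density of smooth and of strictly increasing maps in the cone\<close>

section \<open>Approximation and minimization\<close>

text \<open>C1 lifts of degree-one circle maps. Slope 0 is allowed, since smoothing a monotone map
  gives no positive lower bound; \<open>circle_map_mix\<close> supplies one afterwards.\<close>

definition circle_map :: "(real \<Rightarrow> real) \<Rightarrow> (real \<Rightarrow> real) \<Rightarrow> bool" where
  "circle_map X X' \<longleftrightarrow> (\<forall>a. (X has_real_derivative X' a) (at a)) \<and> continuous_on UNIV X' \<and>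
     (\<forall>a. X (a + 1) = X a + 1) \<and> (\<forall>a. 0 \<le> X' a)"

lemma circle_mapD:
  assumes "circle_map X X'"
  shows "(X has_real_derivative X' a) (at a)" "continuous_on UNIV X'" "X (a + 1) = X a + 1" "0 \<le> X' a"
    "mono X" "continuous_on UNIV X" "abs_L2T (\<lambda>a. X a - a) \<in> K_disp" "L2_fun (\<lambda>a. X a - a)" "X' (a + 1) = X' a"
proof -
  show D: "(X has_real_derivative X' a) (at a)" "continuous_on UNIV X'" and per: "X (a + 1) = X a + 1" and "0 \<le> X' a" for a
    using assms by (auto simp: circle_map_def)
  show m: "mono X"
    by (rule monoI, rule DERIV_nonneg_imp_nondecreasing) (use assms in \<open>auto simp: circle_map_def\<close>)
  show "continuous_on UNIV X"
    using D(1) by (intro continuous_at_imp_continuous_on) (auto intro: DERIV_isCont)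
  show "abs_L2T (\<lambda>a. X a - a) \<in> K_disp" by (rule mono_in_K_disp[OF m per])
  show "L2_fun (\<lambda>a. X a - a)" by (rule mono_L2_fun[OF m per])
  show "X' (a + 1) = X' a"
  proof (rule DERIV_unique)
    show "(X has_real_derivative X' (a + 1)) (at (a + 1))" by (rule D)
    have "((\<lambda>x. X (x + (- 1))) has_real_derivative X' a) (at (a + 1))"
      using D(1)[of a] DERIV_shift[of X "X' a" "a + 1" "- 1"] by simp
    from DERIV_add[OF this DERIV_const[of 1]]
    have "((\<lambda>x. X (x + (- 1)) + 1) has_real_derivative X' a) (at (a + 1))" by simp
    moreover have "X (x + (- 1)) + 1 = X x" for x using per[of "x - 1"] by simp
    ultimately show "(X has_real_derivative X' a) (at (a + 1))" by simp
  qed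
qed

lemma mono_integrable:
  assumes "mono Y" shows "set_integrable lborel {0..1} (Y :: real \<Rightarrow> real)"
proof (rule set_integrable_bound[where f = "\<lambda>_::real. \<bar>Y 0\<bar> + \<bar>Y 1\<bar>"])
  show "set_integrable lborel {0..1} (\<lambda>_::real. \<bar>Y 0\<bar> + \<bar>Y 1\<bar>)" by (rule circ_integrable) simp
  show "set_borel_measurable lborel {0..1} Y"
    using borel_measurable_mono[OF assms] unfolding set_borel_measurable_def by measurable
  have "\<bar>Y a\<bar> \<le> \<bar>Y 0\<bar> + \<bar>Y 1\<bar>" if "a \<in> {0..1}" for a
    using monoD[OF assms, of 0 a] monoD[OF assms, of a 1] that by auto
  then show "AE a in lborel. a \<in> {0..1} \<longrightarrow> norm (Y a) \<le> norm (\<bar>Y 0\<bar> + \<bar>Y 1\<bar>)"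
    by (intro AE_I2) simp
qed

lemma countable_discontinuities_null:
  fixes X :: "real \<Rightarrow> real"
  assumes "mono X" "h \<noteq> 0"
  shows "AE s in lborel. isCont X (a + h * s)"
proof -
  have "{s. \<not> isCont X (a + h * s)} = (\<lambda>x. (x - a) / h) ` {x. \<not> isCont X x}"
    using assms(2) by (auto simp: image_iff field_simps intro!: exI[of _ "a + h * _"])
  moreover have "countable {x. \<not> isCont X x}" by (rule mono_ctble_discont[OF assms(1)])
  ultimately have "countable {s. \<not> isCont X (a + h * s)}" by simp
  then have "AE s in lborel. s \<notin> {s. \<not> isCont X (a + h * s)}"
    by (intro AE_not_in countable_imp_null_set_lborel)
  then show ?thesis by simp
qed

text \<open>The average over [a, a + h], rescaled to a fixed interval of integration so that
  monotonicity in a is immediate.\<close>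

definition mono_avg :: "(real \<Rightarrow> real) \<Rightarrow> real \<Rightarrow> real \<Rightarrow> real" where
  "mono_avg X h a = circ (\<lambda>s. X (a + h * s))"

text \<open>Continuity of the average is dominated convergence: for every a the integrand converges
  at all s outside the countable set where X jumps.\<close>

lemma mono_average:
  fixes X :: "real \<Rightarrow> real"
  assumes X: "mono X" "\<And>a. X (a + 1) = X a + 1" and h: "h > 0"
  shows "mono (mono_avg X h)" "mono_avg X h (a + 1) = mono_avg X h a + 1" "X a \<le> mono_avg X h a"
    "mono_avg X h a \<le> X (a + h)" "continuous_on UNIV (mono_avg X h)"
proof -
  define W where "W = mono_avg X h"
  have W: "W a = circ (\<lambda>s. X (a + h * s))" for a by (simp add: W_def mono_avg_def)
  have int: "set_integrable lborel {0..1} (\<lambda>s. X (a + h * s))" for a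
    using h by (intro mono_integrable monoI monoD[OF X(1)]) simp
  have const: "set_integrable lborel {0..1} (\<lambda>_::real. c)" for c :: real
    by (rule circ_integrable) simp
  show "mono (mono_avg X h)"
    unfolding W_def[symmetric]
  proof (rule monoI)
    show "W x \<le> W y" if "x \<le> y" for x y
      unfolding W using that by (intro set_integral_mono int monoD[OF X(1)]) simp
  qed
  show "mono_avg X h (a + 1) = mono_avg X h a + 1" unfolding W_def[symmetric]
  proof -
    have "X (a + 1 + h * s) = X (a + h * s) + 1" for s using X(2)[of "a + h * s"] by (simp add: algebra_simps)
    then have "W (a + 1) = W a + 1"
      unfolding W using set_integral_add(2)[OF int[of a] const[of 1]] by (simp add: circ_const)
    then show "W (a + 1) = W a + 1" .
  qed
  have "circ (\<lambda>_. X a) \<le> W a" unfolding W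
    using h by (intro set_integral_mono int const monoD[OF X(1)]) simp
  then show "X a \<le> mono_avg X h a" by (simp add: circ_const W_def)
  have "W a \<le> circ (\<lambda>_. X (a + h))" unfolding W
    using h by (intro set_integral_mono int const monoD[OF X(1)]) (simp add: mult_left_le)
  then show "mono_avg X h a \<le> X (a + h)" by (simp add: circ_const W_def)
  show "continuous_on UNIV (mono_avg X h)" unfolding W_def[symmetric]
  proof (rule continuous_on_sequentiallyI)
    fix u :: "nat \<Rightarrow> real" and a assume u: "u \<longlonglongrightarrow> a"
    obtain B where B: "B > 0" "\<And>n. \<bar>u n\<bar> \<le> B"
      using Bseq_def[of u] convergent_imp_Bseq[of u] u by (auto simp: convergent_def)
    have bd: "\<bar>X (u n + h * s)\<bar> \<le> \<bar>X (- B)\<bar> + \<bar>X (B + h)\<bar>" if "s \<in> {0..1}" for n s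
    proof -
      have "0 \<le> h * s" "h * s \<le> h" using h that by (auto simp: mult_left_le)
      then have "- B \<le> u n + h * s" "u n + h * s \<le> B + h" using B(2)[of n] by linarith+
      then show ?thesis using monoD[OF X(1), of "- B" "u n + h * s"] monoD[OF X(1), of "u n + h * s" "B + h"] by linarith
    qed
    have [measurable]: "X \<in> borel_measurable borel" by (rule borel_measurable_mono[OF X(1)])
    show "(\<lambda>n. W (u n)) \<longlonglongrightarrow> W a"
      unfolding W set_lebesgue_integral_def
    proof (rule integral_dominated_convergence)
      show "integrable lborel (\<lambda>s. indicat_real {0..1::real} s *\<^sub>R (\<bar>X (- B)\<bar> + \<bar>X (B + h)\<bar>))"
        using const unfolding set_integrable_def .
      show "AE s in lborel. (\<lambda>n. indicat_real {0..1} s *\<^sub>R X (u n + h * s)) \<longlonglongrightarrow> indicat_real {0..1} s *\<^sub>R X (a + h * s)"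
        using countable_discontinuities_null[OF X(1) less_imp_neq[OF h, symmetric], of a]
      proof eventually_elim
        case (elim s)
        have "(\<lambda>n. u n + h * s) \<longlonglongrightarrow> a + h * s" by (intro tendsto_intros u)
        from isCont_tendsto_compose[OF elim this] show ?case by (intro tendsto_intros)
      qed
      show "AE s in lborel. norm (indicat_real {0..1} s *\<^sub>R X (u n + h * s)) \<le> indicat_real {0..1} s *\<^sub>R (\<bar>X (- B)\<bar> + \<bar>X (B + h)\<bar>)" for n
        using bd by (intro AE_I2) (simp add: indicator_def)
    qed measurable
  qed
qed

text \<open>One average makes X continuous, a second makes it C1. Averaging to the right only keeps
  the result between X a and X (a + 2 h).\<close>

lemma mono_smoothing:
  fixes X :: "real \<Rightarrow> real"
  assumes X: "mono X" "\<And>a. X (a + 1) = X a + 1" and h: "h > 0"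
  shows "\<exists>V V'. circle_map V V' \<and> (\<forall>a. X a \<le> V a \<and> V a \<le> X (a + 2 * h))"
proof -
  define W where "W = mono_avg X h"
  note W = mono_average[OF X h, folded W_def]
  obtain F where F: "\<And>a. (F has_real_derivative W a) (at a)" using antiderivative_exists[OF W(5)] by blast
  have "circle_map (\<lambda>a. (F (a + h) - F a) / h) (\<lambda>a. (W (a + h) - W a) / h)"
    unfolding circle_map_def
  proof (intro conjI allI)
    fix a
    show "((\<lambda>a. (F (a + h) - F a) / h) has_real_derivative (W (a + h) - W a) / h) (at a)"
      by (rule DERIV_shift_diff[OF F])
    show "0 \<le> (W (a + h) - W a) / h" using h monoD[OF W(1), of a "a + h"] by simp
    have "F (a + h + 1) - F (a + 1) - (F (a + h) - F a) = h"
      using antiderivative_shift[of F W 1 a, OF F W(2)] antiderivative_shift[of F W 1 "a + h", OF F W(2)] by simp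
    then have "F (a + 1 + h) - F (a + 1) = F (a + h) - F a + h" by (simp add: algebra_simps)
    then show "(F (a + 1 + h) - F (a + 1)) / h = (F (a + h) - F a) / h + 1" using h by (simp add: field_simps)
  next
    show "continuous_on UNIV (\<lambda>a. (W (a + h) - W a) / h)"
      by (intro continuous_intros continuous_on_compose2[OF W(5)] W(5)) (use h in auto)
  qed
  moreover have "X a \<le> (F (a + h) - F a) / h \<and> (F (a + h) - F a) / h \<le> X (a + 2 * h)" for a
  proof -
    obtain c where c: "a < c" "c < a + h" "(F (a + h) - F a) / h = W c" by (rule average_between[of F W, OF F h])
    have "X a \<le> X c" "X (c + h) \<le> X (a + 2 * h)" using c by (auto intro: monoD[OF X(1)])
    then show ?thesis unfolding c(3) using W(3,4)[of c] by auto
  qed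
  ultimately show ?thesis by blast
qed

text \<open>At continuity points of X the sandwich forces convergence, and since the shift is at
  most 1 the difference is dominated by X (a + 1) - X a = 1.\<close>

lemma smooth_dense_K_disp:
  assumes \<xi>: "\<xi> \<in> K_disp" and e: "e > 0"
  shows "\<exists>V V'. circle_map V V' \<and> norm (abs_L2T (\<lambda>a. V a - a) - \<xi>) < e"
proof -
  obtain X where X: "X \<in> I_plus \<xi>" "mono X" using \<xi> by (auto simp: K_disp_def)
  note IX = I_plusD[OF X(1)]
  have "\<forall>n. \<exists>V V'. circle_map V V' \<and> (\<forall>a. X a \<le> V a \<and> V a \<le> X (a + inverse (real (Suc n))))"
  proof
    fix n
    show "\<exists>V V'. circle_map V V' \<and> (\<forall>a. X a \<le> V a \<and> V a \<le> X (a + inverse (real (Suc n))))"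
      using mono_smoothing[OF X(2) IX(3), of "inverse (real (Suc n)) / 2"] by simp
  qed
  then obtain V V' where V: "\<And>n. circle_map (V n) (V' n)"
    "\<And>n a. X a \<le> V n a" "\<And>n a. V n a \<le> X (a + inverse (real (Suc n)))" by metis
  have bd: "\<bar>V n a - X a\<bar> \<le> 1" for n a
  proof -
    have "inverse (real (Suc n)) \<le> 1" by (simp add: field_simps)
    then have "X (a + inverse (real (Suc n))) \<le> X (a + 1)" by (intro monoD[OF X(2)]) simp
    then show ?thesis using IX(3)[of a] V(3)[of n a] V(2)[of a n] by linarith
  qed
  have [measurable]: "X \<in> borel_measurable borel" by (rule borel_measurable_mono[OF X(2)])
  have [measurable]: "V n \<in> borel_measurable borel" for n by (rule borel_measurable_mono[OF circle_mapD(5)[OF V(1)]])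
  have "(\<lambda>n. circ (\<lambda>a. (V n a - X a)\<^sup>2)) \<longlonglongrightarrow> (\<integral>a. indicat_real {0..1::real} a *\<^sub>R (0::real) \<partial>lborel)"
    unfolding set_lebesgue_integral_def
  proof (rule integral_dominated_convergence)
    show "integrable lborel (\<lambda>a. indicat_real {0..1::real} a *\<^sub>R (1::real))"
      using circ_integrable[of "\<lambda>_. 1"] unfolding set_integrable_def by simp
    show "AE a in lborel. (\<lambda>n. indicat_real {0..1} a *\<^sub>R (V n a - X a)\<^sup>2) \<longlonglongrightarrow> indicat_real {0..1} a *\<^sub>R 0"
      using countable_discontinuities_null[OF X(2) one_neq_zero, of 0]
    proof eventually_elim
      case (elim a)
      have "(\<lambda>n. a + inverse (real (Suc n))) \<longlonglongrightarrow> a + 0" by (intro tendsto_intros LIMSEQ_inverse_real_of_nat)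
      then have "(\<lambda>n. X (a + inverse (real (Suc n)))) \<longlonglongrightarrow> X a"
        using elim by (intro isCont_tendsto_compose[of _ X]) auto
      then have "(\<lambda>n. V n a) \<longlonglongrightarrow> X a"
        by (rule tendsto_sandwich[OF always_eventually[OF allI[OF V(2)]] always_eventually[OF allI[OF V(3)]] tendsto_const])
      then have "(\<lambda>n. indicat_real {0..1} a *\<^sub>R (V n a - X a)\<^sup>2) \<longlonglongrightarrow> indicat_real {0..1} a *\<^sub>R (X a - X a)\<^sup>2"
        by (intro tendsto_intros)
      then show ?case by simp
    qed
    show "AE a in lborel. norm (indicat_real {0..1} a *\<^sub>R (V n a - X a)\<^sup>2) \<le> indicat_real {0..1} a *\<^sub>R 1" for n
      using power_mono[OF bd abs_ge_zero, of n _ 2] by (intro AE_I2) (simp add: indicator_def)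
  qed measurable
  then have "(\<lambda>n. sqrt (circ (\<lambda>a. (V n a - X a)\<^sup>2))) \<longlonglongrightarrow> sqrt 0"
    by (intro tendsto_real_sqrt) simp
  then have "\<forall>\<^sub>F n in sequentially. sqrt (circ (\<lambda>a. (V n a - X a)\<^sup>2)) < e"
    by (rule order_tendstoD) (use e in simp)
  then obtain n where n: "sqrt (circ (\<lambda>a. (V n a - X a)\<^sup>2)) < e" by (auto simp: eventually_sequentially)
  have "abs_L2T (\<lambda>a. V n a - a) - \<xi> = abs_L2T (\<lambda>a. (V n a - a) - (X a - a))"
    using abs_L2T_diff[OF circle_mapD(8)[OF V(1)[of n]] IX(1)] IX(2) by simp
  then have "norm (abs_L2T (\<lambda>a. V n a - a) - \<xi>) = sqrt (circ (\<lambda>a. ((V n a - a) - (X a - a))\<^sup>2))"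
    using norm_abs_L2T[OF L2_fun_diff[OF circle_mapD(8)[OF V(1)[of n]] IX(1)]] by simp
  then show ?thesis using n V(1)[of n] by auto
qed

lemma circle_map_mix:
  assumes "circle_map V V'" "0 \<le> s" "s \<le> 1"
  shows "circle_map (\<lambda>a. (1 - s) * V a + s * a) (\<lambda>a. (1 - s) * V' a + s)"
    "abs_L2T (\<lambda>a. ((1 - s) * V a + s * a) - a) = (1 - s) *\<^sub>R abs_L2T (\<lambda>a. V a - a)"
proof -
  note V = circle_mapD[OF assms(1)]
  show "circle_map (\<lambda>a. (1 - s) * V a + s * a) (\<lambda>a. (1 - s) * V' a + s)"
    unfolding circle_map_def
  proof (intro conjI allI)
    show "((\<lambda>a. (1 - s) * V a + s * a) has_real_derivative (1 - s) * V' a + s) (at a)" for a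
      by (auto intro!: derivative_eq_intros V)
    show "continuous_on UNIV (\<lambda>a. (1 - s) * V' a + s)" by (intro continuous_intros V)
    show "(1 - s) * V (a + 1) + s * (a + 1) = (1 - s) * V a + s * a + 1" for a
      by (subst V(3)) (simp add: algebra_simps)
    show "0 \<le> (1 - s) * V' a + s" for a using V(4) assms(2,3) by simp
  qed
  have "((1 - s) * V a + s * a) - a = (1 - s) * (V a - a)" for a by (simp add: algebra_simps)
  then show "abs_L2T (\<lambda>a. ((1 - s) * V a + s * a) - a) = (1 - s) *\<^sub>R abs_L2T (\<lambda>a. V a - a)"
    by (simp add: abs_L2T_scaleR V(8))
qed

text \<open>Mixing with the identity raises the slope to at least s > 0 and only multiplies the
  displacement by 1 - s.\<close>

lemma positive_dense_K_disp:
  assumes \<xi>: "\<xi> \<in> K_disp" and e: "e > 0"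
  shows "\<exists>X X'. circle_map X X' \<and> (\<forall>a. X' a > 0) \<and> norm (abs_L2T (\<lambda>a. X a - a) - \<xi>) < e"
proof -
  obtain V V' where V: "circle_map V V'" "norm (abs_L2T (\<lambda>a. V a - a) - \<xi>) < e / 2"
    using smooth_dense_K_disp[OF \<xi>, of "e / 2"] e by auto
  define v where "v = abs_L2T (\<lambda>a. V a - a)"
  \<comment> \<open>Small enough for s |v| \<le> e / 2; the 1 in the denominator covers v =
    0.\<close>
  define s where "s = min (1 / 2) (e / (2 * (norm v + 1)))"
  have s: "0 < s" "s \<le> 1 / 2" "s \<le> e / (2 * (norm v + 1))"
    using e by (simp_all only: s_def min.cobounded1 min.cobounded2) (auto simp: add_nonneg_pos)
  have "s * norm v \<le> e / 2"
  proof -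
    have "s * norm v \<le> s * (norm v + 1)" using s(1) by simp
    also have "\<dots> \<le> e / (2 * (norm v + 1)) * (norm v + 1)" using s(3) by (intro mult_right_mono) auto
    also have "\<dots> = e / 2" using norm_ge_zero[of v] by (simp add: field_simps add_nonneg_eq_0_iff)
    finally show ?thesis .
  qed
  then have "norm ((1 - s) *\<^sub>R v - v) \<le> e / 2" using s(1) by (simp add: scaleR_left_diff_distrib)
  then have "norm ((1 - s) *\<^sub>R v - \<xi>) < e"
    using V(2) norm_triangle_ineq[of "(1 - s) *\<^sub>R v - v" "v - \<xi>"] by (simp add: v_def)
  moreover have "0 < (1 - s) * V' a + s" for a
    using circle_mapD(4)[OF V(1), of a] s by (simp add: add_nonneg_pos)
  ultimately show ?thesis
    using circle_map_mix[OF V(1), of s] s unfolding v_def by (intro exI conjI allI) (assumption | simp)+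
qed

text \<open>For C1 test functions the two sides agree by integrating the derivative of f(a) (X a -
  a) over a period; general f follow by uniform approximation, both measures having mass 1.\<close>

lemma deriv_int_circle_map:
  assumes X: "circle_map X X'" and f: "continuous_on UNIV f" "\<And>a. f (a + 1) = f a"
  shows "deriv_int f (abs_L2T (\<lambda>a. X a - a)) = circ (\<lambda>a. f a * X' a)"
proof -
  note XD = circle_mapD[OF X]
  let ?\<xi> = "abs_L2T (\<lambda>a. X a - a)"
  have C1: "deriv_int g ?\<xi> = circ (\<lambda>a. g a * X' a)"
    if g: "\<And>a. (g has_real_derivative g' a) (at a)" "continuous_on UNIV g'" "\<And>a. g (a + 1) = g a" for g g'
  proof -
    have cg: "continuous_on UNIV g" using g(1) by (intro continuous_at_imp_continuous_on) (auto intro: DERIV_isCont)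
    have perg': "g' (a + 1) = g' a" for a
    proof (rule DERIV_unique)
      show "(g has_real_derivative g' (a + 1)) (at (a + 1))" by (rule g)
      have "((\<lambda>x. g (x + (- 1))) has_real_derivative g' a) (at (a + 1))"
        using g(1)[of a] DERIV_shift[of g "g' a" "a + 1" "- 1"] by simp
      moreover have "g (x + (- 1)) = g x" for x using g(3)[of "x - 1"] by simp
      ultimately show "(g has_real_derivative g' a) (at (a + 1))" by simp
    qed
    have Lg': "L2_fun g'" by (rule L2_fun_continuous[OF g(2) perg'])
    have "circ (\<lambda>a. g a * X' a - (g a - g' a * (X a - a))) = 0"
    proof -
      have "((\<lambda>a. g a * (X a - a)) has_real_derivative (g a * X' a - (g a - g' a * (X a - a)))) (at a)" for a
        by (auto intro!: derivative_eq_intros g XD simp: algebra_simps)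
      then have "circ (\<lambda>a. g a * X' a - (g a - g' a * (X a - a))) = g 1 * (X 1 - 1) - g 0 * (X 0 - 0)"
        by (rule circ_FTC) (intro continuous_intros cg XD g)
      then show ?thesis using g(3)[of 0] XD(3)[of 0] by simp
    qed
    moreover have "circ (\<lambda>a. g a * X' a - (g a - g' a * (X a - a))) = circ (\<lambda>a. g a * X' a) - (circ g - circ (\<lambda>a. g' a * (X a - a)))"
      by (subst set_integral_diff(2), (intro circ_integrable continuous_intros cg XD g)+,
          subst set_integral_diff(2), (intro circ_integrable continuous_intros cg XD g)+, simp)
    ultimately show ?thesis
      using deriv_int_C1[OF XD(7) g] inner_abs_L2T[OF Lg' XD(8)] by simp
  qed
  have "\<bar>deriv_int f ?\<xi> - circ (\<lambda>a. f a * X' a)\<bar> \<le> 0 + e" if e: "e > 0" for e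
  proof -
    obtain g g' where g: "\<And>a. (g has_real_derivative g' a) (at a)" "continuous_on UNIV g'"
      "\<And>a. g (a + 1) = g a" "\<And>a. \<bar>f a - g a\<bar> \<le> e / 2" using C1_approximation[OF f, of "e / 2"] e by auto
    have cg: "continuous_on UNIV g" using g(1) by (intro continuous_at_imp_continuous_on) (auto intro: DERIV_isCont)
    have "circ X' = X 1 - X 0" by (rule circ_FTC[OF XD(1,2)])
    then have cX: "circ X' = 1" using XD(3)[of 0] by simp
    have ints: "set_integrable lborel {0..1} (\<lambda>a. f a * X' a)" "set_integrable lborel {0..1} (\<lambda>a. g a * X' a)"
      "set_integrable lborel {0..1} (\<lambda>a. (f a - g a) * X' a)" "set_integrable lborel {0..1} (\<lambda>a. c * X' a)" for c
      by (intro circ_integrable continuous_intros f cg XD)+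
    have eq: "circ (\<lambda>a. f a * X' a) - circ (\<lambda>a. g a * X' a) = circ (\<lambda>a. (f a - g a) * X' a)"
      using set_integral_diff(2)[OF ints(1,2)] by (simp add: left_diff_distrib)
    have "circ (\<lambda>a. (f a - g a) * X' a) \<le> circ (\<lambda>a. e / 2 * X' a)"
    proof (intro set_integral_mono ints mult_right_mono XD(4))
      show "f a - g a \<le> e / 2" for a using g(4)[of a] by linarith
    qed
    moreover have "circ (\<lambda>a. (- (e / 2)) * X' a) \<le> circ (\<lambda>a. (f a - g a) * X' a)"
    proof (intro set_integral_mono ints mult_right_mono XD(4))
      show "- (e / 2) \<le> f a - g a" for a using g(4)[of a] by linarith
    qed
    moreover have "circ (\<lambda>a. e / 2 * X' a) = e / 2" "circ (\<lambda>a. (- (e / 2)) * X' a) = - (e / 2)"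
      by (subst set_integral_mult_right; simp add: cX)+
    ultimately have "\<bar>circ (\<lambda>a. f a * X' a) - circ (\<lambda>a. g a * X' a)\<bar> \<le> e / 2"
      unfolding eq by linarith
    then show ?thesis
      using deriv_int_diff_le[OF XD(7) f(1) cg g(4)] C1[OF g(1-3)] by linarith
  qed
  then have "\<bar>deriv_int f ?\<xi> - circ (\<lambda>a. f a * X' a)\<bar> \<le> 0" by (rule field_le_epsilon)
  then show ?thesis by simp
qed

section \<open>Proximal points and surjectivity of the identity plus a subdifferential\<close>

section \<open>Subdifferentials of convex functionals\<close>

text \<open>The quadratic penalty makes the problem uniformly convex, so minimising sequences are
  Cauchy and semicontinuity along strong limits suffices.\<close>

lemma convex_minimiser_exists:
  fixes \<Phi> :: "'a::{real_inner,banach} \<Rightarrow> ereal"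
  assumes lower: "\<And>x. ereal m \<le> \<Phi> x" and proper: "\<Phi> x0 \<noteq> \<infinity>"
    and convex: "\<And>x y s. 0 < s \<Longrightarrow> s < 1 \<Longrightarrow> \<Phi> x \<noteq> \<infinity> \<Longrightarrow> \<Phi> y \<noteq> \<infinity> \<Longrightarrow>
      \<Phi> ((1 - s) *\<^sub>R x + s *\<^sub>R y) \<le> ereal ((1 - s) * real_of_ereal (\<Phi> x) + s * real_of_ereal (\<Phi> y))"
    and closed: "\<And>X x c. X \<longlonglongrightarrow> x \<Longrightarrow> (\<And>n. \<Phi> (X n) \<le> ereal c) \<Longrightarrow> \<Phi> x \<le> ereal c"
    and \<mu>: "\<mu> > 0"
  shows "\<exists>x. \<Phi> x \<noteq> \<infinity> \<and> (\<forall>y. \<Phi> y \<noteq> \<infinity> \<longrightarrow>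
     real_of_ereal (\<Phi> x) + (norm (x - z))\<^sup>2 / (2 * \<mu>) \<le> real_of_ereal (\<Phi> y) + (norm (y - z))\<^sup>2 / (2 * \<mu>))"
proof -
  define D where "D = {x. \<Phi> x \<noteq> \<infinity>}"
  define f where "f x = real_of_ereal (\<Phi> x)" for x
  have f: "\<Phi> x = ereal (f x)" if "x \<in> D" for x
    using that lower[of x] unfolding D_def f_def by (cases "\<Phi> x") auto
  have fm: "m \<le> f x" if "x \<in> D" for x using lower[of x] f[OF that] by simp
  define F where "F x = f x + (norm (x - z))\<^sup>2 / (2 * \<mu>)" for x
  have Fm: "m \<le> F x" if "x \<in> D" for x using fm[OF that] \<mu> by (simp add: F_def add_increasing2)
  have "x0 \<in> D" using proper by (simp add: D_def)
  define I where "I = Inf (F ` D)"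
  have bdd: "bdd_below (F ` D)" using Fm by (rule bdd_belowI2)
  have I: "I \<le> F x" if "x \<in> D" for x unfolding I_def by (rule cINF_lower[OF bdd that])
  have "\<exists>x\<in>D. F x < I + inverse (real (Suc n))" for n
  proof -
    have "Inf (F ` D) < I + inverse (real (Suc n))" by (simp add: I_def)
    then show ?thesis using \<open>x0 \<in> D\<close> bdd by (subst (asm) cINF_less_iff) auto
  qed
  then obtain X where X: "\<And>n. X n \<in> D" "\<And>n. F (X n) < I + inverse (real (Suc n))" by metis
  \<comment> \<open>The value at the midpoint is at least the infimum, and the parallelogram law
    turns its gain over the average into a bound for |x - y|^2.\<close>
  have mid: "(norm (x - y))\<^sup>2 \<le> 4 * \<mu> * (F x + F y - 2 * I)" if xy: "x \<in> D" "y \<in> D" for x y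
  proof -
    let ?m = "(1/2) *\<^sub>R x + (1/2) *\<^sub>R y"
    have le: "\<Phi> ?m \<le> ereal (1/2 * f x + 1/2 * f y)"
      unfolding f_def using convex[of "1/2" x y] xy by (simp add: D_def)
    then have mD: "?m \<in> D" by (auto simp: D_def)
    have fm: "f ?m \<le> f x / 2 + f y / 2" using le f[OF mD] by simp
    have "?m - z = (1/2) *\<^sub>R ((x - z) + (y - z))"
      by (simp add: scaleR_add_right scaleR_diff_right) (simp add: algebra_simps flip: scaleR_add_left)
    then have "(norm (?m - z))\<^sup>2 = (norm ((x - z) + (y - z)))\<^sup>2 / 4" by (simp add: power_divide)
    also have "(norm ((x - z) + (y - z)))\<^sup>2 = 2 * (norm (x - z))\<^sup>2 + 2 * (norm (y - z))\<^sup>2 - (norm (x - y))\<^sup>2"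
      by (simp add: power2_norm_eq_inner inner_add_left inner_add_right inner_diff_left inner_diff_right inner_commute)
    finally have nm: "(norm (?m - z))\<^sup>2 = (norm (x - z))\<^sup>2 / 2 + (norm (y - z))\<^sup>2 / 2 - (norm (x - y))\<^sup>2 / 4"
      by simp
    have "F ?m \<le> (F x + F y) / 2 - (norm (x - y))\<^sup>2 / (8 * \<mu>)"
    proof -
      define q where "q = 1 / (2 * \<mu>)"
      have q: "t / (2 * \<mu>) = t * q" "t / (8 * \<mu>) = t * q / 4" for t using \<mu> by (simp_all add: q_def)
      show ?thesis unfolding F_def nm q using fm by (simp add: algebra_simps)
    qed
    then have "I \<le> (F x + F y) / 2 - (norm (x - y))\<^sup>2 / (8 * \<mu>)" using I[OF mD] by simp
    then show ?thesis using \<mu> by (simp add: field_simps)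
  qed
  have "Cauchy X"
  proof (rule CauchyI)
    fix e :: real assume e: "e > 0"
    obtain N where N: "inverse (real (Suc N)) < e\<^sup>2 / (8 * \<mu>)"
      using reals_Archimedean[of "e\<^sup>2 / (8 * \<mu>)"] e \<mu> by auto
    have "norm (X n - X k) < e" if nk: "n \<ge> N" "k \<ge> N" for n k
    proof -
      have le: "inverse (real (Suc n)) \<le> inverse (real (Suc N))" "inverse (real (Suc k)) \<le> inverse (real (Suc N))"
        using nk by (auto intro!: le_imp_inverse_le)
      have "(norm (X n - X k))\<^sup>2 \<le> 4 * \<mu> * (F (X n) + F (X k) - 2 * I)" by (rule mid[OF X(1) X(1)])
      also have "\<dots> \<le> 4 * \<mu> * (2 * inverse (real (Suc N)))"
        using X(2)[of n] X(2)[of k] le \<mu> by (intro mult_left_mono) (linarith, simp)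
      also have "\<dots> < 4 * \<mu> * (2 * (e\<^sup>2 / (8 * \<mu>)))" using N \<mu> by (intro mult_strict_left_mono) auto
      also have "\<dots> = e\<^sup>2" using \<mu> by simp
      finally show ?thesis by (rule power2_less_imp_less) (use e in simp)
    qed
    then show "\<exists>M. \<forall>n\<ge>M. \<forall>k\<ge>M. norm (X n - X k) < e" by blast
  qed
  then obtain x where x: "X \<longlonglongrightarrow> x" by (auto simp: Cauchy_convergent_iff convergent_def)
  have lim: "(\<lambda>n. I + inverse (real (Suc n)) - (norm (X n - z))\<^sup>2 / (2 * \<mu>)) \<longlonglongrightarrow> I + 0 - (norm (x - z))\<^sup>2 / (2 * \<mu>)"
    using \<mu> by (intro tendsto_intros LIMSEQ_inverse_real_of_nat x) auto
  define c where "c = I - (norm (x - z))\<^sup>2 / (2 * \<mu>)"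
  \<comment> \<open>Along a tail of the sequence the values stay below a constant, as
    \<open>closed\<close> requires; the slack e is removed afterwards.\<close>
  have \<Phi>x: "\<Phi> x \<le> ereal (c + e)" if e: "e > 0" for e
  proof -
    have "\<forall>\<^sub>F n in sequentially. I + inverse (real (Suc n)) - (norm (X n - z))\<^sup>2 / (2 * \<mu>) < c + e"
      using lim by (rule order_tendstoD) (use e in \<open>simp add: c_def\<close>)
    then obtain N where N: "\<And>n. n \<ge> N \<Longrightarrow> I + inverse (real (Suc n)) - (norm (X n - z))\<^sup>2 / (2 * \<mu>) < c + e"
      by (auto simp: eventually_sequentially)
    show ?thesis
    proof (rule closed)
      show "(\<lambda>n. X (n + N)) \<longlonglongrightarrow> x" using x by (rule LIMSEQ_ignore_initial_segment)
      show "\<Phi> (X (n + N)) \<le> ereal (c + e)" for n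
        using N[of "n + N"] X(2)[of "n + N"] by (simp add: f[OF X(1)] F_def)
    qed
  qed
  have xD: "x \<in> D" using \<Phi>x[OF zero_less_one] by (auto simp: D_def)
  have "f x \<le> c"
    by (rule field_le_epsilon) (use \<Phi>x f[OF xD] in auto)
  then have "F x \<le> I" by (simp add: F_def c_def)
  then have "F x \<le> F y" if "y \<in> D" for y using I[OF that] by simp
  then show ?thesis using xD unfolding D_def F_def f_def by blast
qed

text \<open>Moving from the minimiser x a fraction s towards y cannot lower the penalised
  functional; dividing by s and letting s tend to 0 makes (z - x) / \<mu> a subgradient.\<close>

lemma subdifferential_range:
  fixes \<Phi> :: "'a::{real_inner,banach} \<Rightarrow> ereal"
  assumes lower: "\<And>x. ereal m \<le> \<Phi> x" and proper: "\<Phi> x0 \<noteq> \<infinity>"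
    and convex: "\<And>x y s. 0 < s \<Longrightarrow> s < 1 \<Longrightarrow> \<Phi> x \<noteq> \<infinity> \<Longrightarrow> \<Phi> y \<noteq> \<infinity> \<Longrightarrow>
      \<Phi> ((1 - s) *\<^sub>R x + s *\<^sub>R y) \<le> ereal ((1 - s) * real_of_ereal (\<Phi> x) + s * real_of_ereal (\<Phi> y))"
    and closed: "\<And>X x c. X \<longlonglongrightarrow> x \<Longrightarrow> (\<And>n. \<Phi> (X n) \<le> ereal c) \<Longrightarrow> \<Phi> x \<le> ereal c"
    and \<mu>: "\<mu> > 0"
  shows "\<exists>x. \<exists>y\<in>subdifferential \<Phi> x. z = x + \<mu> *\<^sub>R y"
proof -
  have "\<exists>x. \<Phi> x \<noteq> \<infinity> \<and> (\<forall>y. \<Phi> y \<noteq> \<infinity> \<longrightarrow>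
     real_of_ereal (\<Phi> x) + (norm (x - z))\<^sup>2 / (2 * \<mu>) \<le> real_of_ereal (\<Phi> y) + (norm (y - z))\<^sup>2 / (2 * \<mu>))"
  proof (rule convex_minimiser_exists[where \<Phi> = \<Phi>, OF lower proper _ _ \<mu>])
    fix x y :: 'a and s :: real assume "0 < s" "s < 1" "\<Phi> x \<noteq> \<infinity>" "\<Phi> y \<noteq> \<infinity>"
    then show "\<Phi> ((1 - s) *\<^sub>R x + s *\<^sub>R y) \<le> ereal ((1 - s) * real_of_ereal (\<Phi> x) + s * real_of_ereal (\<Phi> y))"
      by (rule convex)
  next
    fix X :: "nat \<Rightarrow> 'a" and x c assume "X \<longlonglongrightarrow> x" "\<And>n. \<Phi> (X n) \<le> ereal c"
    then show "\<Phi> x \<le> ereal c" by (rule closed)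
  qed
  then obtain x where x: "\<Phi> x \<noteq> \<infinity>" "\<And>y. \<Phi> y \<noteq> \<infinity> \<Longrightarrow>
     real_of_ereal (\<Phi> x) + (norm (x - z))\<^sup>2 / (2 * \<mu>) \<le> real_of_ereal (\<Phi> y) + (norm (y - z))\<^sup>2 / (2 * \<mu>)"
    by blast
  have fin: "\<Phi> y = ereal (real_of_ereal (\<Phi> y))" if "\<Phi> y \<noteq> \<infinity>" for y
    using that lower[of y] by (cases "\<Phi> y") auto
  define p where "p = (z - x) /\<^sub>R \<mu>"
  have "\<Phi> x + ereal (inner p (y - x)) \<le> \<Phi> y" for y
  proof (cases "\<Phi> y = \<infinity>")
    case False
    define d where "d = real_of_ereal (\<Phi> y) - real_of_ereal (\<Phi> x)"
    have "inner p (y - x) \<le> d + s * ((norm (y - x))\<^sup>2 / (2 * \<mu>))" if s: "0 < s" "s < 1" for s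
    proof -
      let ?w = "(1 - s) *\<^sub>R x + s *\<^sub>R y"
      have le: "\<Phi> ?w \<le> ereal ((1 - s) * real_of_ereal (\<Phi> x) + s * real_of_ereal (\<Phi> y))"
        by (rule convex[OF s x(1) False])
      then have w: "\<Phi> ?w \<noteq> \<infinity>" by auto
      have "real_of_ereal (\<Phi> x) + (norm (x - z))\<^sup>2 / (2 * \<mu>) \<le> real_of_ereal (\<Phi> ?w) + (norm (?w - z))\<^sup>2 / (2 * \<mu>)"
        by (rule x(2)[OF w])
      also have "real_of_ereal (\<Phi> ?w) \<le> (1 - s) * real_of_ereal (\<Phi> x) + s * real_of_ereal (\<Phi> y)"
        using le fin[OF w] by (metis ereal_less_eq(3))
      also have "\<dots> = real_of_ereal (\<Phi> x) + s * d" by (simp add: d_def algebra_simps)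
      also have "?w - z = (x - z) + s *\<^sub>R (y - x)" by (simp add: algebra_simps)
      also have "(norm ((x - z) + s *\<^sub>R (y - x)))\<^sup>2 = (norm (x - z))\<^sup>2 + (2 * (s * inner (x - z) (y - x)) + s * (s * (norm (y - x))\<^sup>2))"
        by (simp only: power2_norm_eq_inner) (simp add: inner_add_left inner_add_right inner_commute power2_eq_square)
      finally have "0 \<le> s * d + (2 * (s * inner (x - z) (y - x)) + s * (s * (norm (y - x))\<^sup>2)) / (2 * \<mu>)"
        by (simp add: add_divide_distrib)
      also have "\<dots> = s * (d + inner (x - z) (y - x) / \<mu> + s * ((norm (y - x))\<^sup>2 / (2 * \<mu>)))"
        using \<mu> by (simp add: field_simps)
      finally have "0 \<le> d + inner (x - z) (y - x) / \<mu> + s * ((norm (y - x))\<^sup>2 / (2 * \<mu>))"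
        using s(1) by (simp add: zero_le_mult_iff)
      moreover have "inner p (y - x) = - (inner (x - z) (y - x) / \<mu>)"
        by (simp add: p_def inner_diff_left divide_inverse algebra_simps)
      ultimately show ?thesis by simp
    qed
    then have ev: "\<forall>\<^sub>F s in at_right 0. inner p (y - x) \<le> d + s * ((norm (y - x))\<^sup>2 / (2 * \<mu>))"
      by (intro eventually_at_rightI[of 0 1]) auto
    have "((\<lambda>s. d + s * ((norm (y - x))\<^sup>2 / (2 * \<mu>))) \<longlongrightarrow> d + 0 * ((norm (y - x))\<^sup>2 / (2 * \<mu>))) (at_right 0)"
      by (intro tendsto_intros)
    from tendsto_lowerbound[OF this ev] have "inner p (y - x) \<le> d" by simp
    then have "ereal (real_of_ereal (\<Phi> x)) + ereal (inner p (y - x)) \<le> ereal (real_of_ereal (\<Phi> y))"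
      by (simp add: d_def)
    then show ?thesis using fin[OF x(1)] fin[OF False] by simp
  qed simp
  then have "p \<in> subdifferential \<Phi> x" using x(1) by (simp add: subdifferential_def)
  moreover have "z = x + \<mu> *\<^sub>R p" using \<mu> by (simp add: p_def)
  ultimately show ?thesis by blast
qed

lemma subdifferential_real:
  assumes "p \<in> subdifferential \<Phi> x" "\<Phi> y \<noteq> \<infinity>" "\<And>x. ereal m \<le> \<Phi> x"
  shows "real_of_ereal (\<Phi> x) + inner p (y - x) \<le> real_of_ereal (\<Phi> y)"
proof -
  have fin: "\<Phi> y = ereal (real_of_ereal (\<Phi> y))" if "\<Phi> y \<noteq> \<infinity>" for y
    using that assms(3)[of y] by (cases "\<Phi> y") auto
  have "\<Phi> x \<noteq> \<infinity>" "\<Phi> x + ereal (inner p (y - x)) \<le> \<Phi> y" using assms(1) by (auto simp: subdifferential_def)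
  then show ?thesis using fin[of x] fin[OF assms(2)] by (metis ereal_less_eq(3) plus_ereal.simps(1))
qed

section \<open>Fenchel duality for the convex function of measures and its subgradients\<close>

section \<open>The functional \<open>\<Theta>\<close>\<close>

text \<open>Convexity is used in the form of tangents: they make the optimal test function explicit,
  namely \<open>\<theta>'\<close> composed with the slope.\<close>

locale potential =
  fixes \<theta> \<theta>' :: "real \<Rightarrow> real"
  assumes deriv: "x > 0 \<Longrightarrow> (\<theta> has_real_derivative \<theta>' x) (at x)"
    and cont: "continuous_on {0<..} \<theta>'"
    and tangent: "x > 0 \<Longrightarrow> y > 0 \<Longrightarrow> \<theta> x + \<theta>' x * (y - x) \<le> \<theta> y"
begin

lemma continuous_on_\<theta>: "continuous_on {0<..} \<theta>"
  by (intro continuous_at_imp_continuous_on) (auto intro: DERIV_isCont deriv)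

lemma legendre_ge: "\<tau> > 0 \<Longrightarrow> ereal (s * \<tau> - \<theta> \<tau>) \<le> legendre \<theta> s"
  unfolding legendre_def by (rule SUP_upper2[of \<tau>]) (auto simp: theta_ext_def)

text \<open>The equality case of Fenchel's inequality: the tangent at \<tau> shows that the supremum
  is attained there.\<close>

lemma legendre_deriv: "\<tau> > 0 \<Longrightarrow> legendre \<theta> (\<theta>' \<tau>) = ereal (\<theta>' \<tau> * \<tau> - \<theta> \<tau>)"
proof (rule antisym)
  assume \<tau>: "\<tau> > 0"
  show "legendre \<theta> (\<theta>' \<tau>) \<le> ereal (\<theta>' \<tau> * \<tau> - \<theta> \<tau>)"
    unfolding legendre_def
  proof (rule SUP_least)
    fix t :: real
    show "ereal (\<theta>' \<tau> * t) - theta_ext \<theta> t \<le> ereal (\<theta>' \<tau> * \<tau> - \<theta> \<tau>)"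
      using tangent[OF \<tau>, of t] by (auto simp: theta_ext_def algebra_simps)
  qed
qed (rule legendre_ge)

definition conj_int :: "(real \<Rightarrow> real) \<Rightarrow> ereal" where
  "conj_int f = ereal_integral (restrict_space lborel {0..1}) (\<lambda>a. legendre \<theta> (f a))"

lemma ereal_integral_real:
  assumes "integrable M g"
  shows "ereal_integral M (\<lambda>x. ereal (g x)) = ereal (\<integral>x. g x \<partial>M)"
proof -
  have "(\<integral>\<^sup>+x. ennreal (g x) \<partial>M) < \<infinity>" "(\<integral>\<^sup>+x. ennreal (- g x) \<partial>M) < \<infinity>"
    using assms unfolding real_integrable_def by (auto simp: less_top)
  then show ?thesis
    unfolding ereal_integral_def real_lebesgue_integral_def[OF assms]
    by (cases "\<integral>\<^sup>+x. ennreal (g x) \<partial>M"; cases "\<integral>\<^sup>+x. ennreal (- g x) \<partial>M")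
      (auto simp: e2ennreal_ereal enn2ereal_ennreal)
qed

lemma ereal_integral_mono:
  assumes "\<And>x. x \<in> space M \<Longrightarrow> g x \<le> G x"
  shows "ereal_integral M g \<le> ereal_integral M G"
  unfolding ereal_integral_def
  using assms by (intro ereal_minus_mono) (auto intro!: nn_integral_mono e2ennreal_mono simp: less_eq_ennreal.rep_eq[symmetric])

lemma circ_restrict: "set_integrable lborel {0..1} g \<Longrightarrow>
   integrable (restrict_space lborel {0..1}) g \<and> (\<integral>x. g x \<partial>restrict_space lborel {0..1}) = circ g" for g :: "real \<Rightarrow> real"
  by (simp add: set_integrable_def set_lebesgue_integral_def integral_restrict_space integrable_restrict_space)

text \<open>Fenchel's inequality integrated against an arbitrary positive continuous profile; in
  particular the conjugate integral is never -\<infinity>.\<close>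

lemma conj_int_ge:
  assumes f: "continuous_on UNIV f" and \<tau>: "continuous_on UNIV \<tau>" "\<And>a. \<tau> a > 0"
  shows "ereal (circ (\<lambda>a. f a * \<tau> a - \<theta> (\<tau> a))) \<le> conj_int f"
proof -
  have "set_integrable lborel {0..1} (\<lambda>a. f a * \<tau> a - \<theta> (\<tau> a))"
    by (intro circ_integrable continuous_intros f \<tau> continuous_on_compose2[OF continuous_on_\<theta>]) (use \<tau> in auto)
  note int = circ_restrict[OF this]
  have "ereal (circ (\<lambda>a. f a * \<tau> a - \<theta> (\<tau> a))) = ereal_integral (restrict_space lborel {0..1}) (\<lambda>a. ereal (f a * \<tau> a - \<theta> (\<tau> a)))"
    using ereal_integral_real[OF conjunct1[OF int]] int by simp
  also have "\<dots> \<le> conj_int f"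
    unfolding conj_int_def by (intro ereal_integral_mono legendre_ge \<tau>)
  finally show ?thesis .
qed

lemma conj_int_deriv:
  assumes \<tau>: "continuous_on UNIV \<tau>" "\<And>a. \<tau> a > 0"
  shows "conj_int (\<lambda>a. \<theta>' (\<tau> a)) = ereal (circ (\<lambda>a. \<theta>' (\<tau> a) * \<tau> a - \<theta> (\<tau> a)))"
proof -
  have "set_integrable lborel {0..1} (\<lambda>a. \<theta>' (\<tau> a) * \<tau> a - \<theta> (\<tau> a))"
    by (intro circ_integrable continuous_intros \<tau> continuous_on_compose2[OF continuous_on_\<theta>] continuous_on_compose2[OF cont]) (use \<tau> in auto)
  note int = circ_restrict[OF this]
  show ?thesis
    unfolding conj_int_def legendre_deriv[OF \<tau>(2)] using ereal_integral_real[OF conjunct1[OF int]] int by simp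
qed

lemma conj_int_not_MInf: "continuous_on UNIV f \<Longrightarrow> conj_int f \<noteq> -\<infinity>"
  using conj_int_ge[of f "\<lambda>_. 1"] by auto

lemma Theta_eq:
  "\<xi> \<in> K_disp \<Longrightarrow> Theta \<theta> \<xi> = (SUP f\<in>{f. continuous_on UNIV f \<and> (\<forall>a. f (a + 1) = f a)}. ereal (deriv_int f \<xi>) - conj_int f)"
  by (simp add: Theta_def deriv_int_def conj_int_def)

lemma Theta_ge:
  assumes "\<xi> \<in> K_disp" "continuous_on UNIV f" "\<And>a. f (a + 1) = f a"
  shows "ereal (deriv_int f \<xi>) - conj_int f \<le> Theta \<theta> \<xi>"
  unfolding Theta_eq[OF assms(1)] using assms by (intro SUP_upper) auto

text \<open>The constant test function \<open>\<theta>' 1\<close> gives the bound of Jensen's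
  inequality for a measure of mass 1.\<close>

lemma Theta_lower: "ereal (\<theta> 1) \<le> Theta \<theta> \<xi>"
proof (cases "\<xi> \<in> K_disp")
  case True
  have "ereal (deriv_int (\<lambda>_. \<theta>' 1) \<xi>) - conj_int (\<lambda>_. \<theta>' 1) = ereal (\<theta> 1)"
    using conj_int_deriv[of "\<lambda>_. 1"] deriv_int_const[OF True] by (simp add: circ_const)
  then show ?thesis using Theta_ge[OF True, of "\<lambda>_. \<theta>' 1"] by simp
qed (simp add: Theta_def)

lemma Theta_K_disp: "Theta \<theta> \<xi> \<noteq> \<infinity> \<Longrightarrow> \<xi> \<in> K_disp"
  by (auto simp: Theta_def split: if_splits)

lemma Theta_le_circle_map:
  assumes X: "circle_map X X'" and pos: "\<And>a. X' a > 0"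
  shows "Theta \<theta> (abs_L2T (\<lambda>a. X a - a)) \<le> ereal (circ (\<lambda>a. \<theta> (X' a)))"
  unfolding Theta_eq[OF circle_mapD(7)[OF X]]
proof (rule SUP_least)
  fix f :: "real \<Rightarrow> real" assume "f \<in> {f. continuous_on UNIV f \<and> (\<forall>a. f (a + 1) = f a)}"
  then have f: "continuous_on UNIV f" "\<And>a. f (a + 1) = f a" by auto
  note XD = circle_mapD[OF X]
  have ints: "set_integrable lborel {0..1} (\<lambda>a. f a * X' a)" "set_integrable lborel {0..1} (\<lambda>a. \<theta> (X' a))"
    by (intro circ_integrable continuous_intros f XD continuous_on_compose2[OF continuous_on_\<theta>]; use pos in auto)+
  have "ereal (circ (\<lambda>a. f a * X' a) - circ (\<lambda>a. \<theta> (X' a))) \<le> conj_int f"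
    using conj_int_ge[OF f(1) XD(2) pos] set_integral_diff(2)[OF ints] by simp
  then show "ereal (deriv_int f (abs_L2T (\<lambda>a. X a - a))) - conj_int f \<le> ereal (circ (\<lambda>a. \<theta> (X' a)))"
    unfolding deriv_int_circle_map[OF X f] by (cases "conj_int f") auto
qed

text \<open>The test function \<open>\<theta>' (X' a)\<close> is optimal at X and admissible at
  every other \<eta>; inserting it is the subgradient inequality before integration by
  parts.\<close>

lemma Theta_ge_circle_map:
  assumes X: "circle_map X X'" and pos: "\<And>a. X' a > 0" and \<eta>: "\<eta> \<in> K_disp"
  shows "ereal (circ (\<lambda>a. \<theta> (X' a)) + (deriv_int (\<lambda>a. \<theta>' (X' a)) \<eta> - deriv_int (\<lambda>a. \<theta>' (X' a)) (abs_L2T (\<lambda>a. X a - a)))) \<le> Theta \<theta> \<eta>"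
proof -
  note XD = circle_mapD[OF X]
  have f: "continuous_on UNIV (\<lambda>a. \<theta>' (X' a))" "\<And>a. \<theta>' (X' (a + 1)) = \<theta>' (X' a)"
    by (intro continuous_on_compose2[OF cont] XD) (use pos XD(9) in auto)
  have ints: "set_integrable lborel {0..1} (\<lambda>a. \<theta>' (X' a) * X' a)" "set_integrable lborel {0..1} (\<lambda>a. \<theta> (X' a))"
    by (intro circ_integrable continuous_intros f XD continuous_on_compose2[OF continuous_on_\<theta>]; use pos in auto)+
  have "ereal (deriv_int (\<lambda>a. \<theta>' (X' a)) \<eta>) - conj_int (\<lambda>a. \<theta>' (X' a)) \<le> Theta \<theta> \<eta>"
    by (rule Theta_ge[OF \<eta> f])
  then show ?thesis
    unfolding conj_int_deriv[OF XD(2) pos] deriv_int_circle_map[OF X f] set_integral_diff(2)[OF ints]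
    by (simp add: algebra_simps)
qed

lemma Theta_circle_map:
  assumes X: "circle_map X X'" and pos: "\<And>a. X' a > 0"
  shows "Theta \<theta> (abs_L2T (\<lambda>a. X a - a)) = ereal (circ (\<lambda>a. \<theta> (X' a)))"
  using Theta_le_circle_map[OF assms] Theta_ge_circle_map[OF assms circle_mapD(7)[OF X]] by (intro antisym) auto

lemma Theta_convex:
  assumes s: "0 < s" "s < 1" and fin: "Theta \<theta> \<xi> \<noteq> \<infinity>" "Theta \<theta> \<eta> \<noteq> \<infinity>"
  shows "Theta \<theta> ((1 - s) *\<^sub>R \<xi> + s *\<^sub>R \<eta>) \<le> ereal ((1 - s) * real_of_ereal (Theta \<theta> \<xi>) + s * real_of_ereal (Theta \<theta> \<eta>))"
proof -
  have K: "\<xi> \<in> K_disp" "\<eta> \<in> K_disp" using fin Theta_K_disp by auto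
  have M: "(1 - s) *\<^sub>R \<xi> + s *\<^sub>R \<eta> \<in> K_disp" using K_disp_convex[OF K, of s] s by simp
  have fin': "Theta \<theta> z = ereal (real_of_ereal (Theta \<theta> z))" if "Theta \<theta> z \<noteq> \<infinity>" for z
    using that Theta_lower[of z] by (cases "Theta \<theta> z") auto
  show ?thesis
    unfolding Theta_eq[OF M]
  proof (rule SUP_least)
    fix f :: "real \<Rightarrow> real" assume "f \<in> {f. continuous_on UNIV f \<and> (\<forall>a. f (a + 1) = f a)}"
    then have f: "continuous_on UNIV f" "\<And>a. f (a + 1) = f a" by auto
    show "ereal (deriv_int f ((1 - s) *\<^sub>R \<xi> + s *\<^sub>R \<eta>)) - conj_int f
      \<le> ereal ((1 - s) * real_of_ereal (Theta \<theta> \<xi>) + s * real_of_ereal (Theta \<theta> \<eta>))"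
    proof (cases "conj_int f")
      case (real r)
      have "deriv_int f \<xi> - r \<le> real_of_ereal (Theta \<theta> \<xi>)" "deriv_int f \<eta> - r \<le> real_of_ereal (Theta \<theta> \<eta>)"
        using Theta_ge[OF K(1) f] Theta_ge[OF K(2) f] fin'[OF fin(1)] fin'[OF fin(2)] real by (metis ereal_less_eq(3) ereal_minus(1))+
      then have "(1 - s) * (deriv_int f \<xi> - r) + s * (deriv_int f \<eta> - r) \<le> (1 - s) * real_of_ereal (Theta \<theta> \<xi>) + s * real_of_ereal (Theta \<theta> \<eta>)"
        using s by (intro add_mono mult_left_mono) auto
      then show ?thesis
        using deriv_int_affine[OF f K, of s] s real by (simp add: algebra_simps)
    qed (use conj_int_not_MInf[OF f(1)] in auto)
  qed
qed

text \<open>Each test function contributes a continuous function of \<xi> on the closed cone, and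
  suprema of such functions are lower semicontinuous.\<close>

lemma Theta_closed:
  assumes lim: "\<xi> \<longlonglongrightarrow> \<eta>" and le: "\<And>n. Theta \<theta> (\<xi> n) \<le> ereal c"
  shows "Theta \<theta> \<eta> \<le> ereal c"
proof -
  have K: "\<xi> n \<in> K_disp" for n using le[of n] by (intro Theta_K_disp) auto
  have \<eta>: "\<eta> \<in> K_disp" by (rule K_disp_closed[OF K lim])
  show ?thesis
    unfolding Theta_eq[OF \<eta>]
  proof (rule SUP_least)
    fix f :: "real \<Rightarrow> real" assume "f \<in> {f. continuous_on UNIV f \<and> (\<forall>a. f (a + 1) = f a)}"
    then have f: "continuous_on UNIV f" "\<And>a. f (a + 1) = f a" by auto
    show "ereal (deriv_int f \<eta>) - conj_int f \<le> ereal c"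
    proof (cases "conj_int f")
      case (real r)
      have "deriv_int f (\<xi> n) \<le> c + r" for n
        using order_trans[OF Theta_ge[OF K f] le, of n] real by simp
      then have "deriv_int f \<eta> \<le> c + r"
        by (intro LIMSEQ_le_const2[OF deriv_int_tendsto[OF f K lim]]) auto
      then show ?thesis using real by simp
    qed (use conj_int_not_MInf[OF f(1)] in auto)
  qed
qed

lemma Theta_0: "Theta \<theta> 0 \<noteq> \<infinity>"
proof -
  have "circle_map (\<lambda>a. a) (\<lambda>_. 1)" by (auto simp: circle_map_def intro!: derivative_eq_intros)
  from Theta_circle_map[OF this] have "Theta \<theta> (abs_L2T (\<lambda>a::real. a - a)) \<noteq> \<infinity>" by simp
  then show ?thesis by (simp add: zero_L2T_def)
qed

lemma Theta_finite_dense: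
  assumes "\<xi> \<in> K_disp" "e > 0"
  shows "\<exists>\<eta>. Theta \<theta> \<eta> \<noteq> \<infinity> \<and> norm (\<eta> - \<xi>) < e"
proof -
  obtain X X' where X: "circle_map X X'" "\<And>a. X' a > 0" "norm (abs_L2T (\<lambda>a. X a - a) - \<xi>) < e"
    using positive_dense_K_disp[OF assms] by blast
  then show ?thesis using Theta_circle_map[OF X(1,2)] by (intro exI[of _ "abs_L2T (\<lambda>a. X a - a)"]) simp
qed

text \<open>A subgradient at a smooth strictly increasing map is determined by testing against all directions
  \<open>w - w'\<close> with \<open>w, w'\<close> smooth; these are dense enough to separate points, because differences of step
  functions are.\<close>

lemma K_disp_separates:
  assumes "\<And>\<xi> \<eta>. \<xi> \<in> K_disp \<Longrightarrow> \<eta> \<in> K_disp \<Longrightarrow> inner r (\<xi> - \<eta>) = 0"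
  shows "r = 0"
proof -
  obtain f where f: "L2_fun f" "r = abs_L2T f" by (rule L2T_cases)
  have [measurable]: "f \<in> borel_measurable borel" using f(1) by (simp add: L2_fun_def)
  \<comment> \<open>Steps at the integer translates of c: on [0, 1) the difference
    \<open>stp 0 - stp c\<close> is the indicator of [0, c).\<close>
  define stp where "stp c a = real_of_int \<lfloor>a - c\<rfloor>" for c a :: real
  have stp: "mono (stp c)" "stp c (a + 1) = stp c a + 1" for c a
  proof -
    show "mono (stp c)" by (auto simp: stp_def mono_def floor_mono)
    have "a + 1 - c = (a - c) + 1" by simp
    then show "stp c (a + 1) = stp c a + 1" unfolding stp_def by (simp only: floor_add_int[of _ 1, simplified]) simp
  qed
  note Ls = mono_L2_fun[OF stp]
  have int0: "(LINT a:{0..c}|lborel. f a) = 0" if c: "0 < c" "c < 1" for c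
  proof -
    have "inner r (abs_L2T (\<lambda>a. stp 0 a - a) - abs_L2T (\<lambda>a. stp c a - a)) = 0"
      by (intro assms mono_in_K_disp stp)
    then have "circ (\<lambda>a. f a * ((stp 0 a - a) - (stp c a - a))) = 0"
      by (simp only: abs_L2T_diff[OF Ls Ls] f(2) inner_abs_L2T[OF f(1) L2_fun_diff[OF Ls Ls]])
    moreover have "circ (\<lambda>a. f a * ((stp 0 a - a) - (stp c a - a))) = (LINT a:{0..c}|lborel. f a)"
      unfolding set_lebesgue_integral_def
    proof (rule integral_cong_AE)
      have [measurable]: "stp c \<in> borel_measurable borel" for c by (rule borel_measurable_mono[OF stp(1)])
      show "(\<lambda>a. indicat_real {0..1} a *\<^sub>R (f a * ((stp 0 a - a) - (stp c a - a)))) \<in> borel_measurable lborel" by measurable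
      show "(\<lambda>a. indicat_real {0..c} a *\<^sub>R f a) \<in> borel_measurable lborel" by measurable
      have "{1, c} \<in> null_sets lborel" by (rule finite_imp_null_set_lborel) simp
      then have "AE a in lborel. a \<notin> {1, c}" by (rule AE_not_in)
      then show "AE a in lborel. indicat_real {0..1} a *\<^sub>R (f a * ((stp 0 a - a) - (stp c a - a))) = indicat_real {0..c} a *\<^sub>R f a"
      proof eventually_elim
        case (elim a)
        have "stp 0 a - stp c a = (if a < c then 1 else 0)" if "0 \<le> a" "a < 1"
        proof -
          have "\<lfloor>a\<rfloor> = 0" using that by (simp add: floor_eq_iff)
          moreover have "\<lfloor>a - c\<rfloor> = (if a < c then -1 else 0)"
            using that c by (auto simp: floor_eq_iff)
          ultimately show ?thesis by (simp add: stp_def)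
        qed
        then show ?case using elim c by (auto simp: indicator_def)
      qed
    qed
    ultimately show ?thesis by simp
  qed
  have fint: "set_integrable lborel {0..1} f" by (rule L2_fun_integrable[OF f(1)])
  \<comment> \<open>The translation by 1 and the identity differ by the constant 1, which supplies
    the full period, a case the steps with c < 1 leave out.\<close>
  have one: "circ f = 0"
  proof -
    have L: "L2_fun (\<lambda>a::real. (a + k) - a)" for k by (rule mono_L2_fun) (auto simp: mono_def)
    have "inner r (abs_L2T (\<lambda>a. (a + 1) - a) - abs_L2T (\<lambda>a. (a + 0) - a)) = 0"
      by (intro assms mono_in_K_disp) (auto simp: mono_def)
    then have "circ (\<lambda>a. f a * (((a + 1) - a) - ((a + 0) - a))) = 0"
      by (simp only: abs_L2T_diff[OF L L] f(2) inner_abs_L2T[OF f(1) L2_fun_diff[OF L L]])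
    then show ?thesis by simp
  qed
  define F where "F a = indicat_real {0..1} a *\<^sub>R f a" for a
  have Fint: "integrable lborel F" using fint by (simp add: F_def[abs_def] set_integrable_def)
  have setF: "set_integrable lborel A F" if "A \<in> sets borel" for A
    using that Fint unfolding set_integrable_def by (intro integrable_mult_indicator) auto
  \<comment> \<open>Half-lines are stable under intersection and generate the Borel sets, so
    vanishing on them spreads by complements and disjoint unions.\<close>
  have "(LINT a:A|lborel. F a) = 0" if "A \<in> sets borel" for A
  proof -
    have gen: "sets borel = sigma_sets UNIV (range (\<lambda>c::real. {..c}))"
      by (simp add: borel_eq_atMost)
    have total: "(LINT a|lborel. F a) = 0" using one by (simp add: F_def set_lebesgue_integral_def)
    have mem: "A \<in> sigma_sets UNIV (range (\<lambda>c::real. {..c}))" using that by (simp add: gen)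
    have stable: "Int_stable (range (\<lambda>c::real. {..c}))"
    proof (rule Int_stableI_image)
      show "\<exists>k\<in>UNIV. {..c} \<inter> {..d} = {..k}" for c d :: real by (intro bexI[of _ "min c d"]) auto
    qed
    have sub: "range (\<lambda>c::real. {..c}) \<subseteq> Pow UNIV" by simp
    from stable sub mem show ?thesis
    proof (induction rule: sigma_sets_induct_disjoint)
      case (basic A)
      then obtain c where A: "A = {..c}" by auto
      consider "c < 0" | "c = 0" | "0 < c" "c < 1" | "1 \<le> c" by linarith
      then show ?case
      proof cases
        case 1
        then have "indicat_real A a *\<^sub>R F a = 0" for a by (auto simp: A F_def indicator_def)
        then show ?thesis unfolding set_lebesgue_integral_def by (simp only: Bochner_Integration.integral_zero)
      next
        case 2
        have "AE a in lborel. a \<notin> {0::real}" by (intro AE_not_in finite_imp_null_set_lborel) simp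
        then have "AE a in lborel. indicat_real A a *\<^sub>R F a = 0"
          by eventually_elim (use 2 in \<open>auto simp: A F_def indicator_def\<close>)
        then show ?thesis unfolding set_lebesgue_integral_def by (rule integral_eq_zero_AE)
      next
        case 3
        then have "indicat_real A a *\<^sub>R F a = indicat_real {0..c} a *\<^sub>R f a" for a by (auto simp: A F_def indicator_def)
        then show ?thesis using int0[OF 3] unfolding set_lebesgue_integral_def by (simp only:)
      next
        case 4
        then have "indicat_real A a *\<^sub>R F a = F a" for a by (auto simp: A F_def indicator_def)
        then show ?thesis using total unfolding set_lebesgue_integral_def by (simp only:)
      qed
    next
      case empty
      show ?case by (simp add: set_lebesgue_integral_def)
    next
      case (compl A)
      then have A: "A \<in> sets borel" by (simp add: gen)
      have "(LINT a:UNIV - A|lborel. F a) = (LINT a|lborel. F a - indicat_real A a *\<^sub>R F a)"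
        unfolding set_lebesgue_integral_def by (intro Bochner_Integration.integral_cong) (auto simp: indicator_def)
      also have "\<dots> = (LINT a|lborel. F a) - (LINT a:A|lborel. F a)"
        using setF[OF A] Fint unfolding set_lebesgue_integral_def set_integrable_def by simp
      finally show ?case using compl total by simp
    next
      case (union A)
      then have A: "A i \<in> sets borel" for i by (auto simp: gen)
      have "(LINT a:(\<Union>i. A i)|lborel. F a) = (\<Sum>i. (LINT a:A i|lborel. F a))"
        using union(1) A by (intro lebesgue_integral_countable_add setF) (auto simp: disjoint_family_on_def)
      then show ?case using union by simp
    qed
  qed
  then have "AE a in lborel. F a = 0"
    by (intro density_unique_real Fint) (simp_all add: set_lebesgue_integral_def)
  then have abs0: "AE a in lborel. a \<in> {0..1} \<longrightarrow> f a = 0"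
    by eventually_elim (auto simp: F_def)
  then have "abs_L2T f = 0"
    unfolding zero_L2T_def using f(1) L2_fun_zero by (subst abs_L2T_eq_iff) auto
  then show ?thesis using f(2) by simp
qed

text \<open>Integration by parts in \<open>Theta_ge_circle_map\<close> turns the difference of the
  two integrals into an inner product with - q.\<close>

lemma subgradient_smooth:
  assumes X: "circle_map X X'" and pos: "\<And>a. X' a > 0"
    and q: "\<And>a. ((\<lambda>a. \<theta>' (X' a)) has_real_derivative q a) (at a)" "continuous_on UNIV q"
  shows "L2_fun q" "- abs_L2T q \<in> subdifferential (Theta \<theta>) (abs_L2T (\<lambda>a. X a - a))"
proof -
  note XD = circle_mapD[OF X]
  let ?\<xi> = "abs_L2T (\<lambda>a. X a - a)" and ?f = "\<lambda>a. \<theta>' (X' a)"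
  have perf: "?f (a + 1) = ?f a" for a by (simp add: XD(9))
  have per: "q (a + 1) = q a" for a
  proof (rule DERIV_unique)
    show "(?f has_real_derivative q (a + 1)) (at (a + 1))" by (rule q)
    have "((\<lambda>x. ?f (x + (- 1))) has_real_derivative q a) (at (a + 1))"
      using q(1)[of a] DERIV_shift[of ?f "q a" "a + 1" "- 1"] by simp
    moreover have "?f (x + (- 1)) = ?f x" for x using perf[of "x - 1"] by simp
    ultimately show "(?f has_real_derivative q a) (at (a + 1))" by simp
  qed
  show Lq: "L2_fun q" by (rule L2_fun_continuous[OF q(2) per])
  have "Theta \<theta> ?\<xi> + ereal (inner (- abs_L2T q) (\<eta> - ?\<xi>)) \<le> Theta \<theta> \<eta>" for \<eta>
  proof (cases "\<eta> \<in> K_disp")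
    case True
    have "deriv_int ?f \<eta> - deriv_int ?f ?\<xi> = inner (- abs_L2T q) (\<eta> - ?\<xi>)"
      by (simp add: deriv_int_C1[OF True q perf] deriv_int_C1[OF XD(7) q perf] inner_diff_right)
    then show ?thesis
      using Theta_ge_circle_map[OF X pos True] by (simp add: Theta_circle_map[OF X pos])
  qed (simp add: Theta_def)
  then show "- abs_L2T q \<in> subdifferential (Theta \<theta>) ?\<xi>"
    using Theta_circle_map[OF X pos] by (simp add: subdifferential_def)
qed

lemma circ_tendsto:
  fixes f :: "real \<Rightarrow> real \<Rightarrow> real"
  assumes f: "continuous_on ({0..d} \<times> {0..1}) (\<lambda>(s, a). f s a)" and d: "d > 0"
  shows "((\<lambda>s. circ (f s)) \<longlongrightarrow> circ (f 0)) (at_right 0)"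
proof -
  have c: "continuous_on {0..1} (f s)" if "s \<in> {0..d}" for s
    by (rule continuous_on_compose2[OF f, of _ "\<lambda>a. (s, a)", simplified]) (use that in \<open>auto intro!: continuous_intros\<close>)
  have eq: "circ (f s) = integral {0..1} (f s)" if "s \<in> {0..d}" for s
    by (intro set_borel_integral_eq_integral(2) borel_integrable_atLeastAtMost' c that)
  have "continuous_on {0..d} (\<lambda>s. integral (cbox 0 1) (f s))"
    by (rule integral_continuous_on_param) (use f in simp)
  then have "((\<lambda>s. integral {0..1} (f s)) \<longlongrightarrow> integral {0..1} (f 0)) (at 0 within {0..d})"
    using d by (auto simp: continuous_on_def)
  then have "((\<lambda>s. integral {0..1} (f s)) \<longlongrightarrow> integral {0..1} (f 0)) (at_right 0)"
    using d at_within_Icc_at_right[of 0 d] by simp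
  moreover have "\<forall>\<^sub>F s in at_right 0. integral {0..1} (f s) = circ (f s)"
    using d by (intro eventually_at_rightI[of 0 d]) (auto simp: eq)
  ultimately show ?thesis
    using eq[of 0] d by (simp add: tendsto_cong)
qed

text \<open>Perturb X by s (V - W), which stays increasing for small s because the slope of X has a
  positive minimum. As s tends to 0 the subgradient inequality bounds <p, v - w> by the pairing with
  - q; exchanging V and W gives equality, and such differences separate points.\<close>

lemma subgradient_smooth_unique:
  assumes X: "circle_map X X'" and pos: "\<And>a. X' a > 0"
    and q: "\<And>a. ((\<lambda>a. \<theta>' (X' a)) has_real_derivative q a) (at a)" "continuous_on UNIV q"
    and p: "p \<in> subdifferential (Theta \<theta>) (abs_L2T (\<lambda>a. X a - a))"
  shows "p = - abs_L2T q"
proof -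
  note XD = circle_mapD[OF X]
  let ?\<xi> = "abs_L2T (\<lambda>a. X a - a)" and ?f = "\<lambda>a. \<theta>' (X' a)"
  have perf: "?f (a + 1) = ?f a" for a by (simp add: XD(9))
  have contf: "continuous_on UNIV ?f"
    by (intro continuous_on_compose2[OF cont] XD) (use pos in auto)
  define r where "r = p + abs_L2T q"
  have le: "inner r (abs_L2T (\<lambda>a. V a - a) - abs_L2T (\<lambda>a. W a - a)) \<le> 0"
    if V: "circle_map V V'" and W: "circle_map W W'" for V V' W W'
  proof -
    note VD = circle_mapD[OF V] and WD = circle_mapD[OF W]
    let ?v = "abs_L2T (\<lambda>a. V a - a)" and ?w = "abs_L2T (\<lambda>a. W a - a)"
    define h where "h a = V' a - W' a" for a
    have ch: "continuous_on UNIV h" unfolding h_def by (intro continuous_intros VD WD)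
    have perX: "X' (a + 1) = X' a + 0" "h (a + 1) = h a + 0" for a by (simp_all add: XD(9) VD(9) WD(9) h_def)
    obtain C where C: "\<And>a. a \<in> {0..1} \<Longrightarrow> \<bar>h a\<bar> \<le> C" using bounded_on_unit[OF ch] by blast
    obtain a0 where a0: "a0 \<in> {0..1}" "\<And>a. a \<in> {0..1} \<Longrightarrow> X' a0 \<le> X' a"
      using continuous_attains_inf[of "{0..1}" X'] continuous_on_subset[OF XD(2)] by auto
    have fa: "frac a + of_int \<lfloor>a\<rfloor> = a" for a :: real by (simp add: frac_def)
    have red: "X' a = X' (frac a)" "h a = h (frac a)" for a
      using periodic_int_shift[of X' 0 "frac a" "\<lfloor>a\<rfloor>", OF perX(1)] periodic_int_shift[of h 0 "frac a" "\<lfloor>a\<rfloor>", OF perX(2)]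
      unfolding fa by simp_all
    have fr: "frac a \<in> {0..1}" for a using frac_ge_0[of a] frac_lt_1[of a] by simp
    have C': "\<bar>h a\<bar> \<le> C" and low: "X' a0 \<le> X' a" for a
      unfolding red[of a] using C[OF fr] a0(2)[OF fr] by auto
    have C0: "C \<ge> 0" using C'[of 0] by simp
    \<comment> \<open>For s \<le> d the slope changes by at most half of its minimum; the 1 covers C
      = 0.\<close>
    define d where "d = X' a0 / (2 * (C + 1))"
    have d: "d > 0" using pos[of a0] C0 by (simp add: d_def)
    have posd: "X' a + s * h a > 0" if s: "s \<in> {0..d}" for s a
    proof -
      have "\<bar>s * h a\<bar> \<le> d * (C + 1)" unfolding abs_mult using s C'[of a] C0 by (intro mult_mono) auto
      also have "\<dots> = X' a0 / 2" using C0 by (simp add: d_def field_simps)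
      finally show ?thesis using low[of a] pos[of a0] by (simp add: abs_le_iff)
    qed
    have incr: "inner p (?v - ?w) \<le> circ (\<lambda>a. \<theta>' (X' a + s * h a) * h a)" if s: "0 < s" "s \<le> d" for s
    proof -
      have map: "circle_map (\<lambda>a. X a + s * (V a - W a)) (\<lambda>a. X' a + s * h a)"
        unfolding circle_map_def
      proof (intro conjI allI)
        show "((\<lambda>a. X a + s * (V a - W a)) has_real_derivative X' a + s * h a) (at a)" for a
          unfolding h_def by (auto intro!: derivative_eq_intros XD VD WD)
        show "continuous_on UNIV (\<lambda>a. X' a + s * h a)" by (intro continuous_intros XD ch)
        show "X (a + 1) + s * (V (a + 1) - W (a + 1)) = X a + s * (V a - W a) + 1" for a
          by (simp add: XD(3) VD(3) WD(3))
        show "0 \<le> X' a + s * h a" for a using posd[of s a] s by simp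
      qed
      have eq: "abs_L2T (\<lambda>a. (X a + s * (V a - W a)) - a) = ?\<xi> + s *\<^sub>R (?v - ?w)"
      proof -
        have "?v - ?w = abs_L2T (\<lambda>a. V a - W a)" by (simp add: abs_L2T_diff VD(8) WD(8))
        moreover have L: "L2_fun (\<lambda>a. V a - W a)" using L2_fun_diff[OF VD(8) WD(8)] by simp
        ultimately have "?\<xi> + s *\<^sub>R (?v - ?w) = abs_L2T (\<lambda>a. (X a - a) + s * (V a - W a))"
          by (simp add: abs_L2T_scaleR abs_L2T_add XD(8) L2_fun_cmult)
        then show ?thesis by (simp add: algebra_simps)
      qed
      have posd': "X' a + s * h a > 0" for a using posd[of s a] s by simp
      have "Theta \<theta> ?\<xi> + ereal (inner p ((?\<xi> + s *\<^sub>R (?v - ?w)) - ?\<xi>)) \<le> Theta \<theta> (?\<xi> + s *\<^sub>R (?v - ?w))"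
        using p unfolding subdifferential_def by blast
      then have le: "circ (\<lambda>a. \<theta> (X' a)) + s * inner p (?v - ?w) \<le> circ (\<lambda>a. \<theta> (X' a + s * h a))"
        unfolding Theta_circle_map[OF X pos] eq[symmetric] Theta_circle_map[OF map posd'] by (simp add: eq)
      have ints: "set_integrable lborel {0..1} (\<lambda>a. \<theta> (X' a))" "set_integrable lborel {0..1} (\<lambda>a. \<theta> (X' a + s * h a))"
        "set_integrable lborel {0..1} (\<lambda>a. s * (\<theta>' (X' a + s * h a) * h a))"
        by (intro circ_integrable continuous_intros XD ch continuous_on_compose2[OF continuous_on_\<theta>] continuous_on_compose2[OF cont];
            use pos posd' in auto)+
      have "circ (\<lambda>a. \<theta> (X' a + s * h a)) - circ (\<lambda>a. \<theta> (X' a)) = circ (\<lambda>a. \<theta> (X' a + s * h a) - \<theta> (X' a))"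
        using set_integral_diff(2)[OF ints(2,1)] by simp
      also have "\<dots> \<le> circ (\<lambda>a. s * (\<theta>' (X' a + s * h a) * h a))"
      proof (rule set_integral_mono[OF set_integral_diff(1)[OF ints(2,1)] ints(3)])
        fix a
        \<comment> \<open>The tangent is taken at the perturbed slope because the increment has to
          be bounded from above; the original slope is reached only as s tends to 0.\<close>
        show "\<theta> (X' a + s * h a) - \<theta> (X' a) \<le> s * (\<theta>' (X' a + s * h a) * h a)"
          using tangent[OF posd'[of a] pos[of a]] by (simp add: algebra_simps)
      qed
      also have "\<dots> = s * circ (\<lambda>a. \<theta>' (X' a + s * h a) * h a)" by simp
      finally have "s * inner p (?v - ?w) \<le> s * circ (\<lambda>a. \<theta>' (X' a + s * h a) * h a)" using le by simp
      then show ?thesis using s(1) by simp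
    qed
    have "continuous_on ({0..d} \<times> {0..1}) (\<lambda>(s, a). \<theta>' (X' a + s * h a) * h a)"
      unfolding split_beta
    proof (intro continuous_intros)
      show "continuous_on ({0..d} \<times> {0..1}) (\<lambda>z. h (snd z))"
        by (rule continuous_on_compose2[OF ch]) (auto intro!: continuous_intros)
      moreover have "continuous_on ({0..d} \<times> {0..1}) (\<lambda>z. X' (snd z))"
        by (rule continuous_on_compose2[OF XD(2)]) (auto intro!: continuous_intros)
      ultimately have "continuous_on ({0..d} \<times> {0..1}) (\<lambda>z. X' (snd z) + fst z * h (snd z))"
        by (intro continuous_intros)
      then show "continuous_on ({0..d} \<times> {0..1}) (\<lambda>z. \<theta>' (X' (snd z) + fst z * h (snd z)))"
        by (rule continuous_on_compose2[OF cont]) (use posd in auto)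
    qed
    from circ_tendsto[OF this d]
    have "((\<lambda>s. circ (\<lambda>a. \<theta>' (X' a + s * h a) * h a)) \<longlongrightarrow> circ (\<lambda>a. ?f a * h a)) (at_right 0)" by simp
    then have "inner p (?v - ?w) \<le> circ (\<lambda>a. ?f a * h a)"
      by (rule tendsto_lowerbound) (use incr d in \<open>auto intro!: eventually_at_rightI[of 0 d]\<close>)
    also have "circ (\<lambda>a. ?f a * h a) = circ (\<lambda>a. ?f a * V' a) - circ (\<lambda>a. ?f a * W' a)"
    proof -
      have "set_integrable lborel {0..1} (\<lambda>a. ?f a * V' a)" "set_integrable lborel {0..1} (\<lambda>a. ?f a * W' a)"
        by (intro circ_integrable continuous_intros contf VD WD)+
      from set_integral_diff(2)[OF this] show ?thesis by (simp add: h_def right_diff_distrib)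
    qed
    also have "\<dots> = deriv_int ?f ?v - deriv_int ?f ?w"
      using deriv_int_circle_map[OF V contf perf] deriv_int_circle_map[OF W contf perf] by simp
    also have "\<dots> = - inner (abs_L2T q) (?v - ?w)"
      by (simp add: deriv_int_C1[OF VD(7) q perf] deriv_int_C1[OF WD(7) q perf] inner_diff_right)
    finally show ?thesis by (simp add: r_def inner_add_left)
  qed
  have eq0: "inner r (abs_L2T (\<lambda>a. V a - a) - abs_L2T (\<lambda>a. W a - a)) = 0"
    if "circle_map V V'" "circle_map W W'" for V V' W W'
    using le[OF that] le[OF that(2,1)] by (simp add: inner_diff_right)
  have "inner r (\<zeta> - \<eta>) = 0" if \<zeta>: "\<zeta> \<in> K_disp" and \<eta>: "\<eta> \<in> K_disp" for \<zeta> \<eta>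
  proof -
    have "\<bar>inner r (\<zeta> - \<eta>)\<bar> \<le> 0 + e" if e: "e > 0" for e
    proof -
      define e' where "e' = e / (2 * (norm r + 1))"
      have e': "e' > 0" using e by (simp add: e'_def add_nonneg_pos)
      obtain V V' where V: "circle_map V V'" "norm (abs_L2T (\<lambda>a. V a - a) - \<zeta>) < e'"
        using smooth_dense_K_disp[OF \<zeta> e'] by blast
      obtain W W' where W: "circle_map W W'" "norm (abs_L2T (\<lambda>a. W a - a) - \<eta>) < e'"
        using smooth_dense_K_disp[OF \<eta> e'] by blast
      let ?v = "abs_L2T (\<lambda>a. V a - a)" and ?w = "abs_L2T (\<lambda>a. W a - a)"
      have "inner r (\<zeta> - \<eta>) = inner r ((?w - \<eta>) - (?v - \<zeta>))"
        using eq0[OF V(1) W(1)] by (simp add: inner_diff_right)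
      then have "\<bar>inner r (\<zeta> - \<eta>)\<bar> \<le> norm r * norm ((?w - \<eta>) - (?v - \<zeta>))"
        by (simp only: Cauchy_Schwarz_ineq2)
      also have "\<dots> \<le> (norm r + 1) * (e' + e')"
      proof (rule mult_mono)
        show "norm ((?w - \<eta>) - (?v - \<zeta>)) \<le> e' + e'"
          using V(2) W(2) norm_triangle_ineq4[of "?w - \<eta>" "?v - \<zeta>"] by linarith
      qed (use e' in auto)
      also have "\<dots> = e" using norm_ge_zero[of r] by (simp add: e'_def field_simps add_nonneg_eq_0_iff)
      finally show ?thesis by simp
    qed
    then have "\<bar>inner r (\<zeta> - \<eta>)\<bar> \<le> 0" by (rule field_le_epsilon)
    then show ?thesis by simp
  qed
  then have "r = 0" by (rule K_disp_separates)
  then show ?thesis by (simp add: r_def eq_neg_iff_add_eq_0)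
qed

end

section \<open>Calculus of n times differentiable functions; the example - ln\<close>

section \<open>Smooth functions\<close>

lemma has_derivative_cong_open:
  assumes "open S" "x \<in> S" "\<And>y. y \<in> S \<Longrightarrow> f y = g y"
  shows "(f has_derivative D) (at x) \<longleftrightarrow> (g has_derivative D) (at x)"
  using assms has_derivative_transform_within_open[of f D x UNIV S g] has_derivative_transform_within_open[of g D x UNIV S f]
  by auto

text \<open>The congruence rule at level n is a hypothesis because its own induction
  (\<open>diff_n_on_cong\<close>) passes through this rule; \<open>diff_n_onI\<close> discharges it
  afterwards.\<close>

lemma diff_n_on_SucI:
  assumes "open S" "\<And>x. x \<in> S \<Longrightarrow> (f has_derivative f' x) (at x)" "\<And>v. diff_n_on n S (\<lambda>x. f' x v)"
    and cong: "\<And>f g :: 'a::real_normed_vector \<Rightarrow> 'b::real_normed_vector. (\<And>x. x \<in> S \<Longrightarrow> f x = g x) \<Longrightarrow> diff_n_on n S f \<Longrightarrow> diff_n_on n S g"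
  shows "diff_n_on (Suc n) S (f :: 'a \<Rightarrow> 'b)"
proof -
  have "frechet_derivative f (at x) = f' x" if "x \<in> S" for x
    using frechet_derivative_at[OF assms(2)[OF that]] by simp
  then have "diff_n_on n S (\<lambda>x. frechet_derivative f (at x) v)" for v
    by (intro cong[OF _ assms(3)[of v]]) simp
  then show ?thesis using assms(2) by (auto simp: differentiable_def)
qed

lemma diff_n_on_cong:
  assumes "open S" "\<And>x. x \<in> S \<Longrightarrow> f x = g x" "diff_n_on n S f"
  shows "diff_n_on n S g"
  using assms(2,3)
proof (induction n arbitrary: f g)
  case 0
  then show ?case by (simp cong: continuous_on_cong)
next
  case (Suc n)
  have D: "(g has_derivative frechet_derivative f (at x)) (at x)" if "x \<in> S" for x
    using Suc.prems that has_derivative_cong_open[OF \<open>open S\<close> that, of f g] frechet_derivative_works[of f "at x"] by auto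
  show ?case
    by (rule diff_n_on_SucI[OF \<open>open S\<close> D]) (use Suc in auto)
qed

lemma diff_n_onI:
  assumes "open S" "\<And>x. x \<in> S \<Longrightarrow> (f has_derivative f' x) (at x)" "\<And>v. diff_n_on n S (\<lambda>x. f' x v)"
  shows "diff_n_on (Suc n) S f"
  by (rule diff_n_on_SucI[OF assms]) (auto intro: diff_n_on_cong[OF assms(1)])

lemma diff_n_onD:
  assumes "diff_n_on (Suc n) S f"
  shows "x \<in> S \<Longrightarrow> (f has_derivative frechet_derivative f (at x)) (at x)"
    "diff_n_on n S (\<lambda>x. frechet_derivative f (at x) v)"
  using assms frechet_derivative_works by auto

lemma diff_n_on_Suc_imp: "diff_n_on (Suc n) S f \<Longrightarrow> diff_n_on n S f"
proof (induction n arbitrary: f)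
  case 0
  then show ?case
    by (auto intro!: continuous_at_imp_continuous_on differentiable_imp_continuous_within)
next
  case (Suc n)
  then show ?case by (metis diff_n_on.simps(2))
qed

lemma diff_n_on_const: "open S \<Longrightarrow> diff_n_on n S (\<lambda>_. c)"
proof (induction n arbitrary: c)
  case (Suc n)
  then show ?case by (intro diff_n_onI[where f' = "\<lambda>_ _. 0"]) (auto intro: derivative_intros)
qed simp

lemma diff_n_on_bounded_linear: "open S \<Longrightarrow> bounded_linear T \<Longrightarrow> diff_n_on n S T"
proof (cases n)
  case (Suc m)
  assume "open S" "bounded_linear T"
  then show ?thesis
    unfolding Suc by (intro diff_n_onI[where f' = "\<lambda>_. T"]) (auto intro: bounded_linear_imp_has_derivative diff_n_on_const)
qed (auto intro: linear_continuous_on)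

lemma diff_n_on_add: "open S \<Longrightarrow> diff_n_on n S f \<Longrightarrow> diff_n_on n S g \<Longrightarrow> diff_n_on n S (\<lambda>x. f x + g x)"
proof (induction n arbitrary: f g)
  case (Suc n)
  show ?case
    by (rule diff_n_onI[OF Suc.prems(1)], rule has_derivative_add[OF diff_n_onD(1)[OF Suc.prems(2)] diff_n_onD(1)[OF Suc.prems(3)]])
      (use Suc in auto)
qed (auto intro: continuous_intros)

lemma diff_n_on_mult:
  fixes f g :: "'a::real_normed_vector \<Rightarrow> real"
  shows "open S \<Longrightarrow> diff_n_on n S f \<Longrightarrow> diff_n_on n S g \<Longrightarrow> diff_n_on n S (\<lambda>x. f x * g x)"
proof (induction n arbitrary: f g)
  case (Suc n)
  note S = Suc.prems(1) and f = Suc.prems(2) and g = Suc.prems(3)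
  show ?case
  proof (rule diff_n_onI[OF S])
    fix x assume "x \<in> S"
    then show "((\<lambda>x. f x * g x) has_derivative (\<lambda>v. f x * frechet_derivative g (at x) v + frechet_derivative f (at x) v * g x)) (at x)"
      by (intro has_derivative_mult diff_n_onD(1)[OF f] diff_n_onD(1)[OF g])
  next
    fix v
    show "diff_n_on n S (\<lambda>x. f x * frechet_derivative g (at x) v + frechet_derivative f (at x) v * g x)"
      using S diff_n_onD(2)[OF f] diff_n_onD(2)[OF g] diff_n_on_Suc_imp[OF f] diff_n_on_Suc_imp[OF g]
      by (intro diff_n_on_add Suc.IH)
  qed
qed (auto intro: continuous_intros)

lemma frechet_derivative_real:
  assumes "(g has_derivative g') (at (x::real))"
  shows "g' v = v *\<^sub>R g' 1"
  using linear_scale[OF has_derivative_linear[OF assms], of v 1] by simp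

text \<open>The derivative is a product of f' and of g' composed with f, so the product rule and the
  induction hypothesis for g' close the step.\<close>

lemma diff_n_on_compose:
  fixes g :: "real \<Rightarrow> real" and f :: "'a::real_normed_vector \<Rightarrow> real"
  assumes "open S" "open T" "\<And>x. x \<in> S \<Longrightarrow> f x \<in> T" "diff_n_on n S f" "diff_n_on n T g"
  shows "diff_n_on n S (\<lambda>x. g (f x))"
  using assms(3-)
proof (induction n arbitrary: g)
  case 0
  then show ?case by (auto intro: continuous_on_compose2[of T g])
next
  case (Suc n)
  note f = Suc.prems(2) and g = Suc.prems(3)
  show ?case
  proof (rule diff_n_onI[OF assms(1)])
    fix x assume x: "x \<in> S"
    have g': "(g has_derivative frechet_derivative g (at (f x))) (at (f x))"
      by (rule diff_n_onD(1)[OF g Suc.prems(1)[OF x]])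
    have "((\<lambda>x. g (f x)) has_derivative (\<lambda>v. frechet_derivative g (at (f x)) (frechet_derivative f (at x) v))) (at x)"
      by (rule has_derivative_compose[OF diff_n_onD(1)[OF f x] g'])
    then show "((\<lambda>x. g (f x)) has_derivative (\<lambda>v. frechet_derivative f (at x) v * frechet_derivative g (at (f x)) 1)) (at x)"
      by (rule has_derivative_eq_rhs) (rule ext, subst frechet_derivative_real[OF g'], simp)
  next
    fix v
    show "diff_n_on n S (\<lambda>x. frechet_derivative f (at x) v * frechet_derivative g (at (f x)) 1)"
      using Suc.prems(1) diff_n_on_Suc_imp[OF f] diff_n_onD(2)[OF g]
      by (intro diff_n_on_mult assms(1) diff_n_onD(2)[OF f] Suc.IH[of "\<lambda>y. frechet_derivative g (at y) 1"])
  qed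
qed

lemma diff_n_on_compose2:
  fixes F :: "real \<times> real \<Rightarrow> real" and p q :: "'a::real_normed_vector \<Rightarrow> real"
  assumes "open S" "open T" "\<And>x. x \<in> S \<Longrightarrow> (p x, q x) \<in> T" "diff_n_on n S p" "diff_n_on n S q" "diff_n_on n T F"
  shows "diff_n_on n S (\<lambda>x. F (p x, q x))"
  using assms(3-)
proof (induction n arbitrary: F)
  case 0
  then show ?case by (auto intro!: continuous_on_compose2[of T F] continuous_intros)
next
  case (Suc n)
  note p = Suc.prems(2) and q = Suc.prems(3) and F = Suc.prems(4)
  let ?p = "\<lambda>x. frechet_derivative p (at x)" and ?q = "\<lambda>x. frechet_derivative q (at x)" and ?F = "\<lambda>y. frechet_derivative F (at y)"
  show ?case
  proof (rule diff_n_onI[OF assms(1)])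
    fix x assume x: "x \<in> S"
    have F': "(F has_derivative ?F (p x, q x)) (at (p x, q x))"
      by (rule diff_n_onD(1)[OF F Suc.prems(1)[OF x]])
    have lin: "?F (p x, q x) (a, b) = a * ?F (p x, q x) (1, 0) + b * ?F (p x, q x) (0, 1)" for a b
    proof -
      have "(a, b) = a *\<^sub>R (1, 0) + b *\<^sub>R (0, 1::real)" by simp
      then show ?thesis
        using has_derivative_linear[OF F'] by (simp only: linear_add linear_scale) simp
    qed
    have "((\<lambda>x. F (p x, q x)) has_derivative (\<lambda>v. ?F (p x, q x) (?p x v, ?q x v))) (at x)"
      by (rule has_derivative_compose[OF has_derivative_Pair[OF diff_n_onD(1)[OF p x] diff_n_onD(1)[OF q x]] F'])
    then show "((\<lambda>x. F (p x, q x)) has_derivative (\<lambda>v. ?p x v * ?F (p x, q x) (1, 0) + ?q x v * ?F (p x, q x) (0, 1))) (at x)"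
      by (rule has_derivative_eq_rhs) (rule ext, rule lin)
  next
    fix v
    show "diff_n_on n S (\<lambda>x. ?p x v * ?F (p x, q x) (1, 0) + ?q x v * ?F (p x, q x) (0, 1))"
      using Suc.prems(1) diff_n_on_Suc_imp[OF p] diff_n_on_Suc_imp[OF q] diff_n_onD(2)[OF F]
      by (intro diff_n_on_add diff_n_on_mult assms(1) diff_n_onD(2)[OF p] diff_n_onD(2)[OF q]
          Suc.IH[of "\<lambda>y. ?F y (1, 0)"] Suc.IH[of "\<lambda>y. ?F y (0, 1)"])
  qed
qed

lemma smooth_on_deriv:
  fixes g :: "real \<Rightarrow> real"
  assumes "open T" "smooth_on T g"
  shows "x \<in> T \<Longrightarrow> (g has_real_derivative deriv g x) (at x)" "smooth_on T (deriv g)" "continuous_on T g"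
proof -
  have D: "(g has_real_derivative frechet_derivative g (at x) 1) (at x)" if x: "x \<in> T" for x
  proof -
    have g': "(g has_derivative frechet_derivative g (at x)) (at x)"
      using assms(2) x diff_n_onD(1)[of 0 T g x] unfolding smooth_on_def by blast
    show ?thesis
      unfolding has_field_derivative_def
      by (rule has_derivative_eq_rhs[OF g']) (rule ext, subst frechet_derivative_real[OF g'], simp)
  qed
  then have eq: "deriv g x = frechet_derivative g (at x) 1" if "x \<in> T" for x
    using that by (intro DERIV_imp_deriv) auto
  show "x \<in> T \<Longrightarrow> (g has_real_derivative deriv g x) (at x)" using D eq by simp
  show "continuous_on T g" using assms(2) unfolding smooth_on_def by (metis diff_n_on.simps(1))
  show "smooth_on T (deriv g)"
    unfolding smooth_on_def
  proof
    fix n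
    have "diff_n_on n T (\<lambda>x. frechet_derivative g (at x) 1)"
      using assms(2) diff_n_onD(2)[of n T g 1] unfolding smooth_on_def by blast
    then show "diff_n_on n T (deriv g)" by (rule diff_n_on_cong[OF assms(1), rotated]) (simp add: eq)
  qed
qed

lemma smooth_on_inverse: "smooth_on {0<..} (\<lambda>x::real. inverse x)"
proof -
  have op: "open {0::real<..}" by simp
  have "diff_n_on n {0<..} (\<lambda>x::real. inverse x)" for n
  proof (induction n)
    case 0
    then show ?case by (auto intro!: continuous_intros)
  next
    case (Suc n)
    show ?case
    proof (rule diff_n_onI[OF op])
      fix x :: real assume "x \<in> {0<..}"
      then have "((\<lambda>x. inverse x) has_real_derivative - (inverse x * inverse x)) (at x)"
        by (auto intro!: derivative_eq_intros simp: power2_eq_square)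
      then show "((\<lambda>x. inverse x) has_derivative (\<lambda>v. - v * (inverse x * inverse x))) (at x)"
        unfolding has_field_derivative_def by (rule has_derivative_eq_rhs) auto
    qed (intro diff_n_on_mult op Suc.IH diff_n_on_const)
  qed
  then show ?thesis by (simp add: smooth_on_def)
qed

lemma smooth_on_minus_ln: "smooth_on {0<..} (\<lambda>x::real. - ln x)"
proof -
  have op: "open {0::real<..}" by simp
  have "diff_n_on n {0<..} (\<lambda>x::real. - ln x)" for n
  proof (cases n)
    case 0
    then show ?thesis by (auto intro!: continuous_intros)
  next
    case (Suc m)
    show ?thesis
      unfolding Suc
    proof (rule diff_n_onI[OF op])
      fix x :: real assume "x \<in> {0<..}"
      then have "((\<lambda>x. - ln x) has_real_derivative - inverse x) (at x)"
        by (auto intro!: derivative_eq_intros simp: inverse_eq_divide)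
      then show "((\<lambda>x. - ln x) has_derivative (\<lambda>v. - v * inverse x)) (at x)"
        unfolding has_field_derivative_def by (rule has_derivative_eq_rhs) auto
    qed (use smooth_on_inverse in \<open>intro diff_n_on_mult op diff_n_on_const; simp add: smooth_on_def\<close>)
  qed
  then show ?thesis by (simp add: smooth_on_def)
qed

text \<open>The strict tangent inequality of ln at m = (1 - s) x + s y is summed with the weights 1
  - s and s; the linear terms cancel because m is the barycentre.\<close>

lemma strictly_convex_minus_ln: "strictly_convex_on {0<..} (\<lambda>x. - ln x)"
  unfolding strictly_convex_on_def
proof (intro conjI ballI allI impI)
  show "convex {0::real<..}" by simp
  fix x y s :: real assume xy: "x \<in> {0<..}" "y \<in> {0<..}" and s: "x \<noteq> y \<and> 0 < s \<and> s < 1"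
  define m where "m = (1 - s) * x + s * y"
  have m: "m > 0" using xy s by (auto simp: m_def intro!: add_pos_pos)
  have lt: "ln z < ln m + (z - m) / m" if z: "z > 0" "z \<noteq> m" for z
  proof -
    have "ln (z / m) < z / m - 1"
      using ln_le_minus_one[of "z / m"] ln_eq_minus_one[of "z / m"] z m by fastforce
    then show ?thesis using z m by (simp add: ln_div field_simps)
  qed
  have nm: "x - m = s * (x - y)" "y - m = (1 - s) * (y - x)" by (simp_all add: m_def algebra_simps)
  then have "x \<noteq> m" "y \<noteq> m" using s by auto
  then have "(1 - s) * ln x + s * ln y < (1 - s) * (ln m + (x - m) / m) + s * (ln m + (y - m) / m)"
    using xy s by (intro add_strict_mono mult_strict_left_mono lt) auto
  also have "\<dots> = ln m + ((1 - s) * (x - m) + s * (y - m)) / m" by (simp add: algebra_simps add_divide_distrib diff_divide_distrib)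
  also have "(1 - s) * (x - m) + s * (y - m) = 0" by (simp add: nm) (simp add: algebra_simps)
  finally show "- ln ((1 - s) * x + s * y) < (1 - s) * - ln x + s * - ln y" by (simp add: m_def)
qed

lemma strictly_convex_imp_convex: "strictly_convex_on S f \<Longrightarrow> convex_on S f"
  unfolding strictly_convex_on_def convex_on_def
proof (intro conjI ballI allI impI)
  assume f: "convex S \<and> (\<forall>x\<in>S. \<forall>y\<in>S. \<forall>s. x \<noteq> y \<and> 0 < s \<and> s < 1 \<longrightarrow> f ((1 - s) * x + s * y) < (1 - s) * f x + s * f y)"
  then show "convex S" by blast
  fix x y and u v :: real assume xy: "x \<in> S" "y \<in> S" and uv: "0 \<le> u" "0 \<le> v" "u + v = 1"
  have u: "u = 1 - v" using uv by simp
  show "f (u *\<^sub>R x + v *\<^sub>R y) \<le> u * f x + v * f y"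
  proof (cases "x = y \<or> v = 0 \<or> v = 1")
    case True
    then show ?thesis by (auto simp: u algebra_simps)
  next
    case False
    then have "0 < v" "v < 1" using uv by auto
    then show ?thesis using f xy False by (auto simp: u intro!: less_imp_le)
  qed
qed

section \<open>Partial derivatives of smooth fields and time derivatives in L2\<close>

section \<open>Smooth functions of time and space\<close>

lemma open_half: "open ({0<..} \<times> (UNIV :: real set) :: (real \<times> real) set)"
  by (intro open_Times) auto

lemma smooth2_iff: "smooth2 f \<longleftrightarrow> (\<forall>n. diff_n_on n ({0<..} \<times> UNIV) (\<lambda>z. f (fst z) (snd z)))"
  by (simp add: smooth2_def smooth_on_def case_prod_unfold)

lemma smooth2_derivative:
  assumes "smooth2 f"
  shows "t > 0 \<Longrightarrow> ((\<lambda>z. f (fst z) (snd z)) has_derivative (\<lambda>v. fst v * pd1 f t a + snd v * pd2 f t a)) (at (t, a))"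
    and "t > 0 \<Longrightarrow> ((\<lambda>s. f s a) has_real_derivative pd1 f t a) (at t)"
    and "t > 0 \<Longrightarrow> (f t has_real_derivative pd2 f t a) (at a)"
    and "smooth2 (pd1 f)" "smooth2 (pd2 f)"
proof -
  let ?f = "\<lambda>z. f (fst z) (snd z)"
  have D: "(?f has_derivative frechet_derivative ?f (at (t, a))) (at (t, a))" if "t > 0" for t a
    using assms that diff_n_onD(1)[of 0 "{0<..} \<times> UNIV" ?f "(t, a)"] unfolding smooth2_iff by auto
  have 1: "((\<lambda>s. f s a) has_real_derivative frechet_derivative ?f (at (t, a)) (1, 0)) (at t)" if "t > 0" for t a
  proof -
    have P: "((\<lambda>s. (s, a)) has_derivative (\<lambda>h. (h, 0))) (at t)" by (auto intro!: derivative_eq_intros)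
    have D1: "((\<lambda>s. f s a) has_derivative (\<lambda>h. frechet_derivative ?f (at (t, a)) (h, 0))) (at t)"
      using has_derivative_compose[OF P D[OF that]] by simp
    have lin: "frechet_derivative ?f (at (t, a)) (h, 0) = h * frechet_derivative ?f (at (t, a)) (1, 0)" for h
    proof -
      have e: "(h, 0) = h *\<^sub>R ((1, 0) :: real \<times> real)" by simp
      show ?thesis by (subst e, subst linear_scale[OF has_derivative_linear[OF D[OF that]]], simp)
    qed
    show ?thesis
      unfolding has_field_derivative_def
      by (rule has_derivative_eq_rhs[OF D1]) (rule ext, subst lin, rule mult.commute)
  qed
  have 2: "(f t has_real_derivative frechet_derivative ?f (at (t, a)) (0, 1)) (at a)" if "t > 0" for t a
  proof -
    have P: "((\<lambda>b. (t, b)) has_derivative (\<lambda>h. (0, h))) (at a)" by (auto intro!: derivative_eq_intros)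
    have D1: "(f t has_derivative (\<lambda>h. frechet_derivative ?f (at (t, a)) (0, h))) (at a)"
      using has_derivative_compose[OF P D[OF that]] by simp
    have lin: "frechet_derivative ?f (at (t, a)) (0, h) = h * frechet_derivative ?f (at (t, a)) (0, 1)" for h
    proof -
      have e: "(0, h) = h *\<^sub>R ((0, 1) :: real \<times> real)" by simp
      show ?thesis by (subst e, subst linear_scale[OF has_derivative_linear[OF D[OF that]]], simp)
    qed
    show ?thesis
      unfolding has_field_derivative_def
      by (rule has_derivative_eq_rhs[OF D1]) (rule ext, subst lin, rule mult.commute)
  qed
  have eq: "pd1 f t a = frechet_derivative ?f (at (t, a)) (1, 0)" "pd2 f t a = frechet_derivative ?f (at (t, a)) (0, 1)" if "t > 0" for t a
    unfolding pd1_def pd2_def using 1[OF that] 2[OF that] by (auto intro: DERIV_imp_deriv)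
  show "t > 0 \<Longrightarrow> ((\<lambda>s. f s a) has_real_derivative pd1 f t a) (at t)" "t > 0 \<Longrightarrow> (f t has_real_derivative pd2 f t a) (at a)"
    using 1 2 eq by simp_all
  show "(?f has_derivative (\<lambda>v. fst v * pd1 f t a + snd v * pd2 f t a)) (at (t, a))" if t: "t > 0"
  proof (rule has_derivative_eq_rhs[OF D[OF t]], rule ext)
    fix v :: "real \<times> real"
    have "v = fst v *\<^sub>R (1, 0) + snd v *\<^sub>R (0, 1)" by (simp add: prod_eq_iff)
    then have "frechet_derivative ?f (at (t, a)) v = frechet_derivative ?f (at (t, a)) (fst v *\<^sub>R (1, 0) + snd v *\<^sub>R (0, 1))"
      by simp
    also have "\<dots> = fst v * pd1 f t a + snd v * pd2 f t a"
      using has_derivative_linear[OF D[OF t]] by (simp only: linear_add linear_scale eq[OF t]) simp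
    finally show "frechet_derivative ?f (at (t, a)) v = fst v * pd1 f t a + snd v * pd2 f t a" .
  qed
  have "diff_n_on n ({0<..} \<times> UNIV) (\<lambda>z. pd1 f (fst z) (snd z))" "diff_n_on n ({0<..} \<times> UNIV) (\<lambda>z. pd2 f (fst z) (snd z))" for n
  proof -
    have "diff_n_on n ({0<..} \<times> UNIV) (\<lambda>z. frechet_derivative ?f (at z) v)" for v
      using assms diff_n_onD(2)[of n "{0<..} \<times> UNIV" ?f] unfolding smooth2_iff by blast
    note d = this[of "(1, 0)"] this[of "(0, 1)"]
    show "diff_n_on n ({0<..} \<times> UNIV) (\<lambda>z. pd1 f (fst z) (snd z))" "diff_n_on n ({0<..} \<times> UNIV) (\<lambda>z. pd2 f (fst z) (snd z))"
      by (rule diff_n_on_cong[OF open_half _ d(1)], use eq in force) (rule diff_n_on_cong[OF open_half _ d(2)], use eq in force)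
  qed
  then show "smooth2 (pd1 f)" "smooth2 (pd2 f)" by (simp_all add: smooth2_iff)
qed

lemma smooth2_const: "smooth2 (\<lambda>_ _. c)"
  unfolding smooth2_iff by (intro allI diff_n_on_const open_half)

lemma smooth2_snd: "smooth2 (\<lambda>t a. a)"
  unfolding smooth2_iff by (intro allI diff_n_on_bounded_linear open_half bounded_linear_snd)

lemma smooth2_add: "smooth2 f \<Longrightarrow> smooth2 g \<Longrightarrow> smooth2 (\<lambda>t a. f t a + g t a)"
  unfolding smooth2_iff by (intro allI diff_n_on_add open_half) auto

lemma smooth2_mult: "smooth2 f \<Longrightarrow> smooth2 g \<Longrightarrow> smooth2 (\<lambda>t a. f t a * g t a)"
  unfolding smooth2_iff by (intro allI diff_n_on_mult open_half) auto

lemma smooth2_cmult: "smooth2 f \<Longrightarrow> smooth2 (\<lambda>t a. c * f t a)"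
  by (rule smooth2_mult[OF smooth2_const])

lemma smooth2_diff: "smooth2 f \<Longrightarrow> smooth2 g \<Longrightarrow> smooth2 (\<lambda>t a. f t a - g t a)"
  using smooth2_add[of f "\<lambda>t a. (-1) * g t a"] smooth2_cmult[of g "-1"] by simp

lemma smooth2_compose:
  assumes "open T" "smooth_on T g" "smooth2 f" "\<And>t a. t > 0 \<Longrightarrow> f t a \<in> T"
  shows "smooth2 (\<lambda>t a. g (f t a))"
  unfolding smooth2_iff
proof
  fix n
  show "diff_n_on n ({0<..} \<times> UNIV) (\<lambda>z. g (f (fst z) (snd z)))"
  proof (rule diff_n_on_compose[where f = "\<lambda>z. f (fst z) (snd z)", OF open_half assms(1)])
    show "f (fst z) (snd z) \<in> T" if "z \<in> {0<..} \<times> UNIV" for z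
      using that by (intro assms(4)) (simp add: mem_Times_iff)
    show "diff_n_on n ({0<..} \<times> UNIV) (\<lambda>z. f (fst z) (snd z))" using assms(3) by (simp only: smooth2_iff)
    show "diff_n_on n T g" using assms(2) by (simp only: smooth_on_def)
  qed
qed

lemma smooth2_compose2:
  assumes "smooth2 F" "smooth2 Y"
  shows "smooth2 (\<lambda>t a. F t (Y t a))"
  unfolding smooth2_iff
proof
  fix n
  have "diff_n_on n ({0<..} \<times> UNIV) (\<lambda>x. (\<lambda>z. F (fst z) (snd z)) (fst x, Y (fst x) (snd x)))"
  proof (rule diff_n_on_compose2[where F = "\<lambda>z. F (fst z) (snd z)" and p = fst and q = "\<lambda>x. Y (fst x) (snd x)", OF open_half open_half])
    show "diff_n_on n ({0<..} \<times> UNIV) (\<lambda>z. F (fst z) (snd z))" "diff_n_on n ({0<..} \<times> UNIV) (\<lambda>z. Y (fst z) (snd z))"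
      using assms by (simp_all only: smooth2_iff)
    show "diff_n_on n ({0::real<..} \<times> (UNIV :: real set)) fst"
      by (rule diff_n_on_bounded_linear[OF open_half bounded_linear_fst])
    show "(fst x, Y (fst x) (snd x)) \<in> {0<..} \<times> UNIV" if "x \<in> {0<..} \<times> UNIV" for x
      using that by (simp add: mem_Times_iff)
  qed
  then show "diff_n_on n ({0<..} \<times> UNIV) (\<lambda>z. F (fst z) (Y (fst z) (snd z)))" by simp
qed

lemma smooth2_continuous:
  assumes "smooth2 f"
  shows "continuous_on ({0<..} \<times> UNIV) (\<lambda>(t, a). f t a)" "t > 0 \<Longrightarrow> continuous_on UNIV (f t)"
proof -
  show c: "continuous_on ({0<..} \<times> UNIV) (\<lambda>(t, a). f t a)"
    using assms[unfolded smooth2_def smooth_on_def, rule_format, of 0] by (simp only: diff_n_on.simps)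
  show "continuous_on UNIV (f t)" if t: "t > 0"
  proof -
    have "continuous_on UNIV (\<lambda>a. (t, a))" by (intro continuous_intros)
    moreover have "(\<lambda>a. (t, a)) ` UNIV \<subseteq> {0<..} \<times> UNIV" using t by blast
    ultimately have "continuous_on UNIV (\<lambda>a. case (t, a) of (t, a) \<Rightarrow> f t a)" by (rule continuous_on_compose2[OF c])
    then show ?thesis by simp
  qed
qed

text \<open>f(b) - f(c) is the integral of \<open>pd2 f\<close>; it is differentiated in time under
  the integral sign and then in the upper limit b.\<close>

lemma pd_symmetric:
  assumes f: "smooth2 f" and t: "t > 0"
  shows "pd1 (pd2 f) t a = pd2 (pd1 f) t a"
proof -
  \<comment> \<open>A base point strictly to the left of a lets b vary on both sides of a.\<close>
  define c where "c = a - 1"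
  have f2: "smooth2 (pd2 f)" and f21: "smooth2 (pd1 (pd2 f))" using f smooth2_derivative(4,5) by auto
  note cont = smooth2_continuous(1)
  have int: "f s b - f s c = integral {c..b} (pd2 f s)" if s: "s > 0" and b: "b \<ge> c" for s b
  proof -
    have "(pd2 f s has_integral (f s b - f s c)) {c..b}"
    proof (rule fundamental_theorem_of_calculus[OF b])
      show "(f s has_vector_derivative pd2 f s x) (at x within {c..b})" for x
        using smooth2_derivative(3)[OF f s, of x]
        by (simp add: has_real_derivative_iff_has_vector_derivative has_vector_derivative_at_within)
    qed
    then show ?thesis by (simp add: integral_unique)
  qed
  have eq: "pd1 f t b - pd1 f t c = integral {c..b} (pd1 (pd2 f) t)" if b: "b \<ge> c" for b
  proof (rule DERIV_unique)
    show "((\<lambda>s. f s b - f s c) has_real_derivative pd1 f t b - pd1 f t c) (at t)"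
      by (intro DERIV_diff smooth2_derivative(2)[OF f t])
    have pos: "s > 0" if "s \<in> {t/2..2*t}" for s using that t by simp
    have der: "((\<lambda>s. pd2 f s x) has_field_derivative pd1 (pd2 f) s x) (at s within {t/2..2*t})"
      if "s \<in> {t/2..2*t}" "x \<in> cbox c b" for s x
      using smooth2_derivative(2)[OF f2 pos[OF that(1)]] by (rule has_field_derivative_at_within)
    have intg: "pd2 f s integrable_on cbox c b" if "s \<in> {t/2..2*t}" for s
      using continuous_on_subset[OF smooth2_continuous(2)[OF f2 pos[OF that]] subset_UNIV]
      by (rule integrable_continuous)
    have sub: "{t/2..2*t} \<times> cbox c b \<subseteq> {0<..} \<times> UNIV"
    proof
      fix z assume "z \<in> {t/2..2*t} \<times> cbox c b"
      then have "fst z \<in> {t/2..2*t}" by (rule mem_Times_iff[THEN iffD1, THEN conjunct1])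
      from pos[OF this] show "z \<in> {0<..} \<times> UNIV" by (simp add: mem_Times_iff)
    qed
    have cn: "continuous_on ({t/2..2*t} \<times> cbox c b) (\<lambda>(s, x). pd1 (pd2 f) s x)"
      by (rule continuous_on_subset[OF cont[OF f21] sub])
    have tin: "t \<in> {t/2..2*t}" using t by simp
    have "((\<lambda>s. integral (cbox c b) (pd2 f s)) has_field_derivative integral (cbox c b) (pd1 (pd2 f) t)) (at t within {t/2..2*t})"
      by (rule leibniz_rule_field_derivative[OF der intg cn tin convex_real_interval(5)])
    then have "((\<lambda>s. integral {c..b} (pd2 f s)) has_real_derivative integral {c..b} (pd1 (pd2 f) t)) (at t)"
      using t at_within_interior[of t "{t/2..2*t}"] by simp
    then show "((\<lambda>s. f s b - f s c) has_real_derivative integral {c..b} (pd1 (pd2 f) t)) (at t)"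
      by (rule has_field_derivative_transform_within_open[where S = "{0<..}"]) (use t int[OF _ b] in simp_all)
  qed
  have "((\<lambda>b. integral {c..b} (pd1 (pd2 f) t)) has_real_derivative pd1 (pd2 f) t a) (at a within {c..a+1})"
    using t by (intro integral_has_real_derivative continuous_on_subset[OF smooth2_continuous(2)[OF f21]]) (auto simp: c_def)
  then have "((\<lambda>b. integral {c..b} (pd1 (pd2 f) t)) has_real_derivative pd1 (pd2 f) t a) (at a)"
    using at_within_interior[of a "{c..a+1}"] by (simp add: c_def)
  then have "((\<lambda>b. pd1 f t b - pd1 f t c) has_real_derivative pd1 (pd2 f) t a) (at a)"
    by (rule has_field_derivative_transform_within_open[where S = "{c<..}"]) (use eq in \<open>simp_all add: c_def\<close>)
  moreover have "((\<lambda>b. pd1 f t b - pd1 f t c) has_real_derivative pd2 (pd1 f) t a - 0) (at a)"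
    by (intro DERIV_diff DERIV_const smooth2_derivative(3)[OF smooth2_derivative(4)[OF f] t])
  ultimately have "pd1 (pd2 f) t a = pd2 (pd1 f) t a - 0" by (rule DERIV_unique)
  then show ?thesis by simp
qed

lemma pd1_eqI: "((\<lambda>s. f s a) has_real_derivative d) (at t) \<Longrightarrow> pd1 f t a = d"
  unfolding pd1_def by (rule DERIV_imp_deriv)

lemma pd2_eqI: "(f t has_real_derivative d) (at a) \<Longrightarrow> pd2 f t a = d"
  unfolding pd2_def by (rule DERIV_imp_deriv)

lemma pd1_cong: "t > 0 \<Longrightarrow> (\<And>s. s > 0 \<Longrightarrow> f s a = g s b) \<Longrightarrow> pd1 f t a = pd1 g t b"
  unfolding pd1_def by (intro deriv_cong_ev eventually_nhds_in_open[of "{0<..}", THEN eventually_mono]) auto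

lemma pd2_cong: "(\<And>a. f t a = g t a) \<Longrightarrow> pd2 f t a = pd2 g t a"
  unfolding pd2_def by (metis ext)

text \<open>The mean value theorem at each a and uniform continuity of \<open>pd1 g\<close> on
  [t/2, 2 t] x [0, 1] make the remainder small in the sup norm over a period, which dominates the L2
  norm.\<close>

lemma smooth2_L2_derivative:
  assumes g: "smooth2 g" and per: "\<And>t a. t > 0 \<Longrightarrow> g t (a + 1) = g t a" and t: "t > 0"
  shows "((\<lambda>t. abs_L2T (g t)) has_vector_derivative abs_L2T (pd1 g t)) (at t)"
    and "L2_fun (g t)" "pd1 g t (a + 1) = pd1 g t a"
proof -
  have g1: "smooth2 (pd1 g)" by (rule smooth2_derivative(4)[OF g])
  have per1: "pd1 g t (a + 1) = pd1 g t a" if "t > 0" for t a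
    by (rule pd1_cong) (use that per in auto)
  show "pd1 g t (a + 1) = pd1 g t a" by (rule per1[OF t])
  have L: "L2_fun (g s)" "L2_fun (pd1 g s)" if "s > 0" for s
    using that by (intro L2_fun_continuous smooth2_continuous(2) g g1 per per1; simp)+
  show "L2_fun (g t)" by (rule L(1)[OF t])
  show "((\<lambda>t. abs_L2T (g t)) has_vector_derivative abs_L2T (pd1 g t)) (at t)"
    unfolding has_vector_derivative_def has_derivative_at_alt
  proof (intro conjI allI impI bounded_linear_scaleR_left)
    fix e :: real assume e: "e > 0"
    have "uniformly_continuous_on ({t/2..2*t} \<times> {0..1}) (\<lambda>(t, a). pd1 g t a)"
      using t by (intro compact_uniformly_continuous continuous_on_subset[OF smooth2_continuous(1)[OF g1]] compact_Times) auto
    then obtain d where d: "d > 0" "\<And>z z'. z \<in> {t/2..2*t} \<times> {0..1} \<Longrightarrow> z' \<in> {t/2..2*t} \<times> {0..1} \<Longrightarrow> dist z' z < d \<Longrightarrow>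
       dist (case z' of (t, a) \<Rightarrow> pd1 g t a) (case z of (t, a) \<Rightarrow> pd1 g t a) < e"
      using e unfolding uniformly_continuous_on_def by metis
    have "norm (abs_L2T (g s) - abs_L2T (g t) - (s - t) *\<^sub>R abs_L2T (pd1 g t)) \<le> e * norm (s - t)"
      if s: "norm (s - t) < min d (t / 2)" for s
    proof -
      have "\<bar>s - t\<bar> < t / 2" using s by simp
      then have s0: "s > 0" "s \<in> {t/2..2*t}" using t unfolding atLeastAtMost_iff by linarith+
      have eq: "abs_L2T (g s) - abs_L2T (g t) - (s - t) *\<^sub>R abs_L2T (pd1 g t) = abs_L2T (\<lambda>a. g s a - g t a - (s - t) * pd1 g t a)"
        by (simp only: abs_L2T_diff[OF L(1)[OF s0(1)] L(1)[OF t]] abs_L2T_scaleR[OF L(2)[OF t]]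
            abs_L2T_diff[OF L2_fun_diff[OF L(1)[OF s0(1)] L(1)[OF t]] L2_fun_cmult[OF L(2)[OF t]]])
      show ?thesis
        unfolding eq
      proof (rule norm_abs_L2T_le)
        show "L2_fun (\<lambda>a. g s a - g t a - (s - t) * pd1 g t a)"
          by (intro L2_fun_diff L2_fun_cmult L s0 t)
        fix a :: real assume a: "a \<in> {0..1}"
        have "\<exists>r. r \<in> {t/2..2*t} \<and> \<bar>r - t\<bar> < d \<and> g s a - g t a = (s - t) * pd1 g r a"
        proof (cases s t rule: linorder_cases)
          case less
          have "\<exists>z>s. z < t \<and> g t a - g s a = (t - s) * pd1 g z a"
            using less s0 by (intro MVT2 smooth2_derivative(2)[OF g]) auto
          then obtain z where "z > s" "z < t" "g t a - g s a = (t - s) * pd1 g z a" by blast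
          then show ?thesis using s s0 t by (intro exI[of _ z]) (auto simp: algebra_simps abs_real_def split: if_splits)
        next
          case equal
          then show ?thesis using t d(1) by (intro exI[of _ t]) auto
        next
          case greater
          have "\<exists>z>t. z < s \<and> g s a - g t a = (s - t) * pd1 g z a"
            using greater t by (intro MVT2 smooth2_derivative(2)[OF g]) auto
          then obtain z where "z > t" "z < s" "g s a - g t a = (s - t) * pd1 g z a" by blast
          then show ?thesis using s s0 t by (intro exI[of _ z]) auto
        qed
        then obtain r where r: "r \<in> {t/2..2*t}" "\<bar>r - t\<bar> < d" "g s a - g t a = (s - t) * pd1 g r a" by blast
        have "dist (pd1 g r a) (pd1 g t a) < e"
          using d(2)[of "(t, a)" "(r, a)"] r a t by (auto simp: dist_Pair_Pair dist_real_def)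
        then have "\<bar>s - t\<bar> * \<bar>pd1 g r a - pd1 g t a\<bar> \<le> \<bar>s - t\<bar> * e"
          by (intro mult_left_mono) (auto simp: dist_real_def)
        then show "\<bar>g s a - g t a - (s - t) * pd1 g t a\<bar> \<le> e * norm (s - t)"
          using r(3) by (simp add: mult.commute flip: abs_mult right_diff_distrib)
      qed
    qed
    then show "\<exists>d>0. \<forall>s. norm (s - t) < d \<longrightarrow>
        norm (abs_L2T (g s) - abs_L2T (g t) - (s - t) *\<^sub>R abs_L2T (pd1 g t)) \<le> e * norm (s - t)"
      using d(1) t by (intro exI[of _ "min d (t / 2)"]) auto
  qed
qed

section \<open>From a convex functional to the evolution of the coupled system\<close>

section \<open>Evolution inclusions driven by convex functionals\<close>

text \<open>\<open>closed\<close> is lower semicontinuity along sequences in a sublevel set. The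
  locale covers both \<Theta> and the indicator of the cone.\<close>

locale convex_functional =
  fixes \<Phi> :: "'a::{real_inner,banach} \<Rightarrow> ereal" and m :: real
  assumes lower: "ereal m \<le> \<Phi> x" and proper: "\<exists>x. \<Phi> x \<noteq> \<infinity>"
    and convex: "0 < s \<Longrightarrow> s < 1 \<Longrightarrow> \<Phi> x \<noteq> \<infinity> \<Longrightarrow> \<Phi> y \<noteq> \<infinity> \<Longrightarrow>
      \<Phi> ((1 - s) *\<^sub>R x + s *\<^sub>R y) \<le> ereal ((1 - s) * real_of_ereal (\<Phi> x) + s * real_of_ereal (\<Phi> y))"
    and closed: "X \<longlonglongrightarrow> x \<Longrightarrow> (\<And>n. \<Phi> (X n) \<le> ereal c) \<Longrightarrow> \<Phi> x \<le> ereal c"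
begin

abbreviation "scaled e x \<equiv> (\<lambda>p. e *\<^sub>R p) ` subdifferential \<Phi> x"

abbreviation "val x \<equiv> real_of_ereal (\<Phi> x)"

lemma val_ge: "\<Phi> x \<noteq> \<infinity> \<Longrightarrow> m \<le> val x"
  using lower[of x] by (cases "\<Phi> x") auto

lemma scaled_finite: "p \<in> scaled e x \<Longrightarrow> \<Phi> x \<noteq> \<infinity>"
  by (auto simp: subdifferential_def)

lemma scaled_subgradient:
  assumes e: "e > 0" and p: "p \<in> scaled e x" and y: "\<Phi> y \<noteq> \<infinity>"
  shows "e * val x + inner p (y - x) \<le> e * val y"
proof -
  obtain q where q: "q \<in> subdifferential \<Phi> x" "p = e *\<^sub>R q" using p by blast
  have "e * (val x + inner q (y - x)) \<le> e * val y"
    using subdifferential_real[OF q(1) y lower] e by (intro mult_left_mono) auto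
  then show ?thesis unfolding q(2) by (simp add: distrib_left)
qed

lemma scaled_maximal_monotone:
  assumes e: "e > 0"
  shows "maximal_monotone (scaled e)"
proof
  fix x x' y y' assume y: "y \<in> scaled e x" and y': "y' \<in> scaled e x'"
  have "e * val x + inner y (x' - x) \<le> e * val x'" "e * val x' + inner y' (x - x') \<le> e * val x"
    by (rule scaled_subgradient[OF e y scaled_finite[OF y']], rule scaled_subgradient[OF e y' scaled_finite[OF y]])
  then have "inner y (x' - x) + inner y' (x - x') \<le> 0" by linarith
  moreover have "inner y (x' - x) + inner y' (x - x') = - inner (y - y') (x - x')"
    by (simp add: inner_diff_left inner_diff_right)
  ultimately show "0 \<le> inner (y - y') (x - x')" by linarith
next
  fix \<mu> :: real and z assume \<mu>: "\<mu> > 0"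
  obtain x0 where x0: "\<Phi> x0 \<noteq> \<infinity>" using proper by blast
  have \<mu>e: "\<mu> * e > 0" using e \<mu> by simp
  have "\<exists>x. \<exists>y\<in>subdifferential \<Phi> x. z = x + (\<mu> * e) *\<^sub>R y"
  proof (rule subdifferential_range[where \<Phi> = \<Phi> and m = m, OF lower x0 _ _ \<mu>e])
    show "\<Phi> ((1 - s) *\<^sub>R x + s *\<^sub>R y) \<le> ereal ((1 - s) * val x + s * val y)"
      if "0 < s" "s < 1" "\<Phi> x \<noteq> \<infinity>" "\<Phi> y \<noteq> \<infinity>" for s x y by (rule convex[OF that])
    show "\<Phi> x \<le> ereal c" if "X \<longlonglongrightarrow> x" "\<And>n. \<Phi> (X n) \<le> ereal c" for X x c using that by (rule closed)
  qed
  then obtain x y where xy: "y \<in> subdifferential \<Phi> x" "z = x + (\<mu> * e) *\<^sub>R y" by blast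
  then have "z = x + \<mu> *\<^sub>R (e *\<^sub>R y)" by simp
  then show "\<exists>x. \<exists>y\<in>scaled e x. z = x + \<mu> *\<^sub>R y" using xy(1) by blast
qed

lemma resolvent_finite:
  assumes "e > 0" "\<mu> > 0"
  shows "\<Phi> (resolvent (scaled e) \<mu> x) \<noteq> \<infinity>"
  using maximal_monotone.yosida_in[OF scaled_maximal_monotone[OF assms(1)] assms(2), of x] by (rule scaled_finite)

text \<open>Expanding |x - y|^2 around the resolvent J turns the subgradient inequality into a
  three-point estimate. It serves twice: with y = x for density of the domain, and with e tending to
  0 for the limit of resolvents.\<close>

lemma resolvent_estimate:
  fixes x :: 'a
  assumes e: "e > 0" and \<mu>: "\<mu> > 0" and y: "\<Phi> y \<noteq> \<infinity>"
  defines "J \<equiv> resolvent (scaled e) \<mu> x"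
  shows "(norm (x - J))\<^sup>2 + (norm (y - J))\<^sup>2 \<le> (norm (x - y))\<^sup>2 + 2 * \<mu> * e * (val y - m)"
proof -
  interpret maximal_monotone "scaled e" by (rule scaled_maximal_monotone[OF e])
  have p: "yosida (scaled e) \<mu> x \<in> scaled e J" unfolding J_def by (rule yosida_in[OF \<mu>])
  have xJ: "x - J = \<mu> *\<^sub>R yosida (scaled e) \<mu> x" using \<mu> by (simp add: yosida_def J_def)
  have "e * val J + inner (yosida (scaled e) \<mu> x) (y - J) \<le> e * val y"
    by (rule scaled_subgradient[OF e p y])
  moreover have "e * m \<le> e * val J" using val_ge[OF scaled_finite[OF p]] e by simp
  ultimately have "inner (yosida (scaled e) \<mu> x) (y - J) \<le> e * (val y - m)" by (simp add: right_diff_distrib)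
  then have "\<mu> * inner (yosida (scaled e) \<mu> x) (y - J) \<le> \<mu> * (e * (val y - m))"
    using \<mu> by (intro mult_left_mono) auto
  then have "inner (x - J) (y - J) \<le> \<mu> * e * (val y - m)" unfolding xJ by (simp add: mult.assoc)
  moreover have "(norm (x - y))\<^sup>2 = (norm (x - J))\<^sup>2 + (norm (y - J))\<^sup>2 - 2 * inner (x - J) (y - J)"
    unfolding power2_norm_eq_inner by (simp add: inner_diff_left inner_diff_right inner_commute)
  ultimately show ?thesis by linarith
qed

lemma finite_in_closure_domain:
  assumes x: "\<Phi> x \<noteq> \<infinity>"
  shows "x \<in> closure {x. subdifferential \<Phi> x \<noteq> {}}"
  unfolding closure_approachable
proof (intro allI impI)
  fix d :: real assume d: "d > 0"
  \<comment> \<open>The added 1 keeps c positive and makes the final inequality strict.\<close>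
  define c where "c = val x - m + 1"
  define \<mu> where "\<mu> = d\<^sup>2 / (2 * c)"
  have c: "c > 0" using val_ge[OF x] by (simp add: c_def)
  have \<mu>: "\<mu> > 0" unfolding \<mu>_def using d c by simp
  define J where "J = resolvent (scaled 1) \<mu> x"
  have "yosida (scaled 1) \<mu> x \<in> scaled 1 J"
    unfolding J_def by (rule maximal_monotone.yosida_in[OF scaled_maximal_monotone \<mu>]) simp
  then have J: "subdifferential \<Phi> J \<noteq> {}" by blast
  have "(norm (x - J))\<^sup>2 + (norm (x - J))\<^sup>2 \<le> 2 * \<mu> * (val x - m)"
    using resolvent_estimate[OF _ \<mu> x, of 1 x] by (simp add: J_def)
  also have "\<dots> < 2 * \<mu> * c" using \<mu> by (simp add: c_def algebra_simps)
  also have "\<dots> = d\<^sup>2" unfolding \<mu>_def using c by simp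
  finally have "(norm (x - J))\<^sup>2 < d\<^sup>2" using zero_le_power2[of "norm (x - J)"] by linarith
  then have "dist J x < d" using d by (simp add: dist_norm norm_minus_commute power_less_imp_less_base)
  with J show "\<exists>y\<in>{x. subdifferential \<Phi> x \<noteq> {}}. dist y x < d" by blast
qed

end

lemma product_maximal_monotone:
  fixes A :: "'a::{real_inner,banach} \<Rightarrow> 'a set"
  assumes "maximal_monotone A"
  shows "maximal_monotone (\<lambda>u :: 'a \<times> 'b::{real_inner,banach}. A (fst u) \<times> {0})"
proof -
  interpret maximal_monotone A by (rule assms)
  show ?thesis
  proof
    fix x x' y y' :: "'a \<times> 'b" assume "y \<in> A (fst x) \<times> {0}" "y' \<in> A (fst x') \<times> {0}"
    then have "fst y \<in> A (fst x)" "fst y' \<in> A (fst x')" "snd y = 0" "snd y' = 0" by (simp_all add: mem_Times_iff)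
    then show "0 \<le> inner (y - y') (x - x')" using monotone[of "fst y" "fst x" "fst y'" "fst x'"] by (simp add: inner_prod_def)
  next
    fix \<mu> :: real and z :: "'a \<times> 'b" assume "\<mu> > 0"
    then obtain x y where "y \<in> A x" "fst z = x + \<mu> *\<^sub>R y" using range by blast
    then have "(y, 0) \<in> A (fst (x, snd z)) \<times> {0}" "z = (x, snd z) + \<mu> *\<^sub>R (y, 0)" by (simp_all add: prod_eq_iff)
    then show "\<exists>x. \<exists>y\<in>A (fst x) \<times> {0}. z = x + \<mu> *\<^sub>R y" by blast
  qed
qed

lemma resolvent_product:
  fixes A :: "'a::{real_inner,banach} \<Rightarrow> 'a set"
  assumes A: "maximal_monotone A" and \<mu>: "\<mu> > 0"
  shows "resolvent (\<lambda>u :: 'a \<times> 'b::{real_inner,banach}. A (fst u) \<times> {0}) \<mu> z = (resolvent A \<mu> (fst z), snd z)"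
proof (rule maximal_monotone.resolvent_eqI[OF product_maximal_monotone[OF A] \<mu>])
  interpret maximal_monotone A by (rule A)
  show "(yosida A \<mu> (fst z), 0) \<in> A (fst (resolvent A \<mu> (fst z), snd z)) \<times> {0}"
    using yosida_in[OF \<mu>, of "fst z"] by simp
  show "z = (resolvent A \<mu> (fst z), snd z) + \<mu> *\<^sub>R (yosida A \<mu> (fst z), 0)"
    using \<mu> by (simp add: yosida_def prod_eq_iff)
qed

lemma superpose_lipschitz:
  assumes lip: "\<And>x y. \<bar>F x - F y\<bar> \<le> C * \<bar>x - y\<bar>"
  shows "norm (superpose F \<xi> - superpose F \<eta>) \<le> C * norm (\<xi> - \<eta>)"
proof -
  have C: "C \<ge> 0" using lip[of 0 1] by simp
  obtain f where f: "L2_fun f" "\<xi> = abs_L2T f" by (rule L2T_cases)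
  obtain g where g: "L2_fun g" "\<eta> = abs_L2T g" by (rule L2T_cases)
  note F = superpose_abs_L2T[OF lip]
  have L: "L2_fun (\<lambda>a. F (f a) - F (g a))" "L2_fun (\<lambda>a. f a - g a)" "L2_fun (\<lambda>a. C * (f a - g a))"
    by (intro L2_fun_diff L2_fun_cmult F(1) f(1) g(1))+
  have "norm (superpose F \<xi> - superpose F \<eta>) = norm (abs_L2T (\<lambda>a. F (f a) - F (g a)))"
    unfolding f(2) g(2) F(2)[OF f(1)] F(2)[OF g(1)] by (subst abs_L2T_diff[OF F(1)[OF f(1)] F(1)[OF g(1)]]) simp
  also have "\<dots> = sqrt (circ (\<lambda>a. (F (f a) - F (g a))\<^sup>2))" by (rule norm_abs_L2T[OF L(1)])
  also have "\<dots> \<le> sqrt (circ (\<lambda>a. (C * (f a - g a))\<^sup>2))"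
  proof (intro real_sqrt_le_mono set_integral_mono)
    show "set_integrable lborel {0..1} (\<lambda>a. (F (f a) - F (g a))\<^sup>2)" "set_integrable lborel {0..1} (\<lambda>a. (C * (f a - g a))\<^sup>2)"
      using L(1,3) by (simp_all only: L2_fun_def)
    show "(F (f a) - F (g a))\<^sup>2 \<le> (C * (f a - g a))\<^sup>2" for a
      using lip[of "f a" "g a"] C by (simp add: abs_le_square_iff[symmetric] abs_mult)
  qed
  also have "\<dots> = norm (C *\<^sub>R abs_L2T (\<lambda>a. f a - g a))"
    unfolding abs_L2T_scaleR[OF L(2)] by (rule norm_abs_L2T[OF L(3), symmetric])
  also have "\<dots> = C * norm (\<xi> - \<eta>)"
    using C by (simp add: f(2) g(2) abs_L2T_diff[OF f(1) g(1)])
  finally show ?thesis .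
qed

text \<open>The right-hand side after solving the two relations for the time derivatives; the
  monotone part is left to act on the first component alone.\<close>

definition drift :: "real \<Rightarrow> (real \<Rightarrow> real) \<Rightarrow> L2T \<times> L2T \<Rightarrow> L2T \<times> L2T" where
  "drift lam F u = (snd u + lam *\<^sub>R fst u, superpose F (fst u) - lam *\<^sub>R snd u - lam\<^sup>2 *\<^sub>R fst u)"

lemma drift_lipschitz:
  assumes lip: "\<And>x y. \<bar>F x - F y\<bar> \<le> C * \<bar>x - y\<bar>" and lam: "lam > 0"
  shows "norm (drift lam F u - drift lam F v) \<le> (1 + 2 * lam + lam\<^sup>2 + C) * norm (u - v)"
proof -
  have C: "C \<ge> 0" using lip[of 0 1] by simp
  define x where "x = fst u - fst v"
  define z where "z = snd u - snd v"
  have xz: "norm x \<le> norm (u - v)" "norm z \<le> norm (u - v)"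
    using norm_fst_le[of x z] norm_snd_le[of z x] by (simp_all add: x_def z_def minus_prod_def)
  have "drift lam F u - drift lam F v = (z + lam *\<^sub>R x, (superpose F (fst u) - superpose F (fst v)) - lam *\<^sub>R z - lam\<^sup>2 *\<^sub>R x)"
    by (simp add: drift_def x_def z_def algebra_simps)
  then have "norm (drift lam F u - drift lam F v) \<le> norm (z + lam *\<^sub>R x) + norm ((superpose F (fst u) - superpose F (fst v)) - lam *\<^sub>R z - lam\<^sup>2 *\<^sub>R x)"
    using norm_Pair_le by metis
  also have "\<dots> \<le> (norm z + lam * norm x) + (norm (superpose F (fst u) - superpose F (fst v)) + lam * norm z + lam\<^sup>2 * norm x)"
    using norm_triangle_ineq[of z "lam *\<^sub>R x"] norm_triangle_ineq4[of "superpose F (fst u) - superpose F (fst v)" "lam *\<^sub>R z"]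
      norm_triangle_ineq4[of "superpose F (fst u) - superpose F (fst v) - lam *\<^sub>R z" "lam\<^sup>2 *\<^sub>R x"] lam by simp
  also have "\<dots> \<le> (norm (u - v) + lam * norm (u - v)) + (C * norm (u - v) + lam * norm (u - v) + lam\<^sup>2 * norm (u - v))"
  proof (intro add_mono mult_left_mono xz)
    have "norm (superpose F (fst u) - superpose F (fst v)) \<le> C * norm x"
      unfolding x_def by (rule superpose_lipschitz[OF lip])
    also have "\<dots> \<le> C * norm (u - v)" using xz(1) C by (rule mult_left_mono)
    finally show "norm (superpose F (fst u) - superpose F (fst v)) \<le> C * norm (u - v)" .
  qed (use lam in auto)
  finally show ?thesis by (simp add: algebra_simps)
qed

abbreviation on_fst :: "(L2T \<Rightarrow> L2T set) \<Rightarrow> L2T \<times> L2T \<Rightarrow> (L2T \<times> L2T) set" where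
  "on_fst P u \<equiv> P (fst u) \<times> {0}"

lemma is_solution_iff:
  "is_solution P lam F w u \<longleftrightarrow> u 0 = w \<and> strong_solution (on_fst P) (drift lam F) u"
proof -
  have *: "(\<exists>x z. (u has_vector_derivative (x, z)) (at t) \<and> - x + snd (u t) + lam *\<^sub>R fst (u t) \<in> P (fst (u t)) \<and>
        z + lam *\<^sub>R snd (u t) = - (lam\<^sup>2 *\<^sub>R fst (u t)) + superpose F (fst (u t))) \<longleftrightarrow>
      (\<exists>d. (u has_vector_derivative d) (at t) \<and> drift lam F (u t) - d \<in> on_fst P (u t))" for t
  proof -
    have "z + lam *\<^sub>R snd (u t) = - (lam\<^sup>2 *\<^sub>R fst (u t)) + superpose F (fst (u t)) \<longleftrightarrow>
        superpose F (fst (u t)) - lam *\<^sub>R snd (u t) - lam\<^sup>2 *\<^sub>R fst (u t) - z = 0" for z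
    proof
      assume "z + lam *\<^sub>R snd (u t) = - (lam\<^sup>2 *\<^sub>R fst (u t)) + superpose F (fst (u t))"
      then have "z = - (lam\<^sup>2 *\<^sub>R fst (u t)) + superpose F (fst (u t)) - lam *\<^sub>R snd (u t)" by (simp add: eq_diff_eq)
      then show "superpose F (fst (u t)) - lam *\<^sub>R snd (u t) - lam\<^sup>2 *\<^sub>R fst (u t) - z = 0" by simp
    next
      assume "superpose F (fst (u t)) - lam *\<^sub>R snd (u t) - lam\<^sup>2 *\<^sub>R fst (u t) - z = 0"
      then have "z = superpose F (fst (u t)) - lam *\<^sub>R snd (u t) - lam\<^sup>2 *\<^sub>R fst (u t)" by simp
      then show "z + lam *\<^sub>R snd (u t) = - (lam\<^sup>2 *\<^sub>R fst (u t)) + superpose F (fst (u t))" by simp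
    qed
    moreover have "- x + snd (u t) + lam *\<^sub>R fst (u t) = snd (u t) + lam *\<^sub>R fst (u t) - x" for x by simp
    ultimately show ?thesis by (simp only: drift_def split_paired_Ex diff_Pair mem_Times_iff fst_conv snd_conv singleton_iff)
  qed
  show ?thesis unfolding is_solution_def strong_solution_def * by blast
qed

text \<open>Z is unconstrained and K lies in the closure of the domain of P, so K x UNIV consists of
  admissible initial points; uniqueness is against every strong solution.\<close>

lemma solution_map_evol:
  assumes E: "evolution (on_fst P) \<phi> (drift lam F) L" and dom: "K_disp \<subseteq> closure {x. P x \<noteq> {}}"
  shows "K_disp \<times> UNIV \<subseteq> closure {u. on_fst P u \<noteq> {}}"
    and "solution_map P lam F (evol (on_fst P) (drift lam F))"
    and "continuous_on ({0..} \<times> (K_disp \<times> UNIV)) (\<lambda>(t, w). evol (on_fst P) (drift lam F) t w)"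
proof -
  interpret evolution "on_fst P" \<phi> "drift lam F" L by (rule E)
  have "{u. on_fst P u \<noteq> {}} = {x. P x \<noteq> {}} \<times> UNIV" by auto
  then show W: "K_disp \<times> UNIV \<subseteq> closure {u. on_fst P u \<noteq> {}}"
    using dom by (simp only: closure_Times closure_UNIV Sigma_mono order_refl)
  show "continuous_on ({0..} \<times> (K_disp \<times> UNIV)) (\<lambda>(t, w). evol (on_fst P) (drift lam F) t w)"
    by (rule evol_jointly_continuous[OF W])
  show "solution_map P lam F (evol (on_fst P) (drift lam F))"
    unfolding solution_map_def is_solution_iff
  proof (intro ballI conjI allI impI)
    fix w :: "L2T \<times> L2T" assume "w \<in> K_disp \<times> UNIV"
    then have w: "w \<in> closure {u. on_fst P u \<noteq> {}}" using W by blast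
    show 0: "evol (on_fst P) (drift lam F) 0 w = w" by (rule evol_0[OF w])
    show s: "strong_solution (on_fst P) (drift lam F) (\<lambda>t. evol (on_fst P) (drift lam F) t w)"
      by (rule evol_strong_solution[OF w])
    fix u and t :: real assume u: "u 0 = w \<and> strong_solution (on_fst P) (drift lam F) u" and t: "0 \<le> t"
    show "u t = evol (on_fst P) (drift lam F) t w"
      by (rule strong_solution_unique[OF monotone B_osl conjunct2[OF u] s _ t]) (use u 0 in simp_all)
  qed
qed

context convex_functional
begin

text \<open>Subtracting the lower bound m makes the potential nonnegative and leaves the subgradient
  inequalities unchanged.\<close>

lemma scaled_evolution:
  assumes e: "e > 0" and lip: "\<And>u v. norm (B u - B v) \<le> L * norm (u - v)" and L: "L > 0"
  shows "evolution (\<lambda>u :: 'a \<times> 'b::{real_inner,banach}. scaled e (fst u) \<times> {0}) (\<lambda>u. e * (val (fst u) - m)) B L"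
proof -
  interpret maximal_monotone "\<lambda>u :: 'a \<times> 'b. scaled e (fst u) \<times> {0}"
    by (rule product_maximal_monotone[OF scaled_maximal_monotone[OF e]])
  show ?thesis
  proof
    fix x x' y y' :: "'a \<times> 'b" assume y: "y \<in> scaled e (fst x) \<times> {0}"
    have y1: "fst y \<in> scaled e (fst x)" and y2: "snd y = 0" using y by (simp_all add: mem_Times_iff)
    show "0 \<le> e * (val (fst x) - m)" using val_ge[OF scaled_finite[OF y1]] e by simp
    assume y': "y' \<in> scaled e (fst x') \<times> {0}"
    have y1': "fst y' \<in> scaled e (fst x')" using y' by (simp add: mem_Times_iff)
    show "e * (val (fst x) - m) + inner y (x' - x) \<le> e * (val (fst x') - m)"
      using scaled_subgradient[OF e y1 scaled_finite[OF y1']] y2 by (simp add: inner_prod_def right_diff_distrib)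
  qed (use lip L in auto)
qed

end

section \<open>Convergence of the viscous resolvents to the projection onto the cone\<close>

section \<open>Vanishing viscosity\<close>

lemma potential_deriv:
  assumes "smooth_on {0<..} \<theta>" "strictly_convex_on {0<..} \<theta>"
  shows "potential \<theta> (deriv \<theta>)"
proof
  have D: "(\<theta> has_real_derivative deriv \<theta> x) (at x)" if "x > 0" for x
    by (rule smooth_on_deriv(1)[OF open_greaterThan assms(1)]) (use that in simp)
  show "(\<theta> has_real_derivative deriv \<theta> x) (at x)" if "x > 0" for x by (rule D[OF that])
  show "continuous_on {0<..} (deriv \<theta>)"
    by (rule smooth_on_deriv(3)[OF open_greaterThan smooth_on_deriv(2)[OF open_greaterThan assms(1)]])
  show "\<theta> x + deriv \<theta> x * (y - x) \<le> \<theta> y" if "x > 0" "y > 0" for x y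
  proof -
    have "\<theta> y - \<theta> x \<ge> deriv \<theta> x * (y - x)"
    proof (rule convex_on_imp_above_tangent[OF strictly_convex_imp_convex[OF assms(2)]])
      show "(\<theta> has_real_derivative deriv \<theta> x) (at x within {0<..})"
        by (rule has_field_derivative_at_within[OF D[OF that(1)]])
    qed (use that in \<open>simp_all add: interior_open\<close>)
    then show ?thesis by simp
  qed
qed

lemma lipschitz_of_bounded_deriv:
  fixes F :: "real \<Rightarrow> real"
  assumes F: "smooth_on UNIV F" and bd: "bounded (range (deriv F))"
  shows "\<exists>C\<ge>0. \<forall>x y. \<bar>F x - F y\<bar> \<le> C * \<bar>x - y\<bar>"
proof -
  obtain C where C: "\<And>x. norm (deriv F x) \<le> C" using bd unfolding bounded_iff by blast
  have "norm (F x - F y) \<le> C * norm (x - y)" for x y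
    using has_field_derivative_at_within[OF smooth_on_deriv(1)[OF open_UNIV F UNIV_I]] C UNIV_I UNIV_I
    by (rule field_differentiable_bound[OF convex_UNIV])
  moreover have "C \<ge> 0" using C[of 0] norm_ge_zero order_trans by blast
  ultimately show ?thesis by auto
qed

lemma (in potential) Theta_convex_functional: "convex_functional (Theta \<theta>) (\<theta> 1)"
proof
  show "\<exists>x. Theta \<theta> x \<noteq> \<infinity>" using Theta_0 by blast
qed (fact Theta_lower Theta_convex Theta_closed)+

text \<open>Two densities are composed: points of finite \<Theta> are dense in the cone, and each of
  them is a limit of its own resolvents, which lie in the domain.\<close>

lemma (in potential) K_disp_in_closure_Theta: "K_disp \<subseteq> closure {\<xi>. subdifferential (Theta \<theta>) \<xi> \<noteq> {}}"
proof -
  interpret convex_functional "Theta \<theta>" "\<theta> 1" by (rule Theta_convex_functional)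
  have "K_disp \<subseteq> closure {\<xi>. Theta \<theta> \<xi> \<noteq> \<infinity>}"
  proof
    fix \<xi> assume \<xi>: "\<xi> \<in> K_disp"
    show "\<xi> \<in> closure {\<xi>. Theta \<theta> \<xi> \<noteq> \<infinity>}"
      unfolding closure_approachable dist_norm mem_Collect_eq bex_simps using Theta_finite_dense[OF \<xi>] by blast
  qed
  also have "\<dots> \<subseteq> closure {\<xi>. subdifferential (Theta \<theta>) \<xi> \<noteq> {}}"
    by (rule closure_minimal[OF _ closed_closure]) (use finite_in_closure_domain in blast)
  finally show ?thesis .
qed

lemma indicator_K_convex_functional: "convex_functional indicator_K 0"
proof
  show "ereal 0 \<le> indicator_K x" for x by (simp add: indicator_K_def)
  show "\<exists>x. indicator_K x \<noteq> \<infinity>" using K_disp_0 by (auto simp: indicator_K_def)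
  show "indicator_K ((1 - s) *\<^sub>R x + s *\<^sub>R y) \<le> ereal ((1 - s) * real_of_ereal (indicator_K x) + s * real_of_ereal (indicator_K y))"
    if "0 < s" "s < 1" "indicator_K x \<noteq> \<infinity>" "indicator_K y \<noteq> \<infinity>" for s x y
    using that K_disp_convex[of x y s] by (auto simp: indicator_K_def split: if_splits)
  show "indicator_K x \<le> ereal c" if "X \<longlonglongrightarrow> x" "\<And>n. indicator_K (X n) \<le> ereal c" for X x c
  proof -
    have "X n \<in> K_disp" "0 \<le> c" for n using that(2)[of n] by (auto simp: indicator_K_def split: if_splits)
    then show ?thesis using K_disp_closed[OF _ that(1)] by (simp add: indicator_K_def)
  qed
qed

lemma zero_in_subdifferential_indicator_K: "\<xi> \<in> K_disp \<Longrightarrow> 0 \<in> subdifferential indicator_K \<xi>"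
  by (auto simp: subdifferential_def indicator_K_def)

lemma K_disp_in_closure_indicator_K: "K_disp \<subseteq> closure {\<xi>. subdifferential indicator_K \<xi> \<noteq> {}}"
proof
  fix \<xi> assume "\<xi> \<in> K_disp"
  then have "\<xi> \<in> {\<xi>. subdifferential indicator_K \<xi> \<noteq> {}}" using zero_in_subdifferential_indicator_K by blast
  then show "\<xi> \<in> closure {\<xi>. subdifferential indicator_K \<xi> \<noteq> {}}" by (rule subsetD[OF closure_subset])
qed

lemma viscous_op_scaled: "viscous_op e \<theta> = (\<lambda>x. (\<lambda>p. e *\<^sub>R p) ` subdifferential (Theta \<theta>) x)"
  by (rule ext) (simp add: viscous_op_def)

text \<open>P is the projection of x onto the cone. Comparing the resolvent J with a point y of
  finite \<Theta> near P costs 2 \<mu> e c, while J belongs to the cone and sees x and P under an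
  obtuse angle; together |J - P|^2 \<le> |x - y|^2 - |x - P|^2 + 2 \<mu> e c.\<close>

lemma (in potential) resolvent_tendsto_projection:
  assumes \<mu>: "\<mu> > 0"
  shows "((\<lambda>e. resolvent (viscous_op e \<theta>) \<mu> x) \<longlongrightarrow> resolvent (subdifferential indicator_K) \<mu> x) (at_right 0)"
proof -
  interpret T: convex_functional "Theta \<theta>" "\<theta> 1" by (rule Theta_convex_functional)
  interpret K: convex_functional indicator_K 0 by (rule indicator_K_convex_functional)
  define P where "P = resolvent (subdifferential indicator_K) \<mu> x"
  have PK: "P \<in> K_disp" using K.resolvent_finite[of 1 \<mu> x] \<mu> by (auto simp: P_def indicator_K_def split: if_splits)
  show ?thesis
    unfolding P_def[symmetric]
  proof (rule tendstoI)
    fix d :: real assume d: "d > 0"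
    have "isCont (\<lambda>y. (norm (x - y))\<^sup>2) P" by (intro continuous_intros)
    then obtain r where r: "r > 0" "\<And>y. dist y P < r \<Longrightarrow> dist ((norm (x - y))\<^sup>2) ((norm (x - P))\<^sup>2) < d\<^sup>2 / 2"
      unfolding continuous_at_eps_delta using d by (metis half_gt_zero zero_less_power)
    obtain y where y: "Theta \<theta> y \<noteq> \<infinity>" "norm (y - P) < r" using Theta_finite_dense[OF PK r(1)] by blast
    define c where "c = T.val y - \<theta> 1"
    have c: "c \<ge> 0" using T.val_ge[OF y(1)] by (simp add: c_def)
    have xy: "(norm (x - y))\<^sup>2 < (norm (x - P))\<^sup>2 + d\<^sup>2 / 2"
      using r(2)[of y] y(2) unfolding dist_norm real_norm_def abs_less_iff by linarith
    define k where "k = 4 * \<mu> * (c + 1)"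
    have k: "k > 0" using \<mu> c by (simp add: k_def)
    define e0 where "e0 = d\<^sup>2 / k"
    have e0: "e0 > 0" using d k by (simp add: e0_def)
    have "dist (resolvent (viscous_op e \<theta>) \<mu> x) P < d" if e: "0 < e" "e < e0" for e
    proof -
      define J where "J = resolvent (viscous_op e \<theta>) \<mu> x"
      have JT: "Theta \<theta> J \<noteq> \<infinity>" unfolding J_def viscous_op_scaled by (rule T.resolvent_finite[OF e(1) \<mu>])
      then have JK: "indicator_K J = 0" using Theta_K_disp by (simp add: indicator_K_def)
      \<comment> \<open>The indicator vanishes at J, so the three-point estimate has no error term
        here.\<close>
      have "(norm (x - P))\<^sup>2 + (norm (J - P))\<^sup>2 \<le> (norm (x - J))\<^sup>2"
        using K.resolvent_estimate[of 1 \<mu> J x] \<mu> JK by (simp add: P_def)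
      moreover have "(norm (x - J))\<^sup>2 + (norm (y - J))\<^sup>2 \<le> (norm (x - y))\<^sup>2 + 2 * \<mu> * e * c"
        unfolding J_def viscous_op_scaled c_def by (rule T.resolvent_estimate[OF e(1) \<mu> y(1)])
      moreover have "2 * \<mu> * e * c \<le> d\<^sup>2 / 2"
      proof -
        have "2 * \<mu> * e * c \<le> 2 * \<mu> * e0 * (c + 1)" using e \<mu> c by (intro mult_mono) auto
        also have "\<dots> = k * e0 / 2" by (simp add: k_def algebra_simps)
        also have "\<dots> = d\<^sup>2 / 2" unfolding e0_def using k by simp
        finally show ?thesis .
      qed
      ultimately have "(norm (J - P))\<^sup>2 < d\<^sup>2" using xy zero_le_power2[of "norm (y - J)"] by linarith
      then have "norm (J - P) < d" using d by (simp add: power_less_imp_less_base)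
      then show ?thesis by (simp add: J_def dist_norm)
    qed
    then show "\<forall>\<^sub>F e in at_right 0. dist (resolvent (viscous_op e \<theta>) \<mu> x) P < d"
      unfolding eventually_at_right_field using e0 by blast
  qed
qed

lemma (in potential) viscous_evolution:
  assumes e: "e > 0" and lip: "\<And>u v. norm (drift lam F u - drift lam F v) \<le> L * norm (u - v)" and L: "L > 0"
  shows "evolution (on_fst (viscous_op e \<theta>)) (\<lambda>u. e * (real_of_ereal (Theta \<theta> (fst u)) - \<theta> 1)) (drift lam F) L"
  unfolding viscous_op_scaled by (rule convex_functional.scaled_evolution[OF Theta_convex_functional e lip L])

lemma obstacle_evolution:
  assumes lip: "\<And>u v. norm (drift lam F u - drift lam F v) \<le> L * norm (u - v)" and L: "L > 0"
  shows "evolution (on_fst (subdifferential indicator_K)) (\<lambda>u. 1 * (real_of_ereal (indicator_K (fst u)) - 0)) (drift lam F) L"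
  using convex_functional.scaled_evolution[OF indicator_K_convex_functional zero_less_one lip L]
  by (simp only: scaleR_one image_ident)

lemma (in potential) viscous_domain:
  assumes "e > 0"
  shows "K_disp \<subseteq> closure {\<xi>. viscous_op e \<theta> \<xi> \<noteq> {}}"
  unfolding viscous_op_def image_is_empty by (rule K_disp_in_closure_Theta)

text \<open>The dense set of good initial points is the domain of the subdifferential of \<Theta>,
  with Z free: if p is a subgradient, e p has norm at most |p| for e \<le> 1, and 0 is admissible
  for the cone, so one bound serves all operators.\<close>

lemma (in potential) vanishing_viscosity:
  assumes lip: "\<And>u v. norm (drift lam F u - drift lam F v) \<le> L * norm (u - v)" and L: "L > 0"
    and w: "w \<in> K_disp \<times> UNIV" and T: "T \<ge> 0"
  shows "uniform_limit {0..T} (\<lambda>e t. evol (on_fst (viscous_op e \<theta>)) (drift lam F) t w)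
    (\<lambda>t. evol (on_fst (subdifferential indicator_K)) (drift lam F) t w) (at_right 0)"
proof (rule evol_converges[OF viscous_evolution[OF _ lip L] obstacle_evolution[OF lip L] _ _ T])
  interpret T: convex_functional "Theta \<theta>" "\<theta> 1" by (rule Theta_convex_functional)
  interpret K: convex_functional indicator_K 0 by (rule indicator_K_convex_functional)
  let ?W = "{\<xi>. subdifferential (Theta \<theta>) \<xi> \<noteq> {}} \<times> (UNIV :: L2T set)"
  show "w \<in> closure ?W"
    using w K_disp_in_closure_Theta by (auto simp: closure_Times)
  show "((\<lambda>e. resolvent (on_fst (viscous_op e \<theta>)) \<mu> x) \<longlongrightarrow> resolvent (on_fst (subdifferential indicator_K)) \<mu> x) (at_right 0)"
    if \<mu>: "\<mu> > 0" for \<mu> and x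
  proof -
    have "maximal_monotone (subdifferential indicator_K)" using K.scaled_maximal_monotone[of 1] by simp
    note K' = resolvent_product[OF this \<mu>, of x]
    have "resolvent (on_fst (viscous_op e \<theta>)) \<mu> x = (resolvent (viscous_op e \<theta>) \<mu> (fst x), snd x)" if "e > 0" for e
      unfolding viscous_op_scaled by (rule resolvent_product[OF T.scaled_maximal_monotone[OF that] \<mu>])
    then have ev: "\<forall>\<^sub>F e in at_right 0. (resolvent (viscous_op e \<theta>) \<mu> (fst x), snd x) = resolvent (on_fst (viscous_op e \<theta>)) \<mu> x"
      using eventually_at_right_less[of "0::real"] by (auto elim: eventually_mono)
    show ?thesis unfolding K'
      by (rule Lim_transform_eventually[OF _ ev]) (intro tendsto_Pair resolvent_tendsto_projection \<mu> tendsto_const)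
  qed
  show "\<exists>c. (\<exists>y\<in>on_fst (subdifferential indicator_K) w. norm y \<le> c) \<and>
      (\<forall>e. 0 < e \<longrightarrow> e \<le> 1 \<longrightarrow> (\<exists>y\<in>on_fst (viscous_op e \<theta>) w. norm y \<le> c))" if w: "w \<in> ?W" for w
  proof -
    obtain p where p: "p \<in> subdifferential (Theta \<theta>) (fst w)" using w by auto
    then have "fst w \<in> K_disp" by (intro Theta_K_disp) (simp add: subdifferential_def)
    then have "(0, 0) \<in> on_fst (subdifferential indicator_K) w" by (simp add: zero_in_subdifferential_indicator_K)
    moreover have "norm ((0, 0) :: L2T \<times> L2T) \<le> norm p" by (simp add: norm_Pair)
    moreover have "\<exists>y\<in>on_fst (viscous_op e \<theta>) w. norm y \<le> norm p" if "0 < e" "e \<le> 1" for e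
    proof
      show "(e *\<^sub>R p, 0) \<in> on_fst (viscous_op e \<theta>) w" using p unfolding viscous_op_def mem_Times_iff fst_conv snd_conv by blast
      show "norm (e *\<^sub>R p, 0 :: L2T) \<le> norm p" using that by (simp add: norm_Pair mult_left_le_one_le)
    qed
    ultimately show ?thesis by blast
  qed
qed

lemma DERIV_quotient_sequence:
  assumes "(f has_real_derivative d) (at x)"
  shows "(\<lambda>n. real (Suc n) * (f (x + inverse (real (Suc n))) - f x)) \<longlonglongrightarrow> d"
proof -
  have "((\<lambda>h. (f (x + h) - f x) / h) \<longlongrightarrow> d) (at 0)" using assms by (simp add: DERIV_def)
  moreover have "filterlim (\<lambda>n. inverse (real (Suc n))) (at 0) sequentially"
    unfolding filterlim_at using LIMSEQ_inverse_real_of_nat by simp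
  ultimately have "((\<lambda>n. (f (x + inverse (real (Suc n))) - f x) / inverse (real (Suc n))) \<longlongrightarrow> d) sequentially"
    by (rule filterlim_compose)
  then show ?thesis by (simp add: field_simps)
qed

text \<open>Dominated convergence applied to the difference quotients; the fundamental theorem of the
  library only admits finitely many exceptional points.\<close>

lemma lipschitz_FTC:
  fixes G g :: "real \<Rightarrow> real"
  assumes st: "s \<le> t" and lip: "\<And>a b. s \<le> a \<Longrightarrow> a \<le> b \<Longrightarrow> b \<le> t + 1 \<Longrightarrow> \<bar>G b - G a\<bar> \<le> M * (b - a)"
    and N: "countable N" and der: "\<And>r. r \<in> {s..t} - N \<Longrightarrow> (G has_real_derivative g r) (at r)"
  defines "g0 \<equiv> \<lambda>r. if r \<in> N then 0 else g r"
  shows "set_integrable lborel {s..t} g0" "(LINT r:{s..t}|lborel. g0 r) = G t - G s"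
proof -
  \<comment> \<open>G is frozen outside [s, t + 1] to obtain a continuous function on the line with
    an antiderivative; the extra unit leaves room for forward quotients of step at most 1.\<close>
  define H where "H r = G (max s (min (t + 1) r))" for r
  define h where "h n = inverse (real (Suc n))" for n
  have h: "0 < h n" "h n \<le> 1" for n by (simp_all add: h_def inverse_le_1_iff)
  have M: "M \<ge> 0" using lip[of s "s + 1"] st by simp
  have "continuous_on {s..t+1} G"
  proof (rule lipschitz_on_continuous_on[of M], rule lipschitz_onI)
    fix x y assume "x \<in> {s..t + 1}" "y \<in> {s..t + 1}"
    then show "dist (G x) (G y) \<le> M * dist x y"
      using lip[of x y] lip[of y x] by (cases "x \<le> y") (auto simp: dist_real_def abs_minus_commute)
  qed (fact M)
  then have contH: "continuous_on UNIV H"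
    unfolding H_def by (rule continuous_on_compose2) (use st in \<open>auto intro!: continuous_intros\<close>)
  then obtain \<Gamma> where \<Gamma>: "\<And>x. (\<Gamma> has_real_derivative H x) (at x)" using antiderivative_exists by blast
  have HG: "H r = G r" if "r \<in> {s..t + 1}" for r using that by (simp add: H_def)
  define f where "f n r = real (Suc n) * (H (r + h n) - H r)" for n r
  have contf: "continuous_on UNIV (f n)" for n
    unfolding f_def by (intro continuous_intros continuous_on_compose2[OF contH]) auto
  have bound: "\<bar>f n r\<bar> \<le> M" if r: "r \<in> {s..t}" for n r
  proof -
    have "\<bar>H (r + h n) - H r\<bar> \<le> M * h n"
      using lip[of r "r + h n"] h[of n] r by (simp add: HG)
    then have "real (Suc n) * \<bar>H (r + h n) - H r\<bar> \<le> real (Suc n) * (M * h n)" by (intro mult_left_mono) auto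
    also have "\<dots> = M" by (simp add: h_def)
    finally show ?thesis by (simp add: f_def abs_mult)
  qed
  have lim: "(\<lambda>n. f n r) \<longlonglongrightarrow> g r" if r: "r \<in> {s..t} - N" for r
  proof -
    have "f n r = real (Suc n) * (G (r + inverse (real (Suc n))) - G r)" for n
    proof -
      have "s \<le> r + h n" "r + h n \<le> t + 1" "s \<le> r" "r \<le> t + 1" using h[of n] r by auto
      then show ?thesis by (simp only: f_def HG atLeastAtMost_iff) (simp only: h_def)
    qed
    then show ?thesis using DERIV_quotient_sequence[OF der[OF r]] by simp
  qed
  have sN: "N \<in> sets borel" by (rule sets.countable[OF _ N]) simp
  have N0: "AE r in lborel. r \<notin> N"
    by (rule AE_not_in[OF countable_imp_null_set_lborel[OF N]])
  \<comment> \<open>Cutting out N makes the quotients converge at every point, with limit 0 on N in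
    agreement with \<open>g0\<close>.\<close>
  define k where "k n r = indicat_real ({s..t} - N) r *\<^sub>R f n r" for n r
  have mf: "f n \<in> borel_measurable borel" for n by (rule borel_measurable_continuous_onI[OF contf])
  have mk: "k n \<in> borel_measurable lborel" for n
    unfolding k_def using mf[of n] sN by simp
  have limk: "(\<lambda>n. k n r) \<longlonglongrightarrow> indicat_real {s..t} r *\<^sub>R g0 r" for r
    using lim[of r] by (cases "r \<in> {s..t} - N") (auto simp: k_def g0_def indicator_def)
  have mg: "(\<lambda>r. indicat_real {s..t} r *\<^sub>R g0 r) \<in> borel_measurable lborel"
    by (rule borel_measurable_LIMSEQ_real[OF limk mk])
  have w: "integrable lborel (\<lambda>r. indicat_real {s..t} r *\<^sub>R M)"
    using borel_integrable_atLeastAtMost'[of s t "\<lambda>_. M"] by (simp add: set_integrable_def)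
  have kb: "AE r in lborel. norm (k n r) \<le> indicat_real {s..t} r *\<^sub>R M" for n
    using bound M by (intro AE_I2) (auto simp: k_def indicator_def)
  note dc = mg mk w AE_I2[OF limk] kb
  show "set_integrable lborel {s..t} g0"
    unfolding set_integrable_def by (rule integrable_dominated_convergence[OF dc])
  have "(\<lambda>n. integral\<^sup>L lborel (k n)) \<longlonglongrightarrow> (LINT r:{s..t}|lborel. g0 r)"
    unfolding set_lebesgue_integral_def by (rule integral_dominated_convergence[OF dc])
  moreover have "integral\<^sup>L lborel (k n) = real (Suc n) * (\<Gamma> (t + h n) - \<Gamma> t) - real (Suc n) * (\<Gamma> (s + h n) - \<Gamma> s)" for n
  proof -
    have "integral\<^sup>L lborel (k n) = (\<integral>r. f n r * indicator {s..t} r \<partial>lborel)"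
    proof (rule integral_cong_AE)
      show "AE r in lborel. k n r = f n r * indicator {s..t} r"
        using N0 by eventually_elim (auto simp: k_def indicator_def)
    qed (use mk mf in simp_all)
    also have "\<dots> = real (Suc n) * (\<Gamma> (t + h n) - \<Gamma> t) - real (Suc n) * (\<Gamma> (s + h n) - \<Gamma> s)"
    proof (rule integral_FTC_Icc_real[OF st])
      show "((\<lambda>r. real (Suc n) * (\<Gamma> (r + h n) - \<Gamma> r)) has_real_derivative f n r) (at r)" for r
        unfolding f_def using \<Gamma>[of r] \<Gamma>[of "r + h n"] by (intro DERIV_cmult DERIV_diff) (simp_all add: DERIV_shift)
      show "isCont (f n) r" for r using contf[of n] by (simp add: continuous_on_eq_continuous_at)
    qed
    finally show ?thesis .
  qed
  moreover have "(\<lambda>n. real (Suc n) * (\<Gamma> (t + h n) - \<Gamma> t) - real (Suc n) * (\<Gamma> (s + h n) - \<Gamma> s)) \<longlonglongrightarrow> H t - H s"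
    unfolding h_def by (intro tendsto_diff DERIV_quotient_sequence \<Gamma>)
  ultimately have "(LINT r:{s..t}|lborel. g0 r) = H t - H s" using LIMSEQ_unique by simp
  then show "(LINT r:{s..t}|lborel. g0 r) = G t - G s" using st by (simp add: HG)
qed

section \<open>The weak form of the material equation for arbitrary initial data\<close>

section \<open>The generalized material equation\<close>

lemma continuous_on_of_lip:
  fixes f :: "real \<Rightarrow> 'a::real_normed_vector"
  assumes lip: "\<And>a b. s \<le> a \<Longrightarrow> a \<le> b \<Longrightarrow> b \<le> t \<Longrightarrow> norm (f b - f a) \<le> M * (b - a)"
  shows "continuous_on {s..t} f"
proof (rule lipschitz_on_continuous_on[of "\<bar>M\<bar>"], rule lipschitz_onI)
  have le: "norm (f b - f a) \<le> \<bar>M\<bar> * (b - a)" if "s \<le> a" "a \<le> b" "b \<le> t" for a b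
  proof -
    have "M * (b - a) \<le> \<bar>M\<bar> * (b - a)" by (rule mult_right_mono) (use that in auto)
    then show ?thesis using lip[OF that] by linarith
  qed
  fix x y assume "x \<in> {s..t}" "y \<in> {s..t}"
  then show "dist (f x) (f y) \<le> \<bar>M\<bar> * dist x y"
    using le[of x y] le[of y x] by (cases "x \<le> y") (simp_all add: dist_norm norm_minus_commute)
qed simp

lemma continuous_bounded_Icc:
  fixes f :: "real \<Rightarrow> real"
  assumes "continuous_on {s..t} f"
  obtains C where "\<And>r. r \<in> {s..t} \<Longrightarrow> \<bar>f r\<bar> \<le> C"
proof -
  have "bounded (f ` {s..t})" by (rule compact_imp_bounded[OF compact_continuous_image[OF assms compact_Icc]])
  then obtain C where "\<forall>y\<in>f ` {s..t}. norm y \<le> C" unfolding bounded_iff by blast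
  then show ?thesis by (intro that[of C]) simp
qed

lemma C1_lipschitz:
  fixes f f' :: "real \<Rightarrow> real"
  assumes "\<And>r. (f has_real_derivative f' r) (at r)" "continuous_on UNIV f'"
  shows "\<exists>M. (\<forall>r\<in>{s..t}. \<bar>f r\<bar> \<le> M) \<and> (\<forall>a b. s \<le> a \<longrightarrow> a \<le> b \<longrightarrow> b \<le> t \<longrightarrow> \<bar>f b - f a\<bar> \<le> M * (b - a))"
proof -
  have "continuous_on {s..t} f"
    by (rule DERIV_continuous_on[where D = f']) (rule has_field_derivative_at_within[OF assms(1)])
  then obtain C where C: "\<And>r. r \<in> {s..t} \<Longrightarrow> \<bar>f r\<bar> \<le> C" by (rule continuous_bounded_Icc) blast
  have "continuous_on {s..t} f'" by (rule continuous_on_subset[OF assms(2) subset_UNIV])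
  then obtain D where D: "\<And>r. r \<in> {s..t} \<Longrightarrow> \<bar>f' r\<bar> \<le> D" by (rule continuous_bounded_Icc) blast
  have "\<bar>f b - f a\<bar> \<le> max C D * (b - a)" if "s \<le> a" "a \<le> b" "b \<le> t" for a b
  proof -
    have "norm (f b - f a) \<le> D * norm (b - a)"
    proof (rule field_differentiable_bound[of "{a..b}" f f'])
      show "(f has_real_derivative f' r) (at r within {a..b})" for r by (rule has_field_derivative_at_within[OF assms(1)])
      show "norm (f' r) \<le> D" if "r \<in> {a..b}" for r using D[of r] that \<open>s \<le> a\<close> \<open>b \<le> t\<close> by simp
    qed (use that in simp_all)
    also have "\<dots> = D * (b - a)" using that by simp
    also have "\<dots> \<le> max C D * (b - a)" by (rule mult_right_mono) (use that in simp_all)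
    finally show ?thesis by simp
  qed
  moreover have "\<bar>f r\<bar> \<le> max C D" if "r \<in> {s..t}" for r using C[OF that] by simp
  ultimately show ?thesis by blast
qed

lemma lipschitz_times:
  fixes f g :: "real \<Rightarrow> real"
  assumes "\<bar>f b - f a\<bar> \<le> M * (b - a)" "\<bar>g b - g a\<bar> \<le> K * (b - a)" "\<bar>f b\<bar> \<le> P" "\<bar>g a\<bar> \<le> R" "a \<le> b"
  shows "\<bar>f b * g b - f a * g a\<bar> \<le> (P * K + R * M) * (b - a)"
proof -
  have "f b * g b - f a * g a = f b * (g b - g a) + g a * (f b - f a)" by (simp add: algebra_simps)
  then have "\<bar>f b * g b - f a * g a\<bar> \<le> \<bar>f b\<bar> * \<bar>g b - g a\<bar> + \<bar>g a\<bar> * \<bar>f b - f a\<bar>"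
    using abs_triangle_ineq[of "f b * (g b - g a)" "g a * (f b - f a)"] by (simp add: abs_mult)
  also have "\<dots> \<le> P * (K * (b - a)) + R * (M * (b - a))"
    using assms by (intro add_mono mult_mono) auto
  finally show ?thesis by (simp add: algebra_simps)
qed

lemma set_integrable_continuous_mult:
  fixes f Q :: "real \<Rightarrow> real"
  assumes f: "continuous_on {s..t} f" and Q: "set_integrable lborel {s..t} Q"
  shows "set_integrable lborel {s..t} (\<lambda>r. f r * Q r)"
proof -
  obtain C where C: "\<And>r. r \<in> {s..t} \<Longrightarrow> \<bar>f r\<bar> \<le> C" using f by (rule continuous_bounded_Icc) blast
  have eq: "indicat_real {s..t} r *\<^sub>R (f r * Q r) = (indicat_real {s..t} r *\<^sub>R f r) * (indicat_real {s..t} r *\<^sub>R Q r)" for r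
    by (simp add: indicator_def)
  have m: "(\<lambda>r. indicat_real {s..t} r *\<^sub>R (f r * Q r)) \<in> borel_measurable lborel"
    unfolding eq using borel_measurable_continuous_on_indicator[OF _ f] borel_measurable_integrable[OF Q[unfolded set_integrable_def]]
    by (intro borel_measurable_times) auto
  show ?thesis
    unfolding set_integrable_def
  proof (rule Bochner_Integration.integrable_bound[OF _ m])
    show "integrable lborel (\<lambda>r. C * (indicat_real {s..t} r *\<^sub>R Q r))"
      using Q unfolding set_integrable_def by (rule integrable_mult_right)
    show "AE r in lborel. norm (indicat_real {s..t} r *\<^sub>R (f r * Q r)) \<le> norm (C * (indicat_real {s..t} r *\<^sub>R Q r))"
    proof (rule AE_I2)
      fix r
      show "norm (indicat_real {s..t} r *\<^sub>R (f r * Q r)) \<le> norm (C * (indicat_real {s..t} r *\<^sub>R Q r))"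
      proof (cases "r \<in> {s..t}")
        case True
        then have "\<bar>f r\<bar> \<le> \<bar>C\<bar>" using C[OF True] by linarith
        then show ?thesis using True by (simp add: abs_mult mult_right_mono)
      qed simp
    qed
  qed
qed

lemma zero_at_ends:
  fixes f :: "real \<Rightarrow> real"
  assumes "continuous_on UNIV f" "\<And>r. r \<notin> {s..t} \<Longrightarrow> f r = 0"
  shows "f s = 0" "f t = 0"
proof -
  have cl: "closed {r. f r = 0}" by (intro closed_Collect_eq assms(1) continuous_on_const)
  have "{..<s} \<subseteq> {r. f r = 0}" "{t<..} \<subseteq> {r. f r = 0}" using assms(2) by (simp_all add: subset_eq)
  then have "closure {..<s} \<subseteq> {r. f r = 0}" "closure {t<..} \<subseteq> {r. f r = 0}"
    using closure_minimal[OF _ cl] by blast+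
  then show "f s = 0" "f t = 0" by auto
qed

text \<open>With y = z + lam x the system reads x' = y - eps Q and y' = g - lam eps Q, so \<phi>' x
  - \<phi> y has derivative \<phi>'' x minus the right-hand integrand. This function is Lipschitz
  and vanishes at both ends, and \<open>lipschitz_FTC\<close> integrates it.\<close>

lemma weak_form:
  fixes x z g Q \<phi> :: "real \<Rightarrow> real"
  assumes st: "s < t" and eps: "eps > 0"
    and lipx: "\<And>a b. s \<le> a \<Longrightarrow> a \<le> b \<Longrightarrow> b \<le> t + 1 \<Longrightarrow> \<bar>x b - x a\<bar> \<le> M * (b - a)"
    and lipz: "\<And>a b. s \<le> a \<Longrightarrow> a \<le> b \<Longrightarrow> b \<le> t + 1 \<Longrightarrow> \<bar>z b - z a\<bar> \<le> M * (b - a)"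
    and g: "continuous_on {s..t} g" and N: "countable N"
    and x': "\<And>r. r \<in> {s..t} - N \<Longrightarrow> (x has_real_derivative z r + lam * x r - eps * Q r) (at r)"
    and z': "\<And>r. r \<in> {s..t} - N \<Longrightarrow> (z has_real_derivative g r - lam * z r - lam\<^sup>2 * x r) (at r)"
    and Q0: "\<And>r. r \<in> N \<Longrightarrow> eps * Q r = z r + lam * x r"
  shows "set_integrable lborel {s..t} Q"
    and "smooth_on UNIV \<phi> \<Longrightarrow> (\<And>r. r \<notin> {s..t} \<Longrightarrow> \<phi> r = 0) \<Longrightarrow>
      (LINT r:{s..t}|lborel. deriv (deriv \<phi>) r * x r)
        = (LINT r:{s..t}|lborel. - lam * eps * \<phi> r * Q r + eps * deriv \<phi> r * Q r + \<phi> r * g r)"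
proof -
  define y where "y r = z r + lam * x r" for r
  have lipy: "\<bar>y b - y a\<bar> \<le> (M + \<bar>lam\<bar> * M) * (b - a)" if "s \<le> a" "a \<le> b" "b \<le> t + 1" for a b
  proof -
    have "\<bar>y b - y a\<bar> \<le> \<bar>z b - z a\<bar> + \<bar>lam\<bar> * \<bar>x b - x a\<bar>"
    proof -
      have "y b - y a = (z b - z a) + lam * (x b - x a)" by (simp add: y_def algebra_simps)
      then show ?thesis using abs_triangle_ineq[of "z b - z a" "lam * (x b - x a)"] by (simp add: abs_mult)
    qed
    also have "\<dots> \<le> M * (b - a) + \<bar>lam\<bar> * (M * (b - a))"
      by (intro add_mono mult_left_mono lipx lipz that) simp
    finally show ?thesis by (simp add: algebra_simps)
  qed
  have cont: "continuous_on {s..t} x" "continuous_on {s..t} y"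
    by (rule continuous_on_of_lip[of _ _ _ M], simp add: lipx, rule continuous_on_of_lip[of _ _ _ "M + \<bar>lam\<bar> * M"], simp add: lipy)
  have x'': "(x has_real_derivative y r - eps * Q r) (at r)" if "r \<in> {s..t} - N" for r
    using x'[OF that] by (simp add: y_def)
  have "set_integrable lborel {s..t} (\<lambda>r. if r \<in> N then 0 else y r - eps * Q r)"
    by (rule lipschitz_FTC(1)[OF less_imp_le[OF st] lipx N x''])
  \<comment> \<open>On N the hypothesis on Q makes y - eps Q vanish, exactly the default value
    inserted there; Q is thus integrable as it stands, without modification on N.\<close>
  also have "(\<lambda>r. if r \<in> N then 0 else y r - eps * Q r) = (\<lambda>r. y r - eps * Q r)"
    using Q0 by (auto simp: y_def)
  finally have "set_integrable lborel {s..t} (\<lambda>r. y r - (y r - eps * Q r))"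
    by (rule set_integral_diff(1)[OF borel_integrable_atLeastAtMost'[OF cont(2)]])
  then have "set_integrable lborel {s..t} (\<lambda>r. inverse eps * (y r - (y r - eps * Q r)))"
    by (rule set_integrable_mult_right)
  then show Qi: "set_integrable lborel {s..t} Q" using eps by simp
  assume \<phi>: "smooth_on UNIV \<phi>" and sup: "\<And>r. r \<notin> {s..t} \<Longrightarrow> \<phi> r = 0"
  note d0 = smooth_on_deriv[OF open_UNIV \<phi>]
  note d1 = smooth_on_deriv[OF open_UNIV d0(2)]
  note d2 = smooth_on_deriv[OF open_UNIV d1(2)]
  have sup1: "deriv \<phi> r = 0" if r: "r \<notin> {s..t}" for r
  proof -
    have "((\<lambda>_. 0) has_real_derivative 0) (at r)" by simp
    then have "(\<phi> has_real_derivative 0) (at r)"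
      by (rule has_field_derivative_transform_within_open[of _ _ _ "- {s..t}"]) (use r sup in auto)
    then show ?thesis by (rule DERIV_imp_deriv)
  qed
  have e0: "\<phi> s = 0" "\<phi> t = 0" using zero_at_ends[OF d0(3) sup] by simp_all
  have e1: "deriv \<phi> s = 0" "deriv \<phi> t = 0" using zero_at_ends[OF d1(3) sup1] by simp_all
  define G where "G r = deriv \<phi> r * x r - \<phi> r * y r" for r
  define R where "R r = - lam * eps * \<phi> r * Q r + eps * deriv \<phi> r * Q r + \<phi> r * g r" for r
  obtain P0 where P0: "\<And>r. r \<in> {s..t + 1} \<Longrightarrow> \<bar>\<phi> r\<bar> \<le> P0" "\<And>a b. s \<le> a \<Longrightarrow> a \<le> b \<Longrightarrow> b \<le> t + 1 \<Longrightarrow> \<bar>\<phi> b - \<phi> a\<bar> \<le> P0 * (b - a)"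
    using C1_lipschitz[OF d0(1)[OF UNIV_I] d1(3), of s "t + 1"] by blast
  obtain P1 where P1: "\<And>r. r \<in> {s..t + 1} \<Longrightarrow> \<bar>deriv \<phi> r\<bar> \<le> P1" "\<And>a b. s \<le> a \<Longrightarrow> a \<le> b \<Longrightarrow> b \<le> t + 1 \<Longrightarrow> \<bar>deriv \<phi> b - deriv \<phi> a\<bar> \<le> P1 * (b - a)"
    using C1_lipschitz[OF d1(1)[OF UNIV_I] d2(3), of s "t + 1"] by blast
  have "continuous_on {s..t + 1} x" by (rule continuous_on_of_lip[of _ _ _ M]) (simp add: lipx)
  then obtain X where X: "\<And>r. r \<in> {s..t + 1} \<Longrightarrow> \<bar>x r\<bar> \<le> X" by (rule continuous_bounded_Icc) blast
  have "continuous_on {s..t + 1} y" by (rule continuous_on_of_lip[of _ _ _ "M + \<bar>lam\<bar> * M"]) (simp add: lipy)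
  then obtain Y where Y: "\<And>r. r \<in> {s..t + 1} \<Longrightarrow> \<bar>y r\<bar> \<le> Y" by (rule continuous_bounded_Icc) blast
  define K where "K = (P1 * M + X * P1) + (P0 * (M + \<bar>lam\<bar> * M) + Y * P0)"
  have lipG: "\<bar>G b - G a\<bar> \<le> K * (b - a)" if ab: "s \<le> a" "a \<le> b" "b \<le> t + 1" for a b
  proof -
    have "\<bar>deriv \<phi> b * x b - deriv \<phi> a * x a\<bar> \<le> (P1 * M + X * P1) * (b - a)"
      by (rule lipschitz_times) (use P1 X lipx ab in auto)
    moreover have "\<bar>\<phi> b * y b - \<phi> a * y a\<bar> \<le> (P0 * (M + \<bar>lam\<bar> * M) + Y * P0) * (b - a)"
      by (rule lipschitz_times) (use P0 Y lipy ab in auto)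
    moreover have "G b - G a = (deriv \<phi> b * x b - deriv \<phi> a * x a) - (\<phi> b * y b - \<phi> a * y a)" by (simp add: G_def)
    ultimately show ?thesis unfolding K_def distrib_right by linarith
  qed
  have G': "(G has_real_derivative deriv (deriv \<phi>) r * x r - R r) (at r)" if r: "r \<in> {s..t} - N" for r
  proof -
    have y': "(y has_real_derivative g r - lam * z r - lam\<^sup>2 * x r + lam * (z r + lam * x r - eps * Q r)) (at r)"
      unfolding y_def by (intro DERIV_add DERIV_cmult x'[OF r] z'[OF r])
    show ?thesis
      unfolding G_def
      by (rule DERIV_cong[OF DERIV_diff[OF DERIV_mult[OF d1(1)[OF UNIV_I] x''[OF r]] DERIV_mult[OF d0(1)[OF UNIV_I] y']]])
        (simp add: R_def y_def algebra_simps power2_eq_square)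
  qed
  note F = lipschitz_FTC[OF less_imp_le[OF st] lipG N G']
  have cd: "continuous_on {s..t} \<phi>" "continuous_on {s..t} (deriv \<phi>)" "continuous_on {s..t} (deriv (deriv \<phi>))"
    by (rule continuous_on_subset[OF d0(3)], simp, rule continuous_on_subset[OF d1(3)], simp, rule continuous_on_subset[OF d2(3)], simp)
  have Ri: "set_integrable lborel {s..t} R"
    unfolding R_def
    by (intro set_integral_add(1) set_integrable_continuous_mult Qi borel_integrable_atLeastAtMost' continuous_intros cd g)
  have xi: "set_integrable lborel {s..t} (\<lambda>r. deriv (deriv \<phi>) r * x r)"
    by (intro borel_integrable_atLeastAtMost' continuous_intros cd cont)
  have N0: "AE r in lborel. r \<notin> N" by (rule AE_not_in[OF countable_imp_null_set_lborel[OF N]])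
  have "(LINT r:{s..t}|lborel. deriv (deriv \<phi>) r * x r) - (LINT r:{s..t}|lborel. R r)
      = (LINT r:{s..t}|lborel. deriv (deriv \<phi>) r * x r - R r)"
    by (rule set_integral_diff(2)[OF xi Ri, symmetric])
  also have "\<dots> = (LINT r:{s..t}|lborel. if r \<in> N then 0 else deriv (deriv \<phi>) r * x r - R r)"
    unfolding set_lebesgue_integral_def
  proof (rule integral_cong_AE)
    show "(\<lambda>r. indicat_real {s..t} r *\<^sub>R (deriv (deriv \<phi>) r * x r - R r)) \<in> borel_measurable lborel"
      using set_integral_diff(1)[OF xi Ri] unfolding set_integrable_def by (rule borel_measurable_integrable)
    show "(\<lambda>r. indicat_real {s..t} r *\<^sub>R (if r \<in> N then 0 else deriv (deriv \<phi>) r * x r - R r)) \<in> borel_measurable lborel"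
      using F(1) unfolding set_integrable_def by (rule borel_measurable_integrable)
    show "AE r in lborel. indicat_real {s..t} r *\<^sub>R (deriv (deriv \<phi>) r * x r - R r)
        = indicat_real {s..t} r *\<^sub>R (if r \<in> N then 0 else deriv (deriv \<phi>) r * x r - R r)"
      using N0 by eventually_elim simp
  qed
  also have "\<dots> = G t - G s" by (rule F(2))
  also have "\<dots> = 0" by (simp add: G_def e0 e1)
  finally show "(LINT r:{s..t}|lborel. deriv (deriv \<phi>) r * x r)
        = (LINT r:{s..t}|lborel. - lam * eps * \<phi> r * Q r + eps * deriv \<phi> r * Q r + \<phi> r * g r)"
    by (simp add: R_def)
qed

text \<open>The selection q is read off from the first equation; testing with a fixed h reduces the
  identity in L2 to \<open>weak_form\<close> for real functions.\<close>

lemma evol_generalized_material_NS: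
  assumes E: "evolution (on_fst (viscous_op eps \<theta>)) \<psi> (drift lam F) L" and eps: "eps > 0"
    and lipF: "\<And>x y. \<bar>F x - F y\<bar> \<le> C * \<bar>x - y\<bar>"
    and w: "w \<in> closure {u. on_fst (viscous_op eps \<theta>) u \<noteq> {}}"
  shows "generalized_material_NS eps lam \<theta> F (\<lambda>t. fst (evol (on_fst (viscous_op eps \<theta>)) (drift lam F) t w))"
proof -
  interpret evolution "on_fst (viscous_op eps \<theta>)" \<psi> "drift lam F" L by (rule E)
  define u where "u t = evol (on_fst (viscous_op eps \<theta>)) (drift lam F) t w" for t
  obtain N where N: "countable N" and sol: "\<And>t. t > 0 \<Longrightarrow> t \<notin> N \<Longrightarrow>
      \<exists>d. (u has_vector_derivative d) (at t) \<and> drift lam F (u t) - d \<in> on_fst (viscous_op eps \<theta>) (u t)"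
    using evol_solution[OF w] unfolding u_def by blast
  \<comment> \<open>The value 0 on N is the one \<open>weak_form\<close> expects: there eps q
    becomes Z + lam \<xi>.\<close>
  define d where "d t = (if t \<in> N then 0 else vector_derivative u (at t))" for t
  have d: "(u has_vector_derivative d t) (at t)" "drift lam F (u t) - d t \<in> on_fst (viscous_op eps \<theta>) (u t)" if t: "t > 0" "t \<notin> N" for t
  proof -
    from sol[OF t] obtain d' where d': "(u has_vector_derivative d') (at t) \<and> drift lam F (u t) - d' \<in> on_fst (viscous_op eps \<theta>) (u t)" ..
    have "d t = d'" using t(2) vector_derivative_at[OF conjunct1[OF d']] by (simp add: d_def)
    then show "(u has_vector_derivative d t) (at t)" "drift lam F (u t) - d t \<in> on_fst (viscous_op eps \<theta>) (u t)" using d' by (simp_all only:)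
  qed
  define q where "q t = inverse eps *\<^sub>R fst (drift lam F (u t) - d t)" for t
  have epsq: "eps *\<^sub>R q t = snd (u t) + lam *\<^sub>R fst (u t) - fst (d t)" for t
    using eps by (simp add: q_def drift_def)
  have N0: "AE r in lborel. r \<notin> N" by (rule AE_not_in[OF countable_imp_null_set_lborel[OF N]])
  have sub: "q t \<in> subdifferential (Theta \<theta>) (fst (u t))" if t: "t > 0" "t \<notin> N" for t
  proof -
    obtain p where "p \<in> subdifferential (Theta \<theta>) (fst (u t))" "fst (drift lam F (u t) - d t) = eps *\<^sub>R p"
      using d(2)[OF t] unfolding viscous_op_def mem_Times_iff by blast
    then show ?thesis using eps by (simp add: q_def)
  qed
  have main: "set_integrable lborel {s..t} (\<lambda>r. inner (q r) h)"
      "smooth_on UNIV \<phi> \<Longrightarrow> (\<And>r. r \<notin> {s..t} \<Longrightarrow> \<phi> r = 0) \<Longrightarrow>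
        (LINT r:{s..t}|lborel. deriv (deriv \<phi>) r * inner (fst (u r)) h)
         = (LINT r:{s..t}|lborel. - lam * eps * \<phi> r * inner (q r) h
                + eps * deriv \<phi> r * inner (q r) h + \<phi> r * inner (superpose F (fst (u r))) h)"
    if st: "0 < s" "s < t" for s t h \<phi>
  proof -
    obtain M where M: "M > 0" "\<And>a b. s \<le> a \<Longrightarrow> a \<le> b \<Longrightarrow> b \<le> t + 1 \<Longrightarrow> norm (u b - u a) \<le> M * (b - a)"
      using evol_lipschitz[OF w st(1), of "t + 1"] unfolding u_def by blast
    have comp: "norm (fst v) \<le> norm v" "norm (snd v) \<le> norm v" for v :: "L2T \<times> L2T"
      using norm_fst_le[of "fst v" "snd v"] norm_snd_le[of "snd v" "fst v"] by simp_all
    have inn: "\<bar>inner v h\<bar> \<le> M * norm h * (b - a)" if "norm v \<le> M * (b - a)" for v a b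
      using Cauchy_Schwarz_ineq2[of v h] mult_right_mono[OF that, of "norm h"] by (simp add: mult_ac)
    have lu: "norm (fst (u b) - fst (u a)) \<le> M * (b - a)" "norm (snd (u b) - snd (u a)) \<le> M * (b - a)"
      if "s \<le> a" "a \<le> b" "b \<le> t + 1" for a b
      using comp[of "u b - u a"] M(2)[OF that] by simp_all
    have lx: "\<bar>inner (fst (u b)) h - inner (fst (u a)) h\<bar> \<le> M * norm h * (b - a)"
        "\<bar>inner (snd (u b)) h - inner (snd (u a)) h\<bar> \<le> M * norm h * (b - a)" if "s \<le> a" "a \<le> b" "b \<le> t + 1" for a b
      using inn[OF lu(1)[OF that]] inn[OF lu(2)[OF that]] by (simp_all add: inner_diff_left)
    have cg: "continuous_on {s..t} (\<lambda>r. inner (superpose F (fst (u r))) h)"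
    proof (intro continuous_on_inner continuous_on_const continuous_on_of_lip)
      fix a b assume ab: "s \<le> a" "a \<le> b" "b \<le> t"
      have C: "C \<ge> 0" using lipF[of 0 1] by simp
      have "norm (superpose F (fst (u b)) - superpose F (fst (u a))) \<le> C * norm (fst (u b) - fst (u a))"
        by (rule superpose_lipschitz[OF lipF])
      also have "\<dots> \<le> C * (M * (b - a))"
        using lu(1)[of a b] ab C by (intro mult_left_mono) auto
      finally show "norm (superpose F (fst (u b)) - superpose F (fst (u a))) \<le> (C * M) * (b - a)" by simp
    qed
    have bl: "bounded_linear (\<lambda>v :: L2T \<times> L2T. inner (fst v) h)" "bounded_linear (\<lambda>v :: L2T \<times> L2T. inner (snd v) h)"
      by (rule bounded_linear_inner_left_comp[OF bounded_linear_fst], rule bounded_linear_inner_left_comp[OF bounded_linear_snd])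
    have Q: "eps * inner (q r) h = inner (snd (u r)) h + lam * inner (fst (u r)) h - inner (fst (d r)) h" for r
      using arg_cong[OF epsq[of r], of "\<lambda>v. inner v h"] by (simp add: inner_add_left inner_diff_left)
    have x': "((\<lambda>r. inner (fst (u r)) h) has_real_derivative
        inner (snd (u r)) h + lam * inner (fst (u r)) h - eps * inner (q r) h) (at r)" if "r \<in> {s..t} - N" for r
      using bounded_linear.has_vector_derivative[OF bl(1) d(1)[of r]] that st
      by (simp add: Q has_real_derivative_iff_has_vector_derivative)
    have z': "((\<lambda>r. inner (snd (u r)) h) has_real_derivative
        inner (superpose F (fst (u r))) h - lam * inner (snd (u r)) h - lam\<^sup>2 * inner (fst (u r)) h) (at r)" if r: "r \<in> {s..t} - N" for r
    proof -
      have "snd (drift lam F (u r) - d r) = 0" using d(2)[of r] r st by (simp add: mem_Times_iff)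
      then have "snd (d r) = superpose F (fst (u r)) - lam *\<^sub>R snd (u r) - lam\<^sup>2 *\<^sub>R fst (u r)" by (simp add: drift_def)
      then have eq: "inner (snd (d r)) h = inner (superpose F (fst (u r))) h - lam * inner (snd (u r)) h - lam\<^sup>2 * inner (fst (u r)) h"
        by (simp add: inner_diff_left)
      show ?thesis
        using bounded_linear.has_vector_derivative[OF bl(2) d(1)[of r]] r st
        by (simp add: eq has_real_derivative_iff_has_vector_derivative)
    qed
    have Q0: "eps * inner (q r) h = inner (snd (u r)) h + lam * inner (fst (u r)) h" if "r \<in> N" for r
      using that by (simp add: Q d_def)
    note wf = weak_form[OF st(2) eps lx(1) lx(2) cg N x' z' Q0]
    show "set_integrable lborel {s..t} (\<lambda>r. inner (q r) h)" by (rule wf(1))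
    show "(LINT r:{s..t}|lborel. deriv (deriv \<phi>) r * inner (fst (u r)) h)
         = (LINT r:{s..t}|lborel. - lam * eps * \<phi> r * inner (q r) h
                + eps * deriv \<phi> r * inner (q r) h + \<phi> r * inner (superpose F (fst (u r))) h)"
      if "smooth_on UNIV \<phi>" "\<And>r. r \<notin> {s..t} \<Longrightarrow> \<phi> r = 0" 
      by (rule wf(2)) (use that in simp_all)
  qed
  have ae: "AE t in lborel. 0 < t \<longrightarrow> q t \<in> subdifferential (Theta \<theta>) (fst (u t))"
    using N0 by eventually_elim (use sub in blast)
  show ?thesis
    unfolding generalized_material_NS_def u_def[symmetric]
  proof (intro exI[of _ q] conjI allI impI ae)
    show "set_integrable lborel {s..t} (\<lambda>r. inner (q r) h)" if "0 < s \<and> s < t" for h s t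
      by (rule main(1)[OF conjunct1[OF that] conjunct2[OF that]])
    show "(LINT r:{s..t}|lborel. deriv (deriv \<phi>) r * inner (fst (u r)) h)
         = (LINT r:{s..t}|lborel. - lam * eps * \<phi> r * inner (q r) h
                + eps * deriv \<phi> r * inner (q r) h + \<phi> r * inner (superpose F (fst (u r))) h)"
      if "0 < s \<and> s < t \<and> smooth_on UNIV \<phi> \<and> (\<forall>r. r \<notin> {s..t} \<longrightarrow> \<phi> r = 0)" for h \<phi> s t
      using that by (intro main(2)) simp_all
  qed
qed

section \<open>Equivalence of the inclusion and the material equation on smooth flows\<close>

section \<open>Smooth solutions\<close>

text \<open>The set where two continuous functions differ is open, and a nonempty open set is not
  negligible.\<close>

lemma AE_eq_imp_eq:
  fixes f g :: "real \<Rightarrow> 'a::real_normed_vector"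
  assumes S: "open S" and fg: "continuous_on S f" "continuous_on S g"
    and ae: "AE t in lborel. t \<in> S \<longrightarrow> f t = g t" and t: "t \<in> S"
  shows "f t = g t"
proof (rule ccontr)
  assume ne: "f t \<noteq> g t"
  define U where "U = {t \<in> S. f t - g t \<in> - {0}}"
  have "open U"
  proof -
    have "continuous_on S (\<lambda>t. f t - g t)" by (intro continuous_on_diff fg)
    then have "open ((\<lambda>t. f t - g t) -` (- {0}) \<inter> S)"
      by (rule continuous_on_open_vimage[OF S, THEN iffD1, rule_format]) (simp add: open_Compl)
    moreover have "(\<lambda>t. f t - g t) -` (- {0}) \<inter> S = U" by (auto simp: U_def)
    ultimately show ?thesis by simp
  qed
  moreover have "t \<in> U" using t ne by (simp add: U_def)
  ultimately have "\<not> negligible U" using open_not_negligible by blast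
  moreover have "negligible U"
  proof -
    from ae obtain N where N: "N \<in> null_sets lborel" "{t \<in> space lborel. \<not> (t \<in> S \<longrightarrow> f t = g t)} \<subseteq> N"
      unfolding eventually_ae_filter by (elim bexE)
    have "U \<subseteq> N"
    proof
      fix r assume "r \<in> U"
      then have "r \<in> {t \<in> space lborel. \<not> (t \<in> S \<longrightarrow> f t = g t)}" by (simp add: U_def)
      with N(2) show "r \<in> N" by (rule subsetD)
    qed
    moreover have "U \<in> sets lborel" using \<open>open U\<close> by simp
    ultimately have "U \<in> null_sets lborel" using null_sets_subset[OF N(1)] by simp
    then show ?thesis unfolding negligible_iff_null_sets by (rule null_sets_completionI)
  qed
  ultimately show False by blast
qed

lemma abs_L2T_inject_continuous:
  fixes f g :: "real \<Rightarrow> real"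
  assumes f: "continuous_on UNIV f" "\<And>a. f (a + 1) = f a" and g: "continuous_on UNIV g" "\<And>a. g (a + 1) = g a"
    and eq: "abs_L2T f = abs_L2T g"
  shows "f a = g a"
proof -
  have "AE a in lborel. a \<in> {0..1} \<longrightarrow> f a = g a"
    using eq abs_L2T_eq_iff[OF L2_fun_continuous[OF f] L2_fun_continuous[OF g]] by blast
  then have ae: "AE a in lborel. a \<in> {0<..<1} \<longrightarrow> f a = g a" by eventually_elim simp
  have "f a = g a" if "a \<in> {0<..<1}" for a
    by (rule AE_eq_imp_eq[OF open_greaterThanLessThan continuous_on_subset[OF f(1) subset_UNIV]
          continuous_on_subset[OF g(1) subset_UNIV] ae that])
  then have "{0<..<1} \<subseteq> {a. f a = g a}" by blast
  then have "closure {0<..<1} \<subseteq> {a. f a = g a}"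
    by (rule closure_minimal) (rule closed_Collect_eq[OF f(1) g(1)])
  then have "f (frac a) = g (frac a)"
  proof -
    have "frac a \<in> closure {0<..<1}" using frac_lt_1[of a] by (simp add: less_imp_le)
    then show ?thesis using \<open>closure {0<..<1} \<subseteq> {a. f a = g a}\<close> by blast
  qed
  moreover have "f (frac a + of_int \<lfloor>a\<rfloor>) = f (frac a) + of_int \<lfloor>a\<rfloor> * 0" by (rule periodic_int_shift) (simp add: f)
  moreover have "g (frac a + of_int \<lfloor>a\<rfloor>) = g (frac a) + of_int \<lfloor>a\<rfloor> * 0" by (rule periodic_int_shift) (simp add: g)
  ultimately show ?thesis by (simp add: frac_def)
qed

lemma pd2_periodic:
  assumes f: "smooth2 f" and per: "\<And>a. f t (a + 1) = f t a + c" and t: "t > 0"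
  shows "pd2 f t (a + 1) = pd2 f t a"
proof -
  have "((\<lambda>a. f t (a + 1)) has_real_derivative pd2 f t (a + 1)) (at a)"
    using smooth2_derivative(3)[OF f t, of "a + 1"] by (rule DERIV_shift[THEN iffD1])
  then have "((\<lambda>a. f t a + c) has_real_derivative pd2 f t (a + 1)) (at a)" by (simp only: per)
  moreover have "((\<lambda>a. f t a + c) has_real_derivative pd2 f t a + 0) (at a)"
    by (intro DERIV_add DERIV_const smooth2_derivative(3)[OF f t])
  ultimately have "pd2 f t (a + 1) = pd2 f t a + 0" by (rule DERIV_unique)
  then show ?thesis by simp
qed

lemma smooth2_L2_all:
  assumes "smooth2 g" "\<forall>t>0. \<forall>a. g t (a + 1) = g t a" "t > 0"
  shows "((\<lambda>t. abs_L2T (g t)) has_vector_derivative abs_L2T (pd1 g t)) (at t)"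
    and "L2_fun (g t)" "pd1 g t (a + 1) = pd1 g t a"
proof -
  have per: "\<And>t a. t > 0 \<Longrightarrow> g t (a + 1) = g t a" using assms(2) by blast
  show "((\<lambda>t. abs_L2T (g t)) has_vector_derivative abs_L2T (pd1 g t)) (at t)"
    by (rule smooth2_L2_derivative(1)[OF assms(1) per assms(3)])
  show "L2_fun (g t)" by (rule smooth2_L2_derivative(2)[OF assms(1) per assms(3)])
  show "pd1 g t (a + 1) = pd1 g t a" by (rule smooth2_L2_derivative(3)[OF assms(1) per assms(3)])
qed

lemma has_vector_derivative_local_eq:
  fixes h k :: "real \<Rightarrow> 'b::real_normed_vector"
  assumes "t > 0" "\<And>s. s > 0 \<Longrightarrow> h s = k s" "(h has_vector_derivative d) (at t)"
  shows "(k has_vector_derivative d) (at t)"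
  by (rule has_vector_derivative_transform_within_open[OF assms(3) open_greaterThan[of 0]]) (use assms in simp_all)

text \<open>The inclusion determines the value of Z, after which the second equation is the material
  equation rewritten. Relations holding at almost every time extend to all positive times by
  continuity; conversely a smooth pair is locally Lipschitz in time and hence absolutely
  continuous.\<close>

lemma is_solution_smooth_flow:
  assumes P: "potential \<theta> (deriv \<theta>)" and sm: "smooth_on {0<..} \<theta>"
    and eps: "eps > 0" and F: "smooth_on UNIV F" and lip: "\<And>x y. \<bar>F x - F y\<bar> \<le> C * \<bar>x - y\<bar>"
    and u: "continuous_on {0..} u" and X: "smooth_flow X" and fu: "\<And>t. t > 0 \<Longrightarrow> fst (u t) = displacement X t"
  shows "is_solution (viscous_op eps \<theta>) lam F (u 0) u \<longleftrightarrow>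
    (\<forall>t>0. snd (u t) = Z_of_flow eps lam \<theta> X t) \<and> material_NS eps lam \<theta> F X"
proof -
  interpret potential \<theta> "deriv \<theta>" by (rule P)
  have sX: "smooth2 X" and V: "\<And>t a. t > 0 \<Longrightarrow> pd2 X t a > 0" and perX: "\<And>t a. t > 0 \<Longrightarrow> X t (a + 1) = X t a + 1"
    using X by (auto simp: smooth_flow_def)
  note D = smooth2_derivative
  have sV: "smooth2 (pd2 X)" by (rule D(5)[OF sX])
  have perV: "pd2 X t (a + 1) = pd2 X t a" if "t > 0" for t a by (rule pd2_periodic[OF sX perX[OF that] that])
  note th1 = smooth_on_deriv[OF open_greaterThan sm]
  note th2 = smooth_on_deriv[OF open_greaterThan th1(2)]
  define \<sigma> where "\<sigma> = (\<lambda>t a. deriv \<theta> (pd2 X t a))"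
  have s\<sigma>: "smooth2 \<sigma>" unfolding \<sigma>_def by (rule smooth2_compose[OF open_greaterThan th1(2) sV]) (simp add: V)
  have per\<sigma>: "\<sigma> t (a + 1) = \<sigma> t a" if "t > 0" for t a by (simp add: \<sigma>_def perV[OF that])
  define q where "q = pd2 \<sigma>"
  have sq: "smooth2 q" unfolding q_def by (rule D(5)[OF s\<sigma>])
  have perq: "q t (a + 1) = q t a" if "t > 0" for t a
    unfolding q_def by (rule pd2_periodic[where c = 0, OF s\<sigma> _ that]) (simp add: per\<sigma>[OF that])
  define g where "g = (\<lambda>t a. X t a - a)"
  have sg: "smooth2 g" unfolding g_def by (rule smooth2_diff[OF sX smooth2_snd])
  have perg: "g t (a + 1) = g t a" if "t > 0" for t a by (simp add: g_def perX[OF that])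
  have pd1g: "pd1 g t a = pd1 X t a" if t: "t > 0" for t a
  proof (rule pd1_eqI)
    have "((\<lambda>s. X s a - a) has_real_derivative pd1 X t a - 0) (at t)" by (intro DERIV_diff DERIV_const D(2)[OF sX t])
    then show "((\<lambda>s. g s a) has_real_derivative pd1 X t a) (at t)" by (simp add: g_def)
  qed
  \<comment> \<open>A smooth representative of Z.\<close>
  define \<zeta> where "\<zeta> = (\<lambda>t a. pd1 X t a - eps * q t a - lam * g t a)"
  have sX1: "smooth2 (pd1 X)" by (rule D(4)[OF sX])
  have s\<zeta>: "smooth2 \<zeta>" unfolding \<zeta>_def by (intro smooth2_diff smooth2_cmult sX1 sq sg)
  have perX1: "pd1 X t (a + 1) = pd1 X t a" if "t > 0" for t a
  proof -
    have "\<forall>t>0. \<forall>a. g t (a + 1) = g t a" by (simp add: perg)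
    from smooth2_L2_all(3)[OF sg this that, of a] show ?thesis unfolding pd1g[OF that] .
  qed
  have per\<zeta>: "\<zeta> t (a + 1) = \<zeta> t a" if "t > 0" for t a by (simp add: \<zeta>_def perX1[OF that] perq[OF that] perg[OF that])
  have pd1\<zeta>: "pd1 \<zeta> t a = pd1 (pd1 X) t a - eps * pd1 q t a - lam * pd1 X t a" if t: "t > 0" for t a
    unfolding \<zeta>_def by (rule pd1_eqI, rule DERIV_diff[OF DERIV_diff[OF D(2)[OF sX1 t] DERIV_cmult[OF D(2)[OF sq t]]]])
      (use DERIV_cmult[OF D(2)[OF sg t]] pd1g[OF t] in simp)
  have pd1\<sigma>: "pd1 \<sigma> t a = deriv (deriv \<theta>) (pd2 X t a) * pd1 (pd2 X) t a" if t: "t > 0" for t a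
    unfolding \<sigma>_def by (rule pd1_eqI, rule DERIV_chain2[OF th2(1) D(2)[OF sV t]]) (simp add: V[OF t])
  \<comment> \<open>Symmetry of second derivatives: the viscous term is the time derivative of q,
    and this is why it disappears from the equation for Z.\<close>
  have pd1q: "pd2 (\<lambda>t a. deriv (deriv \<theta>) (pd2 X t a) * pd1 (pd2 X) t a) t a = pd1 q t a" if t: "t > 0" for t a
    unfolding q_def pd_symmetric[OF s\<sigma> t] by (rule pd2_cong) (simp add: pd1\<sigma>[OF t])
  \<comment> \<open>The right-hand side of the equation for Z, evaluated on the smooth
    representatives.\<close>
  define R where "R = (\<lambda>t a. F (g t a) - lam * \<zeta> t a - lam\<^sup>2 * g t a)"
  have NS: "material_NS eps lam \<theta> F X \<longleftrightarrow> (\<forall>t>0. \<forall>a. pd1 \<zeta> t a = R t a)"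
  proof -
    have "pd1 (pd1 X) t a = lam * eps * pd2 (\<lambda>t a. deriv \<theta> (pd2 X t a)) t a
        + eps * pd2 (\<lambda>t a. deriv (deriv \<theta>) (pd2 X t a) * pd1 (pd2 X) t a) t a + F (X t a - a)
      \<longleftrightarrow> pd1 \<zeta> t a = R t a" if t: "t > 0" for t a
      unfolding pd1q[OF t] \<sigma>_def[symmetric] q_def[symmetric] pd1\<zeta>[OF t] R_def
      by (auto simp: \<zeta>_def g_def algebra_simps power2_eq_square)
    then show ?thesis unfolding material_NS_def by blast
  qed
  define \<xi> where "\<xi> t = abs_L2T (g t)" for t
  define Z where "Z t = abs_L2T (\<zeta> t)" for t
  have fu': "fst (u t) = \<xi> t" if "t > 0" for t using fu[OF that] by (simp add: displacement_def \<xi>_def g_def)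
  have ZF: "Z_of_flow eps lam \<theta> X t = Z t" for t by (simp add: Z_of_flow_def Z_def \<zeta>_def q_def \<sigma>_def g_def)
  have Aperg: "\<forall>t>0. \<forall>a. g t (a + 1) = g t a" and Aper\<zeta>: "\<forall>t>0. \<forall>a. \<zeta> t (a + 1) = \<zeta> t a"
    and Aperq: "\<forall>t>0. \<forall>a. q t (a + 1) = q t a"
    by (simp_all add: perg per\<zeta> perq)
  note Lg = smooth2_L2_all[OF sg Aperg] and L\<zeta> = smooth2_L2_all[OF s\<zeta> Aper\<zeta>]
  have s\<zeta>1: "smooth2 (pd1 \<zeta>)" and sg1: "smooth2 (pd1 g)" by (rule D(4)[OF s\<zeta>], rule D(4)[OF sg])
  have per\<zeta>1: "pd1 \<zeta> t (a + 1) = pd1 \<zeta> t a" if "t > 0" for t a by (rule L\<zeta>(3)[OF that])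
  have perg1: "pd1 g t (a + 1) = pd1 g t a" if "t > 0" for t a by (rule Lg(3)[OF that])
  have Aperg1: "\<forall>t>0. \<forall>a. pd1 g t (a + 1) = pd1 g t a" and Aper\<zeta>1: "\<forall>t>0. \<forall>a. pd1 \<zeta> t (a + 1) = pd1 \<zeta> t a"
    by (simp_all add: perg1 per\<zeta>1)
  note L\<zeta>1 = smooth2_L2_all[OF s\<zeta>1 Aper\<zeta>1] and Lg1 = smooth2_L2_all[OF sg1 Aperg1]
  note Lq = smooth2_L2_all[OF sq Aperq]
  have FL: "superpose F (\<xi> t) = abs_L2T (\<lambda>a. F (g t a))" "L2_fun (\<lambda>a. F (g t a))" if "t > 0" for t
    unfolding \<xi>_def by (rule superpose_abs_L2T(2)[OF lip Lg(2)[OF that]], rule superpose_abs_L2T(1)[OF lip Lg(2)[OF that]])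
  have RL: "abs_L2T (R t) = superpose F (\<xi> t) - lam *\<^sub>R Z t - lam\<^sup>2 *\<^sub>R \<xi> t" if t: "t > 0" for t
    unfolding FL(1)[OF t] unfolding \<xi>_def Z_def R_def abs_L2T_scaleR[OF Lg(2)[OF t]] abs_L2T_scaleR[OF L\<zeta>(2)[OF t]]
    by (subst abs_L2T_diff[OF FL(2)[OF t] L2_fun_cmult[OF L\<zeta>(2)[OF t]]],
        subst abs_L2T_diff[OF L2_fun_diff[OF FL(2)[OF t] L2_fun_cmult[OF L\<zeta>(2)[OF t]]] L2_fun_cmult[OF Lg(2)[OF t]]]) simp
  have sR: "smooth2 R"
    unfolding R_def by (intro smooth2_diff smooth2_cmult s\<zeta> sg smooth2_compose[OF open_UNIV F sg UNIV_I])
  have perR: "R t (a + 1) = R t a" if "t > 0" for t a by (simp add: R_def perg[OF that] per\<zeta>[OF that])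
  have AperR: "\<forall>t>0. \<forall>a. R t (a + 1) = R t a" by (simp add: perR)
  note LR = smooth2_L2_all[OF sR AperR]
  have cont_of: "continuous_on {0<..} f" if "\<And>t. t > 0 \<Longrightarrow> (f has_vector_derivative f' t) (at t)" for f f' :: "real \<Rightarrow> L2T"
    using that by (intro continuous_at_imp_continuous_on ballI has_vector_derivative_continuous) simp
  have NS2: "material_NS eps lam \<theta> F X \<longleftrightarrow> (\<forall>t>0. abs_L2T (pd1 \<zeta> t) = abs_L2T (R t))"
  proof
    assume "material_NS eps lam \<theta> F X"
    then have "\<forall>t>0. \<forall>a. pd1 \<zeta> t a = R t a" by (rule NS[THEN iffD1])
    then have "pd1 \<zeta> t = R t" if "t > 0" for t by (intro ext) (simp add: that)
    then show "\<forall>t>0. abs_L2T (pd1 \<zeta> t) = abs_L2T (R t)" by simp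
  next
    assume eq: "\<forall>t>0. abs_L2T (pd1 \<zeta> t) = abs_L2T (R t)"
    show "material_NS eps lam \<theta> F X"
      unfolding NS
    proof (intro allI impI)
      fix t a :: real assume t: "t > 0"
      show "pd1 \<zeta> t a = R t a"
        using eq[rule_format, OF t]
        by (rule abs_L2T_inject_continuous[OF smooth2_continuous(2)[OF s\<zeta>1 t] per\<zeta>1[OF t] smooth2_continuous(2)[OF sR t] perR[OF t]])
    qed
  qed
  have cm: "circle_map (X t) (pd2 X t)" if t: "t > 0" for t
    unfolding circle_map_def
    by (intro conjI allI D(3)[OF sX t] smooth2_continuous(2)[OF sV t] perX[OF t] less_imp_le[OF V[OF t]])
  have q': "((\<lambda>a. deriv \<theta> (pd2 X t a)) has_real_derivative q t a) (at a)" if t: "t > 0" for t a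
    using D(3)[OF s\<sigma> t, of a] unfolding q_def \<sigma>_def .
  have qc: "continuous_on UNIV (q t)" if t: "t > 0" for t by (rule smooth2_continuous(2)[OF sq t])
  have visc: "v \<in> viscous_op eps \<theta> (\<xi> t) \<longleftrightarrow> v = - (eps *\<^sub>R abs_L2T (q t))" if t: "t > 0" for v t
  proof -
    have q1: "- abs_L2T (q t) \<in> subdifferential (Theta \<theta>) (\<xi> t)"
      unfolding \<xi>_def g_def by (rule subgradient_smooth(2)[OF cm[OF t] V[OF t] q'[OF t] qc[OF t]])
    have q2: "p = - abs_L2T (q t)" if "p \<in> subdifferential (Theta \<theta>) (\<xi> t)" for p
      using that unfolding \<xi>_def g_def by (rule subgradient_smooth_unique[OF cm[OF t] V[OF t] q'[OF t] qc[OF t]])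
    have "subdifferential (Theta \<theta>) (\<xi> t) = {- abs_L2T (q t)}"
    proof (intro equalityI subsetI)
      fix p assume "p \<in> subdifferential (Theta \<theta>) (\<xi> t)"
      then show "p \<in> {- abs_L2T (q t)}" using q2 by simp
    next
      fix p assume "p \<in> {- abs_L2T (q t)}"
      then show "p \<in> subdifferential (Theta \<theta>) (\<xi> t)" using q1 by simp
    qed
    then show ?thesis by (simp add: viscous_op_def)
  qed
  have Zeq: "Z t = abs_L2T (pd1 g t) - eps *\<^sub>R abs_L2T (q t) - lam *\<^sub>R \<xi> t" if t: "t > 0" for t
  proof -
    have "\<zeta> t = (\<lambda>a. pd1 g t a - eps * q t a - lam * g t a)" by (simp add: \<zeta>_def pd1g[OF t])
    then show ?thesis
      unfolding Z_def \<xi>_def abs_L2T_scaleR[OF Lg(2)[OF t]] abs_L2T_scaleR[OF Lq(2)[OF t]]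
      by (simp only: abs_L2T_diff[OF Lg1(2)[OF t] L2_fun_cmult[OF Lq(2)[OF t]]]
          abs_L2T_diff[OF L2_fun_diff[OF Lg1(2)[OF t] L2_fun_cmult[OF Lq(2)[OF t]]] L2_fun_cmult[OF Lg(2)[OF t]]])
  qed
  have incl: "- abs_L2T (pd1 g t) + z + lam *\<^sub>R \<xi> t \<in> viscous_op eps \<theta> (\<xi> t) \<longleftrightarrow> z = Z t" if t: "t > 0" for z t
    unfolding visc[OF t] Zeq[OF t] by (auto simp: algebra_simps)
  have d\<xi>: "(\<xi> has_vector_derivative abs_L2T (pd1 g t)) (at t)" if "t > 0" for t unfolding \<xi>_def by (rule Lg(1)[OF that])
  have dZ: "(Z has_vector_derivative abs_L2T (pd1 \<zeta> t)) (at t)" if "t > 0" for t unfolding Z_def by (rule L\<zeta>(1)[OF that])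
  show ?thesis
  proof
    assume sol: "is_solution (viscous_op eps \<theta>) lam F (u 0) u"
    \<comment> \<open>At almost every t the derivative of \<xi> must be the one computed from the
      smooth flow, so the inclusion there fixes Z.\<close>
    have ae: "AE t in lborel. t \<in> {0<..} \<longrightarrow> snd (u t) = Z t \<and>
        (\<exists>x z. (u has_vector_derivative (x, z)) (at t) \<and> z + lam *\<^sub>R snd (u t) = - (lam\<^sup>2 *\<^sub>R \<xi> t) + superpose F (\<xi> t))"
      using sol[unfolded is_solution_def, THEN conjunct2, THEN conjunct2, THEN conjunct2]
    proof eventually_elim
      case (elim t)
      show ?case
      proof
        assume "t \<in> {0<..}" then have t: "t > 0" by simp
        then obtain x z where xz: "(u has_vector_derivative (x, z)) (at t)" "- x + snd (u t) + lam *\<^sub>R \<xi> t \<in> viscous_op eps \<theta> (\<xi> t)"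
            "z + lam *\<^sub>R snd (u t) = - (lam\<^sup>2 *\<^sub>R \<xi> t) + superpose F (\<xi> t)"
          using elim fu'[OF t] by auto
        have "((\<lambda>s. fst (u s)) has_vector_derivative x) (at t)"
          using bounded_linear.has_vector_derivative[OF bounded_linear_fst xz(1)] by simp
        from has_vector_derivative_local_eq[OF t _ this, of \<xi>] have "(\<xi> has_vector_derivative x) (at t)" using fu' by simp
        then have "x = abs_L2T (pd1 g t)" using d\<xi>[OF t] vector_derivative_unique_at by blast
        then have "snd (u t) = Z t" using xz(2) incl[OF t] by blast
        with xz show "snd (u t) = Z t \<and> (\<exists>x z. (u has_vector_derivative (x, z)) (at t) \<and>
            z + lam *\<^sub>R snd (u t) = - (lam\<^sup>2 *\<^sub>R \<xi> t) + superpose F (\<xi> t))" by blast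
      qed
    qed
    have snd: "snd (u t) = Z t" if t: "t > 0" for t
    proof (rule AE_eq_imp_eq[of "{0<..}"])
      show "continuous_on {0<..} (\<lambda>t. snd (u t))"
        by (rule continuous_on_snd[OF continuous_on_subset[OF u]]) auto
      show "continuous_on {0<..} Z" by (rule cont_of[OF dZ])
      show "AE t in lborel. t \<in> {0<..} \<longrightarrow> snd (u t) = Z t" using ae by eventually_elim blast
    qed (use t in simp_all)
    have "abs_L2T (pd1 \<zeta> t) = abs_L2T (R t)" if t: "t > 0" for t
    proof (rule AE_eq_imp_eq[of "{0<..}"])
      show "continuous_on {0<..} (\<lambda>t. abs_L2T (pd1 \<zeta> t))" by (rule cont_of[OF L\<zeta>1(1)])
      show "continuous_on {0<..} (\<lambda>t. abs_L2T (R t))" by (rule cont_of[OF LR(1)])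
      show "AE t in lborel. t \<in> {0<..} \<longrightarrow> abs_L2T (pd1 \<zeta> t) = abs_L2T (R t)"
        using ae
      proof eventually_elim
        case (elim t)
        show ?case
        proof
          assume "t \<in> {0<..}" then have t: "t > 0" by simp
          with elim obtain x z where xz: "(u has_vector_derivative (x, z)) (at t)"
            "z + lam *\<^sub>R snd (u t) = - (lam\<^sup>2 *\<^sub>R \<xi> t) + superpose F (\<xi> t)" by auto
          have "((\<lambda>s. snd (u s)) has_vector_derivative z) (at t)"
            using bounded_linear.has_vector_derivative[OF bounded_linear_snd xz(1)] by simp
          from has_vector_derivative_local_eq[OF t _ this, of Z] have "(Z has_vector_derivative z) (at t)" using snd by simp
          then have "z = abs_L2T (pd1 \<zeta> t)" using dZ[OF t] vector_derivative_unique_at by blast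
          then have "abs_L2T (pd1 \<zeta> t) = - (lam\<^sup>2 *\<^sub>R \<xi> t) + superpose F (\<xi> t) - lam *\<^sub>R Z t"
            using xz(2) snd[OF t] by (simp add: eq_diff_eq)
          then show "abs_L2T (pd1 \<zeta> t) = abs_L2T (R t)" unfolding RL[OF t] by simp
        qed
      qed
    qed (use t in simp_all)
    then show "(\<forall>t>0. snd (u t) = Z_of_flow eps lam \<theta> X t) \<and> material_NS eps lam \<theta> F X"
      using snd NS2 ZF by simp
  next
    assume "(\<forall>t>0. snd (u t) = Z_of_flow eps lam \<theta> X t) \<and> material_NS eps lam \<theta> F X"
    then have snd: "\<And>t. t > 0 \<Longrightarrow> snd (u t) = Z t" and eq: "\<And>t. t > 0 \<Longrightarrow> abs_L2T (pd1 \<zeta> t) = abs_L2T (R t)"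
      using NS2 ZF by simp_all
    define d where "d t = (abs_L2T (pd1 g t), abs_L2T (pd1 \<zeta> t))" for t
    have du: "(u has_vector_derivative d t) (at t)" if t: "t > 0" for t
    proof -
      have A: "((\<lambda>t. (\<xi> t, Z t)) has_vector_derivative d t) (at t)"
        unfolding d_def by (intro has_vector_derivative_Pair d\<xi> dZ t)
      have "(\<xi> s, Z s) = u s" if "s > 0" for s using fu'[OF that] snd[OF that] by (simp add: prod_eq_iff)
      then show ?thesis by (rule has_vector_derivative_local_eq[OF t _ A])
    qed
    have cd: "continuous_on {0<..} d"
      unfolding d_def by (intro continuous_on_Pair cont_of[OF Lg1(1)] cont_of[OF L\<zeta>1(1)])
    \<comment> \<open>Absolute continuity on [s, t] comes from the boundedness of the continuous
      derivative on that compact interval.\<close>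
    show "is_solution (viscous_op eps \<theta>) lam F (u 0) u"
      unfolding is_solution_def
    proof (intro conjI allI impI refl u AE_I2)
      fix s t :: real assume st: "0 < s \<and> s < t"
      have "bounded (d ` {s..t})"
        by (rule compact_imp_bounded[OF compact_continuous_image[OF continuous_on_subset[OF cd] compact_Icc]]) (use st in auto)
      then obtain M where M: "\<forall>y\<in>d ` {s..t}. norm y \<le> M" unfolding bounded_iff by blast
      have M0: "M \<ge> 0" using M st norm_ge_zero[of "d s"] by (meson atLeastAtMost_iff imageI less_imp_le order_refl order_trans)
      show "abs_cont_on s t u"
      proof (rule abs_cont_on_lipschitz)
        show "norm (u b - u a) \<le> (M + 1) * (b - a)" if "s \<le> a" "a \<le> b" "b \<le> t" for a b
        proof (rule deriv_bound_imp_lipschitz[OF that(2)])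
          show "continuous_on {a..b} u" by (rule continuous_on_subset[OF u]) (use that st in auto)
          show "(u has_vector_derivative d r) (at r)" if "a < r" for r
            by (rule du) (use that \<open>s \<le> a\<close> st in linarith)
          show "norm (d r) \<le> M + 1" if "a < r" "r < b" for r
          proof -
            have "r \<in> {s..t}" using that \<open>s \<le> a\<close> \<open>b \<le> t\<close> by simp
            then have "norm (d r) \<le> M" using M by blast
            then show ?thesis by simp
          qed
        qed
        show "M + 1 > 0" using M0 by simp
      qed
    next
      fix t :: real assume t: "0 < t"
      show "\<exists>x z. (u has_vector_derivative (x, z)) (at t) \<and>
          - x + snd (u t) + lam *\<^sub>R fst (u t) \<in> viscous_op eps \<theta> (fst (u t)) \<and>
          z + lam *\<^sub>R snd (u t) = - (lam\<^sup>2 *\<^sub>R fst (u t)) + superpose F (fst (u t))"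
      proof (intro exI conjI)
        show "(u has_vector_derivative (abs_L2T (pd1 g t), abs_L2T (pd1 \<zeta> t))) (at t)" using du[OF t] by (simp add: d_def)
        show "- abs_L2T (pd1 g t) + snd (u t) + lam *\<^sub>R fst (u t) \<in> viscous_op eps \<theta> (fst (u t))"
          unfolding fu'[OF t] snd[OF t] incl[OF t] by (rule refl)
        show "abs_L2T (pd1 \<zeta> t) + lam *\<^sub>R snd (u t) = - (lam\<^sup>2 *\<^sub>R fst (u t)) + superpose F (fst (u t))"
          unfolding fu'[OF t] snd[OF t] eq[OF t] RL[OF t] by simp
      qed
    qed
  qed
qed

section \<open>The inverse flow and the passage between material and Eulerian equations\<close>

section \<open>Eulerian coordinates\<close>

text \<open>The material derivative, that is, the derivative along particle paths.\<close>

lemma smooth2_along: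
  assumes f: "smooth2 f" and X: "smooth2 X" and t: "t > 0"
  shows "((\<lambda>s. f s (X s a)) has_real_derivative pd1 f t (X t a) + pd2 f t (X t a) * pd1 X t a) (at t)"
proof -
  have X': "((\<lambda>s. X s a) has_derivative (\<lambda>h. pd1 X t a * h)) (at t)"
    using smooth2_derivative(2)[OF X t, of a] by (simp only: has_field_derivative_def)
  have "((\<lambda>s. (s, X s a)) has_derivative (\<lambda>h. (h, pd1 X t a * h))) (at t)"
    by (rule has_derivative_Pair[OF has_derivative_ident X'])
  from has_derivative_compose[OF this smooth2_derivative(1)[OF f t]]
  have "((\<lambda>s. f s (X s a)) has_derivative (\<lambda>h. h * pd1 f t (X t a) + (pd1 X t a * h) * pd2 f t (X t a))) (at t)"
    by (simp only: fst_conv snd_conv)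
  then show ?thesis
    unfolding has_field_derivative_def by (rule has_derivative_eq_rhs) (simp add: fun_eq_iff algebra_simps)
qed

text \<open>Positive slope gives injectivity; the shift relation makes X unbounded in both
  directions, and the intermediate value theorem gives surjectivity.\<close>

lemma inverse_flow:
  assumes X: "smooth_flow X" and t: "t > 0"
  shows "X t (inv (X t) x) = x" "inv (X t) (X t a) = a" "inv (X t) (x + 1) = inv (X t) x + 1"
proof -
  have sX: "smooth2 X" and V: "\<And>a. pd2 X t a > 0" and per: "\<And>a. X t (a + 1) = X t a + 1"
    using X t unfolding smooth_flow_def by simp_all
  have inc: "X t a < X t b" if "a < b" for a b
  proof (rule DERIV_pos_imp_increasing[OF that])
    show "\<exists>y. (X t has_real_derivative y) (at z) \<and> 0 < y" for z
      using smooth2_derivative(3)[OF sX t] V by (intro exI[of _ "pd2 X t z"] conjI)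
  qed
  have inj: "inj (X t)"
  proof (rule injI)
    fix a b assume "X t a = X t b"
    then show "a = b" using inc[of a b] inc[of b a] by (cases a b rule: linorder_cases) simp_all
  qed
  have ex: "\<exists>a. X t a = x" for x
  proof -
    define n where "n = \<lfloor>x - X t 0\<rfloor>"
    have shift: "X t (0 + of_int m) = X t 0 + of_int m * 1" for m by (rule periodic_int_shift) (rule per)
    have "X t (of_int n) \<le> x" 
    proof -
      have "of_int n \<le> x - X t 0" unfolding n_def by (rule of_int_floor_le)
      then show ?thesis using shift[of n] by simp
    qed
    moreover have "x \<le> X t (of_int (n + 1))"
    proof -
      have "x - X t 0 < of_int (n + 1)" unfolding n_def by linarith
      then show ?thesis using shift[of "n + 1"] by simp
    qed
    moreover have "continuous_on {of_int n..of_int (n + 1)} (X t)"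
      by (rule continuous_on_subset[OF smooth2_continuous(2)[OF sX t] subset_UNIV])
    ultimately show ?thesis using IVT'[of "X t" "of_int n" x "of_int (n + 1)"] by auto
  qed
  have surj: "X t (inv (X t) x) = x" for x
  proof -
    have "x \<in> range (X t)" using ex[of x] by (metis rangeI)
    then show ?thesis by (rule f_inv_into_f)
  qed
  show "X t (inv (X t) x) = x" by (rule surj)
  show invX: "inv (X t) (X t a) = a" for a by (rule inv_f_f[OF inj])
  have "inv (X t) (x + 1) = inv (X t) (X t (inv (X t) x + 1))" by (simp only: per surj)
  then show "inv (X t) (x + 1) = inv (X t) x + 1" by (simp only: invX)
qed

text \<open>The inverse function theorem is applied to (t, a) \<mapsto> (t, X t a). The derivative
  of the inverse Y is a smooth function evaluated at Y itself, so regularity bootstraps: n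
  derivatives of Y give n derivatives of its derivative.\<close>

lemma inverse_flow_smooth:
  assumes X: "smooth_flow X"
  shows "smooth2 (\<lambda>t. inv (X t))"
    and "t > 0 \<Longrightarrow> (inv (X t) has_real_derivative inverse (pd2 X t (inv (X t) x))) (at x)"
proof -
  have sX: "smooth2 X" and V: "\<And>t a. t > 0 \<Longrightarrow> pd2 X t a > 0" using X unfolding smooth_flow_def by simp_all
  define Y where "Y = (\<lambda>t. inv (X t))"
  let ?S = "{0::real<..} \<times> (UNIV :: real set)"
  \<comment> \<open>Coefficients found by differentiating X t (Y t x) = x: the space derivative of Y
    is the inverse slope, its time derivative minus the velocity times that.\<close>
  define B where "B = (\<lambda>t a. inverse (pd2 X t a))"
  define A where "A = (\<lambda>t a. (-1) * (pd1 X t a * B t a))"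
  have sB: "smooth2 B"
    unfolding B_def by (rule smooth2_compose[OF open_greaterThan smooth_on_inverse smooth2_derivative(5)[OF sX]]) (simp add: V)
  have sA: "smooth2 A" unfolding A_def by (intro smooth2_cmult smooth2_mult smooth2_derivative(4)[OF sX] sB)
  have der: "((\<lambda>z. Y (fst z) (snd z)) has_derivative (\<lambda>v. fst v * A t (Y t x) + snd v * B t (Y t x))) (at (t, x))"
    if t: "t > 0" for t x
  proof -
    define a where "a = Y t x"
    have x: "X t a = x" unfolding a_def Y_def by (rule inverse_flow(1)[OF X t])
    have V0: "pd2 X t a \<noteq> 0" using V[OF t, of a] by simp
    let ?f = "\<lambda>z. (fst z, X (fst z) (snd z))" and ?g = "\<lambda>z. (fst z, Y (fst z) (snd z))"
    let ?f' = "\<lambda>v. (fst v, fst v * pd1 X t a + snd v * pd2 X t a)"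
    let ?g' = "\<lambda>v. (fst v, fst v * A t a + snd v * B t a)"
    have "(?g has_derivative ?g') (at (?f (t, a)))"
    proof (rule has_derivative_inverse_strong[of ?S "(t, a)" ?f ?g ?f' ?g'])
      show "open ?S" by (rule open_half)
      show "(t, a) \<in> ?S" using t by simp
      show "continuous_on ?S ?f"
        using smooth2_continuous(1)[OF sX] by (intro continuous_on_Pair continuous_on_fst continuous_on_id) (simp add: case_prod_unfold)
      show "?g (?f z) = z" if "z \<in> ?S" for z
        using that inverse_flow(2)[OF X, of "fst z" "snd z"] by (simp add: Y_def mem_Times_iff prod_eq_iff)
      show "(?f has_derivative ?f') (at (t, a))"
        by (rule has_derivative_Pair[OF has_derivative_fst[OF has_derivative_ident] smooth2_derivative(1)[OF sX t]])
      show "?f' \<circ> ?g' = id"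
        using V0 by (simp add: fun_eq_iff A_def B_def algebra_simps)
    qed
    from has_derivative_snd[OF this]
    have "((\<lambda>z. Y (fst z) (snd z)) has_derivative (\<lambda>v. fst v * A t a + snd v * B t a)) (at (t, x))"
      by (simp only: fst_conv snd_conv x)
    then show ?thesis by (simp only: a_def)
  qed
  have "diff_n_on n ?S (\<lambda>z. Y (fst z) (snd z))" for n
  proof (induction n)
    case 0
    have "isCont (\<lambda>z. Y (fst z) (snd z)) z" if "z \<in> ?S" for z
      using has_derivative_continuous[OF der[of "fst z" "snd z"]] that by (simp add: mem_Times_iff)
    then show ?case unfolding diff_n_on.simps by (intro continuous_at_imp_continuous_on ballI)
  next
    case (Suc n)
    have comp: "diff_n_on n ?S (\<lambda>z. G (fst z) (Y (fst z) (snd z)))" if G: "smooth2 G" for G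
    proof -
      have "diff_n_on n ?S (\<lambda>z. (\<lambda>y. G (fst y) (snd y)) (fst z, Y (fst z) (snd z)))"
      proof (rule diff_n_on_compose2[where F = "\<lambda>y. G (fst y) (snd y)" and p = fst and q = "\<lambda>z. Y (fst z) (snd z)", OF open_half open_half])
        show "diff_n_on n ?S (\<lambda>y. G (fst y) (snd y))" using G by (simp only: smooth2_iff)
        show "diff_n_on n ?S (\<lambda>z. Y (fst z) (snd z))" by (rule Suc.IH)
        show "diff_n_on n ?S fst" by (rule diff_n_on_bounded_linear[OF open_half bounded_linear_fst])
        show "(fst z, Y (fst z) (snd z)) \<in> ?S" if "z \<in> ?S" for z using that by (simp add: mem_Times_iff)
      qed
      then show ?thesis by (simp only: fst_conv snd_conv)
    qed
    have fd: "frechet_derivative (\<lambda>z. Y (fst z) (snd z)) (at z) = (\<lambda>v. fst v * A (fst z) (Y (fst z) (snd z)) + snd v * B (fst z) (Y (fst z) (snd z)))"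
      "(\<lambda>z. Y (fst z) (snd z)) differentiable (at z)" if "z \<in> ?S" for z
    proof -
      have "fst z > 0" using that by (simp add: mem_Times_iff)
      note d = der[OF this, of "snd z", unfolded prod.collapse]
      show "frechet_derivative (\<lambda>z. Y (fst z) (snd z)) (at z) = (\<lambda>v. fst v * A (fst z) (Y (fst z) (snd z)) + snd v * B (fst z) (Y (fst z) (snd z)))"
        by (rule frechet_derivative_at[OF d, symmetric])
      show "(\<lambda>z. Y (fst z) (snd z)) differentiable (at z)" by (rule differentiableI[OF d])
    qed
    have "diff_n_on n ?S (\<lambda>z. frechet_derivative (\<lambda>z. Y (fst z) (snd z)) (at z) v)" for v
    proof -
      have "diff_n_on n ?S (\<lambda>z. fst v * A (fst z) (Y (fst z) (snd z)) + snd v * B (fst z) (Y (fst z) (snd z)))"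
        by (rule diff_n_on_add[OF open_half diff_n_on_mult[OF open_half diff_n_on_const[OF open_half] comp[OF sA]]
              diff_n_on_mult[OF open_half diff_n_on_const[OF open_half] comp[OF sB]]])
      then show ?thesis by (rule diff_n_on_cong[OF open_half, rotated]) (simp add: fd(1))
    qed
    then show ?case unfolding diff_n_on.simps using fd(2) by (intro conjI ballI allI)
  qed
  then have "\<forall>n. diff_n_on n ?S (\<lambda>z. Y (fst z) (snd z))" by (rule allI)
  then have "smooth2 Y" unfolding smooth2_iff .
  then show "smooth2 (\<lambda>t. inv (X t))" by (simp only: Y_def)
  show "(inv (X t) has_real_derivative inverse (pd2 X t (inv (X t) x))) (at x)" if t: "t > 0"
  proof -
    have "((\<lambda>y. (t, y)) has_derivative (\<lambda>h. (0, h))) (at x)"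
      by (rule has_derivative_Pair[OF has_derivative_const has_derivative_ident])
    from has_derivative_compose[OF this der[OF t]]
    have "((\<lambda>y. Y t y) has_derivative (\<lambda>h. 0 * A t (Y t x) + h * B t (Y t x))) (at x)" by (simp only: fst_conv snd_conv)
    then have "(Y t has_real_derivative B t (Y t x)) (at x)"
      unfolding has_field_derivative_def by (rule has_derivative_eq_rhs) (simp add: fun_eq_iff mult.commute)
    then show ?thesis by (simp only: Y_def B_def)
  qed
qed

text \<open>Mass conservation is the time derivative of \<rho> times the slope being 1 along the
  flow. Momentum minus velocity times mass is then \<rho> times the material equation, since
  x-derivatives are a-derivatives multiplied by \<rho>.\<close>

lemma eulerian_pointwise:
  fixes x :: real
  assumes X: "smooth_flow X" and sm: "smooth_on {0<..} \<theta>" and cl: "constitutive_laws eps lam \<theta> p \<mu>"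
    and r: "smooth2 \<rho>" and v: "smooth2 v" and mc: "material_coordinates X \<rho> v" and t: "t > 0"
  defines "a \<equiv> inv (X t) x"
  shows "pd1 \<rho> t x + pd2 (\<lambda>t x. \<rho> t x * v t x) t x = 0"
    and "pd1 (\<lambda>t x. \<rho> t x * v t x) t x + pd2 (\<lambda>t x. \<rho> t x * (v t x)\<^sup>2 + p (\<rho> t x)) t x
        = pd2 (\<lambda>t x. \<mu> (\<rho> t x) * pd2 v t x) t x + \<rho> t x * eulerian_force F X t x
      \<longleftrightarrow> pd1 (pd1 X) t a = lam * eps * pd2 (\<lambda>t a. deriv \<theta> (pd2 X t a)) t a
        + eps * pd2 (\<lambda>t a. deriv (deriv \<theta>) (pd2 X t a) * pd1 (pd2 X) t a) t a + F (X t a - a)"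
proof -
  have sX: "smooth2 X" and V: "\<And>t a. t > 0 \<Longrightarrow> pd2 X t a > 0" using X unfolding smooth_flow_def by simp_all
  note D = smooth2_derivative
  have mv: "v s (X s b) = pd1 X s b" and mr: "\<rho> s (X s b) * pd2 X s b = 1" if "s > 0" for s b
    using mc that unfolding material_coordinates_def by simp_all
  have sV: "smooth2 (pd2 X)" and sX1: "smooth2 (pd1 X)" by (rule D(5)[OF sX], rule D(4)[OF sX])
  note th1 = smooth_on_deriv[OF open_greaterThan sm]
  note th2 = smooth_on_deriv[OF open_greaterThan th1(2)]
  define \<sigma> where "\<sigma> = (\<lambda>t a. deriv \<theta> (pd2 X t a))"
  define \<omega> where "\<omega> = (\<lambda>t a. deriv (deriv \<theta>) (pd2 X t a) * pd1 (pd2 X) t a)"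
  have s\<sigma>: "smooth2 \<sigma>" unfolding \<sigma>_def by (rule smooth2_compose[OF open_greaterThan th1(2) sV]) (simp add: V)
  have s\<omega>: "smooth2 \<omega>"
    unfolding \<omega>_def by (rule smooth2_mult[OF smooth2_compose[OF open_greaterThan th2(2) sV] D(4)[OF sV]]) (simp add: V)
  have xa: "X t a = x" unfolding a_def by (rule inverse_flow(1)[OF X t])
  define c where "c = v t x"
  define r0 where "r0 = \<rho> t x"
  define w where "w = pd2 X t a"
  have c: "pd1 X t a = c" using mv[OF t, of a] by (simp add: xa c_def)
  have rw: "r0 * w = 1" using mr[OF t, of a] by (simp add: xa r0_def w_def)
  have w: "w > 0" unfolding w_def by (rule V[OF t])
  have r0w: "r0 = inverse w" using rw w by (simp add: field_simps)
  have vx: "pd2 v t (X t b) * pd2 X t b = pd1 (pd2 X) t b" for b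
  proof -
    have "((\<lambda>b. v t (X t b)) has_real_derivative pd2 v t (X t b) * pd2 X t b) (at b)"
      by (rule DERIV_chain2[OF D(3)[OF v t] D(3)[OF sX t]])
    moreover have "((\<lambda>b. v t (X t b)) has_real_derivative pd2 (pd1 X) t b) (at b)"
      unfolding mv[OF t] using D(3)[OF sX1 t, of b] by simp
    ultimately have "pd2 v t (X t b) * pd2 X t b = pd2 (pd1 X) t b" by (rule DERIV_unique)
    then show ?thesis by (simp only: pd_symmetric[OF sX t])
  qed
  have vx': "pd2 v t x * w = pd1 (pd2 X) t a" using vx[of a] by (simp only: xa w_def)
  have "((\<lambda>s. \<rho> s (X s a) * pd2 X s a) has_real_derivative
      (pd1 \<rho> t (X t a) + pd2 \<rho> t (X t a) * pd1 X t a) * pd2 X t a + pd1 (pd2 X) t a * \<rho> t (X t a)) (at t)"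
    by (rule DERIV_mult[OF smooth2_along[OF r sX t] D(2)[OF sV t]])
  moreover have "((\<lambda>s. \<rho> s (X s a) * pd2 X s a) has_real_derivative 0) (at t)"
    by (rule has_field_derivative_transform_within_open[of "\<lambda>_. 1" _ _ "{0<..}"]) (use t mr in simp_all)
  ultimately have "(pd1 \<rho> t (X t a) + pd2 \<rho> t (X t a) * pd1 X t a) * pd2 X t a + pd1 (pd2 X) t a * \<rho> t (X t a) = 0"
    by (rule DERIV_unique)
  then have "(pd1 \<rho> t x + pd2 \<rho> t x * c) * w + (pd2 v t x * w) * r0 = 0"
    by (simp only: vx' xa c w_def[symmetric] r0_def[symmetric])
  then have "w * (pd1 \<rho> t x + (pd2 \<rho> t x * c + pd2 v t x * r0)) = 0" by (simp add: algebra_simps)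
  then have mass: "pd1 \<rho> t x + (pd2 \<rho> t x * c + pd2 v t x * r0) = 0" using w by simp
  have "((\<lambda>x. \<rho> t x * v t x) has_real_derivative pd2 \<rho> t x * v t x + pd2 v t x * \<rho> t x) (at x)"
    by (rule DERIV_mult[OF D(3)[OF r t] D(3)[OF v t]])
  from pd2_eqI[of "\<lambda>t x. \<rho> t x * v t x", OF this]
  show "pd1 \<rho> t x + pd2 (\<lambda>t x. \<rho> t x * v t x) t x = 0" using mass by (simp only: c_def r0_def)
  have "((\<lambda>s. v s (X s a)) has_real_derivative pd1 v t (X t a) + pd2 v t (X t a) * pd1 X t a) (at t)"
    by (rule smooth2_along[OF v sX t])
  moreover have "((\<lambda>s. v s (X s a)) has_real_derivative pd1 (pd1 X) t a) (at t)"
    by (rule has_field_derivative_transform_within_open[OF D(2)[OF sX1 t], of "{0<..}"]) (use t mv in simp_all)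
  ultimately have "pd1 v t (X t a) + pd2 v t (X t a) * pd1 X t a = pd1 (pd1 X) t a" by (rule DERIV_unique)
  then have acc: "pd1 (pd1 X) t a = pd1 v t x + pd2 v t x * c" by (simp only: xa c)
  have "((\<lambda>s. \<rho> s x * v s x) has_real_derivative pd1 \<rho> t x * v t x + pd1 v t x * \<rho> t x) (at t)"
    by (rule DERIV_mult[OF D(2)[OF r t] D(2)[OF v t]])
  from pd1_eqI[of "\<lambda>t x. \<rho> t x * v t x", OF this]
  have e1: "pd1 (\<lambda>t x. \<rho> t x * v t x) t x = pd1 \<rho> t x * c + pd1 v t x * r0" by (simp only: c_def r0_def)
  have at_inv: "\<rho> t y = 1 / pd2 X t (inv (X t) y)" "pd2 v t y = pd1 (pd2 X) t (inv (X t) y) / pd2 X t (inv (X t) y)" for y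
  proof -
    have "pd2 X t (inv (X t) y) > 0" by (rule V[OF t])
    then show "\<rho> t y = 1 / pd2 X t (inv (X t) y)" "pd2 v t y = pd1 (pd2 X) t (inv (X t) y) / pd2 X t (inv (X t) y)"
      using mr[OF t, of "inv (X t) y"] vx[of "inv (X t) y"] unfolding inverse_flow(1)[OF X t] by (simp_all add: eq_divide_eq)
  qed
  have Y': "(inv (X t) has_real_derivative r0) (at x)"
    using inverse_flow_smooth(2)[OF X t, of x] by (simp only: r0w w_def a_def)
  have pe: "p (\<rho> t y) = - lam * eps * \<sigma> t (inv (X t) y)" for y
    using cl V[OF t, of "inv (X t) y"] unfolding constitutive_laws_def at_inv(1) \<sigma>_def by blast
  have me: "\<mu> (\<rho> t y) * pd2 v t y = eps * \<omega> t (inv (X t) y)" for y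
  proof -
    have Vy: "pd2 X t (inv (X t) y) > 0" by (rule V[OF t])
    then have "\<mu> (\<rho> t y) = eps * pd2 X t (inv (X t) y) * deriv (deriv \<theta>) (pd2 X t (inv (X t) y))"
      using cl unfolding constitutive_laws_def at_inv(1) by blast
    then show ?thesis using Vy by (simp add: at_inv(2) \<omega>_def)
  qed
  have "((\<lambda>y. \<sigma> t (inv (X t) y)) has_real_derivative pd2 \<sigma> t (inv (X t) x) * r0) (at x)"
    by (rule DERIV_chain2[OF D(3)[OF s\<sigma> t] Y'])
  then have pd: "((\<lambda>y. p (\<rho> t y)) has_real_derivative - lam * eps * (pd2 \<sigma> t a * r0)) (at x)"
    unfolding pe a_def by (rule DERIV_cmult)
  have "((\<lambda>y. \<omega> t (inv (X t) y)) has_real_derivative pd2 \<omega> t (inv (X t) x) * r0) (at x)"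
    by (rule DERIV_chain2[OF D(3)[OF s\<omega> t] Y'])
  then have "((\<lambda>y. \<mu> (\<rho> t y) * pd2 v t y) has_real_derivative eps * (pd2 \<omega> t a * r0)) (at x)"
    unfolding me a_def by (rule DERIV_cmult)
  from pd2_eqI[of "\<lambda>t y. \<mu> (\<rho> t y) * pd2 v t y", OF this]
  have e3: "pd2 (\<lambda>t x. \<mu> (\<rho> t x) * pd2 v t x) t x = eps * (pd2 \<omega> t a * r0)" .
  have "((\<lambda>y. \<rho> t y * (v t y * v t y) + p (\<rho> t y)) has_real_derivative
      (pd2 \<rho> t x * (v t x * v t x) + (pd2 v t x * v t x + pd2 v t x * v t x) * \<rho> t x) + - lam * eps * (pd2 \<sigma> t a * r0)) (at x)"
    by (rule DERIV_add[OF DERIV_mult[OF D(3)[OF r t] DERIV_mult[OF D(3)[OF v t] D(3)[OF v t]]] pd])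
  then have "((\<lambda>y. \<rho> t y * (v t y)\<^sup>2 + p (\<rho> t y)) has_real_derivative
      (pd2 \<rho> t x * (c * c) + (pd2 v t x * c + pd2 v t x * c) * r0) + - lam * eps * (pd2 \<sigma> t a * r0)) (at x)"
    by (simp only: power2_eq_square c_def r0_def)
  from pd2_eqI[of "\<lambda>t y. \<rho> t y * (v t y)\<^sup>2 + p (\<rho> t y)", OF this]
  have e2: "pd2 (\<lambda>t x. \<rho> t x * (v t x)\<^sup>2 + p (\<rho> t x)) t x
      = (pd2 \<rho> t x * (c * c) + (pd2 v t x * c + pd2 v t x * c) * r0) + - lam * eps * (pd2 \<sigma> t a * r0)" .
  have fe: "eulerian_force F X t x = F (X t a - a)" by (simp only: eulerian_force_def xa a_def[symmetric])
  define f where "f = F (X t a - a)"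
  \<comment> \<open>Pure algebra: subtract c times the mass equation and divide by the density r0,
    which is nonzero.\<close>
  have alg: "(r1 * c + v1 * r0) + ((r2 * (c * c) + (v2 * c + v2 * c) * r0) + - lam * eps * (sa * r0)) = eps * (wa * r0) + r0 * f
      \<longleftrightarrow> v1 + v2 * c = lam * eps * sa + eps * wa + f"
    if m: "r1 + (r2 * c + v2 * r0) = 0" for r1 r2 v1 v2 sa wa :: real
  proof -
    have "((r1 * c + v1 * r0) + ((r2 * (c * c) + (v2 * c + v2 * c) * r0) + - lam * eps * (sa * r0))) - (eps * (wa * r0) + r0 * f)
        = c * (r1 + (r2 * c + v2 * r0)) + r0 * ((v1 + v2 * c) - (lam * eps * sa + eps * wa + f))" by (simp add: algebra_simps)
    also have "\<dots> = r0 * ((v1 + v2 * c) - (lam * eps * sa + eps * wa + f))" by (simp only: m mult_zero_right add_0)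
    finally have id: "((r1 * c + v1 * r0) + ((r2 * (c * c) + (v2 * c + v2 * c) * r0) + - lam * eps * (sa * r0))) - (eps * (wa * r0) + r0 * f)
        = r0 * ((v1 + v2 * c) - (lam * eps * sa + eps * wa + f))" .
    have r00: "r0 \<noteq> 0" using rw by auto
    show ?thesis
      by (subst eq_iff_diff_eq_0, subst (2) eq_iff_diff_eq_0, subst id) (use r00 in simp)
  qed
  show "pd1 (\<lambda>t x. \<rho> t x * v t x) t x + pd2 (\<lambda>t x. \<rho> t x * (v t x)\<^sup>2 + p (\<rho> t x)) t x
        = pd2 (\<lambda>t x. \<mu> (\<rho> t x) * pd2 v t x) t x + \<rho> t x * eulerian_force F X t x
      \<longleftrightarrow> pd1 (pd1 X) t a = lam * eps * pd2 (\<lambda>t a. deriv \<theta> (pd2 X t a)) t a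
        + eps * pd2 (\<lambda>t a. deriv (deriv \<theta>) (pd2 X t a) * pd1 (pd2 X) t a) t a + F (X t a - a)"
    unfolding e1 e2 e3 fe acc \<sigma>_def[symmetric] \<omega>_def[symmetric] r0_def[symmetric] f_def[symmetric] by (rule alg[OF mass])
qed

text \<open>The fields are forced: velocity and inverse slope carried by the inverse flow. The
  density has unit mean because it is the derivative of the inverse flow, which advances by 1 over a
  period.\<close>

lemma material_NS_iff_eulerian_NS:
  assumes X: "smooth_flow X" and sm: "smooth_on {0<..} \<theta>" and cl: "constitutive_laws eps lam \<theta> p \<mu>"
  shows "material_NS eps lam \<theta> F X \<longleftrightarrow>
    (\<exists>\<rho> v. material_coordinates X \<rho> v \<and> eulerian_NS p \<mu> (eulerian_force F X) \<rho> v)"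
proof
  have sX: "smooth2 X" and V: "\<And>t a. t > 0 \<Longrightarrow> pd2 X t a > 0" and per: "\<And>t a. t > 0 \<Longrightarrow> X t (a + 1) = X t a + 1"
    using X unfolding smooth_flow_def by simp_all
  note inv = inverse_flow[OF X] and ep = eulerian_pointwise[OF X sm cl]
  {
    assume NS: "material_NS eps lam \<theta> F X"
    define v where "v = (\<lambda>t x. pd1 X t (inv (X t) x))"
    define \<rho> where "\<rho> = (\<lambda>t x. inverse (pd2 X t (inv (X t) x)))"
    have sr: "smooth2 \<rho>"
      unfolding \<rho>_def
      by (rule smooth2_compose[OF open_greaterThan smooth_on_inverse smooth2_compose2[OF smooth2_derivative(5)[OF sX] inverse_flow_smooth(1)[OF X]]])
        (simp add: V)
    have sv: "smooth2 v" unfolding v_def by (rule smooth2_compose2[OF smooth2_derivative(4)[OF sX] inverse_flow_smooth(1)[OF X]])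
    have mc: "material_coordinates X \<rho> v"
      unfolding material_coordinates_def
    proof (intro allI impI conjI)
      fix t a :: real assume t: "t > 0"
      show "pd1 X t a = v t (X t a)" by (simp only: v_def inv(2)[OF t])
      show "\<rho> t (X t a) * pd2 X t a = 1" using V[OF t, of a] by (simp add: \<rho>_def inv(2)[OF t])
      show "X t (a + 1) = X t a + 1" by (rule per[OF t])
    qed
    have "eulerian_NS p \<mu> (eulerian_force F X) \<rho> v"
      unfolding eulerian_NS_def
    proof (intro conjI allI impI sr sv)
      fix t :: real assume t: "t > 0"
      have Y': "(inv (X t) has_real_derivative \<rho> t x) (at x)" for x
        unfolding \<rho>_def by (rule inverse_flow_smooth(2)[OF X t])
      have "(\<integral>x. \<rho> t x * indicator {0..1} x \<partial>lborel) = inv (X t) 1 - inv (X t) 0"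
      proof (rule integral_FTC_Icc_real)
        show "isCont (\<rho> t) x" for x using smooth2_continuous(2)[OF sr t] by (simp add: continuous_on_eq_continuous_at)
      qed (simp_all add: Y')
      also have "\<dots> = 1" using inv(3)[OF t, of 0] by simp
      finally show "(LINT x:{0..1}|lborel. \<rho> t x) = 1" by (simp add: set_lebesgue_integral_def mult.commute)
    next
      fix t x :: real assume t: "t > 0"
      show "\<rho> t x > 0" using V[OF t] by (simp add: \<rho>_def)
      have p2: "pd2 X t (a + 1) = pd2 X t a" for a
      proof -
        have "circle_map (X t) (pd2 X t)"
          unfolding circle_map_def
          by (intro conjI allI smooth2_derivative(3)[OF sX t] smooth2_continuous(2)[OF smooth2_derivative(5)[OF sX] t] per[OF t] less_imp_le[OF V[OF t]])
        then show ?thesis by (rule circle_mapD(9))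
      qed
      show "\<rho> t (x + 1) = \<rho> t x" by (simp only: \<rho>_def inv(3)[OF t] p2)
      have p1: "pd1 X t (a + 1) = pd1 X t a" for a
      proof -
        have "((\<lambda>s. X s a + 1) has_real_derivative pd1 X t (a + 1)) (at t)"
          by (rule has_field_derivative_transform_within_open[OF smooth2_derivative(2)[OF sX t], of "{0<..}"]) (use t per in simp_all)
        moreover have "((\<lambda>s. X s a + 1) has_real_derivative pd1 X t a + 0) (at t)"
          by (intro DERIV_add DERIV_const smooth2_derivative(2)[OF sX t])
        ultimately have "pd1 X t (a + 1) = pd1 X t a + 0" by (rule DERIV_unique)
        then show ?thesis by simp
      qed
      show "v t (x + 1) = v t x" by (simp only: v_def inv(3)[OF t] p1)
      show "pd1 (\<lambda>t x. \<rho> t x * v t x) t x + pd2 (\<lambda>t x. \<rho> t x * (v t x)\<^sup>2 + p (\<rho> t x)) t x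
          = pd2 (\<lambda>t x. \<mu> (\<rho> t x) * pd2 v t x) t x + \<rho> t x * eulerian_force F X t x"
        by (rule ep(2)[OF sr sv mc t, THEN iffD2]) (use NS t in \<open>simp only: material_NS_def\<close>)
      show "pd1 \<rho> t x + pd2 (\<lambda>t x. \<rho> t x * v t x) t x = 0" by (rule ep(1)[OF sr sv mc t])
    qed
    then show "\<exists>\<rho> v. material_coordinates X \<rho> v \<and> eulerian_NS p \<mu> (eulerian_force F X) \<rho> v" using mc by blast
  }
  assume "\<exists>\<rho> v. material_coordinates X \<rho> v \<and> eulerian_NS p \<mu> (eulerian_force F X) \<rho> v"
  then obtain \<rho> v where mc: "material_coordinates X \<rho> v" and E: "eulerian_NS p \<mu> (eulerian_force F X) \<rho> v" by (elim exE conjE)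
  have sr: "smooth2 \<rho>" and sv: "smooth2 v" using E unfolding eulerian_NS_def by simp_all
  show "material_NS eps lam \<theta> F X"
    unfolding material_NS_def
  proof (intro allI impI)
    fix t a :: real assume t: "t > 0"
    have "pd1 (\<lambda>t x. \<rho> t x * v t x) t (X t a) + pd2 (\<lambda>t x. \<rho> t x * (v t x)\<^sup>2 + p (\<rho> t x)) t (X t a)
          = pd2 (\<lambda>t x. \<mu> (\<rho> t x) * pd2 v t x) t (X t a) + \<rho> t (X t a) * eulerian_force F X t (X t a)"
      using E t unfolding eulerian_NS_def by simp
    from ep(2)[OF sr sv mc t, THEN iffD1, OF this]
    show "pd1 (pd1 X) t a = lam * eps * pd2 (\<lambda>t a. deriv \<theta> (pd2 X t a)) t a
        + eps * pd2 (\<lambda>t a. deriv (deriv \<theta>) (pd2 X t a) * pd1 (pd2 X) t a) t a + F (X t a - a)"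
      unfolding inv(2)[OF t] .
  qed
qed

lemma constitutive_laws_minus_ln:
  "constitutive_laws eps lam (\<lambda>\<tau>. - ln \<tau>) (\<lambda>\<rho>. lam * eps * \<rho>) (\<lambda>\<rho>. eps * \<rho>)"
proof -
  have d1: "deriv (\<lambda>\<tau>. - ln \<tau>) x = - inverse x" if "x > 0" for x :: real
    by (rule DERIV_imp_deriv) (rule DERIV_minus[OF DERIV_ln[OF that]])
  have d2: "deriv (deriv (\<lambda>\<tau>. - ln \<tau>)) x = inverse x * inverse x" if x: "x > 0" for x :: real
  proof (rule DERIV_imp_deriv)
    have "((\<lambda>x. - inverse x) has_real_derivative - (- (inverse x ^ Suc (Suc 0)))) (at x)"
      by (rule DERIV_minus[OF DERIV_inverse]) (use x in simp)
    then have "(deriv (\<lambda>\<tau>. - ln \<tau>) has_real_derivative - (- (inverse x ^ Suc (Suc 0)))) (at x)"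
      by (rule has_field_derivative_transform_within_open[of _ _ _ "{0<..}"]) (use x d1 in simp_all)
    then show "(deriv (\<lambda>\<tau>. - ln \<tau>) has_real_derivative inverse x * inverse x) (at x)" by simp
  qed
  show ?thesis
    unfolding constitutive_laws_def
  proof (intro allI impI conjI)
    fix \<tau> :: real assume t: "\<tau> > 0"
    have "eps * \<tau> * (inverse \<tau> * inverse \<tau>) = eps * (\<tau> * inverse \<tau>) * inverse \<tau>" by (simp only: mult_ac)
    then show "eps * (1 / \<tau>) = eps * \<tau> * deriv (deriv (\<lambda>\<tau>. - ln \<tau>)) \<tau>" using t by (simp add: d2[OF t] inverse_eq_divide)
    show "lam * eps * (1 / \<tau>) = - lam * eps * deriv (\<lambda>\<tau>. - ln \<tau>) \<tau>" by (simp add: d1[OF t] inverse_eq_divide)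
  qed
qed

theorem theorem2p1:
  fixes lam :: real and \<theta> F :: "real \<Rightarrow> real"
  assumes "lam > 0"
    and "smooth_on {0<..} \<theta>" and "strictly_convex_on {0<..} \<theta>"
    and "smooth_on UNIV F" and "bounded (range (deriv F))" and "F 0 = 0"
  shows "\<exists>S S0.
    (\<forall>eps>0. solution_map (viscous_op eps \<theta>) lam F (S eps)
       \<and> continuous_on ({0..} \<times> (K_disp \<times> UNIV)) (\<lambda>(t, w). S eps t w))
    \<and> (\<forall>eps>0.
         (\<forall>w \<in> K_disp \<times> UNIV. generalized_material_NS eps lam \<theta> F (\<lambda>t. fst (S eps t w)))
       \<and> (\<forall>u X. continuous_on {0..} u \<and> smooth_flow X \<and> (\<forall>t>0. fst (u t) = displacement X t) \<longrightarrow>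
            (is_solution (viscous_op eps \<theta>) lam F (u 0) u \<longleftrightarrow>
               (\<forall>t>0. snd (u t) = Z_of_flow eps lam \<theta> X t) \<and> material_NS eps lam \<theta> F X))
       \<and> (\<forall>X p \<mu>. smooth_flow X \<and> constitutive_laws eps lam \<theta> p \<mu> \<longrightarrow>
            (material_NS eps lam \<theta> F X \<longleftrightarrow>
               (\<exists>\<rho> v. material_coordinates X \<rho> v \<and> eulerian_NS p \<mu> (eulerian_force F X) \<rho> v)))
       \<and> smooth_on {0<..} (\<lambda>\<tau>::real. - ln \<tau>) \<and> strictly_convex_on {0<..} (\<lambda>\<tau>. - ln \<tau>)
       \<and> constitutive_laws eps lam (\<lambda>\<tau>. - ln \<tau>) (\<lambda>\<rho>. lam * eps * \<rho>) (\<lambda>\<rho>. eps * \<rho>))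
    \<and> solution_map (subdifferential indicator_K) lam F S0
    \<and> (\<forall>w \<in> K_disp \<times> UNIV. \<forall>T>0.
         uniform_limit {0..T} (\<lambda>eps t. S eps t w) (\<lambda>t. S0 t w) (at_right 0))"
proof -
  interpret potential \<theta> "deriv \<theta>" by (rule potential_deriv[OF assms(2,3)])
  obtain C where C: "C \<ge> 0" and lip: "\<And>x y. \<bar>F x - F y\<bar> \<le> C * \<bar>x - y\<bar>"
    using lipschitz_of_bounded_deriv[OF assms(4,5)] by blast
  \<comment> \<open>The Lipschitz constant of the drift involves neither eps nor the operator, so
    all viscous evolutions and the limiting one share it.\<close>
  define L where "L = 1 + 2 * lam + lam\<^sup>2 + C"
  have L: "L > 0" unfolding L_def using assms(1) C zero_le_power2[of lam] by linarith
  have dl: "norm (drift lam F u - drift lam F v) \<le> L * norm (u - v)" for u v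
    unfolding L_def by (rule drift_lipschitz[OF lip assms(1)])
  define S where "S eps = evol (on_fst (viscous_op eps \<theta>)) (drift lam F)" for eps
  define S0 where "S0 = evol (on_fst (subdifferential indicator_K)) (drift lam F)"
  note V = solution_map_evol[OF viscous_evolution[OF _ dl L] viscous_domain]
  have viscous: "\<forall>eps>0. solution_map (viscous_op eps \<theta>) lam F (S eps)
       \<and> continuous_on ({0..} \<times> (K_disp \<times> UNIV)) (\<lambda>(t, w). S eps t w)"
  proof (intro allI impI conjI)
    fix eps :: real assume e: "eps > 0"
    show "solution_map (viscous_op eps \<theta>) lam F (S eps)" unfolding S_def by (rule V(2)[OF e e])
    show "continuous_on ({0..} \<times> (K_disp \<times> UNIV)) (\<lambda>(t, w). S eps t w)" unfolding S_def by (rule V(3)[OF e e])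
  qed
  have navier_stokes: "\<forall>eps>0.
         (\<forall>w \<in> K_disp \<times> UNIV. generalized_material_NS eps lam \<theta> F (\<lambda>t. fst (S eps t w)))
       \<and> (\<forall>u X. continuous_on {0..} u \<and> smooth_flow X \<and> (\<forall>t>0. fst (u t) = displacement X t) \<longrightarrow>
            (is_solution (viscous_op eps \<theta>) lam F (u 0) u \<longleftrightarrow>
               (\<forall>t>0. snd (u t) = Z_of_flow eps lam \<theta> X t) \<and> material_NS eps lam \<theta> F X))
       \<and> (\<forall>X p \<mu>. smooth_flow X \<and> constitutive_laws eps lam \<theta> p \<mu> \<longrightarrow>
            (material_NS eps lam \<theta> F X \<longleftrightarrow>
               (\<exists>\<rho> v. material_coordinates X \<rho> v \<and> eulerian_NS p \<mu> (eulerian_force F X) \<rho> v)))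
       \<and> smooth_on {0<..} (\<lambda>\<tau>::real. - ln \<tau>) \<and> strictly_convex_on {0<..} (\<lambda>\<tau>. - ln \<tau>)
       \<and> constitutive_laws eps lam (\<lambda>\<tau>. - ln \<tau>) (\<lambda>\<rho>. lam * eps * \<rho>) (\<lambda>\<rho>. eps * \<rho>)"
  proof (intro allI impI conjI ballI)
    fix eps :: real assume e: "eps > 0"
    show "generalized_material_NS eps lam \<theta> F (\<lambda>t. fst (S eps t w))" if "w \<in> K_disp \<times> UNIV" for w
      unfolding S_def
      by (rule evol_generalized_material_NS[OF viscous_evolution[OF e dl L] e lip subsetD[OF V(1)[OF e e] that]])
    show "is_solution (viscous_op eps \<theta>) lam F (u 0) u \<longleftrightarrow>
        (\<forall>t>0. snd (u t) = Z_of_flow eps lam \<theta> X t) \<and> material_NS eps lam \<theta> F X"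
      if "continuous_on {0..} u \<and> smooth_flow X \<and> (\<forall>t>0. fst (u t) = displacement X t)" for u X
      by (rule is_solution_smooth_flow[OF potential_axioms assms(2) e assms(4) lip]) (use that in simp_all)
    show "material_NS eps lam \<theta> F X \<longleftrightarrow>
        (\<exists>\<rho> v. material_coordinates X \<rho> v \<and> eulerian_NS p \<mu> (eulerian_force F X) \<rho> v)"
      if "smooth_flow X \<and> constitutive_laws eps lam \<theta> p \<mu>" for X p \<mu>
      by (rule material_NS_iff_eulerian_NS[OF conjunct1[OF that] assms(2) conjunct2[OF that]])
  qed (rule smooth_on_minus_ln strictly_convex_minus_ln constitutive_laws_minus_ln)+
  have obstacle: "solution_map (subdifferential indicator_K) lam F S0"
    unfolding S0_def by (rule solution_map_evol(2)[OF obstacle_evolution[OF dl L] K_disp_in_closure_indicator_K])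
  have limit: "\<forall>w \<in> K_disp \<times> UNIV. \<forall>T>0.
         uniform_limit {0..T} (\<lambda>eps t. S eps t w) (\<lambda>t. S0 t w) (at_right 0)"
    unfolding S_def S0_def
  proof (intro ballI allI impI)
    fix w :: "L2T \<times> L2T" and T :: real assume "w \<in> K_disp \<times> UNIV" "T > 0"
    then show "uniform_limit {0..T} (\<lambda>eps t. evol (on_fst (viscous_op eps \<theta>)) (drift lam F) t w)
        (\<lambda>t. evol (on_fst (subdifferential indicator_K)) (drift lam F) t w) (at_right 0)"
      by (intro vanishing_viscosity[OF dl L]) simp_all
  qed
  show ?thesis by (intro exI[of _ S] exI[of _ S0] conjI viscous navier_stokes obstacle limit)
qed

end
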